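(* Let $d\ge 2$ be an integer, and let $\mu_d$, $\mathsf H_d$ and $\mathcal Q_d$ be as defined in the context. Set $$\alpha_d:=\frac{d^{1-d}\,\Gamma(d/2)}{2\,(d-1)\,\pi^{d/2}}.$$ Then for every smooth compactly supported function $u:\mathbb R^d\to\mathbb R$, $$\log\left(\int_{\mathbb R^d}e^u\,d\mu_d\right)-\int_{\mathbb R^d}u\,d\mu_d\le\alpha_d\int_{\mathbb R^d}\mathsf H_d(x,\nabla u(x))\,dx .$$ The constant $\alpha_d$ is optimal, i.e. it is the smallest constant for which this inequality holds for all smooth compactly supported $u$. Moreover, for any unit vector $\mathsf e\in\mathbb R^d$, small multiples of the function $$v(x)=-\,d\,\frac{x\cdot\mathsf e}{|x|^{\frac{d-2}{d-1}}\left(1+|x|^{\frac d{d-1}}\right)}$$ are approximate extremals in the sense that $$\lim_{\varepsilon\to0}\mathcal Q_d[\varepsilon\,v]=\frac1{\alpha_d}.$$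
   Context: Let $|\cdot|$ be the Euclidean norm on $\mathbb R^d$, $\mathbb S^{d-1}$ the unit sphere of $\mathbb R^d$ and $|\mathbb S^{d-1}|$ its surface measure. The probability measure $\mu_d$ on $\mathbb R^d$ is $$d\mu_d(x):=\frac d{|\mathbb S^{d-1}|}\,\frac{dx}{\left(1+|x|^{\frac d{d-1}}\right)^d}.$$ For $(X,Y)\in\mathbb R^d\times\mathbb R^d$, $$\mathsf R_d(X,Y):=|X+Y|^d-|X|^d-d\,|X|^{d-2}\,X\cdot Y,$$ and for $(x,p)\in\mathbb R^d\times\mathbb R^d$, $$\mathsf H_d(x,p):=\mathsf R_d\left(-\frac{d\,|x|^{-\frac{d-2}{d-1}}}{1+|x|^{\frac d{d-1}}}\,x,\ \frac{d-1}d\,p\right)$$ (the first argument of $\mathsf R_d$ is understood to be $0$ at $x=0$). For a function $u$ for which the expressions make sense and the denominator is nonzero, $$\mathcal Q_d[u]:=\frac{\int_{\mathbb R^d}\mathsf H_d(x,\nabla u)\,dx}{\log\left(\int_{\mathbb R^d}e^u\,d\mu_d\right)-\int_{\mathbb R^d}u\,d\mu_d}.$$ The function $v$ is understood to be $0$ at $x=0$, and $\nabla v$ is defined almost everywhere (for $x\neq0$). *)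

theory Defs
  imports "HOL-Analysis.Analysis"
begin

text \<open>Throughout, the dimension \<open>d\<close> of the ambient Euclidean space is \<open>DIM('a)\<close>.\<close>

primrec continuously_differentiable ::
  "nat \<Rightarrow> ('a::real_normed_vector \<Rightarrow> 'b::real_normed_vector) \<Rightarrow> bool" where
  "continuously_differentiable 0 f \<longleftrightarrow> continuous_on UNIV f"
| "continuously_differentiable (Suc k) f \<longleftrightarrow>
     (\<forall>x. f differentiable (at x)) \<and>
     (\<forall>h. continuously_differentiable k (\<lambda>x. frechet_derivative f (at x) h))"

definition smooth :: "('a::real_normed_vector \<Rightarrow> 'b::real_normed_vector) \<Rightarrow> bool" where
  "smooth f \<longleftrightarrow> (\<forall>k. continuously_differentiable k f)"

definition compactly_supported :: "('a::topological_space \<Rightarrow> 'b::zero) \<Rightarrow> bool" where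
  "compactly_supported f \<longleftrightarrow> compact (closure {x. f x \<noteq> 0})"

text \<open>The value of \<open>grad u x\<close> is unspecified where \<open>u\<close> is not differentiable; such points
  matter only for the function \<open>v\<close> below, and there only the origin.\<close>

definition grad :: "('a::real_inner \<Rightarrow> real) \<Rightarrow> 'a \<Rightarrow> 'a" where
  "grad u x = (THE D. GDERIV u x :> D)"

text \<open>Surface measure on the unit sphere, by the usual polar-coordinates definition:
  \<open>d\<close> times the Lebesgue measure of the cone over \<open>A\<close> with apex at the origin.\<close>

definition sphere_measure :: "'a::euclidean_space set \<Rightarrow> real" where
  "sphere_measure A =
     real DIM('a) * measure lebesgue {t *\<^sub>R x | t x. 0 < t \<and> t \<le> 1 \<and> x \<in> A}"

definition mu :: "'a::euclidean_space measure" where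
  "mu = density lborel (\<lambda>x::'a.
     let d = real DIM('a) in
     ennreal (d / sphere_measure (sphere (0::'a) 1)
              * (1 / (1 + norm x powr (d / (d - 1))) ^ DIM('a))))"

definition R_fun :: "'a::euclidean_space \<Rightarrow> 'a \<Rightarrow> real" where
  "R_fun X Y = norm (X + Y) ^ DIM('a) - norm X ^ DIM('a)
     - real DIM('a) * norm X ^ (DIM('a) - 2) * (X \<bullet> Y)"

definition H_fun :: "'a::euclidean_space \<Rightarrow> 'a \<Rightarrow> real" where
  "H_fun x p = (let d = real DIM('a) in
     R_fun (- (d * norm x powr (- ((d - 2) / (d - 1))) / (1 + norm x powr (d / (d - 1)))) *\<^sub>R x)
           (((d - 1) / d) *\<^sub>R p))"

definition Q_fun :: "('a::euclidean_space \<Rightarrow> real) \<Rightarrow> real" where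
  "Q_fun u = (\<integral>x. H_fun x (grad u x) \<partial>lborel)
     / (ln (\<integral>x. exp (u x) \<partial>mu) - (\<integral>x. u x \<partial>mu))"

definition alpha :: "nat \<Rightarrow> real" where
  "alpha d = real d powi (1 - int d) * Gamma (real d / 2)
     / (2 * (real d - 1) * pi powr (real d / 2))"

text \<open>The value at the origin is \<open>0\<close>, the numerator of the quotient being \<open>0\<close> there.\<close>

definition v_fun :: "'a::euclidean_space \<Rightarrow> 'a \<Rightarrow> real" where
  "v_fun e x = (let d = real DIM('a) in
     - d * ((x \<bullet> e) / (norm x powr ((d - 2) / (d - 1)) * (1 + norm x powr (d / (d - 1))))))"

end

theory Submission
  imports Defs "HOL-Probability.Probability"
begin

text \<open>
Write \<open>n\<close> for the dimension and put \<open>w = u - n ln (1 + |x|\<^bsup>n/(n-1)\<^esup>)\<close>. The density of \<open>\<mu>\<close> is proportional to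
\<open>e\<^sup>w\<close> when \<open>u = 0\<close>, and integrating the cross term by parts turns the inequality into a comparison of
\<open>\<integral>|\<nabla>w|\<^sup>n\<close> with \<open>ln \<integral>e\<^sup>w\<close>. On a superlevel set \<open>{w > c}\<close> let \<open>S\<close> be the average of \<open>e\<^bsup>w-c\<^esup>\<close>. The isoperimetric
inequality, in the form that it takes for a thin band \<open>{c < w \<le> c'}\<close>, is a differential inequality in \<open>c\<close>
for the energy in \<open>{w > c}\<close> against \<open>S\<close>; integrated, it bounds that energy from below by an explicit function of \<open>ln S\<close>, with
equality for \<open>u = 0\<close>. Taking for \<open>c\<close> the level whose superlevel set is a large ball and letting the radius tend to
infinity gives the inequality. Optimality follows from smooth functions with a logarithmic peak, for which both sides are asymptotic
to multiples of \<open>ln (1/\<delta>)\<close> as the width \<open>\<delta>\<close> of the peak tends to \<open>0\<close>. For the last claim both the numerator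
and the denominator are expanded to second order at \<open>0\<close>; after averaging over the sphere, the two quadratic forms differ by the
integral of an exact derivative.
\<close>

section \<open>The Brunn--Minkowski inequality\<close>

text \<open>The energy of \<open>w\<close> over the whole space is infinite, since \<open>w\<close>
  falls off like \<open>- n^2/(n-1) ln |x|\<close>; only its excess over the energy of the profile
  \<open>bubble\<close> is finite. This forces the truncation at a level: in a ball of radius
  \<open>r\<close> beyond the support of \<open>u\<close>, both sides carry the same divergent term
  \<open>sharp_const n * Phi n (ln (1 + rt n r ^ n))\<close>, and what survives is an increment of
  \<open>Phi\<close>, whose derivative tends to 1. Level sets of \<open>w\<close> may be irregular,
  so neither perimeters nor the coarea formula appear: isoperimetry enters through volumes of bands.
  The number \<open>n^2/(n-1)\<close> is the decay rate of the profile. It is also the best height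
  of a peak \<open>k ln (1/|x|)\<close>: the entropy gained is \<open>k - n\<close> per unit of
  \<open>ln (1/\<delta>)\<close>, the energy paid is proportional to \<open>k^n\<close>, and
  \<open>(k - n) / k^n\<close> is largest at \<open>k = n^2/(n-1)\<close>. The function
  \<open>v\<close> is \<open>(n-1)/n\<close> times the derivative of the profile along
  \<open>e\<close>, an infinitesimal translation. Translates of the profile are again extremal,
  which explains why the two quadratic forms at \<open>v\<close> have exactly the ratio
  \<open>1 / alpha n\<close>.\<close>

text \<open>Following Hadwiger and Ohmann, the inequality is proved first for finite unions of disjoint boxes, by induction on
  their number: both unions are cut by parallel hyperplanes in the same volume ratio.\<close>

definition disjoint_boxes :: "'a::euclidean_space set set \<Rightarrow> bool" where
  "disjoint_boxes \<A> \<longleftrightarrow> finite \<A> \<and> disjoint \<A> \<and> (\<forall>A\<in>\<A>. A \<noteq> {} \<and> (\<exists>a b. A = box a b))"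

definition sumset :: "'a::plus set \<Rightarrow> 'a set \<Rightarrow> 'a set" where
  "sumset A B = {x + y | x y. x \<in> A \<and> y \<in> B}"

lemma sumset_commute: "sumset A B = sumset B (A :: 'a::ab_semigroup_add set)"
  unfolding sumset_def by (metis (no_types, opaque_lifting) add.commute)

lemma sumset_mono: "A \<subseteq> A' \<Longrightarrow> B \<subseteq> B' \<Longrightarrow> sumset A B \<subseteq> sumset A' B'"
  unfolding sumset_def by blast

lemma sumset_eq_UN: "sumset A B = (\<Union>x\<in>A. \<Union>y\<in>B. {x + y})"
  unfolding sumset_def by blast

lemma open_sumset: "open A \<Longrightarrow> open (sumset A (B :: 'a::real_normed_vector set))"
  using open_sums[of A B] by (simp add: sumset_eq_UN)

lemma bounded_sumset: "bounded A \<Longrightarrow> bounded B \<Longrightarrow> bounded (sumset A (B :: 'a::real_normed_vector set))"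
  using bounded_plus[of A B] by (rule bounded_subset) (auto simp: sumset_def)

lemma fmeasurable_open_bounded:
  "open A \<Longrightarrow> bounded (A :: 'a::euclidean_space set) \<Longrightarrow> A \<in> fmeasurable lborel"
  using emeasure_bounded_finite[of A] by (auto simp: fmeasurable_def top_unique less_top)

lemma box_Int_greater:
  fixes a b :: "'a::euclidean_space"
  assumes i: "i \<in> Basis"
  shows "\<exists>c d. box a b \<inter> {x. s < x \<bullet> i} = box c d"
proof -
  have "box a b \<inter> {x. s < x \<bullet> i} = box (\<Sum>j\<in>Basis. (if j = i then max (a \<bullet> i) s else a \<bullet> j) *\<^sub>R j) b"
    using i by (auto simp: box_def)
  then show ?thesis by blast
qed

lemma box_Int_less:
  fixes a b :: "'a::euclidean_space"
  assumes i: "i \<in> Basis"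
  shows "\<exists>c d. box a b \<inter> {x. x \<bullet> i < s} = box c d"
proof -
  have "box a b \<inter> {x. x \<bullet> i < s} = box a (\<Sum>j\<in>Basis. (if j = i then min (b \<bullet> i) s else b \<bullet> j) *\<^sub>R j)"
    using i by (auto simp: box_def)
  then show ?thesis by blast
qed

text \<open>Empty intersections are discarded, because \<open>disjoint_boxes\<close> admits only
  nonempty boxes and because the count of boxes then drops strictly as soon as one box misses the
  half-space. That drop drives the induction.\<close>

definition cut_boxes :: "'a set set \<Rightarrow> 'a set \<Rightarrow> 'a set set" where
  "cut_boxes \<A> H = (\<lambda>A. A \<inter> H) ` \<A> - {{}}"

lemma disjoint_boxes_Int:
  assumes \<A>: "disjoint_boxes \<A>" and H: "\<And>a b. \<exists>c d. box a b \<inter> H = box c d"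
  shows "disjoint_boxes (cut_boxes \<A> H)" "\<Union>(cut_boxes \<A> H) = \<Union>\<A> \<inter> H" "card (cut_boxes \<A> H) \<le> card \<A>"
    "A0 \<in> \<A> \<Longrightarrow> A0 \<inter> H = {} \<Longrightarrow> card (cut_boxes \<A> H) < card \<A>"
proof -
  define \<A>' where "\<A>' = (\<lambda>A. A \<inter> H) ` \<A> - {{}}"
  have cut: "cut_boxes \<A> H = \<A>'" by (simp add: cut_boxes_def \<A>'_def)
  have fin: "finite \<A>" using \<A> by (simp add: disjoint_boxes_def)
  show "disjoint_boxes (cut_boxes \<A> H)"
    unfolding cut disjoint_boxes_def
  proof (intro conjI ballI)
    show "finite \<A>'" using fin by (simp add: \<A>'_def)
    show "disjoint \<A>'"
    proof (rule disjointI)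
      fix A B assume AB: "A \<in> \<A>'" "B \<in> \<A>'" "A \<noteq> B"
      then obtain A1 B1 where 1: "A1 \<in> \<A>" "B1 \<in> \<A>" "A = A1 \<inter> H" "B = B1 \<inter> H" by (auto simp: \<A>'_def)
      then have "A1 \<inter> B1 = {}" using \<A> AB(3) by (auto simp: disjoint_boxes_def disjoint_def)
      then show "A \<inter> B = {}" using 1 by auto
    qed
  next
    fix A assume "A \<in> \<A>'" then show "A \<noteq> {}" by (auto simp: \<A>'_def)
  next
    fix A assume "A \<in> \<A>'"
    then obtain A1 where 1: "A1 \<in> \<A>" "A = A1 \<inter> H" by (auto simp: \<A>'_def)
    then obtain a b where "A1 = box a b" using \<A> unfolding disjoint_boxes_def by meson
    then show "\<exists>a b. A = box a b" using H 1 by blast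
  qed
  show "\<Union>(cut_boxes \<A> H) = \<Union>\<A> \<inter> H" by (auto simp: cut_boxes_def)
  show "card (cut_boxes \<A> H) \<le> card \<A>"
    unfolding cut \<A>'_def using fin by (meson card_Diff1_le card_image_le le_trans)
  assume A0: "A0 \<in> \<A>" "A0 \<inter> H = {}"
  have "\<A>' \<subseteq> (\<lambda>A. A \<inter> H) ` (\<A> - {A0})" using A0 by (auto simp: \<A>'_def)
  then have "card \<A>' \<le> card (\<A> - {A0})"
    using card_mono[of "(\<lambda>A. A \<inter> H) ` (\<A> - {A0})" \<A>'] card_image_le[of "\<A> - {A0}" "\<lambda>A. A \<inter> H"] fin by auto
  also have "\<dots> < card \<A>" using A0 fin by (meson card_Diff1_less)
  finally show "card (cut_boxes \<A> H) < card \<A>" unfolding cut .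
qed

lemma disjoint_boxes_Union:
  assumes "disjoint_boxes \<A>"
  shows "open (\<Union>\<A>)" "bounded (\<Union>\<A>)" "\<Union>\<A> \<in> fmeasurable lborel"
    "\<A> \<noteq> {} \<Longrightarrow> 0 < measure lborel (\<Union>\<A>)"
proof -
  show o: "open (\<Union>\<A>)" using assms by (auto simp: disjoint_boxes_def intro!: open_Union)
  show b: "bounded (\<Union>\<A>)"
    using assms unfolding disjoint_boxes_def by (intro bounded_Union) (auto simp: bounded_box)
  show f: "\<Union>\<A> \<in> fmeasurable lborel" using o b by (rule fmeasurable_open_bounded)
  assume "\<A> \<noteq> {}"
  then obtain A where A: "A \<in> \<A>" by auto
  then obtain a b where "A = box a b" "A \<noteq> {}" using assms unfolding disjoint_boxes_def by meson
  then have "0 < measure lborel A"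
    by (auto simp: box_ne_empty measure_lborel_box_eq less_imp_le intro!: prod_pos)
      (auto simp: inner_diff_left)
  also have "\<dots> \<le> measure lborel (\<Union>\<A>)"
    using A f \<open>A = box a b\<close> by (intro measure_mono_fmeasurable) auto
  finally show "0 < measure lborel (\<Union>\<A>)" .
qed

lemma hyperplane_null_sets:
  fixes i :: "'a::euclidean_space"
  assumes "i \<in> Basis" shows "{x. x \<bullet> i = s} \<in> null_sets lborel"
proof -
  have "negligible {x. x \<bullet> i = s}" using negligible_standard_hyperplane[OF assms] by simp
  moreover have "{x. x \<bullet> i = s} \<in> sets lborel" by simp
  ultimately show ?thesis by (simp add: negligible_iff_null_sets null_sets_completion_iff)
qed

lemma measure_halfspace_split:
  fixes i :: "'a::euclidean_space"
  assumes i: "i \<in> Basis" and A: "A \<in> fmeasurable lborel"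
  shows "measure lborel A = measure lborel (A \<inter> {x. s < x \<bullet> i}) + measure lborel (A \<inter> {x. x \<bullet> i < s})"
    and "measure lborel (A \<inter> {x. x \<bullet> i \<le> s}) = measure lborel (A \<inter> {x. x \<bullet> i < s})"
proof -
  have s [measurable]: "A \<in> sets borel" using A by (auto simp: fmeasurable_def)
  have f: "A \<inter> {x. s < x \<bullet> i} \<in> fmeasurable lborel" "A \<inter> {x. x \<bullet> i < s} \<in> fmeasurable lborel"
     "A \<inter> {x. x \<bullet> i \<le> s} \<in> fmeasurable lborel"
    using A by (auto intro!: fmeasurable_Int_fmeasurable)
  have n: "A \<inter> {x. x \<bullet> i = s} \<in> null_sets lborel"
    using hyperplane_null_sets[OF i, of s] by (rule null_sets_subset) auto
  have "A \<inter> {x. x \<bullet> i \<le> s} = (A \<inter> {x. x \<bullet> i < s}) \<union> (A \<inter> {x. x \<bullet> i = s})" by auto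
  then show 1: "measure lborel (A \<inter> {x. x \<bullet> i \<le> s}) = measure lborel (A \<inter> {x. x \<bullet> i < s})"
    using measure_Un_null_set[OF fmeasurableD[OF f(2)] n] by simp
  have "A = (A \<inter> {x. s < x \<bullet> i}) \<union> (A \<inter> {x. x \<bullet> i \<le> s})" by auto
  then have "measure lborel A = measure lborel ((A \<inter> {x. s < x \<bullet> i}) \<union> (A \<inter> {x. x \<bullet> i \<le> s}))" by simp
  also have "\<dots> = measure lborel (A \<inter> {x. s < x \<bullet> i}) + measure lborel (A \<inter> {x. x \<bullet> i \<le> s})"
    using f by (intro measure_Union) (auto simp: fmeasurable_def)
  finally show "measure lborel A = measure lborel (A \<inter> {x. s < x \<bullet> i}) + measure lborel (A \<inter> {x. x \<bullet> i < s})"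
    using 1 by simp
qed

text \<open>Intermediate value theorem for the distribution function of the coordinate
  \<open>x \<bullet> i\<close> on \<open>B\<close>; it is continuous because hyperplanes are null
  sets.\<close>

lemma halfspace_fraction:
  fixes i :: "'a::euclidean_space"
  assumes i: "i \<in> Basis" and B: "B \<in> fmeasurable lborel" and t: "0 < t" "t < measure lborel B"
  obtains s where "measure lborel (B \<inter> {x. x \<bullet> i < s}) = t"
proof -
  have s [measurable]: "B \<in> sets borel" using B by (auto simp: fmeasurable_def)
  define M where "M = distr (density lborel (indicator B)) borel (\<lambda>x. x \<bullet> i)"
  have em: "emeasure M X = emeasure lborel (B \<inter> {x. x \<bullet> i \<in> X})" if [measurable]: "X \<in> sets borel" for X
  proof -
    have *: "(\<lambda>x. x \<bullet> i) -` X \<inter> space lborel \<in> sets lborel" by (rule measurable_sets[of _ _ borel]) auto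
    have "emeasure M X = emeasure (density lborel (indicator B)) ((\<lambda>x. x \<bullet> i) -` X \<inter> space (density lborel (indicator B)))"
      unfolding M_def by (rule emeasure_distr) auto
    also have "\<dots> = (\<integral>\<^sup>+ x. indicator B x * indicator ((\<lambda>x. x \<bullet> i) -` X) x \<partial>lborel)"
      using * by (subst emeasure_density) auto
    also have "\<dots> = (\<integral>\<^sup>+x. indicator (B \<inter> {x. x \<bullet> i \<in> X}) x \<partial>lborel)"
      by (intro nn_integral_cong) (auto simp: indicator_def)
    finally show ?thesis by simp
  qed
  have me: "measure M X = measure lborel (B \<inter> {x. x \<bullet> i \<in> X})" if "X \<in> sets borel" for X
    using em[OF that] by (simp add: measure_def)
  interpret finite_measure M
    by (rule finite_measureI) (use em[of UNIV] B in \<open>simp add: M_def fmeasurable_def\<close>)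
  interpret finite_borel_measure M
    by standard (simp add: M_def)
  have "isCont (cdf M) x" for x
    unfolding isCont_cdf using hyperplane_null_sets[OF i, of x] me[of "{x}"]
    by (simp add: measure_eq_0_null_sets null_sets_subset[of _ lborel "B \<inter> {xa. xa \<bullet> i = x}"])
  then have c: "continuous_on X (cdf M)" for X by (simp add: continuous_at_imp_continuous_on)
  have "\<forall>\<^sub>F x in at_bot. cdf M x < t" using cdf_lim_at_bot t(1) by (rule order_tendstoD)
  then obtain a where a: "cdf M a < t" by (metis eventually_at_bot_linorder order_refl)
  have "measure M (space M) = measure lborel B" using me[of UNIV] by (simp add: M_def)
  then have "\<forall>\<^sub>F x in at_top. t < cdf M x" using cdf_lim_at_top t(2) by (intro order_tendstoD) auto
  then obtain b where b: "t < cdf M b" by (metis eventually_at_top_linorder order_refl)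
  have "a \<le> b" using a b cdf_nondecreasing[of b a] by linarith
  then obtain x where "cdf M x = t" using IVT'[of "cdf M" a t b] a b c by force
  then have "measure lborel (B \<inter> {y. y \<bullet> i \<le> x}) = t" by (simp add: cdf_def me)
  then show ?thesis using measure_halfspace_split(2)[OF i B] that by metis
qed

text \<open>Superadditivity of the geometric mean. The arithmetic-geometric mean inequality is
  applied to the quotients \<open>x i / (x i + y i)\<close> and to \<open>y i / (x i + y i)\<close>;
  the two arithmetic means add up to 1.\<close>

lemma root_prod_add:
  fixes x y :: "'b \<Rightarrow> real"
  assumes S: "finite S" "S \<noteq> {}" and x: "\<And>i. i \<in> S \<Longrightarrow> 0 < x i" and y: "\<And>i. i \<in> S \<Longrightarrow> 0 < y i"
  shows "root (card S) (\<Prod>i\<in>S. x i) + root (card S) (\<Prod>i\<in>S. y i) \<le> root (card S) (\<Prod>i\<in>S. x i + y i)"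
proof -
  have n: "card S > 0" using S by (simp add: card_gt_0_iff)
  have P: "0 < (\<Prod>i\<in>S. x i + y i)" using x y by (auto intro!: prod_pos add_pos_pos)
  have *: "root (card S) (\<Prod>i\<in>S. z i) \<le> root (card S) (\<Prod>i\<in>S. x i + y i) * (\<Sum>i\<in>S. z i / (x i + y i) / card S)"
    if z: "\<And>i. i \<in> S \<Longrightarrow> 0 < z i" for z
  proof -
    have "(\<Prod>i\<in>S. z i / (x i + y i)) powr (1 / card S) \<le> (\<Sum>i\<in>S. z i / (x i + y i) / card S)"
      by (rule arith_geom_mean[OF S]) (use x y z in \<open>simp add: add_nonneg_nonneg less_imp_le\<close>)
    moreover have Z: "0 < (\<Prod>i\<in>S. z i)" using z by (auto intro!: prod_pos)
    have "(\<Prod>i\<in>S. z i / (x i + y i)) powr (1 / card S) = root (card S) (\<Prod>i\<in>S. z i) / root (card S) (\<Prod>i\<in>S. x i + y i)"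
      unfolding prod_dividef using P Z n by (simp add: root_powr_inverse powr_divide less_imp_le)
    ultimately have "root (card S) (\<Prod>i\<in>S. z i) / root (card S) (\<Prod>i\<in>S. x i + y i) \<le> (\<Sum>i\<in>S. z i / (x i + y i) / card S)"
      by simp
    then show ?thesis
      using P n by (simp add: divide_le_eq mult.commute)
  qed
  have "(\<Sum>i\<in>S. x i / (x i + y i) / card S) + (\<Sum>i\<in>S. y i / (x i + y i) / card S) = (\<Sum>i\<in>S. 1 / card S)"
    unfolding sum.distrib[symmetric]
  proof (rule sum.cong)
    fix i assume i: "i \<in> S"
    have "x i + y i \<noteq> 0" using x[OF i] y[OF i] by linarith
    then show "x i / (x i + y i) / card S + y i / (x i + y i) / card S = 1 / card S"
      by (simp add: add_divide_distrib[symmetric])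
  qed simp
  also have "\<dots> = 1" using n by simp
  finally have 1: "(\<Sum>i\<in>S. x i / (x i + y i) / card S) + (\<Sum>i\<in>S. y i / (x i + y i) / card S) = 1" .
  have "root (card S) (\<Prod>i\<in>S. x i) + root (card S) (\<Prod>i\<in>S. y i)
     \<le> root (card S) (\<Prod>i\<in>S. x i + y i) * ((\<Sum>i\<in>S. x i / (x i + y i) / card S) + (\<Sum>i\<in>S. y i / (x i + y i) / card S))"
    unfolding distrib_left by (intro add_mono * x y)
  then show ?thesis using 1 by simp
qed

text \<open>A point of the large box divides the i-th edge in some ratio \<open>t i\<close>; the
  points dividing the edges of the two small boxes in the same ratios are the required
  summands.\<close>

lemma box_sumset:
  fixes a b c d :: "'a::euclidean_space"
  assumes "box a b \<noteq> {}" "box c d \<noteq> {}"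
  shows "box (a + c) (b + d) \<subseteq> sumset (box a b) (box c d)"
proof
  fix z assume z: "z \<in> box (a + c) (b + d)"
  define t where "t i = (z \<bullet> i - a \<bullet> i - c \<bullet> i) / (b \<bullet> i - a \<bullet> i + (d \<bullet> i - c \<bullet> i))" for i
  have pos: "0 < b \<bullet> i - a \<bullet> i" "0 < d \<bullet> i - c \<bullet> i" if "i \<in> Basis" for i
    using assms that by (auto simp: box_ne_empty)
  have t: "0 < t i" "t i < 1" if "i \<in> Basis" for i
    using pos[OF that] z that by (auto simp: t_def box_def inner_simps)
  define x where "x = (\<Sum>i\<in>Basis. (a \<bullet> i + t i * (b \<bullet> i - a \<bullet> i)) *\<^sub>R i)"
  have xi: "x \<bullet> i = a \<bullet> i + t i * (b \<bullet> i - a \<bullet> i)" if "i \<in> Basis" for i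
    using that by (simp add: x_def)
  have zi: "(z - x) \<bullet> i = c \<bullet> i + t i * (d \<bullet> i - c \<bullet> i)" if "i \<in> Basis" for i
  proof -
    have "t i * (b \<bullet> i - a \<bullet> i + (d \<bullet> i - c \<bullet> i)) = z \<bullet> i - a \<bullet> i - c \<bullet> i"
      using pos[OF that] by (simp add: t_def)
    then show ?thesis using xi[OF that] by (simp add: inner_diff_left algebra_simps)
  qed
  have *: "p < p + s * (q - p)" "p + s * (q - p) < q" if "0 < s" "s < 1" "0 < q - p" for p q s :: real
  proof -
    show "p < p + s * (q - p)" using that by simp
    have "s * (q - p) < 1 * (q - p)" using that by (intro mult_strict_right_mono)
    then show "p + s * (q - p) < q" by simp
  qed
  have "x \<in> box a b" unfolding box_def using xi *[OF t pos(1)] by auto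
  moreover have "z - x \<in> box c d" unfolding box_def using zi *[OF t pos(2)] by auto
  ultimately show "z \<in> sumset (box a b) (box c d)"
    unfolding sumset_def by (intro CollectI exI[of _ x] exI[of _ "z - x"]) simp
qed

text \<open>The \<open>n\<close>-th power of the usual inequality. In this form the left side is
  homogeneous of degree one in the pair of volumes, so it splits additively when both sets are cut
  in the same ratio.\<close>

definition brunn_minkowski :: "'a::euclidean_space set \<Rightarrow> 'a set \<Rightarrow> bool" where
  "brunn_minkowski A B \<longleftrightarrow>
     (root DIM('a) (measure lborel A) + root DIM('a) (measure lborel B)) ^ DIM('a) \<le> measure lborel (sumset A B)"

lemma brunn_minkowski_commute: "brunn_minkowski A B = brunn_minkowski B A"
  by (simp add: brunn_minkowski_def sumset_commute add.commute)

lemma brunn_minkowski_box: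
  fixes a b c d :: "'a::euclidean_space"
  assumes ne: "box a b \<noteq> {}" "box c d \<noteq> {}"
  shows "brunn_minkowski (box a b) (box c d)"
proof -
  have pos: "0 < (b - a) \<bullet> i" "0 < (d - c) \<bullet> i" if "i \<in> Basis" for i
    using assms that by (auto simp: box_ne_empty inner_diff_left)
  have le: "a \<bullet> i \<le> b \<bullet> i" "c \<bullet> i \<le> d \<bullet> i" if "i \<in> Basis" for i
    using pos[OF that] by (auto simp: inner_diff_left)
  have m: "measure lborel (box a b) = (\<Prod>i\<in>Basis. (b - a) \<bullet> i)" "measure lborel (box c d) = (\<Prod>i\<in>Basis. (d - c) \<bullet> i)"
    "measure lborel (box (a + c) (b + d)) = (\<Prod>i\<in>Basis. (b - a) \<bullet> i + (d - c) \<bullet> i)"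
    using le by (auto simp: measure_lborel_box_eq add_mono inner_simps intro!: prod.cong)
  have "root DIM('a) (measure lborel (box a b)) + root DIM('a) (measure lborel (box c d))
      \<le> root DIM('a) (measure lborel (box (a + c) (b + d)))"
    unfolding m by (rule root_prod_add) (use pos in auto)
  then have "(root DIM('a) (measure lborel (box a b)) + root DIM('a) (measure lborel (box c d))) ^ DIM('a)
      \<le> root DIM('a) (measure lborel (box (a + c) (b + d))) ^ DIM('a)"
    by (intro power_mono) auto
  also have "\<dots> = measure lborel (box (a + c) (b + d))" by simp
  also have "\<dots> \<le> measure lborel (sumset (box a b) (box c d))"
    by (intro measure_mono_fmeasurable box_sumset ne fmeasurable_open_bounded open_sumset bounded_sumset) auto
  finally show ?thesis by (simp add: brunn_minkowski_def)
qed

text \<open>The sum of the lower pieces and the sum of the upper pieces lie on opposite sides of the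
  hyperplane at height \<open>s + r\<close>, so their volumes add inside \<open>sumset A B\<close>;
  by homogeneity the two lower bounds are \<open>t\<close> and \<open>1 - t\<close> times the bound
  for the whole.\<close>

lemma brunn_minkowski_cut:
  fixes A B :: "'a::euclidean_space set"
  assumes A: "open A" "bounded A" and B: "open B" "bounded B" and i: "i \<in> Basis" and t: "0 \<le> t" "t \<le> 1"
    and mA: "measure lborel (A \<inter> {x. x \<bullet> i < s}) = t * measure lborel A"
    and mB: "measure lborel (B \<inter> {x. x \<bullet> i < r}) = t * measure lborel B"
    and 1: "brunn_minkowski (A \<inter> {x. x \<bullet> i < s}) (B \<inter> {x. x \<bullet> i < r})"
    and 2: "brunn_minkowski (A \<inter> {x. s < x \<bullet> i}) (B \<inter> {x. r < x \<bullet> i})"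
  shows "brunn_minkowski A B"
proof -
  let ?n = "DIM('a)"
  let ?V = "measure (lborel :: 'a measure)"
  let ?S = "(root ?n (?V A) + root ?n (?V B)) ^ ?n"
  have f: "A \<in> fmeasurable lborel" "B \<in> fmeasurable lborel" using A B by (auto intro: fmeasurable_open_bounded)
  have mA': "?V (A \<inter> {x. s < x \<bullet> i}) = (1 - t) * ?V A" and mB': "?V (B \<inter> {x. r < x \<bullet> i}) = (1 - t) * ?V B"
    using measure_halfspace_split(1)[OF i f(1), of s] measure_halfspace_split(1)[OF i f(2), of r] mA mB
    by (auto simp: algebra_simps)
  have sc: "(root ?n (l * ?V A) + root ?n (l * ?V B)) ^ ?n = l * ?S" if "0 \<le> l" for l
    using that by (simp add: real_root_mult distrib_left[symmetric] power_mult_distrib)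
  let ?C = "sumset (A \<inter> {x. x \<bullet> i < s}) (B \<inter> {x. x \<bullet> i < r})"
  let ?D = "sumset (A \<inter> {x. s < x \<bullet> i}) (B \<inter> {x. r < x \<bullet> i})"
  have oh: "open {x. x \<bullet> i < c}" "open {x. c < x \<bullet> i}" for c
    using open_halfspace_component_lt open_halfspace_component_gt by auto
  have fm: "?C \<in> fmeasurable lborel" "?D \<in> fmeasurable lborel" "sumset A B \<in> fmeasurable lborel"
    by (intro fmeasurable_open_bounded open_sumset bounded_sumset open_Int bounded_Int disjI1 A B oh)+
  have disj: "?C \<inter> ?D = {}"
  proof -
    have "z \<bullet> i < s + r" if "z \<in> ?C" for z
      using that by (auto simp: sumset_def inner_add_left)
    moreover have "s + r < z \<bullet> i" if "z \<in> ?D" for z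
      using that by (auto simp: sumset_def inner_add_left)
    ultimately show ?thesis by fastforce
  qed
  have "?V ?C + ?V ?D = ?V (?C \<union> ?D)"
    using fm disj by (intro measure_Union[symmetric]) (auto simp: fmeasurable_def)
  also have "\<dots> \<le> ?V (sumset A B)"
  proof (intro measure_mono_fmeasurable fm(3))
    show "?C \<union> ?D \<subseteq> sumset A B" by (intro Un_least sumset_mono) auto
    show "?C \<union> ?D \<in> sets lborel" using fm by (intro sets.Un fmeasurableD)
  qed
  finally have "?V ?C + ?V ?D \<le> ?V (sumset A B)" .
  moreover have "t * ?S \<le> ?V ?C" "(1 - t) * ?S \<le> ?V ?D"
    using 1 2 t unfolding brunn_minkowski_def mA mB mA' mB' by (simp_all add: sc)
  ultimately have "t * ?S + (1 - t) * ?S \<le> ?V (sumset A B)" by linarith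
  then show ?thesis by (simp add: brunn_minkowski_def algebra_simps)
qed

lemma disjoint_boxesD:
  assumes "disjoint_boxes \<A>" "A \<in> \<A>"
  shows "\<exists>a b. A = box a b" "A \<noteq> {}" "open A"
proof -
  show *: "\<exists>a b. A = box a b" "A \<noteq> {}" using assms unfolding disjoint_boxes_def by blast+
  then show "open A" by auto
qed

text \<open>Two disjoint boxes of one family are separated by a coordinate hyperplane. Cutting there
  lowers the number of boxes of that family on both sides, while the matching cut of the other
  family does not raise its number, so the total count decreases.\<close>

lemma brunn_minkowski_disjoint_boxes:
  fixes \<A> \<B> :: "'a::euclidean_space set set"
  assumes "disjoint_boxes \<A>" "disjoint_boxes \<B>" "\<A> \<noteq> {}" "\<B> \<noteq> {}"
  shows "brunn_minkowski (\<Union>\<A>) (\<Union>\<B>)"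
  using assms
proof (induction "card \<A> + card \<B>" arbitrary: \<A> \<B> rule: less_induct)
  case less
  \<comment> \<open>Stated for fresh families with the same total count, so that it also serves with
    the two roles exchanged when only the second family has two boxes.\<close>
  have step: "brunn_minkowski (\<Union>\<A>') (\<Union>\<B>')"
    if \<A>: "disjoint_boxes \<A>'" and \<B>: "disjoint_boxes \<B>'" and ne: "\<A>' \<noteq> {}" "\<B>' \<noteq> {}" and
      card: "card \<A>' + card \<B>' = card \<A> + card \<B>" and A01: "A0 \<in> \<A>'" "A1 \<in> \<A>'" "A0 \<noteq> A1" for \<A>' \<B>' :: "'a set set" and A0 A1
  proof -
    let ?V = "measure (lborel :: 'a measure)"
    obtain a b where ab: "A0 = box a b"
      using disjoint_boxesD(1)[OF \<A> A01(1)] by blast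
    obtain c d where cd: "A1 = box c d"
      using disjoint_boxesD(1)[OF \<A> A01(2)] by blast
    have ne': "A0 \<noteq> {}" "A1 \<noteq> {}" using disjoint_boxesD(2)[OF \<A>] A01 by blast+
    have "A0 \<inter> A1 = {}" using A01 \<A> unfolding disjoint_boxes_def disjoint_def by blast
    then obtain i where i: "i \<in> Basis"
        "b \<bullet> i \<le> a \<bullet> i \<or> d \<bullet> i \<le> c \<bullet> i \<or> b \<bullet> i \<le> c \<bullet> i \<or> d \<bullet> i \<le> a \<bullet> i"
      unfolding ab cd disjoint_interval by blast
    moreover have "a \<bullet> i < b \<bullet> i" "c \<bullet> i < d \<bullet> i"
      using ne' i(1) unfolding ab cd box_ne_empty by blast+
    ultimately have i: "i \<in> Basis" "b \<bullet> i \<le> c \<bullet> i \<or> d \<bullet> i \<le> a \<bullet> i" by linarith+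
    \<comment> \<open>The cut passes through a face of the lower of the two boxes: \<open>C\<close>
      has nothing above it and \<open>D\<close> nothing below.\<close>
    obtain C D s where CD: "C \<in> \<A>'" "D \<in> \<A>'" "C \<inter> {x. s < x \<bullet> i} = {}" "D \<inter> {x. x \<bullet> i < s} = {}"
    proof (cases "b \<bullet> i \<le> c \<bullet> i")
      case True
      have "A0 \<inter> {x. b \<bullet> i < x \<bullet> i} = {}" "A1 \<inter> {x. x \<bullet> i < b \<bullet> i} = {}"
        using True i(1) by (force simp: ab cd mem_box)+
      then show ?thesis using that A01 by blast
    next
      case False
      then have "A1 \<inter> {x. d \<bullet> i < x \<bullet> i} = {}" "A0 \<inter> {x. x \<bullet> i < d \<bullet> i} = {}"
        using i by (force simp: ab cd mem_box)+
      then show ?thesis using that A01 by blast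
    qed
    note cutA = disjoint_boxes_Int[OF \<A>, of "{x. s < x \<bullet> i}", OF box_Int_greater[OF i(1)]]
      disjoint_boxes_Int[OF \<A>, of "{x. x \<bullet> i < s}", OF box_Int_less[OF i(1)]]
    note UA = disjoint_boxes_Union[OF \<A>] and UB = disjoint_boxes_Union[OF \<B>]
    define t where "t = ?V (\<Union>\<A>' \<inter> {x. x \<bullet> i < s}) / ?V (\<Union>\<A>')"
    have "D \<noteq> {}" "C \<noteq> {}" using CD(1,2) disjoint_boxesD(2)[OF \<A>] by blast+
    have "open C" "open D" using CD(1,2) disjoint_boxesD(3)[OF \<A>] by blast+
    \<comment> \<open>A nonempty open box does not fit into a hyperplane, so \<open>C\<close>
      contributes to the lower side and \<open>D\<close> to the upper one. Hence \<open>t\<close>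
      lies strictly between 0 and 1.\<close>
    have neA: "cut_boxes \<A>' {x. s < x \<bullet> i} \<noteq> {}" "cut_boxes \<A>' {x. x \<bullet> i < s} \<noteq> {}"
    proof -
      have *: "E \<inter> {x. x \<bullet> i \<noteq> s} \<noteq> {}" if "open E" "E \<noteq> {}" for E :: "'a set"
      proof
        assume "E \<inter> {x. x \<bullet> i \<noteq> s} = {}"
        then have "E \<subseteq> {x. x \<bullet> i = s}" by auto
        then have "negligible E"
          using negligible_standard_hyperplane[OF i(1)] negligible_subset by blast
        then show False using that open_not_negligible by blast
      qed
      show "cut_boxes \<A>' {x. s < x \<bullet> i} \<noteq> {}"
      proof -
        obtain x where "x \<in> D" "x \<bullet> i \<noteq> s" using *[OF \<open>open D\<close> \<open>D \<noteq> {}\<close>] by blast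
        then have "x \<in> D \<inter> {x. s < x \<bullet> i}" using CD(4) by auto
        then show ?thesis using CD(2) unfolding cut_boxes_def by blast
      qed
      show "cut_boxes \<A>' {x. x \<bullet> i < s} \<noteq> {}"
      proof -
        obtain x where "x \<in> C" "x \<bullet> i \<noteq> s" using *[OF \<open>open C\<close> \<open>C \<noteq> {}\<close>] by blast
        then have "x \<in> C \<inter> {x. x \<bullet> i < s}" using CD(3) by auto
        then show ?thesis using CD(1) unfolding cut_boxes_def by blast
      qed
    qed
    have VA: "0 < ?V (\<Union>\<A>')" "0 < ?V (\<Union>\<A>' \<inter> {x. s < x \<bullet> i})" "0 < ?V (\<Union>\<A>' \<inter> {x. x \<bullet> i < s})"
      using UA(4) ne disjoint_boxes_Union(4)[OF cutA(1) neA(1)] disjoint_boxes_Union(4)[OF cutA(5) neA(2)]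
      unfolding cutA(2,6) by auto
    have VB: "0 < ?V (\<Union>\<B>')" using UB(4) ne by auto
    have t: "0 < t" "t < 1"
      using VA measure_halfspace_split(1)[OF i(1) UA(3), of s] by (auto simp: t_def)
    obtain r where r: "?V (\<Union>\<B>' \<inter> {x. x \<bullet> i < r}) = t * ?V (\<Union>\<B>')"
      using halfspace_fraction[OF i(1) UB(3), of "t * ?V (\<Union>\<B>')"] t VB by auto
    note cutB = disjoint_boxes_Int[OF \<B>, of "{x. r < x \<bullet> i}", OF box_Int_greater[OF i(1)]]
      disjoint_boxes_Int[OF \<B>, of "{x. x \<bullet> i < r}", OF box_Int_less[OF i(1)]]
    have "?V (\<Union>\<B>' \<inter> {x. r < x \<bullet> i}) = (1 - t) * ?V (\<Union>\<B>')"
      using measure_halfspace_split(1)[OF i(1) UB(3), of r] r by (simp add: algebra_simps)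
    then have "0 < ?V (\<Union>\<B>' \<inter> {x. r < x \<bullet> i})" "0 < ?V (\<Union>\<B>' \<inter> {x. x \<bullet> i < r})" using r t VB by auto
    then have "\<Union>(cut_boxes \<B>' {x. r < x \<bullet> i}) \<noteq> {}" "\<Union>(cut_boxes \<B>' {x. x \<bullet> i < r}) \<noteq> {}"
      unfolding cutB(2,6) by (auto simp del: Int_iff)
    then have neB: "cut_boxes \<B>' {x. r < x \<bullet> i} \<noteq> {}" "cut_boxes \<B>' {x. x \<bullet> i < r} \<noteq> {}" by auto
    show ?thesis
    proof (rule brunn_minkowski_cut[OF UA(1,2) UB(1,2) i(1), of t s r])
      show "?V (\<Union>\<A>' \<inter> {x. x \<bullet> i < s}) = t * ?V (\<Union>\<A>')" using VA by (simp add: t_def)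
      show "brunn_minkowski (\<Union>\<A>' \<inter> {x. x \<bullet> i < s}) (\<Union>\<B>' \<inter> {x. x \<bullet> i < r})"
        using less.hyps[OF _ cutA(5) cutB(5) neA(2) neB(2)] cutA(8)[OF CD(2,4)] cutB(7) card
        unfolding cutA(2,6) cutB(2,6) by linarith
      show "brunn_minkowski (\<Union>\<A>' \<inter> {x. s < x \<bullet> i}) (\<Union>\<B>' \<inter> {x. r < x \<bullet> i})"
        using less.hyps[OF _ cutA(1) cutB(1) neA(1) neB(1)] cutA(4)[OF CD(1,3)] cutB(3) card
        unfolding cutA(2,6) cutB(2,6) by linarith
    qed (use t r in auto)
  qed
  have fin: "finite \<A>" "finite \<B>" using less.prems by (auto simp: disjoint_boxes_def)
  consider (1) A where "\<A> = {A}" | (2) A0 A1 where "A0 \<in> \<A>" "A1 \<in> \<A>" "A0 \<noteq> A1"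
    using less.prems(3) by blast
  then show ?case
  proof cases
    case 2
    show ?thesis by (rule step[OF less.prems refl 2])
  next
    case 1
    consider (3) B where "\<B> = {B}" | (4) B0 B1 where "B0 \<in> \<B>" "B1 \<in> \<B>" "B0 \<noteq> B1"
      using less.prems(4) by blast
    then show ?thesis
    proof cases
      case 4
      show ?thesis
        unfolding brunn_minkowski_commute[of "\<Union>\<A>"]
        by (rule step[OF less.prems(2,1,4,3) add.commute 4])
    next
      case 3
      have AB: "A \<in> \<A>" "B \<in> \<B>" using 1 3 by auto
      obtain a b where a: "A = box a b" using disjoint_boxesD(1)[OF less.prems(1) AB(1)] by blast
      obtain c d where c: "B = box c d" using disjoint_boxesD(1)[OF less.prems(2) AB(2)] by blast
      have "brunn_minkowski A B"
        using brunn_minkowski_box disjoint_boxesD(2)[OF less.prems(1) AB(1)] disjoint_boxesD(2)[OF less.prems(2) AB(2)]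
        unfolding a c .
      then show ?thesis using 1 3 by simp
    qed
  qed
qed


text \<open>An open set is a countable union of closed boxes, and finitely many of them already have
  measure above \<open>m\<close>. A division of that finite union into boxes with disjoint interiors
  loses only the frontiers, which are null sets.\<close>

lemma open_inner_disjoint_boxes:
  fixes A :: "'a::euclidean_space set"
  assumes A: "open A" "bounded A" and m: "m < measure lborel A"
  obtains \<A> where "disjoint_boxes \<A>" "\<Union>\<A> \<subseteq> A" "m < measure lborel (\<Union>\<A>)"
proof -
  have fA: "A \<in> fmeasurable lborel" using A by (rule fmeasurable_open_bounded)
  obtain D where D: "countable D" "D \<subseteq> Pow A" "\<And>X. X \<in> D \<Longrightarrow> \<exists>a b. X = cbox a b" "\<Union>D = A"
    using open_countable_Union_open_cbox[OF A(1)] by metis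
  \<comment> \<open>The empty set is adjoined so that the enumeration is meaningful even if
    \<open>D\<close> is empty.\<close>
  define C where "C k = (\<Union>j<k. from_nat_into (insert {} D) j)" for k
  have D': "countable (insert {} D)" "insert {} D \<noteq> {}" using D by auto
  have e: "from_nat_into (insert {} D) j \<in> insert {} D" for j
    using from_nat_into[OF D'(2)] .
  have cb: "\<exists>a b. from_nat_into (insert {} D) j = cbox a b" for j
    using e[of j] D(3) empty_as_interval[where 'a='a] by (metis insertE)
  have sC: "C k \<in> sets lborel" for k
  proof -
    have "from_nat_into (insert {} D) j \<in> sets lborel" for j
      using cb[of j] by (metis closed_cbox borel_closed sets_lborel)
    then show ?thesis unfolding C_def by (intro sets.finite_UN) auto
  qed
  have UC: "(\<Union>k. C k) = A"
  proof -
    have "(\<Union>k. C k) = (\<Union>j. from_nat_into (insert {} D) j)" unfolding C_def by blast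
    also have "\<dots> = \<Union>(insert {} D)" using range_from_nat_into[OF D'(2,1)] by simp
    finally show ?thesis using D(4) by simp
  qed
  have "(\<lambda>k. measure lborel (C k)) \<longlonglongrightarrow> measure lborel (\<Union>k. C k)"
  proof (rule Lim_measure_incseq)
    show "range C \<subseteq> sets lborel"
      using sC by blast
    show "incseq C" unfolding C_def incseq_def by (intro allI impI UN_mono) auto
    show "emeasure lborel (\<Union>k. C k) \<noteq> \<infinity>" using fA by (auto simp: UC fmeasurable_def)
  qed
  then have "\<forall>\<^sub>F k in sequentially. m < measure lborel (C k)"
    using m by (intro order_tendstoD) (auto simp: UC)
  then obtain k where k: "m < measure lborel (C k)" by (metis eventually_sequentially order_refl)
  have "C k = \<Union>(from_nat_into (insert {} D) ` {..<k})" by (simp add: C_def)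
  moreover obtain p where "p division_of \<Union>(from_nat_into (insert {} D) ` {..<k})"
    by (rule elementary_unions_intervals[of "from_nat_into (insert {} D) ` {..<k}"]) (use cb in auto)
  ultimately have p: "p division_of C k" by simp
  define \<A> where "\<A> = interior ` p - {{}}"
  have "disjoint_boxes \<A>"
    unfolding disjoint_boxes_def
  proof (intro conjI ballI)
    show "finite \<A>" using division_ofD(1)[OF p] by (simp add: \<A>_def)
    show "disjoint \<A>"
      unfolding \<A>_def by (intro disjointI) (use division_ofD(5)[OF p] in blast)
    fix X assume X: "X \<in> \<A>"
    then show "X \<noteq> {}" by (auto simp: \<A>_def)
    from X obtain Y where Y: "X = interior Y" "Y \<in> p" by (auto simp: \<A>_def)
    then obtain a b where "Y = cbox a b" using division_ofD(4)[OF p] by blast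
    then show "\<exists>a b. X = box a b" using Y by auto
  qed
  moreover have UA: "\<Union>\<A> \<subseteq> C k"
  proof
    fix x assume "x \<in> \<Union>\<A>"
    then obtain Y where "x \<in> interior Y" "Y \<in> p" by (auto simp: \<A>_def)
    then show "x \<in> C k" using interior_subset division_ofD(2)[OF p] by blast
  qed
  moreover have "C k \<subseteq> A" using UC by blast
  moreover have "measure lborel (C k) \<le> measure lborel (\<Union>\<A>)"
  proof -
    have *: "C k \<subseteq> \<Union>\<A> \<union> (\<Union>Y\<in>p. frontier Y)"
    proof
      fix x assume "x \<in> C k"
      then obtain Y where Y: "x \<in> Y" "Y \<in> p" using division_ofD(6)[OF p] by blast
      then show "x \<in> \<Union>\<A> \<union> (\<Union>Y\<in>p. frontier Y)"
        using closure_subset[of Y] by (auto simp: \<A>_def frontier_def)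
    qed
    have "(\<Union>Y\<in>p. frontier Y) \<in> null_sets lborel"
    proof (rule null_sets.finite_UN)
      show "finite p" using division_ofD(1)[OF p] .
      fix Y assume "Y \<in> p"
      then obtain a b where Y: "Y = cbox a b" using division_ofD(4)[OF p] by blast
      then have "negligible (frontier Y)" by (simp add: negligible_convex_frontier)
      then show "frontier Y \<in> null_sets lborel"
        by (simp add: negligible_iff_null_sets null_sets_completion_iff borel_closed)
    qed
    then have n: "(\<Union>Y\<in>p. frontier Y) \<in> null_sets lborel" .
    have o: "\<Union>\<A> \<in> sets lborel" using disjoint_boxes_Union(1)[OF \<open>disjoint_boxes \<A>\<close>] by simp
    have f: "\<Union>\<A> \<in> fmeasurable lborel" using disjoint_boxes_Union(3)[OF \<open>disjoint_boxes \<A>\<close>] .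
    have "measure lborel (C k) \<le> measure lborel (\<Union>\<A> \<union> (\<Union>Y\<in>p. frontier Y))"
    proof (rule measure_mono_fmeasurable[OF * sC])
      have "(\<Union>Y\<in>p. frontier Y) \<in> fmeasurable lborel" using n by (simp add: fmeasurable_def null_sets_def)
      then show "\<Union>\<A> \<union> (\<Union>Y\<in>p. frontier Y) \<in> fmeasurable lborel" using f by (rule fmeasurable.Un[rotated])
    qed
    also have "\<dots> = measure lborel (\<Union>\<A>)" using measure_Un_null_set[OF o n] .
    finally show ?thesis .
  qed
  ultimately show ?thesis using that k by (meson less_le_trans subset_trans)
qed

text \<open>Volumes strictly below those of \<open>A\<close> and \<open>B\<close> are exceeded by
  unions of disjoint boxes inside them. The two volumes are then let tend to their limits from the
  left, one after the other.\<close>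

theorem brunn_minkowski_open:
  fixes A B :: "'a::euclidean_space set"
  assumes A: "open A" "bounded A" "A \<noteq> {}" and B: "open B" "bounded B" "B \<noteq> {}"
  shows "root DIM('a) (measure lborel A) + root DIM('a) (measure lborel B) \<le> root DIM('a) (measure lborel (sumset A B))"
proof -
  let ?n = "DIM('a)"
  let ?V = "measure (lborel :: 'a measure)"
  have pos: "0 < ?V C" if C: "open C" "bounded C" "C \<noteq> {}" for C
  proof -
    have "\<not> negligible C" using open_not_negligible C by blast
    then have "emeasure lborel C \<noteq> 0"
      using C(1) by (auto simp: negligible_iff_null_sets null_sets_completion_iff null_sets_def)
    then show ?thesis
      using fmeasurable_open_bounded[OF C(1,2)]
      by (metis emeasure_eq_measure2 ennreal_0 measure_nonneg order_le_less)
  qed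
  have *: "root ?n a + root ?n b \<le> root ?n (?V (sumset A B))" if ab: "0 \<le> a" "a < ?V A" "0 \<le> b" "b < ?V B" for a b
  proof -
    obtain \<A> where \<A>: "disjoint_boxes \<A>" "\<Union>\<A> \<subseteq> A" "a < ?V (\<Union>\<A>)"
      by (rule open_inner_disjoint_boxes[OF A(1,2) ab(2)])
    obtain \<B> where \<B>: "disjoint_boxes \<B>" "\<Union>\<B> \<subseteq> B" "b < ?V (\<Union>\<B>)"
      by (rule open_inner_disjoint_boxes[OF B(1,2) ab(4)])
    have "\<A> \<noteq> {}" "\<B> \<noteq> {}" using \<A>(3) \<B>(3) ab by auto
    then have "brunn_minkowski (\<Union>\<A>) (\<Union>\<B>)"
      using brunn_minkowski_disjoint_boxes \<A>(1) \<B>(1) by blast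
    then have "root ?n ((root ?n (?V (\<Union>\<A>)) + root ?n (?V (\<Union>\<B>))) ^ ?n) \<le> root ?n (?V (sumset (\<Union>\<A>) (\<Union>\<B>)))"
      by (simp add: brunn_minkowski_def)
    then have "root ?n (?V (\<Union>\<A>)) + root ?n (?V (\<Union>\<B>)) \<le> root ?n (?V (sumset (\<Union>\<A>) (\<Union>\<B>)))"
      by (simp add: real_root_power_cancel)
    also have "\<dots> \<le> root ?n (?V (sumset A B))"
    proof -
      have "?V (sumset (\<Union>\<A>) (\<Union>\<B>)) \<le> ?V (sumset A B)"
        using A B \<A> \<B> disjoint_boxes_Union(1)[OF \<A>(1)]
        by (intro measure_mono_fmeasurable sumset_mono fmeasurable_open_bounded open_sumset bounded_sumset)
          (simp_all add: open_sumset)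
      then show ?thesis by simp
    qed
    finally have "root ?n (?V (\<Union>\<A>)) + root ?n (?V (\<Union>\<B>)) \<le> root ?n (?V (sumset A B))" .
    moreover have "root ?n a \<le> root ?n (?V (\<Union>\<A>))" "root ?n b \<le> root ?n (?V (\<Union>\<B>))" using \<A>(3) \<B>(3) by auto
    ultimately show ?thesis by linarith
  qed
  have ev: "\<forall>\<^sub>F a in at_left x. 0 \<le> a \<and> a < x" if "0 < x" for x :: real
    by (rule eventually_at_leftI[of 0]) (use that in auto)
  have 1: "root ?n (?V A) + root ?n b \<le> root ?n (?V (sumset A B))" if "0 \<le> b" "b < ?V B" for b
  proof (rule tendsto_upperbound)
    show "((\<lambda>a. root ?n a + root ?n b) \<longlongrightarrow> root ?n (?V A) + root ?n b) (at_left (?V A))"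
      by (intro tendsto_intros)
    show "\<forall>\<^sub>F a in at_left (?V A). root ?n a + root ?n b \<le> root ?n (?V (sumset A B))"
      using ev[OF pos[OF A]] by eventually_elim (use * that in auto)
  qed simp
  show ?thesis
  proof (rule tendsto_upperbound)
    show "((\<lambda>b. root ?n (?V A) + root ?n b) \<longlongrightarrow> root ?n (?V A) + root ?n (?V B)) (at_left (?V B))"
      by (intro tendsto_intros)
    show "\<forall>\<^sub>F b in at_left (?V B). root ?n (?V A) + root ?n b \<le> root ?n (?V (sumset A B))"
      using ev[OF pos[OF B]] by eventually_elim (use 1 in auto)
  qed simp
qed

section \<open>The isoperimetric inequality for bands between level sets\<close>

text \<open>The first two terms of the expansion of \<open>(a + b) ^ n\<close>, with
  \<open>a\<close> and \<open>b\<close> the \<open>n\<close>-th roots of the volumes of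
  \<open>A\<close> and of the ball of radius \<open>t\<close>. The coefficient of \<open>t\<close>
  is the perimeter of a ball with the volume of \<open>A\<close>.\<close>

lemma minkowski_enlargement:
  fixes A :: "'a::euclidean_space set"
  assumes A: "open A" "bounded A" "A \<noteq> {}" and t: "0 < t"
  shows "measure lborel A + DIM('a) * root DIM('a) (measure lborel A) ^ (DIM('a) - 1) * (root DIM('a) (unit_ball_vol DIM('a)) * t)
     \<le> measure lborel (sumset A (ball 0 t))"
proof -
  let ?n = "DIM('a)"
  define a where "a = root ?n (measure lborel A)"
  define b where "b = root ?n (unit_ball_vol ?n) * t"
  have n: "0 < ?n" by simp
  have a0: "0 \<le> a" and b0: "0 \<le> b" using t by (auto simp: a_def b_def)
  have b: "root ?n (measure lborel (ball (0::'a) t)) = b"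
    using t by (simp add: content_ball real_root_mult real_root_power_cancel b_def)
  have "a + b \<le> root ?n (measure lborel (sumset A (ball 0 t)))"
    using brunn_minkowski_open[OF A, of "ball 0 t"] t unfolding b a_def by simp
  then have "(a + b) ^ ?n \<le> root ?n (measure lborel (sumset A (ball 0 t))) ^ ?n"
    using a0 b0 by (intro power_mono) auto
  then have 1: "(a + b) ^ ?n \<le> measure lborel (sumset A (ball 0 t))" by simp
  have "a ^ k + k * a ^ (k - 1) * b \<le> (a + b) ^ k" for k
  proof (induction k)
    case (Suc k)
    have "a ^ Suc k + Suc k * a ^ k * b \<le> (a + b) * (a ^ k + k * a ^ (k - 1) * b)"
    proof (cases k)
      case (Suc j)
      have "0 \<le> real k * a ^ (k - 1) * b * b" using a0 b0 by simp
      then show ?thesis using Suc by (simp add: algebra_simps)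
    qed simp
    also have "\<dots> \<le> (a + b) * (a + b) ^ k" using Suc a0 b0 by (intro mult_left_mono) auto
    finally show ?case by simp
  qed simp
  from this[of ?n] 1 show ?thesis unfolding a_def[symmetric] b_def[symmetric] by (simp add: a_def)
qed

lemma emeasure_ge_of_slices:
  assumes S: "S \<in> sets (lborel \<Otimes>\<^sub>M lborel)"
    and hi: "\<And>z. emeasure lborel (Pair z -` S) \<le> F z"
    and lo: "\<And>c. c \<in> I \<Longrightarrow> a \<le> emeasure lborel ((\<lambda>z. (z, c)) -` S)" and I: "I \<in> sets lborel"
  shows "a * emeasure lborel I \<le> (\<integral>\<^sup>+z. F z \<partial>(lborel :: 'a::euclidean_space measure))"
proof -
  have "a * emeasure lborel I = (\<integral>\<^sup>+c. a * indicator I c \<partial>lborel)"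
    using I by (simp add: nn_integral_cmult_indicator)
  also have "\<dots> \<le> (\<integral>\<^sup>+c. emeasure lborel ((\<lambda>z. (z, c)) -` S) \<partial>lborel)"
    by (intro nn_integral_mono) (auto simp: indicator_def lo)
  also have "\<dots> = emeasure (lborel \<Otimes>\<^sub>M lborel) S"
    using lborel_pair.emeasure_pair_measure_alt2[OF S] by simp
  also have "\<dots> = (\<integral>\<^sup>+z. emeasure lborel (Pair z -` S) \<partial>lborel)"
    by (rule lborel.emeasure_pair_measure_alt[OF S])
  also have "\<dots> \<le> (\<integral>\<^sup>+z. F z \<partial>lborel)" by (intro nn_integral_mono hi)
  finally show ?thesis .
qed

text \<open>Mean value theorem on the segment from \<open>z\<close> to \<open>z + y\<close>, on
  which uniform continuity keeps the gradient within \<open>\<epsilon>\<close> of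
  \<open>g z\<close>. Only \<open>z + y\<close> is known to lie in the ball of radius
  \<open>r\<close>; as \<open>t \<le> 1\<close>, the whole segment stays in the ball of radius
  \<open>r + 1\<close>.\<close>

lemma gradient_increment_uniform:
  fixes w :: "'a::euclidean_space \<Rightarrow> real"
  assumes der: "\<And>x. (w has_derivative (\<lambda>h. g x \<bullet> h)) (at x)" and cont: "continuous_on UNIV g"
    and "0 < \<epsilon>"
  obtains t where "0 < t" "t \<le> 1"
    "\<And>z y. norm y < t \<Longrightarrow> z + y \<in> ball 0 r \<Longrightarrow> w (z + y) \<le> w z + norm y * (norm (g z) + \<epsilon>)"
proof -
  have "uniformly_continuous_on (cball 0 (r + 1)) g"
    using cont by (intro compact_uniformly_continuous continuous_on_subset[OF cont]) auto
  then obtain d where d: "0 < d" "\<And>x x'. x \<in> cball 0 (r + 1) \<Longrightarrow> x' \<in> cball 0 (r + 1) \<Longrightarrow> dist x' x < d \<Longrightarrow> dist (g x') (g x) < \<epsilon>"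
    using \<open>0 < \<epsilon>\<close> unfolding uniformly_continuous_on_def by metis
  show ?thesis
  proof (rule that[of "min d 1"])
    fix z y :: 'a assume y: "norm y < min d 1" and zy: "z + y \<in> ball 0 r"
    have "((\<lambda>s. w (z + s *\<^sub>R y)) has_derivative (\<lambda>h. h * (g (z + s *\<^sub>R y) \<bullet> y))) (at s)" for s
      by (rule has_derivative_eq_rhs, rule has_derivative_compose[OF _ der]) (auto intro!: derivative_eq_intros)
    then obtain s where s: "s \<in> {0<..<1}" "w (z + 1 *\<^sub>R y) - w (z + 0 *\<^sub>R y) = (1 - 0) * (g (z + s *\<^sub>R y) \<bullet> y)"
      using mvt_simple[of 0 1 "\<lambda>s. w (z + s *\<^sub>R y)" "\<lambda>s h. h * (g (z + s *\<^sub>R y) \<bullet> y)"]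
      by (metis has_derivative_at_withinI zero_less_one)
    have nz: "norm z \<le> norm (z + y) + norm y" using norm_triangle_ineq4[of "z + y" y] by simp
    have in_z: "z \<in> cball 0 (r + 1)" using nz zy y by simp
    moreover have "z + s *\<^sub>R y \<in> cball 0 (r + 1)"
    proof -
      have "z + s *\<^sub>R y = (z + y) - (1 - s) *\<^sub>R y" by (simp add: algebra_simps)
      then have "norm (z + s *\<^sub>R y) \<le> norm (z + y) + norm ((1 - s) *\<^sub>R y)"
        using norm_triangle_ineq4[of "z + y" "(1 - s) *\<^sub>R y"] by metis
      also have "norm ((1 - s) *\<^sub>R y) = (1 - s) * norm y" using s by simp
      also have "norm (z + y) + (1 - s) * norm y \<le> r + 1 * 1" using zy y s by (intro add_mono mult_mono) auto
      finally show ?thesis by simp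
    qed
    moreover have "dist (z + s *\<^sub>R y) z < d"
    proof -
      have "dist (z + s *\<^sub>R y) z = s * norm y" using s by (simp add: dist_norm)
      also have "\<dots> \<le> 1 * norm y" using s by (intro mult_right_mono) auto
      finally show ?thesis using y by simp
    qed
    ultimately have "dist (g (z + s *\<^sub>R y)) (g z) < \<epsilon>" using d by blast
    then have "norm (g (z + s *\<^sub>R y)) \<le> norm (g z) + \<epsilon>"
      using norm_triangle_ineq2[of "g (z + s *\<^sub>R y)" "g z"] by (simp add: dist_norm)
    then have "norm (g (z + s *\<^sub>R y)) * norm y \<le> (norm (g z) + \<epsilon>) * norm y" by (intro mult_right_mono) auto
    then show "w (z + y) \<le> w z + norm y * (norm (g z) + \<epsilon>)"
      using s norm_cauchy_schwarz[of "g (z + s *\<^sub>R y)" y] by (simp add: mult.commute)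
  qed (use d in auto)
qed

text \<open>Fubini in both orders, applied to the set of pairs \<open>(z, c)\<close> with \<open>w z \<le> c < w y\<close> for some \<open>y\<close> within distance \<open>t\<close> of \<open>z\<close>:
  for fixed \<open>c\<close> its measure is bounded below by Brunn--Minkowski, for fixed \<open>z\<close> it is bounded above by about \<open>t |\<nabla>w z|\<close>.\<close>

lemma isoperimetric_band_aux:
  fixes w :: "'a::euclidean_space \<Rightarrow> real"
  assumes der: "\<And>x. (w has_derivative (\<lambda>h. g x \<bullet> h)) (at x)" and cont: "continuous_on UNIV g"
    and bd: "bounded {x. c0 < w x}" and c: "c0 < c'" "c' < c1" and ne: "{x. c1 < w x} \<noteq> {}" and \<epsilon>: "0 < \<epsilon>"
  defines "m \<equiv> \<lambda>c. measure lborel {x. c < w x}"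
  shows "DIM('a) * root DIM('a) (m c1) ^ (DIM('a) - 1) * root DIM('a) (unit_ball_vol DIM('a)) * (c1 - c')
    \<le> (\<integral>x. indicator {x. c0 < w x \<and> w x \<le> c1} x * (norm (g x) + \<epsilon>) \<partial>lborel)"
proof -
  let ?n = "DIM('a)"
  define \<kappa> where "\<kappa> = ?n * root ?n (m c1) ^ (?n - 1) * root ?n (unit_ball_vol ?n)"
  have contw: "continuous_on X w" for X
    using der by (meson differentiable_def differentiable_imp_continuous_on differentiable_at_withinI differentiable_on_def)
  have [measurable]: "w \<in> borel_measurable borel" "g \<in> borel_measurable borel"
    using contw cont by (auto intro: borel_measurable_continuous_onI)
  have opw: "open {x. c < w x}" for c by (intro open_Collect_less continuous_on_const contw)
  have bdc: "bounded {x. c < w x}" if "c0 \<le> c" for c using bd by (rule bounded_subset) (use that in auto)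
  have mono: "m c1 \<le> m c" if "c0 \<le> c" "c \<le> c1" for c
    unfolding m_def using that by (intro measure_mono_fmeasurable fmeasurable_open_bounded opw bdc) (auto simp: opw)
  obtain r where r: "0 < r" "{x. c0 < w x} \<subseteq> ball 0 r"
    using bd by (metis bounded_subset_ballD)
  have "compact (g ` cball 0 (r + 1))" by (intro compact_continuous_image continuous_on_subset[OF cont]) auto
  then obtain L where L: "\<And>z. z \<in> cball 0 (r + 1) \<Longrightarrow> norm (g z) \<le> L"
    by (metis compact_imp_bounded bounded_iff imageI)
  obtain t0 where t0: "0 < t0" "t0 \<le> 1"
    "\<And>z y. norm y < t0 \<Longrightarrow> z + y \<in> ball 0 r \<Longrightarrow> w (z + y) \<le> w z + norm y * (norm (g z) + \<epsilon>)"
    using gradient_increment_uniform[OF der cont \<epsilon>, of r] by metis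
  define l where "l = max L 0 + \<epsilon>"
  have l: "0 < l" using \<epsilon> by (simp add: l_def)
  \<comment> \<open>The bound \<open>t * l \<le> c' - c0\<close> guarantees that a point from which
    a level above \<open>c'\<close> is reached within distance \<open>t\<close> already has
    \<open>c0 < w z\<close>. The gap between \<open>c0\<close> and \<open>c'\<close> is the buffer
    that keeps all relevant \<open>z\<close> inside the band.\<close>
  define t where "t = min t0 ((c' - c0) / l)"
  have t: "0 < t" "t \<le> t0" "t * l \<le> c' - c0" using t0 c l by (auto simp: t_def min_def field_simps)
  have t1: "w (z + y) \<le> w z + t * (norm (g z) + \<epsilon>)" "z \<in> cball 0 (r + 1)"
    if "norm y < t" "c0 < w (z + y)" for z y
  proof -
    have zy: "z + y \<in> ball 0 r" using that r by auto
    have "w (z + y) \<le> w z + norm y * (norm (g z) + \<epsilon>)"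
      using t0(3)[of y z] zy that t by auto
    also have "norm y * (norm (g z) + \<epsilon>) \<le> t * (norm (g z) + \<epsilon>)"
      using that \<epsilon> by (intro mult_right_mono) auto
    finally show "w (z + y) \<le> w z + t * (norm (g z) + \<epsilon>)" by simp
    show "z \<in> cball 0 (r + 1)" using norm_triangle_ineq4[of "z + y" y] zy that t t0 by simp
  qed
  define S where "S = {p. c' < snd p \<and> snd p < c1 \<and> w (fst p) \<le> snd p \<and> (\<exists>y. norm y < t \<and> snd p < w (fst p + y))}"
  define F where "F = (\<lambda>z. t * (indicator {x. c0 < w x \<and> w x \<le> c1} z * (norm (g z) + \<epsilon>)))"
  have "ennreal (\<kappa> * t) * emeasure lborel {c'<..<c1} \<le> (\<integral>\<^sup>+z. ennreal (F z) \<partial>lborel)"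
  proof (rule emeasure_ge_of_slices[where S = S])
    have "S = {p. c' < snd p \<and> snd p < c1 \<and> w (fst p) \<le> snd p} \<inter> (\<Union>y\<in>ball 0 t. {p. snd p < w (fst p + y)})"
      unfolding S_def by auto
    moreover have "open (\<Union>y\<in>ball 0 t. {p. snd p < w (fst p + y)})"
      by (intro open_UN ballI open_Collect_less continuous_intros continuous_on_compose2[OF contw[of UNIV]]) auto
    moreover have "open {p :: 'a \<times> real. c' < snd p}" "open {p :: 'a \<times> real. snd p < c1}"
      by (intro open_Collect_less continuous_intros)+
    moreover have "closed {p. w (fst p) \<le> snd p}"
      by (intro closed_Collect_le continuous_intros continuous_on_compose2[OF contw[of UNIV]]) auto
    moreover have "{p. c' < snd p \<and> snd p < c1 \<and> w (fst p) \<le> snd p}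
      = {p. c' < snd p} \<inter> {p. snd p < c1} \<inter> {p. w (fst p) \<le> snd p}" by auto
    ultimately have "S \<in> sets borel"
      by (metis (no_types, lifting) borel_closed borel_open sets.Int)
    then show "S \<in> sets (lborel \<Otimes>\<^sub>M lborel)" by (subst lborel_prod) simp
  next
    fix z
    have "Pair z -` S \<subseteq> (if c0 < w z \<and> w z \<le> c1 then {w z..w z + t * (norm (g z) + \<epsilon>)} else {})"
    proof
      fix x assume "x \<in> Pair z -` S"
      then obtain y where y: "c' < x" "x < c1" "w z \<le> x" "norm y < t" "x < w (z + y)" by (auto simp: S_def)
      have "c0 < w (z + y)" using y c by linarith
      note * = t1[OF y(4) this]
      have "t * (norm (g z) + \<epsilon>) \<le> t * l" using L[OF *(2)] t by (intro mult_left_mono) (auto simp: l_def)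
      then have "c0 < w z" using * y t by linarith
      then show "x \<in> (if c0 < w z \<and> w z \<le> c1 then {w z..w z + t * (norm (g z) + \<epsilon>)} else {})"
        using * y by auto
    qed
    then have "emeasure lborel (Pair z -` S) \<le> emeasure lborel (if c0 < w z \<and> w z \<le> c1 then {w z..w z + t * (norm (g z) + \<epsilon>)} else {})"
      by (intro emeasure_mono) auto
    also have "\<dots> = ennreal (F z)"
      using t \<epsilon> by (auto simp: F_def)
    finally show "emeasure lborel (Pair z -` S) \<le> ennreal (F z)" .
  next
    fix cc assume cc: "cc \<in> {c'<..<c1}"
    let ?A = "{x. cc < w x}"
    obtain x1 where "c1 < w x1" using ne by auto
    then have "x1 \<in> ?A" using cc by auto
    then have A: "open ?A" "bounded ?A" "?A \<noteq> {}" using opw bdc[of cc] cc c by auto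
    have "?A \<subseteq> sumset ?A (ball 0 t)"
    proof
      fix x assume "x \<in> ?A"
      then show "x \<in> sumset ?A (ball 0 t)"
        unfolding sumset_def using t by (intro CollectI exI[of _ x] exI[of _ "0::'a"]) auto
    qed
    \<comment> \<open>At a fixed level the slice is the shell by which the superlevel set grows when
      enlarged by \<open>t\<close>.\<close>
    moreover have "(\<lambda>z. (z, cc)) -` S = sumset ?A (ball 0 t) - ?A"
    proof (intro set_eqI iffI)
      fix z assume "z \<in> (\<lambda>z. (z, cc)) -` S"
      then obtain y where y: "w z \<le> cc" "norm y < t" "cc < w (z + y)" by (auto simp: S_def)
      then have "z \<in> sumset ?A (ball 0 t)"
        unfolding sumset_def by (intro CollectI exI[of _ "z + y"] exI[of _ "- y"]) auto
      then show "z \<in> sumset ?A (ball 0 t) - ?A" using y by auto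
    next
      fix z assume "z \<in> sumset ?A (ball 0 t) - ?A"
      then obtain x y where "z = x + y" "cc < w x" "norm y < t" "w z \<le> cc" by (auto simp: sumset_def)
      then show "z \<in> (\<lambda>z. (z, cc)) -` S"
        unfolding S_def using cc by (auto intro!: exI[of _ "- y"])
    qed
    moreover have f: "sumset ?A (ball 0 t) \<in> fmeasurable lborel" "?A \<in> fmeasurable lborel"
      by (intro fmeasurable_open_bounded open_sumset bounded_sumset A bounded_ball)+
    moreover have "emeasure lborel (sumset ?A (ball 0 t) - ?A) = ennreal (measure lborel (sumset ?A (ball 0 t) - ?A))"
      using f by (intro emeasure_eq_measure2 fmeasurable.Diff)
    ultimately have "emeasure lborel ((\<lambda>z. (z, cc)) -` S) = ennreal (measure lborel (sumset ?A (ball 0 t)) - measure lborel ?A)"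
      using measurable_measure_Diff[OF f(1) fmeasurableD[OF f(2)]] by simp
    moreover have "\<kappa> * t \<le> measure lborel (sumset ?A (ball 0 t)) - measure lborel ?A"
    proof -
      have "root ?n (m c1) ^ (?n - 1) \<le> root ?n (m cc) ^ (?n - 1)"
        using mono[of cc] cc c by (intro power_mono) (auto simp: m_def)
      then have "\<kappa> * t \<le> DIM('a) * root DIM('a) (measure lborel ?A) ^ (DIM('a) - 1) * (root DIM('a) (unit_ball_vol DIM('a)) * t)"
        using t unfolding \<kappa>_def m_def mult.assoc by (intro mult_left_mono mult_right_mono) auto
      then show ?thesis using minkowski_enlargement[OF A t(1)] by linarith
    qed
    ultimately show "ennreal (\<kappa> * t) \<le> emeasure lborel ((\<lambda>z. (z, cc)) -` S)" by (simp add: ennreal_leI)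
  qed simp
  moreover have \<kappa>: "0 \<le> \<kappa>" by (simp add: \<kappa>_def m_def)
  ultimately have "ennreal (t * (\<kappa> * (c1 - c'))) \<le> (\<integral>\<^sup>+z. ennreal (F z) \<partial>lborel)"
    using c t by (simp add: ennreal_mult[symmetric] mult_ac)
  also have "\<dots> = ennreal (\<integral>z. F z \<partial>lborel)"
  proof (rule nn_integral_eq_integral)
    have "integrable lborel (\<lambda>z. indicator {x. c0 < w x \<and> w x \<le> c1} z *\<^sub>R (norm (g z) + \<epsilon>))"
    proof (rule integrableI_bounded_set_indicator[where B = "L + \<epsilon>"])
      have "{x. c0 < w x \<and> w x \<le> c1} \<in> fmeasurable lborel"
        by (rule fmeasurableI2[OF fmeasurable_open_bounded[OF opw bd]]) auto
      then show "emeasure lborel {x. c0 < w x \<and> w x \<le> c1} < \<infinity>" by (simp add: fmeasurable_def)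
      show "AE x in lborel. x \<in> {x. c0 < w x \<and> w x \<le> c1} \<longrightarrow> norm (norm (g x) + \<epsilon>) \<le> L + \<epsilon>"
        using L r \<epsilon> by (intro AE_I2) (auto simp: subset_eq abs_of_nonneg less_imp_le)
    qed auto
    then show "integrable lborel F" by (simp add: F_def)
    show "AE x in lborel. 0 \<le> F x" using t \<epsilon> by (auto simp: F_def)
  qed
  finally have "t * (\<kappa> * (c1 - c')) \<le> (\<integral>z. F z \<partial>lborel)"
    using t \<epsilon> by (subst (asm) ennreal_le_iff) (auto simp: F_def intro!: Bochner_Integration.integral_nonneg)
  also have "\<dots> = t * (\<integral>x. indicator {x. c0 < w x \<and> w x \<le> c1} x * (norm (g x) + \<epsilon>) \<partial>lborel)"
    by (simp add: F_def)
  finally show ?thesis using t by (simp add: \<kappa>_def)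
qed

lemma isoperimetric_band:
  fixes w :: "'a::euclidean_space \<Rightarrow> real"
  assumes der: "\<And>x. (w has_derivative (\<lambda>h. g x \<bullet> h)) (at x)" and cont: "continuous_on UNIV g"
    and bd: "bounded {x. c0 < w x}" and c: "c0 < c1" and ne: "{x. c1 < w x} \<noteq> {}"
  shows "DIM('a) * root DIM('a) (measure lborel {x. c1 < w x}) ^ (DIM('a) - 1) * root DIM('a) (unit_ball_vol DIM('a)) * (c1 - c0)
    \<le> (\<integral>x. indicator {x. c0 < w x \<and> w x \<le> c1} x * norm (g x) \<partial>lborel)"
proof -
  let ?D = "{x. c0 < w x \<and> w x \<le> c1}"
  define \<kappa> where "\<kappa> = DIM('a) * root DIM('a) (measure lborel {x. c1 < w x}) ^ (DIM('a) - 1) * root DIM('a) (unit_ball_vol DIM('a))"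
  define I where "I = (\<integral>x. indicator ?D x * norm (g x) \<partial>lborel)"
  have contw: "continuous_on X w" for X
    using der by (meson differentiable_def differentiable_imp_continuous_on differentiable_at_withinI differentiable_on_def)
  have [measurable]: "w \<in> borel_measurable borel" "g \<in> borel_measurable borel"
    using contw cont by (auto intro: borel_measurable_continuous_onI)
  obtain r where r: "0 < r" "{x. c0 < w x} \<subseteq> ball 0 r"
    using bd by (metis bounded_subset_ballD)
  have "compact (g ` cball 0 r)" by (intro compact_continuous_image continuous_on_subset[OF cont]) auto
  then obtain L where L: "\<And>z. z \<in> cball 0 r \<Longrightarrow> norm (g z) \<le> L"
    by (metis compact_imp_bounded bounded_iff imageI)
  have fm: "?D \<in> fmeasurable lborel"
    by (rule fmeasurableI2[OF fmeasurable_open_bounded[OF open_Collect_less[OF continuous_on_const contw] bd]]) auto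
  have int: "integrable lborel (\<lambda>z. indicator ?D z *\<^sub>R norm (g z))"
  proof (rule integrableI_bounded_set_indicator[where B = L])
    show "emeasure lborel ?D < \<infinity>" using fm by (simp add: fmeasurable_def)
    show "AE x in lborel. x \<in> ?D \<longrightarrow> norm (norm (g x)) \<le> L"
      using L r by (intro AE_I2) (auto simp: subset_eq less_imp_le)
  qed auto
  have intc: "integrable lborel (\<lambda>z. indicator ?D z * \<epsilon>)" for \<epsilon> :: real
    using fm by (simp add: fmeasurable_def)
  have *: "\<kappa> * (c1 - c') \<le> I + \<epsilon> * measure lborel ?D" if "c0 < c'" "c' < c1" "0 < \<epsilon>" for c' \<epsilon>
  proof -
    have "\<kappa> * (c1 - c') \<le> (\<integral>x. indicator ?D x * (norm (g x) + \<epsilon>) \<partial>lborel)"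
      unfolding \<kappa>_def by (rule isoperimetric_band_aux[OF der cont bd that(1,2) ne that(3)])
    also have "\<dots> = (\<integral>x. indicator ?D x * norm (g x) + indicator ?D x * \<epsilon> \<partial>lborel)"
      by (simp add: distrib_left)
    also have "\<dots> = I + (\<integral>x. indicator ?D x * \<epsilon> \<partial>lborel)"
      using int intc unfolding I_def by (intro Bochner_Integration.integral_add) auto
    finally show ?thesis by (simp add: mult.commute)
  qed
  \<comment> \<open>A single parameter removes both errors: \<open>c' = c0 + s * (c1 - c0)\<close>
    and \<open>\<epsilon> = s\<close>, with \<open>s\<close> tending to 0.\<close>
  have "((\<lambda>s. \<kappa> * (c1 - (c0 + s * (c1 - c0))) - s * measure lborel ?D) \<longlongrightarrow> \<kappa> * (c1 - (c0 + 0 * (c1 - c0))) - 0 * measure lborel ?D) (at_right (0::real))"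
    by (intro tendsto_intros)
  moreover have "\<forall>\<^sub>F s in at_right (0::real). \<kappa> * (c1 - (c0 + s * (c1 - c0))) - s * measure lborel ?D \<le> I"
  proof (rule eventually_at_rightI[of 0 1])
    fix s :: real assume s: "s \<in> {0<..<1}"
    have "s * (c1 - c0) < 1 * (c1 - c0)" using s c by (intro mult_strict_right_mono) auto
    then have "c0 + s * (c1 - c0) < c1" by (simp only: mult_1)
    then show "\<kappa> * (c1 - (c0 + s * (c1 - c0))) - s * measure lborel ?D \<le> I"
      using *[of "c0 + s * (c1 - c0)" s] s c by simp
  qed simp
  ultimately have "\<kappa> * (c1 - (c0 + 0 * (c1 - c0))) - 0 * measure lborel ?D \<le> I"
    by (rule tendsto_upperbound) simp
  then show ?thesis by (simp add: \<kappa>_def I_def)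
qed

section \<open>Energy of a function on its superlevel sets\<close>

text \<open>This is the integral of \<open>(1 - e\<^bsup>-s\<^esup>)\<^bsup>n-1\<^esup>\<close> over \<open>0 \<le> s \<le> l\<close>.\<close>

definition Phi :: "nat \<Rightarrow> real \<Rightarrow> real" where
  "Phi n l = l - (\<Sum>k=1..<n. (1 - exp (- l)) ^ k / k)"

lemma Phi_0 [simp]: "Phi n 0 = 0"
  by (auto simp: Phi_def intro!: sum.neutral)

text \<open>With \<open>q = 1 - exp (- l)\<close> the derivative of \<open>q ^ k / k\<close> is
  \<open>q ^ (k - 1) * (1 - q)\<close>, and these terms telescope to
  \<open>1 - q ^ (n - 1)\<close>.\<close>

lemma DERIV_Phi:
  assumes "0 < n"
  shows "(Phi n has_real_derivative (1 - exp (- l)) ^ (n - 1)) (at l)"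
proof -
  define q where "q = 1 - exp (- l)"
  have "(Phi n has_real_derivative 1 - (\<Sum>k=1..<n. q ^ (k - 1) * (1 - q))) (at l)"
    unfolding Phi_def[abs_def] q_def
    by (rule derivative_eq_intros refl DERIV_sum | simp)+
      (auto intro!: sum.cong simp: field_simps)
  also have "(\<Sum>k=1..<n. q ^ (k - 1) * (1 - q)) = 1 - q ^ (n - 1)"
    using assms
  proof (induction n rule: nat_induct_non_zero)
    case (Suc n)
    then obtain j where "n = Suc j" using gr0_conv_Suc by blast
    with Suc show ?case by (simp add: algebra_simps)
  qed simp
  finally show ?thesis by (simp add: q_def)
qed

lemma Phi_diff_bounds:
  assumes n: "0 < n" and ab: "0 \<le> a" "a \<le> b"
  shows "Phi n b - Phi n a \<le> (b - a) * (1 - exp (- b)) ^ (n - 1)"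
    and "(b - a) * (1 - exp (- a)) ^ (n - 1) \<le> Phi n b - Phi n a"
    and "Phi n b - Phi n a \<le> b - a" "Phi n a \<le> Phi n b"
proof -
  have "\<exists>z\<ge>a. z \<le> b \<and> Phi n b - Phi n a = (b - a) * (1 - exp (- z)) ^ (n - 1)"
  proof (cases "a = b")
    case False
    then have "a < b" using ab by simp
    from MVT2[OF this DERIV_Phi[OF n]] show ?thesis by (meson less_imp_le)
  qed auto
  then obtain z where z: "a \<le> z" "z \<le> b" "Phi n b - Phi n a = (b - a) * (1 - exp (- z)) ^ (n - 1)" by blast
  show "Phi n b - Phi n a \<le> (b - a) * (1 - exp (- b)) ^ (n - 1)"
    unfolding z using z ab by (intro mult_left_mono power_mono) auto
  show "(b - a) * (1 - exp (- a)) ^ (n - 1) \<le> Phi n b - Phi n a"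
    unfolding z using z ab by (intro mult_left_mono power_mono) auto
  have "(b - a) * (1 - exp (- z)) ^ (n - 1) \<le> (b - a) * 1"
    using z ab by (intro mult_left_mono power_le_one) auto
  then show "Phi n b - Phi n a \<le> b - a" unfolding z by simp
  have "0 \<le> (b - a) * (1 - exp (- z)) ^ (n - 1)"
    using z ab by (intro mult_nonneg_nonneg zero_le_power) auto
  then show "Phi n a \<le> Phi n b" using z by linarith
qed

text \<open>By the chain rule the derivative of \<open>Phi n (ln (1 + t * \<sigma>))\<close> in
  \<open>t\<close> is \<open>q ^ (n - 1) * (\<sigma> / (1 + t * \<sigma>))\<close> with
  \<open>q = t * \<sigma> / (1 + t * \<sigma>)\<close>. For \<open>t \<le> 1\<close> this is at
  least \<open>q ^ n\<close>, and \<open>q\<close> increases with \<open>t\<close>.\<close>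

lemma Phi_ln_diff_ge:
  assumes n: "0 < n" and \<sigma>: "0 \<le> \<sigma>" and \<theta>: "0 < \<theta>" "\<theta> \<le> 1"
  shows "(1 - 1 / (1 + \<theta> * \<sigma>)) ^ n * (1 - \<theta>) \<le> Phi n (ln (1 + \<sigma>)) - Phi n (ln (1 + \<theta> * \<sigma>))"
proof (cases "\<theta> = 1")
  case False
  have pos: "0 < 1 + t * \<sigma>" if "\<theta> \<le> t" for t
    using \<sigma> \<theta> that by (intro add_pos_nonneg mult_nonneg_nonneg) auto
  have "((\<lambda>t. Phi n (ln (1 + t * \<sigma>))) has_real_derivative (1 - 1 / (1 + t * \<sigma>)) ^ (n - 1) * (\<sigma> / (1 + t * \<sigma>))) (at t)"
    if "\<theta> \<le> t" "t \<le> 1" for t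
  proof -
    have d: "((\<lambda>t. ln (1 + t * \<sigma>)) has_real_derivative \<sigma> / (1 + t * \<sigma>)) (at t)"
      using pos[OF that(1)] by (auto intro!: derivative_eq_intros)
    have e: "1 - exp (- ln (1 + t * \<sigma>)) = 1 - 1 / (1 + t * \<sigma>)"
      using pos[OF that(1)] by (simp add: exp_minus inverse_eq_divide)
    show ?thesis using DERIV_chain2[OF DERIV_Phi[OF n] d] unfolding e .
  qed
  then obtain z where z: "\<theta> < z" "z < 1" "Phi n (ln (1 + 1 * \<sigma>)) - Phi n (ln (1 + \<theta> * \<sigma>))
      = (1 - \<theta>) * ((1 - 1 / (1 + z * \<sigma>)) ^ (n - 1) * (\<sigma> / (1 + z * \<sigma>)))"
    using MVT2[of \<theta> 1 "\<lambda>t. Phi n (ln (1 + t * \<sigma>))" "\<lambda>t. (1 - 1 / (1 + t * \<sigma>)) ^ (n - 1) * (\<sigma> / (1 + t * \<sigma>))"] False \<theta>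
    by auto
  have q: "0 \<le> 1 - 1 / (1 + \<theta> * \<sigma>)" using pos[of \<theta>] \<sigma> \<theta> by (simp add: field_simps)
  have qz: "1 - 1 / (1 + \<theta> * \<sigma>) \<le> 1 - 1 / (1 + z * \<sigma>)"
    using pos[of \<theta>] pos[of z] z \<sigma> by (auto intro!: divide_left_mono mult_right_mono)
  have "1 - 1 / (1 + z * \<sigma>) = z * (\<sigma> / (1 + z * \<sigma>))" using pos[of z] z by (simp add: field_simps)
  also have "\<dots> \<le> 1 * (\<sigma> / (1 + z * \<sigma>))" using pos[of z] z \<sigma> by (intro mult_right_mono) auto
  finally have "(1 - 1 / (1 + z * \<sigma>)) ^ (n - 1) * (1 - 1 / (1 + z * \<sigma>)) \<le> (1 - 1 / (1 + z * \<sigma>)) ^ (n - 1) * (\<sigma> / (1 + z * \<sigma>))"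
    using q qz by (intro mult_left_mono) auto
  moreover have "(1 - 1 / (1 + \<theta> * \<sigma>)) ^ n \<le> (1 - 1 / (1 + z * \<sigma>)) ^ n" using q qz by (intro power_mono)
  moreover have "(1 - 1 / (1 + z * \<sigma>)) ^ n = (1 - 1 / (1 + z * \<sigma>)) ^ (n - 1) * (1 - 1 / (1 + z * \<sigma>))"
    using n by (cases n) auto
  ultimately have "(1 - 1 / (1 + \<theta> * \<sigma>)) ^ n \<le> (1 - 1 / (1 + z * \<sigma>)) ^ (n - 1) * (\<sigma> / (1 + z * \<sigma>))" by linarith
  then have "(1 - \<theta>) * (1 - 1 / (1 + \<theta> * \<sigma>)) ^ n \<le> (1 - \<theta>) * ((1 - 1 / (1 + z * \<sigma>)) ^ (n - 1) * (\<sigma> / (1 + z * \<sigma>)))"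
    using \<theta> by (intro mult_left_mono) auto
  then show ?thesis using z(3) by (simp add: mult.commute)
qed simp

text \<open>The convex function \<open>a ^ n\<close> lies above its tangent at \<open>b\<close>; for
  positive \<open>b\<close> this is Bernoulli's inequality at \<open>a / b - 1\<close>.\<close>

lemma young_power:
  fixes a b :: real
  assumes "0 \<le> a" "0 \<le> b" "0 < n"
  shows "real n * b ^ (n - 1) * a - (real n - 1) * b ^ n \<le> a ^ n"
proof (cases "b = 0")
  case True
  then show ?thesis using assms by (cases "n = 1") (auto simp: power_0_left)
next
  case False
  then have "b > 0" using assms by simp
  have "1 + real n * (a / b - 1) \<le> (1 + (a / b - 1)) ^ n"
    using assms by (intro Bernoulli_inequality) auto
  then have "b ^ n * (1 + real n * (a / b - 1)) \<le> b ^ n * (a / b) ^ n"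
    using \<open>b > 0\<close> by (intro mult_left_mono) auto
  moreover have "b ^ n * (a / b) ^ n = a ^ n" using \<open>b > 0\<close> by (simp add: power_mult_distrib[symmetric])
  moreover have "b ^ n = b * b ^ (n - 1)" using assms(3) by (cases n) auto
  ultimately show ?thesis using \<open>b > 0\<close> by (simp add: algebra_simps)
qed

lemma power_diff_le:
  fixes a b :: real
  assumes "0 \<le> a" "a \<le> b" "b \<le> 1"
  shows "b ^ k - a ^ k \<le> k * (b - a)"
proof (induction k)
  case (Suc k)
  have "b ^ Suc k - a ^ Suc k = b * (b ^ k - a ^ k) + (b - a) * a ^ k" by (simp add: algebra_simps)
  also have "\<dots> \<le> 1 * (b ^ k - a ^ k) + (b - a) * 1"
    using assms by (intro add_mono mult_mono mult_left_mono power_le_one) (auto intro: power_mono)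
  also have "\<dots> \<le> Suc k * (b - a)" using Suc by (simp add: algebra_simps)
  finally show ?case .
qed simp

text \<open>The factor for which \<open>energy_ge_Phi\<close> is an equality at the profile
  \<open>bubble\<close>, compare \<open>bubble_energy_ball\<close>. It is
  \<open>(n - 1) * \<beta> ^ n\<close> for
  \<open>\<beta> = n^2/(n-1) * root n (unit_ball_vol n)\<close>.\<close>

definition sharp_const :: "nat \<Rightarrow> real" where
  "sharp_const n = (real n - 1) * (real n ^ 2 / (real n - 1)) ^ n * unit_ball_vol n"

lemma sharp_const_pos: "2 \<le> n \<Longrightarrow> 0 < sharp_const n"
  by (auto simp: sharp_const_def)

text \<open>The differential inequality for one thin band, in terms of numbers only:
  \<open>m0\<close> and \<open>m1\<close> stand for the volumes at the lower and upper level,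
  \<open>S0\<close> and \<open>S1\<close> for the corresponding averages, \<open>\<delta>\<close>
  for the thickness and \<open>E\<close> for the energy in the band. The hypothesis on
  \<open>E\<close> holds for every tangent point \<open>b\<close>, which leaves \<open>b\<close> to
  be optimised. The subtracted term is of second order: \<open>\<delta>\<close> times the relative
  growth of volume plus a multiple of \<open>\<delta>\<close>.\<close>

lemma band_step:
  fixes m0 m1 S0 S1 \<delta> E :: real
  assumes n: "2 \<le> n" and m: "0 < m1" "m1 \<le> m0" and \<delta>: "0 \<le> \<delta>" and S: "1 \<le> S1" "1 \<le> S0"
    and S01: "S0 \<le> exp \<delta> * (1 + m1 / m0 * (S1 - 1))"
    and E: "\<And>b. 0 \<le> b \<Longrightarrow> n * b ^ (n - 1) * (n * root n m1 ^ (n - 1) * root n (unit_ball_vol n) * \<delta>) - (real n - 1) * b ^ n * (m0 - m1) \<le> E"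
  shows "sharp_const n * (Phi n (ln S0) - Phi n (ln S1)) - sharp_const n * \<delta> * ((m0 - m1) / m0 + (real n - 1) * \<delta>) \<le> E"
proof -
  define K where "K = sharp_const n"
  have K: "0 < K" using sharp_const_pos[OF n] by (simp add: K_def)
  define \<theta> where "\<theta> = m1 / m0"
  have \<theta>: "0 < \<theta>" "\<theta> \<le> 1" using m by (auto simp: \<theta>_def)
  \<comment> \<open>The passage from \<open>S1\<close> to \<open>S0\<close> is split. Enlarging the
    volume from \<open>m1\<close> to \<open>m0\<close> at a fixed level adds points where the
    exponential is 1 and turns \<open>S1\<close> into \<open>S'\<close>; lowering the level by
    \<open>\<delta>\<close> then multiplies by at most \<open>exp \<delta>\<close>.\<close>
  define S' where "S' = 1 + \<theta> * (S1 - 1)"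
  have S': "1 \<le> S'" using \<theta> S by (simp add: S'_def)
  define q where "q = 1 - 1 / S'"
  have q: "0 \<le> q" "q \<le> 1" using S' by (auto simp: q_def)
  have n0: "0 < n" using n by simp
  have 1: "q ^ n * (1 - \<theta>) \<le> Phi n (ln S1) - Phi n (ln S')"
    using Phi_ln_diff_ge[OF n0 _ \<theta>, of "S1 - 1"] S by (simp add: q_def S'_def)
  have "ln S0 \<le> ln S' + \<delta>"
  proof -
    have "ln S0 \<le> ln (exp \<delta> * S')" using S01 S S' by (simp add: S'_def \<theta>_def)
    then show ?thesis using S' by (simp add: ln_mult)
  qed
  then have "Phi n (ln S0) \<le> Phi n (ln S' + \<delta>)"
    using S by (intro Phi_diff_bounds(4)[OF n0]) auto
  also have "\<dots> \<le> Phi n (ln S') + \<delta> * (1 - exp (- (ln S' + \<delta>))) ^ (n - 1)"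
    using Phi_diff_bounds(1)[OF n0, of "ln S'" "ln S' + \<delta>"] S' \<delta> by simp
  also have "(1 - exp (- (ln S' + \<delta>))) ^ (n - 1) \<le> q ^ (n - 1) + (real n - 1) * \<delta>"
  proof -
    have e: "exp (- (ln S' + \<delta>)) = exp (- \<delta>) / S'" using S' by (simp add: exp_diff exp_minus field_simps exp_add)
    have "exp (- \<delta>) \<le> 1" using \<delta> by simp
    then have a: "q \<le> 1 - exp (- (ln S' + \<delta>))" unfolding e q_def using S' by (simp add: divide_right_mono)
    have "1 - exp (- (ln S' + \<delta>)) - q = (1 - exp (- \<delta>)) / S'" unfolding e q_def by (simp add: diff_divide_distrib)
    also have "\<dots> \<le> (1 - exp (- \<delta>)) / 1" using S' \<delta> by (intro divide_left_mono) auto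
    also have "\<dots> \<le> \<delta>" using exp_ge_add_one_self[of "- \<delta>"] by simp
    finally have b: "1 - exp (- (ln S' + \<delta>)) - q \<le> \<delta>" .
    have "(1 - exp (- (ln S' + \<delta>))) ^ (n - 1) - q ^ (n - 1) \<le> real (n - 1) * (1 - exp (- (ln S' + \<delta>)) - q)"
      using a q by (intro power_diff_le) auto
    also have "\<dots> \<le> real (n - 1) * \<delta>" using b by (intro mult_left_mono) auto
    finally show ?thesis using n by (simp add: of_nat_diff)
  qed
  finally have 2: "Phi n (ln S0) \<le> Phi n (ln S') + \<delta> * (q ^ (n - 1) + (real n - 1) * \<delta>)"
    using \<delta> by (simp add: mult_left_mono)
  have "Phi n (ln S0) - Phi n (ln S1) \<le> \<delta> * (q ^ (n - 1) + (real n - 1) * \<delta>) - q ^ n * (1 - \<theta>)"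
    using 1 2 by linarith
  then have 3: "K * (Phi n (ln S0) - Phi n (ln S1)) \<le> K * (\<delta> * (q ^ (n - 1) + (real n - 1) * \<delta>) - q ^ n * (1 - \<theta>))"
    using K by (intro mult_left_mono) auto
  define \<beta> where "\<beta> = real n ^ 2 / (real n - 1) * root n (unit_ball_vol n)"
  \<comment> \<open>The optimal tangent point: the boundary slope of the dilated profile whose
    superlevel set has volume \<open>m0\<close> and average \<open>S'\<close>. For
    \<open>bubble\<close> itself and a ball of radius R this slope is
    \<open>n^2/(n-1) * q / R\<close>.\<close>
  define b where "b = \<beta> * q / root n m0"
  have \<beta>: "0 < \<beta>" using n by (auto simp: \<beta>_def)
  have r0: "0 < root n m0" using m n by simp
  have r1: "0 < root n m1" using m n by simp
  have b: "0 \<le> b" using \<beta> q r0 by (simp add: b_def)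
  have \<beta>n: "(real n - 1) * \<beta> ^ n = K"
  proof -
    have "\<beta> ^ n = (real n ^ 2 / (real n - 1)) ^ n * root n (unit_ball_vol n) ^ n"
      unfolding \<beta>_def by (rule power_mult_distrib)
    also have "root n (unit_ball_vol n) ^ n = unit_ball_vol n" using n0 by simp
    finally show ?thesis by (simp add: K_def sharp_const_def)
  qed
  have K2: "n * \<beta> ^ (n - 1) * (n * root n (unit_ball_vol n)) = K"
  proof -
    have "n * (n * root n (unit_ball_vol n)) = (real n - 1) * \<beta>" using n by (simp add: \<beta>_def power2_eq_square)
    moreover have "n * \<beta> ^ (n - 1) * (n * root n (unit_ball_vol n)) = n * (n * root n (unit_ball_vol n)) * \<beta> ^ (n - 1)"
      by (simp only: mult_ac)
    ultimately have "n * \<beta> ^ (n - 1) * (n * root n (unit_ball_vol n)) = (real n - 1) * (\<beta> * \<beta> ^ (n - 1))"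
      by (simp only: mult.assoc)
    also have "\<beta> * \<beta> ^ (n - 1) = \<beta> ^ n" using n0 by (cases n) auto
    finally show ?thesis using \<beta>n by simp
  qed
  have bn: "(real n - 1) * b ^ n * (m0 - m1) = K * (q ^ n * (1 - \<theta>))"
  proof -
    have "b ^ n = \<beta> ^ n * q ^ n / m0" using m n by (simp add: b_def power_mult_distrib power_divide)
    then have "(real n - 1) * b ^ n * (m0 - m1) = ((real n - 1) * \<beta> ^ n) * (q ^ n * ((m0 - m1) / m0))" by simp
    moreover have "(m0 - m1) / m0 = 1 - \<theta>" using m by (simp add: \<theta>_def field_simps)
    ultimately show ?thesis using \<beta>n by metis
  qed
  have bn1: "n * b ^ (n - 1) * (n * root n m1 ^ (n - 1) * root n (unit_ball_vol n) * \<delta>) = K * (\<delta> * (q ^ (n - 1) * root n \<theta> ^ (n - 1)))"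
  proof -
    have "b ^ (n - 1) * root n m1 ^ (n - 1) = \<beta> ^ (n - 1) * (q ^ (n - 1) * root n \<theta> ^ (n - 1))"
      by (simp add: b_def \<theta>_def real_root_divide power_mult_distrib power_divide)
    then have "n * b ^ (n - 1) * (n * root n m1 ^ (n - 1) * root n (unit_ball_vol n) * \<delta>)
      = (n * \<beta> ^ (n - 1) * (n * root n (unit_ball_vol n))) * (\<delta> * (q ^ (n - 1) * root n \<theta> ^ (n - 1)))"
      by (simp add: algebra_simps)
    then show ?thesis unfolding K2 .
  qed
  \<comment> \<open>The isoperimetric term involves \<open>m1\<close> instead of \<open>m0\<close>,
    which costs the factor \<open>root n \<theta> ^ (n - 1)\<close>. Since this is at least
    \<open>\<theta>\<close>, the loss is at most \<open>1 - \<theta>\<close> and goes into the error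
    term.\<close>
  have "\<theta> \<le> root n \<theta> ^ (n - 1)"
  proof -
    have "root n \<theta> \<le> 1" "0 \<le> root n \<theta>" using \<theta> n0 by auto
    then have "root n \<theta> * root n \<theta> ^ (n - 1) \<le> 1 * root n \<theta> ^ (n - 1)" by (intro mult_right_mono) auto
    moreover have "root n \<theta> * root n \<theta> ^ (n - 1) = root n \<theta> ^ n" using n0 by (cases n) auto
    moreover have "root n \<theta> ^ n = \<theta>" using \<theta> n0 by simp
    ultimately show ?thesis by linarith
  qed
  then have "q ^ (n - 1) * \<theta> \<le> q ^ (n - 1) * root n \<theta> ^ (n - 1)" using q by (intro mult_left_mono) auto
  moreover have "q ^ (n - 1) * (1 - \<theta>) \<le> 1 * (1 - \<theta>)" using q \<theta> by (intro mult_right_mono power_le_one) auto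
  ultimately have "q ^ (n - 1) - (1 - \<theta>) \<le> q ^ (n - 1) * root n \<theta> ^ (n - 1)" by (simp add: algebra_simps)
  then have "K * (\<delta> * (q ^ (n - 1) - (1 - \<theta>))) \<le> K * (\<delta> * (q ^ (n - 1) * root n \<theta> ^ (n - 1)))"
    using K \<delta> by (intro mult_left_mono) auto
  then have "K * (\<delta> * (q ^ (n - 1) - (1 - \<theta>))) - K * (q ^ n * (1 - \<theta>)) \<le> E"
    using E[OF b] unfolding bn bn1 by linarith
  moreover have r: "(m0 - m1) / m0 = 1 - \<theta>" using m by (simp add: \<theta>_def field_simps)
  ultimately show ?thesis using 3 unfolding K_def[symmetric] r by (simp add: algebra_simps)
qed

lemma measure_open_bounded_pos:
  fixes C :: "'a::euclidean_space set"
  assumes C: "open C" "bounded C" "C \<noteq> {}"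
  shows "0 < measure lborel C"
proof -
  have "\<not> negligible C" using open_not_negligible C by blast
  then have "emeasure lborel C \<noteq> 0"
    using C(1) by (auto simp: negligible_iff_null_sets null_sets_completion_iff null_sets_def)
  then show ?thesis
    using fmeasurable_open_bounded[OF C(1,2)]
    by (metis emeasure_eq_measure2 ennreal_0 measure_nonneg order_le_less)
qed

locale bounded_superlevel =
  fixes w :: "'a::euclidean_space \<Rightarrow> real" and g :: "'a \<Rightarrow> 'a" and c0 :: real
  assumes deriv: "\<And>x. (w has_derivative (\<lambda>h. g x \<bullet> h)) (at x)"
    and cont_g: "continuous_on UNIV g"
    and bdd: "bounded {x. c0 < w x}"
    and dim: "2 \<le> DIM('a)"
begin

definition vol :: "real \<Rightarrow> real" where "vol c = measure lborel {x. c < w x}"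
definition energy :: "real \<Rightarrow> real" where
  "energy c = (\<integral>x. indicator {x. c < w x} x * norm (g x) ^ DIM('a) \<partial>lborel)"
definition mass :: "real \<Rightarrow> real" where
  "mass c = (\<integral>x. indicator {x. c < w x} x * exp (w x) \<partial>lborel)"
text \<open>This is the \<open>S\<close> of the overview. For the unperturbed profile, at its level
  on the sphere of radius R, it equals \<open>1 + rt n R ^ n\<close>.\<close>

definition ratio :: "real \<Rightarrow> real" where "ratio c = mass c / (vol c * exp c)"

lemma cont_w: "continuous_on X w"
  using deriv by (meson differentiable_def differentiable_imp_continuous_on differentiable_at_withinI differentiable_on_def)

lemma meas [measurable]: "w \<in> borel_measurable borel" "g \<in> borel_measurable borel"
  using cont_w cont_g by (auto intro: borel_measurable_continuous_onI)

lemma open_superlevel: "open {x. c < w x}"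
  by (intro open_Collect_less continuous_on_const cont_w)

lemma bounded_superlevel_set: "c0 \<le> c \<Longrightarrow> bounded {x. c < w x}"
  using bdd by (rule bounded_subset) auto

lemma fmeasurable_superlevel: "c0 \<le> c \<Longrightarrow> {x. c < w x} \<in> fmeasurable lborel"
  by (intro fmeasurable_open_bounded open_superlevel bounded_superlevel_set)

lemma fmeasurable_band: "c0 \<le> c \<Longrightarrow> {x. c < w x \<and> w x \<le> c'} \<in> fmeasurable lborel"
  by (rule fmeasurableI2[OF fmeasurable_superlevel[of c]]) auto

lemma integrable_superlevel_continuous:
  fixes f :: "'a \<Rightarrow> real"
  assumes A: "A \<subseteq> {x. c0 < w x}" "A \<in> sets borel" and f: "continuous_on UNIV f"
  shows "integrable lborel (\<lambda>x. indicator A x * f x)"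
proof -
  obtain r where r: "{x. c0 < w x} \<subseteq> cball 0 r"
    using bounded_subset_ballD[OF bdd, of 0] ball_subset_cball by (meson subset_trans)
  have "compact (f ` cball 0 r)" by (intro compact_continuous_image continuous_on_subset[OF f]) auto
  then obtain L where L: "\<And>z. z \<in> cball 0 r \<Longrightarrow> norm (f z) \<le> L"
    by (metis compact_imp_bounded bounded_iff imageI)
  have [measurable]: "f \<in> borel_measurable borel" using f by (rule borel_measurable_continuous_onI)
  have "integrable lborel (\<lambda>x. indicator A x *\<^sub>R f x)"
  proof (rule integrableI_bounded_set_indicator[where B = L])
    have "A \<in> fmeasurable lborel" using A by (intro fmeasurableI2[OF fmeasurable_superlevel[of c0]]) auto
    then show "emeasure lborel A < \<infinity>" by (simp add: fmeasurable_def)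
    show "AE x in lborel. x \<in> A \<longrightarrow> norm (f x) \<le> L"
      using L r A by (intro AE_I2) blast
  qed (use A in auto)
  then show ?thesis by simp
qed

lemma integral_superlevel_split:
  fixes f :: "'a \<Rightarrow> real"
  assumes c: "c0 \<le> c" "c \<le> c'" and f: "continuous_on UNIV f"
  shows "(\<integral>x. indicator {x. c < w x} x * f x \<partial>lborel) =
    (\<integral>x. indicator {x. c' < w x} x * f x \<partial>lborel) + (\<integral>x. indicator {x. c < w x \<and> w x \<le> c'} x * f x \<partial>lborel)"
proof -
  have "(\<integral>x. indicator {x. c < w x} x * f x \<partial>lborel) =
      (\<integral>x. indicator {x. c' < w x} x * f x + indicator {x. c < w x \<and> w x \<le> c'} x * f x \<partial>lborel)"
    using c by (intro Bochner_Integration.integral_cong) (auto simp: indicator_def)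
  also have "\<dots> = (\<integral>x. indicator {x. c' < w x} x * f x \<partial>lborel) + (\<integral>x. indicator {x. c < w x \<and> w x \<le> c'} x * f x \<partial>lborel)"
    using c by (intro Bochner_Integration.integral_add integrable_superlevel_continuous f) auto
  finally show ?thesis .
qed

lemma vol_split: "c0 \<le> c \<Longrightarrow> c \<le> c' \<Longrightarrow> vol c = vol c' + measure lborel {x. c < w x \<and> w x \<le> c'}"
  using integral_superlevel_split[of c c' "\<lambda>_. 1"] fmeasurable_superlevel[of c] fmeasurable_superlevel[of c'] fmeasurable_band[of c c']
  by (simp add: vol_def)

lemma vol_antimono: "c0 \<le> c \<Longrightarrow> c \<le> c' \<Longrightarrow> vol c' \<le> vol c"
  using vol_split[of c c'] by simp

lemma superlevel_nonempty: "{x. c' < w x} \<noteq> {} \<Longrightarrow> c \<le> c' \<Longrightarrow> {x. c < w x} \<noteq> {}"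
proof -
  assume "{x. c' < w x} \<noteq> {}" "c \<le> c'"
  then obtain x where "c' < w x" by blast
  then have "x \<in> {x. c < w x}" using \<open>c \<le> c'\<close> by simp
  then show ?thesis by blast
qed

lemma vol_pos: "c0 \<le> c \<Longrightarrow> {x. c < w x} \<noteq> {} \<Longrightarrow> 0 < vol c"
  unfolding vol_def by (rule measure_open_bounded_pos[OF open_superlevel bounded_superlevel_set])

lemma continuous_energy_density: "continuous_on UNIV (\<lambda>x. norm (g x) ^ DIM('a))"
  by (intro continuous_intros cont_g)

lemma continuous_exp_w: "continuous_on UNIV (\<lambda>x. exp (w x))"
  by (intro continuous_intros cont_w)

lemma ratio_ge_1:
  assumes c: "c0 \<le> c" "{x. c < w x} \<noteq> {}"
  shows "1 \<le> ratio c"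
proof -
  have "vol c * exp c = (\<integral>x. indicator {x. c < w x} x * exp c \<partial>lborel)"
    using fmeasurable_superlevel[OF c(1)] by (simp add: vol_def)
  also have "\<dots> \<le> mass c"
    unfolding mass_def
    by (intro integral_mono integrable_superlevel_continuous continuous_exp_w continuous_on_const) (use c in \<open>auto simp: indicator_def\<close>)
  finally show ?thesis using vol_pos[OF c] by (simp add: ratio_def)
qed

text \<open>The hypothesis of \<open>band_step\<close> on the averages holds because
  \<open>exp (w x)\<close> is at most \<open>exp c'\<close> in the band; the one on the energy is
  \<open>young_power\<close> at the fixed slope \<open>b\<close>, integrated over the band, with
  \<open>isoperimetric_band\<close> bounding the integral of the gradient from below.\<close>

lemma energy_step:
  assumes c: "c0 \<le> c" "c < c'" and ne: "{x. c' < w x} \<noteq> {}"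
  shows "sharp_const DIM('a) * (Phi DIM('a) (ln (ratio c)) - Phi DIM('a) (ln (ratio c')))
     - sharp_const DIM('a) * (c' - c) * ((vol c - vol c') / vol c + (real DIM('a) - 1) * (c' - c))
     \<le> energy c - energy c'"
proof (rule band_step[OF dim])
  let ?n = "DIM('a)"
  let ?D = "{x. c < w x \<and> w x \<le> c'}"
  have ne': "{x. c < w x} \<noteq> {}" using superlevel_nonempty[OF ne] c by simp
  show v: "0 < vol c'" using vol_pos[OF _ ne] c by simp
  show vv: "vol c' \<le> vol c" using vol_antimono[of c c'] c by simp
  show "1 \<le> ratio c'" "1 \<le> ratio c" using ratio_ge_1 c ne ne' by auto
  show "0 \<le> c' - c" using c by simp
  have "mass c = mass c' + (\<integral>x. indicator ?D x * exp (w x) \<partial>lborel)"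
    unfolding mass_def using integral_superlevel_split[OF c(1) less_imp_le[OF c(2)] continuous_exp_w] by simp
  also have "(\<integral>x. indicator ?D x * exp (w x) \<partial>lborel) \<le> (\<integral>x. indicator ?D x * exp c' \<partial>lborel)"
    by (intro integral_mono integrable_superlevel_continuous continuous_exp_w continuous_on_const) (use c in \<open>auto simp: indicator_def\<close>)
  also have "\<dots> = (vol c - vol c') * exp c'"
    using fmeasurable_band[OF c(1), of c'] vol_split[of c c'] c by simp
  finally have "mass c \<le> mass c' + (vol c - vol c') * exp c'" by simp
  also have "mass c' = ratio c' * (vol c' * exp c')" using v by (simp add: ratio_def)
  finally have le: "mass c \<le> ratio c' * (vol c' * exp c') + (vol c - vol c') * exp c'" .
  have vc: "0 < vol c" using v vv by simp
  have "mass c \<le> exp c' * vol c * (1 + vol c' / vol c * (ratio c' - 1))"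
  proof -
    have "exp c' * vol c * (1 + vol c' / vol c * (ratio c' - 1)) = ratio c' * (vol c' * exp c') + (vol c - vol c') * exp c'"
      using vc by (simp add: field_simps)
    then show ?thesis using le by simp
  qed
  then have "ratio c \<le> exp c' * vol c * (1 + vol c' / vol c * (ratio c' - 1)) / (vol c * exp c)"
    using vc unfolding ratio_def[of c] by (intro divide_right_mono) auto
  also have "\<dots> = exp (c' - c) * (1 + vol c' / vol c * (ratio c' - 1))"
    using vc by (simp add: exp_diff)
  finally show "ratio c \<le> exp (c' - c) * (1 + vol c' / vol c * (ratio c' - 1))" .
  fix b :: real assume b: "0 \<le> b"
  have "?n * root ?n (vol c') ^ (?n - 1) * root ?n (unit_ball_vol ?n) * (c' - c) \<le> (\<integral>x. indicator ?D x * norm (g x) \<partial>lborel)"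
    unfolding vol_def by (rule isoperimetric_band[OF deriv cont_g bounded_superlevel_set[OF c(1)] c(2) ne])
  then have "?n * b ^ (?n - 1) * (?n * root ?n (vol c') ^ (?n - 1) * root ?n (unit_ball_vol ?n) * (c' - c))
     \<le> ?n * b ^ (?n - 1) * (\<integral>x. indicator ?D x * norm (g x) \<partial>lborel)"
    using b by (intro mult_left_mono) auto
  moreover have i: "integrable lborel (\<lambda>x. indicator ?D x * ((real ?n * b ^ (?n - 1)) * norm (g x)))"
      "integrable lborel (\<lambda>x. indicator ?D x * ((real ?n - 1) * b ^ ?n))"
      "integrable lborel (\<lambda>x. indicator ?D x * norm (g x) ^ ?n)"
    by (intro integrable_superlevel_continuous continuous_intros cont_g; use c in auto)+
  moreover have "(\<integral>x. indicator ?D x * ((real ?n * b ^ (?n - 1)) * norm (g x)) - indicator ?D x * ((real ?n - 1) * b ^ ?n) \<partial>lborel)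
      = ?n * b ^ (?n - 1) * (\<integral>x. indicator ?D x * norm (g x) \<partial>lborel) - (real ?n - 1) * b ^ ?n * (vol c - vol c')"
  proof -
    have "(\<integral>x. indicator ?D x * ((real ?n * b ^ (?n - 1)) * norm (g x)) \<partial>lborel) = (\<integral>x. (real ?n * b ^ (?n - 1)) * (indicator ?D x * norm (g x)) \<partial>lborel)"
      by (simp add: mult_ac)
    moreover have "(\<integral>x. indicator ?D x * ((real ?n - 1) * b ^ ?n) \<partial>lborel) = (real ?n - 1) * b ^ ?n * (vol c - vol c')"
      using fmeasurable_band[OF c(1), of c'] vol_split[of c c'] c by simp
    ultimately show ?thesis using Bochner_Integration.integral_diff[OF i(1,2)] by simp
  qed
  moreover have "(\<integral>x. indicator ?D x * ((real ?n * b ^ (?n - 1)) * norm (g x)) - indicator ?D x * ((real ?n - 1) * b ^ ?n) \<partial>lborel)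
      \<le> (\<integral>x. indicator ?D x * norm (g x) ^ ?n \<partial>lborel)"
  proof (rule integral_mono[OF Bochner_Integration.integrable_diff[OF i(1,2)] i(3)])
    fix x
    show "indicator ?D x * ((real ?n * b ^ (?n - 1)) * norm (g x)) - indicator ?D x * ((real ?n - 1) * b ^ ?n) \<le> indicator ?D x * norm (g x) ^ ?n"
      using young_power[OF norm_ge_zero b DIM_positive[where 'a='a], of "g x"] by (simp add: indicator_def)
  qed
  moreover have "(\<integral>x. indicator ?D x * norm (g x) ^ ?n \<partial>lborel) = energy c - energy c'"
    unfolding energy_def using integral_superlevel_split[OF c(1) less_imp_le[OF c(2)] continuous_energy_density] by simp
  ultimately show "?n * b ^ (?n - 1) * (?n * root ?n (vol c') ^ (?n - 1) * root ?n (unit_ball_vol ?n) * (c' - c))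
    - (real ?n - 1) * b ^ ?n * (vol c - vol c') \<le> energy c - energy c'"
    by linarith
qed

text \<open>Steps are counted downward from \<open>c\<close>. In each error term the denominator is
  replaced by the smallest volume \<open>vol c\<close>; the volume increments then telescope, so
  that the total error remains \<open>\<delta>\<close> times a bounded quantity.\<close>

lemma energy_partition:
  fixes k :: nat and \<delta> :: real
  assumes \<delta>: "0 < \<delta>" and ne: "{x. c < w x} \<noteq> {}" and k: "c0 \<le> c - k * \<delta>"
  shows "sharp_const DIM('a) * (Phi DIM('a) (ln (ratio (c - k * \<delta>))) - Phi DIM('a) (ln (ratio c)))
     - sharp_const DIM('a) * \<delta> * ((vol (c - k * \<delta>) - vol c) / vol c + (real DIM('a) - 1) * (k * \<delta>))
     \<le> energy (c - k * \<delta>) - energy c"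
  using k
proof (induction k)
  case (Suc k)
  let ?n = "DIM('a)" and ?K = "sharp_const DIM('a)"
  let ?d = "c - k * \<delta>" and ?e = "c - Suc k * \<delta>"
  have e: "?e = ?d - \<delta>" by (simp add: algebra_simps)
  have d: "c0 \<le> ?d" "?d \<le> c" "?e < ?d" "?d - ?e = \<delta>" using Suc.prems \<delta> unfolding e by auto
  have K: "0 < ?K" using sharp_const_pos[OF dim] .
  have ne': "{x. ?d < w x} \<noteq> {}" using superlevel_nonempty[OF ne d(2)] .
  have v: "0 < vol c" "vol c \<le> vol ?d" "vol ?d \<le> vol ?e"
    using vol_pos[OF _ ne] d vol_antimono[OF d(1,2)] vol_antimono[OF Suc.prems, of ?d] by auto
  have "(vol ?e - vol ?d) / vol ?e \<le> (vol ?e - vol ?d) / vol c"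
    using v by (intro divide_left_mono) auto
  then have "?K * \<delta> * ((vol ?e - vol ?d) / vol ?e + (real ?n - 1) * \<delta>) \<le> ?K * \<delta> * ((vol ?e - vol ?d) / vol c + (real ?n - 1) * \<delta>)"
    using K \<delta> by (intro mult_left_mono add_right_mono) auto
  moreover have "?K * (Phi ?n (ln (ratio ?e)) - Phi ?n (ln (ratio ?d)))
     - ?K * \<delta> * ((vol ?e - vol ?d) / vol ?e + (real ?n - 1) * \<delta>) \<le> energy ?e - energy ?d"
    using energy_step[OF Suc.prems d(3) ne'] unfolding d(4) .
  moreover have "?K * \<delta> * ((vol ?d - vol c) / vol c + (real ?n - 1) * (k * \<delta>)) + ?K * \<delta> * ((vol ?e - vol ?d) / vol c + (real ?n - 1) * \<delta>)
      = ?K * \<delta> * ((vol ?e - vol c) / vol c + (real ?n - 1) * (Suc k * \<delta>))"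
    by (simp add: algebra_simps diff_divide_distrib)
  moreover note Suc.IH[OF d(1)]
  ultimately show ?case unfolding right_diff_distrib by linarith
qed simp

lemma energy_diff_ge:
  assumes c: "c0 < c" and ne: "{x. c < w x} \<noteq> {}"
  shows "sharp_const DIM('a) * (Phi DIM('a) (ln (ratio c0)) - Phi DIM('a) (ln (ratio c))) \<le> energy c0 - energy c"
proof -
  let ?n = "DIM('a)" and ?K = "sharp_const DIM('a)"
  \<comment> \<open>This bound does not depend on the number of steps, so the error disappears as
    the partition is refined.\<close>
  define B where "B = (vol c0 - vol c) / vol c + (real ?n - 1) * (c - c0)"
  have *: "?K * (Phi ?n (ln (ratio c0)) - Phi ?n (ln (ratio c))) - ?K * ((c - c0) * inverse (real (Suc j))) * B \<le> energy c0 - energy c" for j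
  proof -
    define \<delta> where "\<delta> = (c - c0) * inverse (real (Suc j))"
    have 1: "real (Suc j) * \<delta> = c - c0"
      by (simp add: \<delta>_def field_simps del: of_nat_Suc)
    have 2: "c - (c - c0) = c0" by simp
    have "0 < \<delta>" using c by (simp add: \<delta>_def)
    from energy_partition[OF this ne, of "Suc j", unfolded 1 2] show ?thesis
      unfolding B_def \<delta>_def by simp
  qed
  have "(\<lambda>j. ?K * (Phi ?n (ln (ratio c0)) - Phi ?n (ln (ratio c))) - ?K * ((c - c0) * inverse (real (Suc j))) * B)
     \<longlonglongrightarrow> ?K * (Phi ?n (ln (ratio c0)) - Phi ?n (ln (ratio c))) - ?K * ((c - c0) * 0) * B"
    by (intro tendsto_intros LIMSEQ_inverse_real_of_nat)
  then show ?thesis using * by (intro LIMSEQ_le_const2) auto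
qed

text \<open>The maximum of \<open>w\<close> is attained on the compact closure of the superlevel
  set. As \<open>c\<close> rises to it, the average over \<open>{x. c < w x}\<close> tends to 1,
  since it is at most \<open>exp (w z - c)\<close>; the \<open>Phi\<close> term vanishes in the
  limit and the energy above \<open>c\<close> is dropped as nonnegative.\<close>

theorem energy_ge_Phi:
  assumes ne: "{x. c0 < w x} \<noteq> {}"
  shows "sharp_const DIM('a) * Phi DIM('a) (ln (ratio c0)) \<le> energy c0"
proof -
  let ?n = "DIM('a)" and ?K = "sharp_const DIM('a)"
  have K: "0 < ?K" using sharp_const_pos[OF dim] .
  have "compact (closure {x. c0 < w x})" using bdd by simp
  moreover have "closure {x. c0 < w x} \<noteq> {}" using ne by simp
  ultimately obtain z where z: "z \<in> closure {x. c0 < w x}" "\<And>x. x \<in> closure {x. c0 < w x} \<Longrightarrow> w x \<le> w z"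
    using continuous_attains_sup[OF _ _ cont_w] by metis
  obtain x0 where x0: "c0 < w x0" using ne by auto
  have le: "w x \<le> w z" if "c0 < w x" for x
    by (rule z(2), rule subsetD[OF closure_subset]) (use that in simp)
  have cz: "c0 < w z" using le[OF x0] x0 by simp
  have main: "?K * Phi ?n (ln (ratio c0)) - ?K * (w z - c) \<le> energy c0" if c: "c0 < c" "c < w z" for c
  proof -
    have ne': "{x. c < w x} \<noteq> {}" using c by auto
    have v: "0 < vol c" using vol_pos[OF _ ne'] c by simp
    have "mass c \<le> (\<integral>x. indicator {x. c < w x} x * exp (w z) \<partial>lborel)"
      unfolding mass_def
      by (intro integral_mono integrable_superlevel_continuous continuous_exp_w continuous_on_const) (use c le in \<open>auto simp: indicator_def\<close>)
    also have "\<dots> = vol c * exp (w z)" using fmeasurable_superlevel[of c] c by (simp add: vol_def)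
    finally have "ratio c \<le> exp (w z - c)" using v by (simp add: ratio_def exp_diff field_simps)
    moreover have 1: "1 \<le> ratio c" using ratio_ge_1[OF _ ne'] c by simp
    ultimately have l: "0 \<le> ln (ratio c)" "ln (ratio c) \<le> w z - c"
      using ln_le_cancel_iff[of "ratio c" "exp (w z - c)"] by auto
    have "Phi ?n (ln (ratio c)) \<le> w z - c"
      using Phi_diff_bounds(3)[of ?n 0 "ln (ratio c)"] l by simp
    then have "?K * Phi ?n (ln (ratio c)) \<le> ?K * (w z - c)" using K by simp
    moreover have "0 \<le> energy c" unfolding energy_def by (intro Bochner_Integration.integral_nonneg) auto
    ultimately show ?thesis using energy_diff_ge[OF c(1) ne'] by (simp add: right_diff_distrib)
  qed
  have "((\<lambda>c. ?K * Phi ?n (ln (ratio c0)) - ?K * (w z - c)) \<longlongrightarrow> ?K * Phi ?n (ln (ratio c0)) - ?K * (w z - w z)) (at_left (w z))"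
    by (intro tendsto_intros)
  moreover have "\<forall>\<^sub>F c in at_left (w z). ?K * Phi ?n (ln (ratio c0)) - ?K * (w z - c) \<le> energy c0"
    by (rule eventually_at_leftI[OF _ cz]) (use main in auto)
  ultimately have "?K * Phi ?n (ln (ratio c0)) - ?K * (w z - w z) \<le> energy c0"
    by (rule tendsto_upperbound) simp
  then show ?thesis by simp
qed

end

section \<open>Radial integrals and the extremal profile\<close>

definition polar_weight :: "nat \<Rightarrow> real \<Rightarrow> real" where
  "polar_weight n r = n * unit_ball_vol n * r ^ (n - 1)"

lemma polar_weight_measurable [measurable]: "polar_weight n \<in> borel_measurable borel"
  unfolding polar_weight_def[abs_def] by measurable

lemma polar_weight_nonneg: "0 \<le> r \<Longrightarrow> 0 \<le> polar_weight n r"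
  by (simp add: polar_weight_def)

text \<open>The two measures are compared on the half-lines \<open>{..a}\<close>, which form a
  generator stable under intersections; their preimages under the norm are balls.\<close>

lemma distr_norm:
  "distr (lborel :: 'a::euclidean_space measure) borel norm =
    density lborel (\<lambda>r. ennreal (indicator {0<..} r * polar_weight DIM('a) r))"
proof (rule measure_eqI_generator_eq[where E = "range atMost" and \<Omega> = UNIV and A = "\<lambda>i. {..real i}"])
  let ?n = "DIM('a)"
  have eq: "emeasure (distr (lborel :: 'a measure) borel norm) {..a} = (if 0 \<le> a then ennreal (unit_ball_vol ?n * a ^ ?n) else 0)" for a :: real
  proof -
    have "emeasure (distr (lborel :: 'a measure) borel norm) {..a} = emeasure lborel (norm -` {..a} \<inter> space (lborel :: 'a measure))"
      by (rule emeasure_distr) auto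
    also have "norm -` {..a} \<inter> space (lborel :: 'a measure) = cball 0 a" by auto
    also have "emeasure lborel (cball (0::'a) a) = (if 0 \<le> a then ennreal (unit_ball_vol ?n * a ^ ?n) else 0)"
      using emeasure_cball[of a "0::'a"] by (auto simp: cball_eq_empty)
    finally show ?thesis .
  qed
  show "emeasure (distr (lborel :: 'a measure) borel norm) X
      = emeasure (density lborel (\<lambda>r. ennreal (indicator {0<..} r * polar_weight ?n r))) X" if "X \<in> range atMost" for X
  proof -
    obtain a where a: "X = {..a}" using \<open>X \<in> range atMost\<close> by auto
    have "emeasure (density lborel (\<lambda>r. ennreal (indicator {0<..} r * polar_weight ?n r))) {..a}
       = (\<integral>\<^sup>+r. ennreal (indicator {0<..} r * polar_weight ?n r) * indicator {..a} r \<partial>lborel)"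
      by (rule emeasure_density) auto
    also have "\<dots> = (if 0 \<le> a then ennreal (unit_ball_vol ?n * a ^ ?n) else 0)"
    proof (cases "0 \<le> a")
      case True
      have "(\<integral>\<^sup>+r. ennreal (indicator {0<..} r * polar_weight ?n r) * indicator {..a} r \<partial>lborel)
        = (\<integral>\<^sup>+r. ennreal (polar_weight ?n r) * indicator {0..a} r \<partial>lborel)"
      proof (rule nn_integral_cong_AE)
        have "AE r in lborel. r \<noteq> (0::real)" by (rule AE_lborel_singleton)
        then show "AE r in lborel. ennreal (indicator {0<..} r * polar_weight ?n r) * indicator {..a} r = ennreal (polar_weight ?n r) * indicator {0..a} r"
          by eventually_elim (auto simp: indicator_def)
      qed
      also have "\<dots> = ennreal (unit_ball_vol ?n * a ^ ?n - unit_ball_vol ?n * 0 ^ ?n)"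
      proof (rule nn_integral_FTC_Icc)
        show "DERIV (\<lambda>r. unit_ball_vol ?n * r ^ ?n) r :> polar_weight ?n r" for r
          by (auto intro!: derivative_eq_intros simp: polar_weight_def)
      qed (use True in \<open>auto simp: polar_weight_nonneg\<close>)
      finally show ?thesis using True by (simp add: power_0_left)
    next
      case False
      have "(\<integral>\<^sup>+r. ennreal (indicator {0<..} r * polar_weight ?n r) * indicator {..a} r \<partial>lborel) = (\<integral>\<^sup>+r. 0 \<partial>(lborel :: real measure))"
        using False by (intro nn_integral_cong) (auto simp: indicator_def)
      then show ?thesis using False by simp
    qed
    finally show ?thesis unfolding a eq by simp
  qed
  show "emeasure (distr (lborel :: 'a measure) borel norm) {..real i} \<noteq> \<infinity>" for i
    unfolding eq by simp
  show "sets (distr (lborel :: 'a measure) borel norm) = sigma_sets UNIV (range atMost)"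
    by (simp add: borel_eq_atMost)
  show "sets (density lborel (\<lambda>r. ennreal (indicator {0<..} r * polar_weight ?n r))) = sigma_sets UNIV (range atMost)"
    by (simp add: borel_eq_atMost)
  show "Int_stable (range (atMost :: real \<Rightarrow> real set))" by (auto simp: Int_stable_def)
  show "(\<Union>i. {..real i}) = UNIV" using real_arch_simple by fastforce
qed auto

lemma radial_integral:
  fixes f :: "real \<Rightarrow> real"
  assumes [measurable]: "f \<in> borel_measurable borel"
  shows "integrable (lborel :: 'a::euclidean_space measure) (\<lambda>x. f (norm x)) \<longleftrightarrow>
      integrable lborel (\<lambda>r. indicator {0<..} r * polar_weight DIM('a) r * f r)" (is ?int)
    and "(\<integral>x. f (norm x) \<partial>(lborel :: 'a measure)) = (\<integral>r. indicator {0<..} r * polar_weight DIM('a) r * f r \<partial>lborel)" (is ?eq)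
proof -
  have nn: "AE r in lborel. 0 \<le> indicator {0<..} r * polar_weight DIM('a) r"
    by (intro AE_I2) (auto simp: indicator_def polar_weight_nonneg)
  have "integrable (lborel :: 'a measure) (\<lambda>x. f (norm x)) \<longleftrightarrow> integrable (distr (lborel :: 'a measure) borel norm) f"
    by (rule integrable_distr_eq[symmetric]) auto
  also have "\<dots> \<longleftrightarrow> integrable lborel (\<lambda>r. (indicator {0<..} r * polar_weight DIM('a) r) *\<^sub>R f r)"
    unfolding distr_norm using nn by (intro integrable_density) auto
  finally show ?int by simp
  have "(\<integral>x. f (norm x) \<partial>(lborel :: 'a measure)) = integral\<^sup>L (distr (lborel :: 'a measure) borel norm) f"
    by (rule integral_distr[symmetric]) auto
  also have "\<dots> = (\<integral>r. (indicator {0<..} r * polar_weight DIM('a) r) *\<^sub>R f r \<partial>lborel)"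
    unfolding distr_norm using nn by (intro integral_density) auto
  finally show ?eq by simp
qed

text \<open>The upper end is an extended real so that balls and the whole space are covered at once.
  Nonnegativity of \<open>f\<close> makes integrability part of the conclusion.\<close>

lemma radial_FTC_nonneg:
  fixes f F :: "real \<Rightarrow> real" and b :: ereal
  assumes [measurable]: "f \<in> borel_measurable borel" and b: "0 < b"
    and F: "\<And>r. 0 < r \<Longrightarrow> ereal r < b \<Longrightarrow> DERIV F r :> polar_weight DIM('a) r * f r"
    and f: "\<And>r. 0 < r \<Longrightarrow> ereal r < b \<Longrightarrow> isCont f r" "\<And>r. 0 < r \<Longrightarrow> ereal r < b \<Longrightarrow> 0 \<le> f r"
    and A: "(F \<longlongrightarrow> A) (at_right 0)" and B: "((F \<circ> real_of_ereal) \<longlongrightarrow> B) (at_left b)"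
  shows "integrable (lborel :: 'a::euclidean_space measure) (\<lambda>x. indicator {x. ereal (norm x) < b} x * f (norm x))"
    and "(\<integral>x. indicator {x. ereal (norm x) < b} x * f (norm x) \<partial>(lborel :: 'a measure)) = B - A"
proof -
  let ?g = "\<lambda>r. indicator {r. ereal r < b} r * f r"
  have e: "indicator {0<..} r * polar_weight DIM('a) r * ?g r = indicator (einterval 0 b) r * (polar_weight DIM('a) r * f r)" for r
    by (auto simp: indicator_def einterval_def)
  have m: "?g \<in> borel_measurable borel" by measurable
  have A': "((F \<circ> real_of_ereal) \<longlongrightarrow> A) (at_right 0)"
    using A by (simp add: zero_ereal_def ereal_tendsto_simps)
  have *: "set_integrable lborel (einterval 0 b) (\<lambda>r. polar_weight DIM('a) r * f r)"
    "(LBINT r=0..b. polar_weight DIM('a) r * f r) = B - A"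
    by (rule interval_integral_FTC_nonneg[OF b _ _ _ A' B]; use F f in \<open>auto simp: polar_weight_nonneg zero_ereal_def polar_weight_def intro!: continuous_intros AE_I2\<close>)+
  have i: "indicator {x. ereal (norm x) < b} x * f (norm x) = ?g (norm x)" for x :: 'a
    by (simp add: indicator_def)
  show "integrable (lborel :: 'a measure) (\<lambda>x. indicator {x. ereal (norm x) < b} x * f (norm x))"
    unfolding i radial_integral(1)[OF m] e using *(1) by (simp add: set_integrable_def)
  show "(\<integral>x. indicator {x. ereal (norm x) < b} x * f (norm x) \<partial>(lborel :: 'a measure)) = B - A"
    unfolding i radial_integral(2)[OF m] e using *(2) b
    by (simp add: interval_lebesgue_integral_def set_lebesgue_integral_def less_imp_le)
qed

text \<open>The radial variable in which all exponents become integers: the radius is its power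
  \<open>n - 1\<close> and \<open>r powr (n / (n - 1))\<close> its power \<open>n\<close>.\<close>

definition rt :: "nat \<Rightarrow> real \<Rightarrow> real" where
  "rt n r = r powr (1 / (real n - 1))"

lemma rt_pos: "0 < r \<Longrightarrow> 0 < rt n r" by (simp add: rt_def)
lemma rt_nonneg: "0 \<le> rt n r" by (simp add: rt_def)
lemma rt_0 [simp]: "rt n 0 = 0" by (simp add: rt_def)

lemma rt_measurable [measurable]: "rt n \<in> borel_measurable borel"
  unfolding rt_def[abs_def] by measurable

lemma rt_power: assumes "2 \<le> n" "0 \<le> r" shows "rt n r ^ (n - 1) = r" "rt n r ^ n = r powr (real n / (real n - 1))"
proof -
  have "real n / (real n - 1) = 1 / (real n - 1) * real n" by simp
  have e: "rt n r ^ k = r powr (1 / (real n - 1) * real k)" if "0 < k" for k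
    using assms that unfolding rt_def by (cases "r = 0") (auto simp: powr_realpow[symmetric] powr_powr)
  show "rt n r ^ (n - 1) = r"
    using e[of "n - 1"] assms by (simp add: of_nat_diff)
  show "rt n r ^ n = r powr (real n / (real n - 1))"
    using e[of n] assms by simp
qed

lemma DERIV_rt_power:
  assumes n: "2 \<le> n" and r: "0 < r"
  shows "DERIV (\<lambda>r. rt n r ^ n) r :> real n / (real n - 1) * rt n r"
proof -
  have "DERIV (\<lambda>r. r powr (real n / (real n - 1))) r :> real n / (real n - 1) * r powr (real n / (real n - 1) - 1)"
    using r by (auto intro!: derivative_eq_intros)
  moreover have "real n / (real n - 1) - 1 = 1 / (real n - 1)" using n by (simp add: field_simps)
  ultimately have "DERIV (\<lambda>r. r powr (real n / (real n - 1))) r :> real n / (real n - 1) * rt n r" by (simp add: rt_def)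
  then show ?thesis
  proof (rule has_field_derivative_transform_within_open[where S = "{0<..}"])
    show "x powr (real n / (real n - 1)) = rt n x ^ n" if "x \<in> {0<..}" for x
      using rt_power(2)[OF n, of x] that by simp
  qed (use r in auto)
qed

lemma isCont_rt: "0 < r \<Longrightarrow> isCont (rt n) r"
  unfolding rt_def[abs_def] by (intro continuous_intros) auto

lemma tendsto_rt_0:
  assumes "2 \<le> n" shows "(rt n \<longlongrightarrow> 0) (at_right 0)"
proof -
  have "((\<lambda>r::real. r powr (1 / (real n - 1))) \<longlongrightarrow> 0) (at_right 0)"
    using assms by real_asymp
  then show ?thesis by (simp add: rt_def[abs_def])
qed

lemma rt_at_top:
  assumes "2 \<le> n" shows "filterlim (rt n) at_top at_top"
proof -
  have "filterlim (\<lambda>r::real. r powr (1 / (real n - 1))) at_top at_top"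
    using assms by real_asymp
  then show ?thesis by (simp add: rt_def[abs_def])
qed

lemma one_plus_rt_pos: "0 < 1 + rt n r ^ n"
  by (intro add_pos_nonneg zero_le_power rt_nonneg) simp

lemma bubble_mass_FTC:
  fixes b :: ereal
  assumes n: "2 \<le> DIM('a)" and b: "0 < b"
    and B: "(((\<lambda>r. unit_ball_vol DIM('a) * (1 - 1 / (1 + rt DIM('a) r ^ DIM('a))) ^ (DIM('a) - 1)) \<circ> real_of_ereal) \<longlongrightarrow> B) (at_left b)"
  shows "integrable (lborel :: 'a::euclidean_space measure) (\<lambda>x. indicator {x. ereal (norm x) < b} x * (1 / (1 + rt DIM('a) (norm x) ^ DIM('a)) ^ DIM('a)))"
    and "(\<integral>x. indicator {x. ereal (norm x) < b} x * (1 / (1 + rt DIM('a) (norm x) ^ DIM('a)) ^ DIM('a)) \<partial>(lborel :: 'a measure)) = B"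
proof -
  let ?n = "DIM('a)"
  define f where "f = (\<lambda>r. 1 / (1 + rt ?n r ^ ?n) ^ ?n)"
  define F where "F = (\<lambda>r. unit_ball_vol ?n * (1 - 1 / (1 + rt ?n r ^ ?n)) ^ (?n - 1))"
  have D: "DERIV F r :> polar_weight ?n r * f r" if r: "0 < r" for r
  proof -
    define k where "k = ?n - 2"
    have k: "?n = Suc (Suc k)" using n unfolding k_def by arith
    define t where "t = rt ?n r"
    have tr: "r = t ^ (?n - 1)" using rt_power(1)[OF n, of r] r by (simp add: t_def)
    have ps: "0 < 1 + t ^ ?n" using one_plus_rt_pos[of ?n r] by (simp add: t_def)
    have d: "DERIV (\<lambda>r. 1 - 1 / (1 + rt ?n r ^ ?n)) r :> (real ?n / (real ?n - 1) * t) / (1 + t ^ ?n) ^ 2"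
    proof -
      have "DERIV (\<lambda>r. 1 - 1 / (1 + rt ?n r ^ ?n)) r :>
        0 - (0 * (1 + rt ?n r ^ ?n) - 1 * (0 + real ?n / (real ?n - 1) * rt ?n r)) / ((1 + rt ?n r ^ ?n) * (1 + rt ?n r ^ ?n))"
        by (intro DERIV_diff DERIV_divide DERIV_add DERIV_const DERIV_rt_power[OF n r]) (use one_plus_rt_pos[of ?n r] in simp)
      then show ?thesis by (simp add: t_def power2_eq_square)
    qed
    have e: "1 - 1 / (1 + rt ?n r ^ ?n) = t ^ ?n / (1 + t ^ ?n)"
      using ps by (simp add: t_def[symmetric] field_simps)
    have "DERIV (\<lambda>r. (1 - 1 / (1 + rt ?n r ^ ?n)) ^ (?n - 1)) r :>
       real (?n - 1) * ((real ?n / (real ?n - 1) * t) / (1 + t ^ ?n) ^ 2 * (1 - 1 / (1 + rt ?n r ^ ?n)) ^ (?n - 1 - Suc 0))"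
      by (rule DERIV_power[OF d])
    then have "DERIV F r :> unit_ball_vol ?n * (real (?n - 1) * ((real ?n / (real ?n - 1) * t) / (1 + t ^ ?n) ^ 2 * (t ^ ?n / (1 + t ^ ?n)) ^ (?n - 1 - Suc 0)))"
      unfolding F_def e by (rule DERIV_cmult)
    also have "real (?n - 1) * ((real ?n / (real ?n - 1) * t) / (1 + t ^ ?n) ^ 2 * (t ^ ?n / (1 + t ^ ?n)) ^ (?n - 1 - Suc 0))
       = real ?n * ((t * (t ^ ?n) ^ k) / (1 + t ^ ?n) ^ ?n)"
    proof -
      have "real (?n - 1) = real ?n - 1" "real ?n - 1 \<noteq> 0" using n by (auto simp: of_nat_diff)
      moreover have "?n - 1 - Suc 0 = k" by (simp add: k)
      moreover have "(1 + t ^ ?n) ^ ?n = (1 + t ^ ?n) ^ 2 * (1 + t ^ ?n) ^ k"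
        by (subst (2) k) (simp add: power2_eq_square)
      ultimately show ?thesis by (simp add: power_divide)
    qed
    \<comment> \<open>The exponents of \<open>t\<close> agree because
      \<open>1 + n (n - 2) = (n - 1)^2\<close>.\<close>
    also have "t * (t ^ ?n) ^ k = r ^ (?n - 1)"
      unfolding tr by (simp add: k power_mult[symmetric] power_add[symmetric] algebra_simps flip: power_Suc)
    finally show ?thesis
      by (simp add: f_def polar_weight_def t_def[symmetric] mult_ac)
  qed
  have f0: "0 \<le> f r" for r using one_plus_rt_pos[of ?n r] by (simp add: f_def)
  have fm: "f \<in> borel_measurable borel" unfolding f_def by measurable
  have fc: "isCont f r" if "0 < r" for r
  proof -
    have "1 + rt ?n r ^ ?n \<noteq> 0" using one_plus_rt_pos[of ?n r] by simp
    then show ?thesis unfolding f_def by (intro continuous_intros isCont_rt[OF that]) auto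
  qed
  have "(F \<longlongrightarrow> unit_ball_vol ?n * (1 - 1 / (1 + 0 ^ ?n)) ^ (?n - 1)) (at_right 0)"
    unfolding F_def by (intro tendsto_intros tendsto_rt_0[OF n]) (simp add: power_0_left)
  then have A: "(F \<longlongrightarrow> 0) (at_right 0)" using n by (simp add: power_0_left)
  note * = radial_FTC_nonneg[OF fm b D fc f0 A B[folded F_def]]
  show "integrable (lborel :: 'a::euclidean_space measure) (\<lambda>x. indicator {x. ereal (norm x) < b} x * (1 / (1 + rt DIM('a) (norm x) ^ DIM('a)) ^ DIM('a)))"
    using *(1) by (simp add: f_def)
  show "(\<integral>x. indicator {x. ereal (norm x) < b} x * (1 / (1 + rt DIM('a) (norm x) ^ DIM('a)) ^ DIM('a)) \<partial>(lborel :: 'a measure)) = B"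
    using *(2) by (simp add: f_def)
qed

lemma bubble_mass_ball:
  assumes n: "2 \<le> DIM('a)" and R: "0 < R"
  shows "(\<integral>x. indicator (ball 0 R) x * (1 / (1 + rt DIM('a) (norm x) ^ DIM('a)) ^ DIM('a)) \<partial>(lborel :: 'a::euclidean_space measure))
     = unit_ball_vol DIM('a) * (1 - 1 / (1 + rt DIM('a) R ^ DIM('a))) ^ (DIM('a) - 1)"
proof -
  have "1 + rt DIM('a) R ^ DIM('a) \<noteq> 0" using one_plus_rt_pos[of "DIM('a)" R] by simp
  moreover have "(rt DIM('a) \<longlongrightarrow> rt DIM('a) R) (at_left R)"
    using isCont_rt[OF R, of "DIM('a)"] by (simp add: filterlim_at_split isCont_def)
  ultimately have "((\<lambda>r. unit_ball_vol DIM('a) * (1 - 1 / (1 + rt DIM('a) r ^ DIM('a))) ^ (DIM('a) - 1)) \<longlongrightarrow>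
     unit_ball_vol DIM('a) * (1 - 1 / (1 + rt DIM('a) R ^ DIM('a))) ^ (DIM('a) - 1)) (at_left R)"
    by (intro tendsto_intros)
  moreover have "{x::'a. ereal (norm x) < ereal R} = ball 0 R" by auto
  ultimately show ?thesis
    using bubble_mass_FTC(2)[OF n, of "ereal R"] R by (simp add: ereal_tendsto_simps)
qed

lemma bubble_mass:
  assumes n: "2 \<le> DIM('a)"
  shows "integrable (lborel :: 'a::euclidean_space measure) (\<lambda>x. 1 / (1 + rt DIM('a) (norm x) ^ DIM('a)) ^ DIM('a))"
    "(\<integral>x. 1 / (1 + rt DIM('a) (norm x) ^ DIM('a)) ^ DIM('a) \<partial>(lborel :: 'a measure)) = unit_ball_vol DIM('a)"
proof -
  let ?n = "DIM('a)"
  have "filterlim (\<lambda>r. 1 + rt ?n r ^ ?n) at_infinity at_top"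
  proof (rule filterlim_at_top_imp_at_infinity, rule filterlim_tendsto_add_at_top[OF tendsto_const])
    show "filterlim (\<lambda>r. rt ?n r ^ ?n) at_top at_top" by (rule filterlim_pow_at_top[OF _ rt_at_top[OF n]]) simp
  qed
  then have "((\<lambda>r. 1 / (1 + rt ?n r ^ ?n)) \<longlongrightarrow> 0) at_top" by (rule tendsto_divide_0[OF tendsto_const])
  then have "((\<lambda>r. unit_ball_vol ?n * (1 - 1 / (1 + rt ?n r ^ ?n)) ^ (?n - 1)) \<longlongrightarrow> unit_ball_vol ?n * (1 - 0) ^ (?n - 1)) at_top"
    by (intro tendsto_intros)
  then have "(((\<lambda>r. unit_ball_vol ?n * (1 - 1 / (1 + rt ?n r ^ ?n)) ^ (?n - 1)) \<circ> real_of_ereal) \<longlongrightarrow> unit_ball_vol ?n) (at_left \<infinity>)"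
    by (simp add: ereal_tendsto_simps)
  from bubble_mass_FTC[OF n _ this]
  show "integrable (lborel :: 'a::euclidean_space measure) (\<lambda>x. 1 / (1 + rt DIM('a) (norm x) ^ DIM('a)) ^ DIM('a))"
    "(\<integral>x. 1 / (1 + rt DIM('a) (norm x) ^ DIM('a)) ^ DIM('a) \<partial>(lborel :: 'a measure)) = unit_ball_vol DIM('a)"
    by simp_all
qed

text \<open>The equality case of \<open>energy_ge_Phi\<close>. At \<open>l = ln (1 + s)\<close> the
  derivative of \<open>Phi n\<close> is \<open>(s / (1 + s)) ^ (n - 1)\<close>, so the right side is
  a primitive of the radial energy density.\<close>

lemma bubble_energy_ball:
  assumes n: "2 \<le> DIM('a)" and R: "0 < R"
  shows "(\<integral>x. indicator (ball 0 R) x *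
       (real DIM('a) ^ 2 / (real DIM('a) - 1) * rt DIM('a) (norm x) / (1 + rt DIM('a) (norm x) ^ DIM('a))) ^ DIM('a) \<partial>(lborel :: 'a::euclidean_space measure))
     = sharp_const DIM('a) * Phi DIM('a) (ln (1 + rt DIM('a) R ^ DIM('a)))"
proof -
  let ?n = "DIM('a)"
  define c where "c = real ?n ^ 2 / (real ?n - 1)"
  define f where "f = (\<lambda>r. (c * rt ?n r / (1 + rt ?n r ^ ?n)) ^ ?n)"
  define F where "F = (\<lambda>r. sharp_const ?n * Phi ?n (ln (1 + rt ?n r ^ ?n)))"
  have pos: "0 < 1 + rt ?n r ^ ?n" for r by (meson add_pos_nonneg rt_nonneg zero_le_power zero_less_one)
  have c: "0 < c" using n by (auto simp: c_def)
  have n0: "0 < ?n" by simp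
  have D: "DERIV F r :> polar_weight ?n r * f r" if r: "0 < r" for r
  proof -
    define k where "k = ?n - 2"
    have k: "?n = Suc (Suc k)" using n unfolding k_def by arith
    define t where "t = rt ?n r"
    have tr: "r = t ^ (?n - 1)" using rt_power(1)[OF n, of r] r by (simp add: t_def)
    have ps: "0 < 1 + t ^ ?n" using pos[of r] by (simp add: t_def)
    have d: "DERIV (\<lambda>r. ln (1 + rt ?n r ^ ?n)) r :> (real ?n / (real ?n - 1) * t) / (1 + t ^ ?n)"
      unfolding t_def by (rule derivative_eq_intros DERIV_rt_power[OF n r] refl | use pos[of r] in simp)+
    have e: "1 - exp (- ln (1 + rt ?n r ^ ?n)) = t ^ ?n / (1 + t ^ ?n)"
      using ps by (simp add: t_def[symmetric] exp_minus field_simps)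
    have "DERIV F r :> sharp_const ?n * ((1 - exp (- ln (1 + rt ?n r ^ ?n))) ^ (?n - 1) * ((real ?n / (real ?n - 1) * t) / (1 + t ^ ?n)))"
      unfolding F_def by (intro DERIV_cmult DERIV_chain2[OF DERIV_Phi[OF n0] d])
    also have "sharp_const ?n * ((1 - exp (- ln (1 + rt ?n r ^ ?n))) ^ (?n - 1) * ((real ?n / (real ?n - 1) * t) / (1 + t ^ ?n)))
      = (sharp_const ?n * (real ?n / (real ?n - 1))) * ((t ^ ?n) ^ (?n - 1) * t / (1 + t ^ ?n) ^ ?n)"
    proof -
      have Pn: "x ^ ?n = x ^ (?n - 1) * x" for x :: real by (simp add: k)
      show ?thesis unfolding e power_divide Pn[of "1 + t ^ ?n"] by (simp add: mult_ac)
    qed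
    also have "sharp_const ?n * (real ?n / (real ?n - 1)) = ?n * unit_ball_vol ?n * c ^ ?n"
      using n by (simp add: sharp_const_def c_def)
    \<comment> \<open>Here the exponents match by
      \<open>n (n - 1) + 1 = (n - 1)^2 + n\<close>.\<close>
    also have "(t ^ ?n) ^ (?n - 1) * t = r ^ (?n - 1) * t ^ ?n"
      unfolding tr by (simp add: k power_mult[symmetric] power_add[symmetric] algebra_simps flip: power_Suc2)
    finally show ?thesis
      by (simp add: f_def polar_weight_def t_def[symmetric] power_divide power_mult_distrib mult_ac)
  qed
  have "(\<integral>x. indicator {x. ereal (norm x) < ereal R} x * f (norm x) \<partial>(lborel :: 'a measure)) = F R - 0"
  proof (rule radial_FTC_nonneg)
    show "f \<in> borel_measurable borel" unfolding f_def by measurable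
    show "isCont f r" if "0 < r" for r
      unfolding f_def using pos[of r] by (intro continuous_intros isCont_rt[OF that]) auto
    have "((\<lambda>r. ln (1 + rt ?n r ^ ?n)) \<longlongrightarrow> ln (1 + 0 ^ ?n)) (at_right 0)"
      by (intro tendsto_intros tendsto_rt_0[OF n]) (simp add: power_0_left)
    then have l: "((\<lambda>r. ln (1 + rt ?n r ^ ?n)) \<longlongrightarrow> 0) (at_right 0)" by (simp add: power_0_left)
    have "((\<lambda>r. Phi ?n (ln (1 + rt ?n r ^ ?n))) \<longlongrightarrow> Phi ?n 0) (at_right 0)"
      by (rule isCont_tendsto_compose[OF DERIV_isCont[OF DERIV_Phi[OF n0]] l])
    then show "(F \<longlongrightarrow> 0) (at_right 0)"
      unfolding F_def by (auto intro!: tendsto_eq_intros)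
    have "isCont F R" using D[OF R] by (rule DERIV_isCont)
    then have "(F \<longlongrightarrow> F R) (at_left R)"
      by (meson continuous_at_imp_continuous_at_within continuous_within)
    then show "((F \<circ> real_of_ereal) \<longlongrightarrow> F R) (at_left (ereal R))" by (simp add: ereal_tendsto_simps)
    show "0 \<le> f r" for r using pos[of r] c rt_nonneg[of ?n r] unfolding f_def by (intro zero_le_power divide_nonneg_pos mult_nonneg_nonneg) auto
  qed (use R D in auto)
  moreover have "{x::'a. ereal (norm x) < ereal R} = ball 0 R" by auto
  ultimately show ?thesis by (simp add: f_def F_def c_def)
qed

section \<open>Integration by parts against the extremal profile\<close>

lemma lborel_integral_translation:
  fixes f :: "'a::euclidean_space \<Rightarrow> real"
  assumes [measurable]: "f \<in> borel_measurable borel"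
  shows "(\<integral>x. f (a + x) \<partial>lborel) = (\<integral>x. f x \<partial>lborel)"
proof -
  have "(\<integral>x. f x \<partial>lborel) = (\<integral>x. f x \<partial>distr lborel borel ((+) a))"
    by (simp add: lborel_distr_plus)
  also have "\<dots> = (\<integral>x. f (a + x) \<partial>lborel)" by (rule integral_distr) auto
  finally show ?thesis by simp
qed

lemma integral_compactly_supported_integrable:
  fixes f :: "'a::euclidean_space \<Rightarrow> real"
  assumes f: "continuous_on UNIV f" and 0: "\<And>x. R < norm x \<Longrightarrow> f x = 0"
  shows "integrable lborel f"
proof -
  have "compact (f ` cball 0 R)" by (intro compact_continuous_image continuous_on_subset[OF f]) auto
  then have "bounded (f ` cball 0 R)" by (rule compact_imp_bounded)
  then obtain L where L: "\<And>z. z \<in> cball 0 R \<Longrightarrow> norm (f z) \<le> L"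
    unfolding bounded_iff by blast
  have [measurable]: "f \<in> borel_measurable borel" using f by (rule borel_measurable_continuous_onI)
  have "integrable lborel (\<lambda>x. indicator (cball 0 R) x *\<^sub>R f x)"
  proof (rule integrableI_bounded_set_indicator[where B = L])
    show "emeasure lborel (cball (0::'a) R) < \<infinity>" using emeasure_bounded_finite[of "cball (0::'a) R"] by simp
    show "AE x in lborel. x \<in> cball 0 R \<longrightarrow> norm (f x) \<le> L" using L by (intro AE_I2) blast
  qed auto
  moreover have "(\<lambda>x. indicator (cball 0 R) x *\<^sub>R f x) = f"
  proof
    fix x show "indicator (cball 0 R) x *\<^sub>R f x = f x" using 0[of x] by (cases "norm x \<le> R") auto
  qed
  ultimately show ?thesis by metis
qed

text \<open>The difference quotients of \<open>f\<close> along \<open>v\<close> have integral 0 by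
  translation invariance, and they converge to the directional derivative under a common integrable
  bound.\<close>

lemma integral_directional_derivative_0:
  fixes f :: "'a::euclidean_space \<Rightarrow> real"
  assumes der: "\<And>x. (f has_derivative f' x) (at x)" and cont: "continuous_on UNIV (\<lambda>x. f' x v)"
    and 0: "\<And>x. R < norm x \<Longrightarrow> f x = 0"
  shows "(\<integral>x. f' x v \<partial>lborel) = 0"
proof -
  have contf: "continuous_on UNIV f"
    by (rule has_derivative_continuous_on[where f' = f']) (simp add: der)
  have [measurable]: "f \<in> borel_measurable borel" using contf by (rule borel_measurable_continuous_onI)
  have m [measurable]: "(\<lambda>x. f' x v) \<in> borel_measurable borel" using cont by (rule borel_measurable_continuous_onI)
  \<comment> \<open>Outside this radius both \<open>x\<close> and its translates by at most
    \<open>v\<close> lie where \<open>f\<close> vanishes.\<close>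
  define r where "r = \<bar>R\<bar> + norm v"
  have "compact ((\<lambda>x. f' x v) ` cball 0 (r + norm v))"
    by (intro compact_continuous_image continuous_on_subset[OF cont]) auto
  then have "bounded ((\<lambda>x. f' x v) ` cball 0 (r + norm v))" by (rule compact_imp_bounded)
  then obtain L where L: "\<And>z. z \<in> cball 0 (r + norm v) \<Longrightarrow> norm (f' z v) \<le> L"
    unfolding bounded_iff by blast
  define e where "e k = inverse (real (Suc k))" for k
  have e: "0 < e k" "e k \<le> 1" for k by (auto simp: e_def field_simps)
  define q where "q k x = (f (e k *\<^sub>R v + x) - f x) / e k" for k x
  have line: "((\<lambda>t. f (t *\<^sub>R v + x)) has_derivative (\<lambda>h. h * f' (t *\<^sub>R v + x) v)) (at t)" for x t
  proof -
    have "((\<lambda>t. f (t *\<^sub>R v + x)) has_derivative (\<lambda>h. f' (t *\<^sub>R v + x) (h *\<^sub>R v))) (at t)"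
      by (rule has_derivative_compose[OF _ der]) (auto intro!: derivative_eq_intros)
    moreover have "f' (t *\<^sub>R v + x) (h *\<^sub>R v) = h * f' (t *\<^sub>R v + x) v" for h
      using linear_simps(5)[OF has_derivative_bounded_linear[OF der[of "t *\<^sub>R v + x"]]] by simp
    ultimately show ?thesis by simp
  qed
  have int: "integrable lborel f" by (rule integral_compactly_supported_integrable[OF contf 0])
  have int': "integrable lborel (\<lambda>x. f (a + x))" for a
  proof (rule integral_compactly_supported_integrable[where R = "R + norm a"])
    show "continuous_on UNIV (\<lambda>x. f (a + x))"
      by (intro continuous_on_compose2[OF contf] continuous_intros) auto
    show "f (a + x) = 0" if "R + norm a < norm x" for x
      using norm_triangle_ineq4[of "a + x" a] that by (intro 0) simp
  qed
  have "(\<lambda>k. \<integral>x. q k x \<partial>lborel) \<longlonglongrightarrow> (\<integral>x. f' x v \<partial>lborel)"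
  proof (rule integral_dominated_convergence)
    show "integrable lborel (\<lambda>x::'a. indicator (cball 0 r) x * L :: real)"
      using emeasure_bounded_finite[of "cball (0::'a) r"]
      by (intro integrable_mult_left integrable_real_indicator) auto
    show "AE x in lborel. (\<lambda>k. q k x) \<longlonglongrightarrow> f' x v"
    proof (rule AE_I2)
      fix x
      have "((\<lambda>t. f (t *\<^sub>R v + x)) has_real_derivative f' x v) (at 0)"
        using line[of x 0] by (simp add: has_field_derivative_def mult.commute[of _ "f' x v"])
      then have "((\<lambda>t. (f (t *\<^sub>R v + x) - f x) / t) \<longlongrightarrow> f' x v) (at 0)"
        by (simp add: DERIV_def)
      moreover have "filterlim e (at 0) sequentially"
        unfolding filterlim_at using e(1) LIMSEQ_inverse_real_of_nat
        by (auto simp: e_def[abs_def] intro!: always_eventually)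
      ultimately show "(\<lambda>k. q k x) \<longlonglongrightarrow> f' x v"
        unfolding q_def by (rule filterlim_compose)
    qed
    show "AE x in lborel. norm (q k x) \<le> indicator (cball 0 r) x * L" for k
    proof (rule AE_I2)
      fix x
      show "norm (q k x) \<le> indicator (cball 0 r) x * L"
      proof (cases "norm x \<le> r")
        case True
        have "\<exists>t\<in>{0<..<e k}. f (e k *\<^sub>R v + x) - f (0 *\<^sub>R v + x) = (e k - 0) * f' (t *\<^sub>R v + x) v"
          by (rule mvt_simple[OF e(1)]) (rule has_derivative_at_withinI[OF line])
        then obtain t where t: "t \<in> {0<..<e k}" "f (e k *\<^sub>R v + x) - f x = e k * f' (t *\<^sub>R v + x) v" by auto
        then have q: "q k x = f' (t *\<^sub>R v + x) v" using e(1)[of k] by (simp add: q_def)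
        have "norm (t *\<^sub>R v) \<le> 1 * norm v"
          using t(1) e(2)[of k] unfolding norm_scaleR by (intro mult_right_mono) auto
        then have "norm (t *\<^sub>R v + x) \<le> r + norm v"
          using norm_triangle_ineq[of "t *\<^sub>R v" x] True by simp
        then show ?thesis unfolding q using L True by simp
      next
        case False
        have "norm (e k *\<^sub>R v) \<le> norm v" using e[of k] by (simp add: mult_left_le_one_le)
        moreover have "norm x \<le> norm (e k *\<^sub>R v + x) + norm (e k *\<^sub>R v)"
          using norm_triangle_ineq4[of "e k *\<^sub>R v + x" "e k *\<^sub>R v"] by simp
        ultimately have "R < norm (e k *\<^sub>R v + x)" "R < norm x"
          using False norm_ge_zero[of v] unfolding r_def by linarith+
        then have "f (e k *\<^sub>R v + x) = 0" "f x = 0" by (auto intro: 0)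
        then have "q k x = 0" by (simp add: q_def)
        then show ?thesis using False by simp
      qed
    qed
  qed (auto simp: q_def[abs_def])
  moreover have "(\<integral>x. q k x \<partial>lborel) = 0" for k
    unfolding q_def using int int' lborel_integral_translation[of f "e k *\<^sub>R v"]
    by (simp add: Bochner_Integration.integral_diff)
  ultimately show ?thesis by (simp add: LIMSEQ_const_iff)
qed

section \<open>The extremal profile and its gradient\<close>

definition sig :: "'a::euclidean_space \<Rightarrow> real" where
  "sig x = rt DIM('a) (norm x) ^ DIM('a)"

lemma sig_nonneg: "0 \<le> sig x" by (simp add: sig_def rt_nonneg)

lemma one_plus_sig: "0 < 1 + sig x" "1 + sig x \<noteq> 0" "1 \<le> 1 + sig x"
  using sig_nonneg[of x] by auto

lemma sig_measurable [measurable]: "sig \<in> borel_measurable borel"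
  unfolding sig_def[abs_def] by measurable

lemma norm_mult_rt:
  assumes "2 \<le> DIM('a)" shows "norm x * rt DIM('a) (norm x) = sig (x :: 'a::euclidean_space)"
proof -
  have "rt DIM('a) (norm x) ^ DIM('a) = rt DIM('a) (norm x) ^ (DIM('a) - 1) * rt DIM('a) (norm x)"
    by (metis DIM_positive Suc_diff_1 power_Suc2)
  then show ?thesis using rt_power(1)[OF assms, of "norm x"] by (simp add: sig_def)
qed

lemma tendsto_rt_norm_0:
  assumes n: "2 \<le> n" shows "((\<lambda>x :: 'a::euclidean_space. rt n (norm x)) \<longlongrightarrow> 0) (at 0)"
proof (rule filterlim_compose[OF tendsto_rt_0[OF n]])
  show "filterlim norm (at_right 0) (at (0::'a))"
    unfolding filterlim_at
  proof
    show "\<forall>\<^sub>F x in at (0::'a). norm x \<in> {0<..} \<and> norm x \<noteq> 0"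
      unfolding eventually_at_filter by (intro always_eventually) simp
    show "(norm \<longlongrightarrow> 0) (at (0::'a))" by (rule tendsto_norm_zero[OF tendsto_ident_at])
  qed
qed

lemma continuous_rt_norm:
  assumes "2 \<le> n" shows "continuous_on UNIV (\<lambda>x :: 'a::euclidean_space. rt n (norm x))"
proof (intro continuous_at_imp_continuous_on ballI)
  fix x :: 'a
  show "isCont (\<lambda>x :: 'a. rt n (norm x)) x"
  proof (cases "x = 0")
    case True
    then show ?thesis using tendsto_rt_norm_0[OF assms] by (simp add: isCont_def)
  next
    case False
    then show ?thesis by (intro isCont_o2[OF _ isCont_rt] continuous_intros) auto
  qed
qed

text \<open>The formula is correct at the origin too: \<open>sgn 0 = 0\<close>, and the quotient
  \<open>sig h / norm h\<close> is \<open>rt DIM('a) (norm h)\<close>, which tends to 0.\<close>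

lemma has_derivative_sig:
  fixes x :: "'a::euclidean_space"
  assumes n: "2 \<le> DIM('a)"
  shows "(sig has_derivative (\<lambda>h. (real DIM('a) / (real DIM('a) - 1) * rt DIM('a) (norm x)) * (sgn x \<bullet> h))) (at x)"
proof (cases "x = 0")
  case True
  have "((\<lambda>h :: 'a. sig h / norm h) \<longlongrightarrow> 0) (at 0)"
  proof (rule Lim_transform_eventually[OF tendsto_rt_norm_0[OF n]])
    show "\<forall>\<^sub>F h :: 'a in at 0. rt DIM('a) (norm h) = sig h / norm h"
      unfolding eventually_at_filter by (intro always_eventually) (auto simp: norm_mult_rt[OF n, symmetric])
  qed
  then have "((\<lambda>h :: 'a. norm (sig (0 + h) - sig (0::'a) - 0) / norm h) \<longlongrightarrow> 0) (at 0)"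
    by (simp add: sig_nonneg abs_of_nonneg sig_def[of "0::'a"] power_0_left)
  then show ?thesis using True by (simp add: has_derivative_at)
next
  case False
  have "((\<lambda>y. rt DIM('a) (norm y) ^ DIM('a)) has_derivative (\<lambda>h. (sgn x \<bullet> h) * (real DIM('a) / (real DIM('a) - 1) * rt DIM('a) (norm x)))) (at x)"
    using DERIV_compose_FDERIV[OF DERIV_rt_power[OF n, of "norm x"] has_derivative_norm[OF False]] False
    by (simp add: inner_commute)
  then show ?thesis by (simp add: sig_def[abs_def] mult.commute)
qed

lemma continuous_sig: "2 \<le> DIM('a) \<Longrightarrow> continuous_on UNIV (sig :: 'a::euclidean_space \<Rightarrow> real)"
  unfolding sig_def[abs_def] by (intro continuous_intros continuous_rt_norm)

definition bubble :: "'a::euclidean_space \<Rightarrow> real" where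
  "bubble x = - real DIM('a) * ln (1 + sig x)"

definition grad_bubble :: "'a::euclidean_space \<Rightarrow> 'a" where
  "grad_bubble x = (- (real DIM('a) ^ 2 / (real DIM('a) - 1) * rt DIM('a) (norm x) / (1 + sig x))) *\<^sub>R sgn x"

lemma has_derivative_bubble:
  fixes x :: "'a::euclidean_space"
  assumes n: "2 \<le> DIM('a)"
  shows "(bubble has_derivative (\<lambda>h. grad_bubble x \<bullet> h)) (at x)"
proof -
  let ?n = "DIM('a)"
  have d: "DERIV (\<lambda>s. - real ?n * ln (1 + s)) (sig x) :> - real ?n / (1 + sig x)"
    using one_plus_sig(1)[of x] by (auto intro!: derivative_eq_intros)
  have "((\<lambda>y. - real ?n * ln (1 + sig y)) has_derivative
      (\<lambda>h. (real ?n / (real ?n - 1) * rt ?n (norm x)) * (sgn x \<bullet> h) * (- real ?n / (1 + sig x)))) (at x)"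
    by (rule DERIV_compose_FDERIV[OF d has_derivative_sig[OF n]])
  moreover have "(real ?n / (real ?n - 1) * rt ?n (norm x)) * (sgn x \<bullet> h) * (- real ?n / (1 + sig x)) = grad_bubble x \<bullet> h" for h
    by (simp add: grad_bubble_def power2_eq_square)
  ultimately show ?thesis by (simp add: bubble_def[abs_def])
qed

lemma norm_grad_bubble:
  assumes "2 \<le> DIM('a)"
  shows "norm (grad_bubble (x::'a::euclidean_space)) = real DIM('a) ^ 2 / (real DIM('a) - 1) * rt DIM('a) (norm x) / (1 + sig x)"
proof -
  have "0 \<le> real DIM('a) ^ 2 / (real DIM('a) - 1) * rt DIM('a) (norm x) / (1 + sig x)"
    using assms rt_nonneg[of "DIM('a)" "norm x"] one_plus_sig(1)[of x] by (intro divide_nonneg_pos mult_nonneg_nonneg) auto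
  then have "norm (grad_bubble x) = real DIM('a) ^ 2 / (real DIM('a) - 1) * rt DIM('a) (norm x) / (1 + sig x) * norm (sgn x)"
    unfolding grad_bubble_def norm_scaleR by (simp only: abs_minus_cancel abs_of_nonneg)
  then show ?thesis by (cases "x = 0") (simp_all add: norm_sgn)
qed

text \<open>Away from the origin all factors are continuous. At the origin \<open>sgn\<close> is
  not, but the norm of the gradient is a continuous function vanishing there.\<close>

lemma continuous_grad_bubble:
  assumes n: "2 \<le> DIM('a)"
  shows "continuous_on UNIV (grad_bubble :: 'a::euclidean_space \<Rightarrow> 'a)"
proof (intro continuous_at_imp_continuous_on ballI)
  fix x :: 'a
  have c: "isCont (\<lambda>x::'a. real DIM('a) ^ 2 / (real DIM('a) - 1) * rt DIM('a) (norm x) / (1 + sig x)) x" for x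
    using continuous_rt_norm[OF n] continuous_sig[OF n] one_plus_sig(2)[of x]
    by (intro continuous_intros) (auto simp: continuous_on_eq_continuous_at)
  show "isCont grad_bubble x"
  proof (cases "x = 0")
    case True
    have g0: "grad_bubble (0::'a) = 0" by (simp add: grad_bubble_def)
    have "isCont (\<lambda>x::'a. norm (grad_bubble x)) 0"
      using c[of 0] by (simp only: norm_grad_bubble[OF n])
    then show ?thesis using True by (simp add: isCont_def g0 tendsto_norm_zero_iff)
  next
    case False
    then show ?thesis unfolding grad_bubble_def[abs_def]
      by (intro continuous_intros c)
  qed
qed

text \<open>The roots disappear in this combination: \<open>rt\<close> to the power
  \<open>n - 1\<close> is the radius, and the radius times \<open>sgn x\<close> is \<open>x\<close>.
  It is the field against which the gradient of \<open>u\<close> is paired in the cross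
  term.\<close>

lemma grad_bubble_power:
  assumes n: "2 \<le> DIM('a)"
  shows "norm (grad_bubble x) ^ (DIM('a) - 2) *\<^sub>R grad_bubble x
     = (- ((real DIM('a) ^ 2 / (real DIM('a) - 1)) ^ (DIM('a) - 1) / (1 + sig x) ^ (DIM('a) - 1))) *\<^sub>R (x::'a::euclidean_space)"
proof -
  let ?n = "DIM('a)"
  define c where "c = real ?n ^ 2 / (real ?n - 1)"
  define k where "k = ?n - 2"
  have k: "?n - 2 = k" "?n - 1 = Suc k" using n by (auto simp: k_def)
  have "rt ?n (norm x) ^ (?n - 1) = norm x" using rt_power(1)[OF n, of "norm x"] by simp
  then have r: "rt ?n (norm x) ^ k * rt ?n (norm x) = norm x" unfolding k by (simp add: mult.commute)
  have e: "norm (grad_bubble x) = c * rt ?n (norm x) / (1 + sig x)" using norm_grad_bubble[OF n] by (simp add: c_def)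
  have g: "grad_bubble x = (- (c * rt ?n (norm x) / (1 + sig x))) *\<^sub>R sgn x" by (simp add: grad_bubble_def c_def)
  have "norm (grad_bubble x) ^ k *\<^sub>R grad_bubble x = (c * rt ?n (norm x) / (1 + sig x)) ^ k *\<^sub>R ((- (c * rt ?n (norm x) / (1 + sig x))) *\<^sub>R sgn x)"
    unfolding e by (simp only: g)
  also have "\<dots> = (- (c ^ Suc k * (rt ?n (norm x) ^ k * rt ?n (norm x)) / (1 + sig x) ^ Suc k)) *\<^sub>R sgn x"
    by (simp add: power_mult_distrib power_divide mult_ac)
  also have "\<dots> = (- (c ^ Suc k / (1 + sig x) ^ Suc k)) *\<^sub>R (norm x *\<^sub>R sgn x)" unfolding r by simp
  also have "norm x *\<^sub>R sgn x = x" by (cases "x = 0") (simp_all add: sgn_div_norm)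
  finally show ?thesis unfolding k c_def .
qed

lemma sum_Basis_inner_mult: "(\<Sum>i\<in>Basis. (x \<bullet> i) * (y \<bullet> i)) = x \<bullet> (y :: 'a::euclidean_space)"
  by (rule euclidean_inner[symmetric])

text \<open>The field \<open>x / (1 + sig x) ^ (n - 1)\<close> has divergence
  \<open>n / (1 + sig x) ^ n\<close>, because \<open>n (1 + sig x) - n sig x = n\<close>. By
  \<open>grad_bubble_power\<close> this says that \<open>bubble\<close> solves the Liouville
  equation for the \<open>n\<close>-Laplacian. The identity is tested against
  \<open>u\<close>.\<close>

lemma bubble_divergence:
  fixes u :: "'a::euclidean_space \<Rightarrow> real"
  assumes n: "2 \<le> DIM('a)" and der: "\<And>x. (u has_derivative (\<lambda>h. g x \<bullet> h)) (at x)"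
    and cont: "continuous_on UNIV g" and 0: "\<And>x. R < norm x \<Longrightarrow> u x = 0"
  shows "(\<integral>x. (x \<bullet> g x) / (1 + sig x) ^ (DIM('a) - 1) \<partial>lborel) = - real DIM('a) * (\<integral>x. u x / (1 + sig x) ^ DIM('a) \<partial>lborel)"
proof -
  let ?n = "DIM('a)"
  define k where "k = ?n - 2"
  have k: "?n = Suc (Suc k)" using n unfolding k_def by arith
  define Z where "Z x = 1 / (1 + sig x) ^ (?n - 1)" for x :: 'a
  define D where "D x = real ?n * rt ?n (norm x) / (1 + sig x) ^ ?n" for x :: 'a
  have contu: "continuous_on UNIV u"
    by (rule has_derivative_continuous_on[where f' = "\<lambda>x h. g x \<bullet> h"]) (simp add: der)
  have contZ: "continuous_on UNIV Z"
    unfolding Z_def[abs_def] using continuous_sig[OF n] one_plus_sig(2) by (intro continuous_intros) auto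
  have contD: "continuous_on UNIV D"
    unfolding D_def[abs_def] using continuous_sig[OF n] continuous_rt_norm[OF n] one_plus_sig(2) by (intro continuous_intros) auto
  \<comment> \<open>\<open>sgn\<close> jumps at the origin, but the factor \<open>rt\<close>
    vanishes there.\<close>
  have conts: "continuous_on UNIV (\<lambda>x::'a. rt ?n (norm x) * (sgn x \<bullet> i))" for i
  proof -
    have *: "isCont (\<lambda>x::'a. rt ?n (norm x) *\<^sub>R sgn x) x" for x
    proof (cases "x = 0")
      case True
      have "((\<lambda>x::'a. norm (rt ?n (norm x) *\<^sub>R sgn x)) \<longlongrightarrow> 0) (at 0)"
      proof (rule Lim_transform_eventually[OF tendsto_rt_norm_0[OF n]])
        show "\<forall>\<^sub>F x in at (0::'a). rt ?n (norm x) = norm (rt ?n (norm x) *\<^sub>R sgn x)"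
          unfolding eventually_at_filter by (intro always_eventually) (auto simp: norm_sgn rt_nonneg)
      qed
      then show ?thesis using True tendsto_norm_zero_cancel by (fastforce simp: isCont_def)
    next
      case False
      moreover have "isCont (\<lambda>x::'a. rt ?n (norm x)) x" using continuous_rt_norm[where 'a='a, OF n] by (simp add: continuous_on_eq_continuous_at)
      ultimately show ?thesis by (intro continuous_intros)
    qed
    have "continuous_on UNIV (\<lambda>x::'a. (rt ?n (norm x) *\<^sub>R sgn x) \<bullet> i)"
      using * by (intro continuous_on_inner continuous_on_const) (simp add: continuous_at_imp_continuous_on)
    then show ?thesis by simp
  qed
  have dZ: "(Z has_derivative (\<lambda>h. - (D x * (sgn x \<bullet> h)))) (at x)" for x
  proof -
    have d: "DERIV (\<lambda>s. 1 / (1 + s) ^ (?n - 1)) (sig x) :> - (real ?n - 1) / (1 + sig x) ^ ?n"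
    proof -
      define p where "p = 1 + sig x"
      have p: "p \<noteq> 0" using one_plus_sig(2)[of x] by (simp add: p_def)
      have "DERIV (\<lambda>s. 1 / (1 + s) ^ (?n - 1)) (sig x) :>
        (0 * p ^ (?n - 1) - 1 * (real (?n - 1) * ((0 + 1) * p ^ (?n - 1 - Suc 0)))) / (p ^ (?n - 1) * p ^ (?n - 1))"
        unfolding p_def
        by (intro DERIV_divide DERIV_const DERIV_power DERIV_add DERIV_ident) (use p in \<open>simp add: p_def\<close>)
      moreover have "(0 * p ^ (?n - 1) - 1 * (real (?n - 1) * ((0 + 1) * p ^ (?n - 1 - Suc 0)))) / (p ^ (?n - 1) * p ^ (?n - 1))
        = - ((real ?n - 1) / p ^ ?n)"
        using p by (simp add: k)
      ultimately show ?thesis unfolding p_def minus_divide_left by metis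
    qed
    have "((\<lambda>y. 1 / (1 + sig y) ^ (?n - 1)) has_derivative
        (\<lambda>h. (real ?n / (real ?n - 1) * rt ?n (norm x)) * (sgn x \<bullet> h) * (- (real ?n - 1) / (1 + sig x) ^ ?n))) (at x)"
      by (rule DERIV_compose_FDERIV[OF d has_derivative_sig[OF n]])
    moreover have "(real ?n / (real ?n - 1) * rt ?n (norm x)) * (sgn x \<bullet> h) * (- (real ?n - 1) / (1 + sig x) ^ ?n) = - (D x * (sgn x \<bullet> h))" for h
    proof -
      have "a / b * r * s * (- b / q) = - (a * r / q * s)" if "b \<noteq> 0" for a b r s q :: real
        using that by simp
      moreover have "real ?n - 1 \<noteq> 0" using n by simp
      ultimately show ?thesis unfolding D_def by blast
    qed
    ultimately show ?thesis by (simp add: Z_def[abs_def])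
  qed
  \<comment> \<open>The derivative of \<open>u x * ((x \<bullet> i) * Z x)\<close> in the direction
    \<open>i\<close>. Each of these integrates to 0, and their sum over the basis is the integrand
    of the identity.\<close>
  define P where "P i x = u x * ((x \<bullet> i) * - (D x * (sgn x \<bullet> i)) + (i \<bullet> i) * Z x) + (g x \<bullet> i) * ((x \<bullet> i) * Z x)" for i x
  have contP: "continuous_on UNIV (P i)" for i
  proof -
    have "D x * (sgn x \<bullet> i) = real ?n / (1 + sig x) ^ ?n * (rt ?n (norm x) * (sgn x \<bullet> i))" for x by (simp add: D_def)
    moreover have "continuous_on UNIV (\<lambda>x::'a. real ?n / (1 + sig x) ^ ?n * (rt ?n (norm x) * (sgn x \<bullet> i)))"
      using continuous_sig[where 'a='a, OF n] one_plus_sig(2) by (intro continuous_on_mult conts continuous_intros) auto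
    ultimately have cD: "continuous_on UNIV (\<lambda>x. D x * (sgn x \<bullet> i))" by simp
    have ci: "continuous_on UNIV (\<lambda>x::'a. x \<bullet> i)" by (intro continuous_intros)
    have c1: "continuous_on UNIV (\<lambda>x. (x \<bullet> i) * - (D x * (sgn x \<bullet> i)))"
      by (rule continuous_on_mult[OF ci continuous_on_minus[OF cD]])
    have c2: "continuous_on UNIV (\<lambda>x. (i \<bullet> i) * Z x)" by (intro continuous_on_mult continuous_on_const contZ)
    have c3: "continuous_on UNIV (\<lambda>x. (g x \<bullet> i) * ((x \<bullet> i) * Z x))"
      by (intro continuous_on_mult contZ ci continuous_on_inner cont continuous_on_const)
    show ?thesis unfolding P_def[abs_def]
      by (rule continuous_on_add[OF continuous_on_mult[OF contu continuous_on_add[OF c1 c2]] c3])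
  qed
  have g0: "g x = 0" if "R < norm x" for x
  proof -
    have "(u has_derivative (\<lambda>h. 0)) (at x)"
    proof (rule has_derivative_transform_within_open[OF has_derivative_const[of 0]])
      show "open {x. R < norm (x::'a)}" by (intro open_Collect_less continuous_intros)
    qed (use that 0 in auto)
    from has_derivative_unique[OF this der] have "g x \<bullet> g x = 0" by metis
    then show ?thesis by simp
  qed
  have P0: "(\<integral>x. P i x \<partial>lborel) = 0" for i
  proof -
    have "((\<lambda>x. u x * ((x \<bullet> i) * Z x)) has_derivative
       (\<lambda>h. u x * ((x \<bullet> i) * - (D x * (sgn x \<bullet> h)) + (h \<bullet> i) * Z x) + (g x \<bullet> h) * ((x \<bullet> i) * Z x))) (at x)" for x
      by (intro has_derivative_mult der dZ has_derivative_inner_left has_derivative_ident)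
    from integral_directional_derivative_0[OF this, of i R] contP[of i] 0 show ?thesis
      by (simp add: P_def[abs_def])
  qed
  have intP: "integrable lborel (P i)" for i
    by (rule integral_compactly_supported_integrable[OF contP, of R]) (simp add: P_def 0 g0)
  have "(\<Sum>i\<in>Basis. P i x) = real ?n * (u x / (1 + sig x) ^ ?n) + (x \<bullet> g x) / (1 + sig x) ^ (?n - 1)" for x
  proof -
    have "(\<Sum>i\<in>Basis. P i x) = u x * (real ?n * Z x - D x * (\<Sum>i\<in>Basis. (x \<bullet> i) * (sgn x \<bullet> i))) + Z x * (\<Sum>i\<in>Basis. (x \<bullet> i) * (g x \<bullet> i))"
      by (simp add: P_def sum.distrib sum_distrib_left sum_subtractf algebra_simps)
    also have "\<dots> = u x * (real ?n * Z x - D x * norm x) + Z x * (x \<bullet> g x)"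
      unfolding sum_Basis_inner_mult by (cases "x = 0") (auto simp: sgn_div_norm dot_square_norm power2_eq_square)
    also have "D x * norm x = real ?n * sig x / (1 + sig x) ^ ?n"
      by (simp add: D_def norm_mult_rt[OF n, symmetric] mult_ac)
    also have "real ?n * Z x - real ?n * sig x / (1 + sig x) ^ ?n = real ?n / (1 + sig x) ^ ?n"
    proof -
      have "a * ((1 + s) / q) - a * s / q = a / q" for a s q :: real
        by (simp add: add_divide_distrib algebra_simps)
      moreover have "Z x = (1 + sig x) / (1 + sig x) ^ ?n"
        using one_plus_sig(2)[of x] by (simp add: Z_def k)
      ultimately show ?thesis by metis
    qed
    finally show ?thesis by (simp add: Z_def)
  qed
  then have "(\<integral>x. real ?n * (u x / (1 + sig x) ^ ?n) + (x \<bullet> g x) / (1 + sig x) ^ (?n - 1) \<partial>lborel) = (\<Sum>i\<in>Basis. \<integral>x. P i x \<partial>lborel)"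
    using intP by (simp flip: Bochner_Integration.integral_sum)
  also have "\<dots> = 0" by (simp add: P0)
  finally have "(\<integral>x. real ?n * (u x / (1 + sig x) ^ ?n) + (x \<bullet> g x) / (1 + sig x) ^ (?n - 1) \<partial>lborel) = 0" .
  have ps: "1 + sig x \<noteq> 0" for x :: 'a by (rule one_plus_sig)
  have cs: "continuous_on UNIV (sig :: 'a \<Rightarrow> real)" by (rule continuous_sig[OF n])
  have "continuous_on UNIV (\<lambda>x. real ?n * (u x / (1 + sig x) ^ ?n))"
    by (intro continuous_intros contu cs) (simp add: ps)
  then have i1: "integrable lborel (\<lambda>x. real ?n * (u x / (1 + sig x) ^ ?n))"
    by (rule integral_compactly_supported_integrable[of _ R]) (simp add: 0)
  have "continuous_on UNIV (\<lambda>x. (x \<bullet> g x) / (1 + sig x) ^ (?n - 1))"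
    by (intro continuous_intros cont cs) (simp add: ps)
  then have i2: "integrable lborel (\<lambda>x. (x \<bullet> g x) / (1 + sig x) ^ (?n - 1))"
    by (rule integral_compactly_supported_integrable[of _ R]) (simp add: g0)
  have e: "(\<integral>x. real ?n * (u x / (1 + sig x) ^ ?n) \<partial>lborel) = real ?n * (\<integral>x. u x / (1 + sig x) ^ ?n \<partial>lborel)"
    by (rule integral_mult_right_zero)
  show ?thesis using Bochner_Integration.integral_add[OF i1 i2] \<open>(\<integral>x. real ?n * (u x / (1 + sig x) ^ ?n) + (x \<bullet> g x) / (1 + sig x) ^ (?n - 1) \<partial>lborel) = 0\<close>
    unfolding e by linarith
qed

section \<open>The inequality\<close>

lemma grad_eqI:
  assumes "(u has_derivative (\<lambda>h. g \<bullet> h)) (at x)"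
  shows "grad u x = g"
proof -
  have 1: "GDERIV u x :> g" using assms by (simp add: gderiv_def inner_commute)
  have "D = g" if "GDERIV u x :> D" for D
  proof -
    have "(\<lambda>h. h \<bullet> D) = (\<lambda>h. h \<bullet> g)"
      using that 1 unfolding gderiv_def by (rule has_derivative_unique)
    then have "(D - g) \<bullet> D = (D - g) \<bullet> g" by metis
    then have "(D - g) \<bullet> (D - g) = 0" by (simp add: inner_diff_right)
    then show ?thesis by simp
  qed
  with 1 show ?thesis unfolding grad_def by (rule the_equality)
qed

lemma smooth_gradient:
  fixes u :: "'a::euclidean_space \<Rightarrow> real"
  assumes "smooth u"
  obtains g where "\<And>x. (u has_derivative (\<lambda>h. g x \<bullet> h)) (at x)" "continuous_on UNIV g" "\<And>x. grad u x = g x"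
proof -
  have "continuously_differentiable (Suc 0) u" using assms unfolding smooth_def by blast
  then have d: "\<And>x. u differentiable (at x)" and c: "\<And>h. continuous_on UNIV (\<lambda>x. frechet_derivative u (at x) h)"
    by auto
  define g where "g x = (\<Sum>i\<in>Basis. frechet_derivative u (at x) i *\<^sub>R i)" for x
  have "(u has_derivative (\<lambda>h. g x \<bullet> h)) (at x)" for x
  proof -
    have D: "(u has_derivative frechet_derivative u (at x)) (at x)" using d frechet_derivative_works by blast
    have "frechet_derivative u (at x) h = g x \<bullet> h" for h
    proof -
      have l: "linear (frechet_derivative u (at x))" using D by (rule has_derivative_linear)
      have "frechet_derivative u (at x) h = frechet_derivative u (at x) (\<Sum>i\<in>Basis. (h \<bullet> i) *\<^sub>R i)"
        by (simp add: euclidean_representation)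
      also have "\<dots> = (\<Sum>i\<in>Basis. (h \<bullet> i) * frechet_derivative u (at x) i)"
        by (simp add: linear_sum[OF l] linear_cmul[OF l])
      also have "\<dots> = g x \<bullet> h"
        unfolding g_def inner_sum_left by (intro sum.cong refl) (simp add: inner_commute[of h])
      finally show ?thesis .
    qed
    then have "frechet_derivative u (at x) = (\<lambda>h. g x \<bullet> h)" by (rule ext)
    then show ?thesis using D by simp
  qed
  moreover have "continuous_on UNIV g"
    unfolding g_def[abs_def] by (intro continuous_on_sum continuous_on_scaleR c continuous_on_const)
  ultimately show ?thesis using that grad_eqI by blast
qed

text \<open>The cone over the sphere is the closed unit ball without its centre. The normalising
  factor of \<open>mu\<close> is therefore the inverse of the volume of the unit ball.\<close>

lemma sphere_measure_sphere:
  "sphere_measure (sphere (0::'a::euclidean_space) 1) = real DIM('a) * unit_ball_vol DIM('a)"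
proof -
  have "{t *\<^sub>R x | t x. 0 < t \<and> t \<le> 1 \<and> x \<in> sphere (0::'a) 1} = cball 0 1 - {0}"
  proof (intro set_eqI iffI)
    fix y :: 'a assume "y \<in> {t *\<^sub>R x | t x. 0 < t \<and> t \<le> 1 \<and> x \<in> sphere (0::'a) 1}"
    then show "y \<in> cball 0 1 - {0}" by auto
  next
    fix y :: 'a assume y: "y \<in> cball 0 1 - {0}"
    then have "y = norm y *\<^sub>R sgn y" "sgn y \<in> sphere 0 1" "0 < norm y" "norm y \<le> 1"
      by (auto simp: sgn_div_norm)
    then show "y \<in> {t *\<^sub>R x | t x. 0 < t \<and> t \<le> 1 \<and> x \<in> sphere (0::'a) 1}" by blast
  qed
  moreover have "measure lebesgue (cball (0::'a) 1 - {0}) = measure lebesgue (cball (0::'a) 1)"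
    by (rule measure_Diff_null_set) (auto simp: negligible_iff_null_sets[symmetric])
  moreover have "measure lebesgue (cball (0::'a) 1) = unit_ball_vol DIM('a)"
    using content_cball[of 1 "0::'a"] by simp
  ultimately show ?thesis by (simp add: sphere_measure_def)
qed

section \<open>The probability measure and the remainder in terms of the profile\<close>

lemma sig_eq_powr:
  assumes "2 \<le> DIM('a)" shows "norm x powr (real DIM('a) / (real DIM('a) - 1)) = sig (x::'a::euclidean_space)"
  using rt_power(2)[OF assms, of "norm x"] by (simp add: sig_def)

definition mu_density :: "'a::euclidean_space \<Rightarrow> real" where
  "mu_density x = 1 / unit_ball_vol DIM('a) * (1 / (1 + sig x) ^ DIM('a))"

lemma mu_density_nonneg: "0 \<le> mu_density x"
  unfolding mu_density_def using one_plus_sig(1)[of x] by simp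

lemma mu_density_measurable [measurable]: "mu_density \<in> borel_measurable borel"
  unfolding mu_density_def[abs_def] by measurable

lemma mu_density_eq:
  assumes n: "2 \<le> DIM('a)"
  shows "mu = density lborel (\<lambda>x::'a::euclidean_space. ennreal (mu_density x))"
proof -
  have "real DIM('a) / (real DIM('a) * unit_ball_vol (real DIM('a))) = 1 / unit_ball_vol (real DIM('a))" by simp
  then show ?thesis
    unfolding mu_def Let_def sphere_measure_sphere sig_eq_powr[OF n] mu_density_def by simp
qed

lemma integral_mu:
  fixes f :: "'a::euclidean_space \<Rightarrow> real"
  assumes n: "2 \<le> DIM('a)" and [measurable]: "f \<in> borel_measurable borel"
  shows "(\<integral>x. f x \<partial>mu) = (\<integral>x. mu_density x * f x \<partial>lborel)"
    and "integrable mu f \<longleftrightarrow> integrable lborel (\<lambda>x. mu_density x * f x)"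
proof -
  have nn: "AE x in lborel. 0 \<le> mu_density (x::'a)" by (simp add: mu_density_nonneg)
  show "(\<integral>x. f x \<partial>mu) = (\<integral>x. mu_density x * f x \<partial>lborel)"
    unfolding mu_density_eq[OF n] using nn by (subst integral_density) auto
  show "integrable mu f \<longleftrightarrow> integrable lborel (\<lambda>x. mu_density x * f x)"
    unfolding mu_density_eq[OF n] using nn by (subst integrable_density) auto
qed

lemma unit_ball_vol_nonzero: "unit_ball_vol (real n) \<noteq> 0"
  using unit_ball_vol_pos[of "real n"] by linarith

lemma integral_mu_density:
  assumes n: "2 \<le> DIM('a)"
  shows "integrable lborel (mu_density :: 'a::euclidean_space \<Rightarrow> real)" "(\<integral>x. mu_density (x::'a) \<partial>lborel) = 1"
proof -
  have "integrable (lborel :: 'a measure) (\<lambda>x. 1 / unit_ball_vol DIM('a) * (1 / (1 + rt DIM('a) (norm x) ^ DIM('a)) ^ DIM('a)))"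
    by (rule integrable_mult_right[OF bubble_mass(1)[OF n]])
  then show "integrable lborel (mu_density :: 'a \<Rightarrow> real)" by (simp add: mu_density_def[abs_def] sig_def)
  have "(\<integral>x. mu_density (x::'a) \<partial>lborel) = 1 / unit_ball_vol DIM('a) * (\<integral>x. 1 / (1 + rt DIM('a) (norm x) ^ DIM('a)) ^ DIM('a) \<partial>(lborel :: 'a measure))"
    unfolding mu_density_def sig_def by (rule integral_mult_right_zero)
  also have "\<dots> = 1" unfolding bubble_mass(2)[OF n] by (simp add: unit_ball_vol_nonzero)
  finally show "(\<integral>x. mu_density (x::'a) \<partial>lborel) = 1" .
qed

lemma prob_space_mu:
  assumes n: "2 \<le> DIM('a)" shows "prob_space (mu :: 'a::euclidean_space measure)"
proof (rule prob_spaceI)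
  have "emeasure (mu :: 'a measure) (space mu) = (\<integral>\<^sup>+x. ennreal (mu_density (x::'a)) \<partial>lborel)"
    unfolding mu_density_eq[OF n] by (subst emeasure_density) auto
  also have "\<dots> = ennreal (\<integral>x. mu_density (x::'a) \<partial>lborel)"
    by (rule nn_integral_eq_integral[OF integral_mu_density(1)[OF n]]) (simp add: mu_density_nonneg)
  finally show "emeasure (mu :: 'a measure) (space mu) = 1" using integral_mu_density(2)[OF n] by simp
qed

lemma R_fun_scaleR:
  assumes "2 \<le> DIM('a)" "0 \<le> c"
  shows "R_fun (c *\<^sub>R X) (c *\<^sub>R (Y::'a::euclidean_space)) = c ^ DIM('a) * R_fun X Y"
proof -
  have "c ^ (DIM('a) - 2) * (c * c) = c ^ DIM('a)"
    using assms(1) by (metis le_add_diff_inverse2 power_add power2_eq_square)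
  moreover have "a * (c ^ k * x) * (c * (c * y)) = (c ^ k * (c * c)) * (a * x * y)" for a k x y by simp
  ultimately have 3: "real DIM('a) * norm (c *\<^sub>R X) ^ (DIM('a) - 2) * ((c *\<^sub>R X) \<bullet> (c *\<^sub>R Y))
      = c ^ DIM('a) * (real DIM('a) * norm X ^ (DIM('a) - 2) * (X \<bullet> Y))"
    using assms(2) by (simp add: power_mult_distrib)
  have 1: "norm (c *\<^sub>R X + c *\<^sub>R Y) ^ DIM('a) = c ^ DIM('a) * norm (X + Y) ^ DIM('a)"
    unfolding scaleR_add_right[symmetric] using assms(2) by (simp add: power_mult_distrib)
  have 2: "norm (c *\<^sub>R X) ^ DIM('a) = c ^ DIM('a) * norm X ^ DIM('a)"
    using assms(2) by (simp add: power_mult_distrib)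
  show ?thesis unfolding R_fun_def 1 2 3 by (simp add: right_diff_distrib)
qed

text \<open>The first argument of the remainder in \<open>H_fun\<close> is
  \<open>(n - 1) / n\<close> times the gradient of the profile, the same factor that multiplies
  \<open>p\<close>; homogeneity of degree \<open>n\<close> takes it out. Thus \<open>H_fun\<close>
  measures how far the energy density at \<open>grad_bubble x + p\<close> exceeds its
  linearisation.\<close>

lemma H_fun_eq:
  assumes n: "2 \<le> DIM('a)"
  shows "H_fun x p = ((real DIM('a) - 1) / real DIM('a)) ^ DIM('a) * R_fun (grad_bubble x) (p::'a::euclidean_space)"
proof -
  let ?n = "DIM('a)"
  define N where "N = real ?n"
  have N: "2 \<le> N" using n by (simp add: N_def)
  have "(- (N * norm x powr (- ((N - 2) / (N - 1))) / (1 + sig x))) *\<^sub>R x = ((N - 1) / N) *\<^sub>R grad_bubble x"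
  proof (cases "x = 0")
    case False
    have "1 / (N - 1) - 1 = - ((N - 2) / (N - 1))" using N by (simp add: field_simps)
    then have "norm x powr (- ((N - 2) / (N - 1))) = rt ?n (norm x) / norm x"
      using False powr_diff[of "norm x" "1 / (N - 1)" 1] by (simp add: rt_def N_def)
    then have "(- (N * norm x powr (- ((N - 2) / (N - 1))) / (1 + sig x))) *\<^sub>R x = (- (N * rt ?n (norm x) / (1 + sig x))) *\<^sub>R sgn x"
      by (simp add: sgn_div_norm divide_inverse mult_ac)
    also have "- (N * rt ?n (norm x) / (1 + sig x)) = (N - 1) / N * - (N ^ 2 / (N - 1) * rt ?n (norm x) / (1 + sig x))"
    proof -
      have "- (N * r / s) = (N - 1) / N * - (N ^ 2 / (N - 1) * r / s)" for r s
        using N by (simp add: power2_eq_square)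
      then show ?thesis .
    qed
    finally show ?thesis by (simp add: grad_bubble_def N_def)
  qed (simp add: grad_bubble_def)
  moreover have "norm x powr (N / (N - 1)) = sig x" using sig_eq_powr[OF n, of x] by (simp add: N_def)
  ultimately show ?thesis
    using R_fun_scaleR[OF n, of "(N - 1) / N" "grad_bubble x" p] N
    unfolding H_fun_def Let_def N_def[symmetric] by simp
qed

text \<open>The power in the numerator cancels the factor of \<open>H_fun_eq\<close>, so that
  \<open>alpha\<close> times the integral of \<open>H_fun\<close> is the excess energy divided by
  \<open>sharp_const n\<close>.\<close>

lemma alpha_eq:
  assumes n: "2 \<le> n"
  shows "alpha n = (real n / (real n - 1)) ^ n / sharp_const n"
proof -
  define N where "N = real n"
  have N: "2 \<le> N" using n by (simp add: N_def)
  have G: "Gamma (N / 2 + 1) = N / 2 * Gamma (N / 2)" using N by (intro Gamma_plus1) auto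
  have Gp: "0 < Gamma (N / 2)" using N by (intro Gamma_real_pos) auto
  define P where "P = pi powr (N / 2)"
  have P: "0 < P" by (simp add: P_def)
  have pw: "N powi (1 - int n) = N / N ^ n"
    using N by (subst power_int_diff) auto
  have "(N ^ 2 / (N - 1)) ^ n = (N / (N - 1)) ^ n * N ^ n"
    by (simp add: power2_eq_square power_mult_distrib[symmetric])
  then have "(N / (N - 1)) ^ n / sharp_const n = 1 / ((N - 1) * N ^ n * unit_ball_vol N)"
    using N by (simp add: sharp_const_def N_def[symmetric])
  also have "unit_ball_vol N = P / (N / 2 * Gamma (N / 2))" by (simp add: unit_ball_vol_def G P_def)
  finally show ?thesis
    unfolding alpha_def N_def[symmetric] pw P_def[symmetric] using N P Gp by (simp add: field_simps)
qed

text \<open>For the level attained on a sphere of radius \<open>r\<close> beyond the support of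
  \<open>u\<close>, all quantities of the locale are explicit. With \<open>l = ln (1 + s r)\<close>,
  the energy is \<open>HH + K * Phi l + K * U\<close> and the logarithm of the average is
  \<open>l + \<Lambda> r\<close>, where \<open>K\<close> is the sharp constant and \<open>U\<close>
  the mean of \<open>u\<close>. The lower bound becomes
  \<open>K * (Phi (l + \<Lambda> r) - Phi l) - K * U \<le> HH\<close>, in which nothing
  diverges.\<close>

lemma onofri_C1:
  fixes u :: "'a::euclidean_space \<Rightarrow> real"
  assumes n: "2 \<le> DIM('a)" and der: "\<And>x. (u has_derivative (\<lambda>h. g x \<bullet> h)) (at x)"
    and cont: "continuous_on UNIV g" and R0: "\<And>x. R0 < norm x \<Longrightarrow> u x = 0"
  shows "ln (\<integral>x. exp (u x) \<partial>mu) - (\<integral>x. u x \<partial>mu) \<le> alpha DIM('a) * (\<integral>x. H_fun x (g x) \<partial>lborel)"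
proof -
  let ?n = "DIM('a)"
  let ?K = "sharp_const ?n"
  define \<omega> where "\<omega> = unit_ball_vol ?n"
  define \<beta> where "\<beta> = real ?n ^ 2 / (real ?n - 1)"
  have \<omega>: "0 < \<omega>" by (simp add: \<omega>_def)
  have K: "0 < ?K" using sharp_const_pos[OF n] .
  have ps: "0 < 1 + sig x" for x :: 'a by (rule one_plus_sig)
  have contu: "continuous_on UNIV u"
    by (rule has_derivative_continuous_on[where f' = "\<lambda>x h. g x \<bullet> h"]) (simp add: der)
  have cs: "continuous_on UNIV (sig :: 'a \<Rightarrow> real)" by (rule continuous_sig[OF n])
  have cb: "continuous_on UNIV (grad_bubble :: 'a \<Rightarrow> 'a)" by (rule continuous_grad_bubble[OF n])
  have [measurable]: "u \<in> borel_measurable borel" "g \<in> borel_measurable borel"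
      "(grad_bubble :: 'a \<Rightarrow> 'a) \<in> borel_measurable borel"
    using contu cont cb by (auto intro: borel_measurable_continuous_onI)
  have g0: "g x = 0" if "R0 < norm x" for x
  proof -
    have "(u has_derivative (\<lambda>h. 0)) (at x)"
    proof (rule has_derivative_transform_within_open[OF has_derivative_const[of 0]])
      show "open {x. R0 < norm (x::'a)}" by (intro open_Collect_less continuous_intros)
    qed (use that R0 in auto)
    from has_derivative_unique[OF this der] have "g x \<bullet> g x = 0" by metis
    then show ?thesis by simp
  qed
  define w where "w x = bubble x + u x" for x
  define gw where "gw x = grad_bubble x + g x" for x
  have derw: "(w has_derivative (\<lambda>h. gw x \<bullet> h)) (at x)" for x
    unfolding w_def[abs_def] gw_def inner_add_left by (intro has_derivative_add has_derivative_bubble[OF n] der)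
  have contgw: "continuous_on UNIV gw" unfolding gw_def[abs_def] by (intro continuous_on_add cb cont)
  have expw: "exp (w x) = exp (u x) / (1 + sig x) ^ ?n" for x
  proof -
    have "exp (bubble x) = 1 / (1 + sig x) ^ ?n"
      using ps[of x] by (simp add: bubble_def exp_minus inverse_eq_divide exp_of_nat_mult)
    then show ?thesis by (simp add: w_def exp_add)
  qed
  \<comment> \<open>The change of mass caused by \<open>u\<close>. The integrand has bounded
    support, so this same number enters the mass of every large ball and the integral over the whole
    space.\<close>
  define D where "D = (\<integral>x. (exp (u x) - 1) / (1 + sig x) ^ ?n \<partial>lborel)"
  have contD: "continuous_on UNIV (\<lambda>x. (exp (u x) - 1) / (1 + sig x) ^ ?n)"
    by (intro continuous_intros contu cs) (metis ps less_irrefl power_eq_0_iff)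
  have intD: "integrable lborel (\<lambda>x. (exp (u x) - 1) / (1 + sig x) ^ ?n)"
    by (rule integral_compactly_supported_integrable[OF contD, of R0]) (simp add: R0)
  have expmu: "(\<integral>x. exp (u x) \<partial>mu) = 1 + D / \<omega>"
  proof -
    have "(\<integral>x. exp (u x) \<partial>mu) = (\<integral>x. mu_density x * exp (u x) \<partial>lborel)"
      by (rule integral_mu(1)[OF n]) measurable
    also have "\<dots> = (\<integral>x. mu_density x + 1 / \<omega> * ((exp (u x) - 1) / (1 + sig x) ^ ?n) \<partial>lborel)"
      by (intro Bochner_Integration.integral_cong refl) (simp add: mu_density_def \<omega>_def diff_divide_distrib right_diff_distrib)
    also have "\<dots> = 1 + 1 / \<omega> * D"
      using Bochner_Integration.integral_add[OF integral_mu_density(1)[OF n] integrable_mult_right[OF intD, of "1 / \<omega>"]]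
      unfolding D_def integral_mu_density(2)[OF n] integral_mult_right_zero .
    finally show ?thesis by simp
  qed
  have expmu_pos: "0 < 1 + D / \<omega>"
  proof -
    interpret prob_space "mu :: 'a measure" by (rule prob_space_mu[OF n])
    have "continuous_on UNIV (\<lambda>x. \<bar>u x\<bar>)" by (intro continuous_intros contu)
    then have "compact ((\<lambda>x. \<bar>u x\<bar>) ` cball 0 (max R0 0))" 
      by (intro compact_continuous_image) (auto intro: continuous_on_subset)
    then have "bounded ((\<lambda>x. \<bar>u x\<bar>) ` cball 0 (max R0 0))" by (rule compact_imp_bounded)
    then obtain L where L: "\<And>x. x \<in> cball 0 (max R0 0) \<Longrightarrow> \<bar>u x\<bar> \<le> L" unfolding bounded_iff by fastforce
    have L': "\<bar>u x\<bar> \<le> max L 0" for x using L[of x] R0[of x] by (cases "R0 < norm x") (auto simp: le_max_iff_disj)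
    have s: "sets (mu :: 'a measure) = sets borel" by (simp add: mu_def)
    have m: "(\<lambda>x. exp (u x)) \<in> borel_measurable mu"
      unfolding measurable_cong_sets[OF s refl] by measurable
    have "exp (- max L 0) = (\<integral>x. exp (- max L 0) \<partial>(mu :: 'a measure))" by (simp add: prob_space)
    also have "\<dots> \<le> (\<integral>x. exp (u x) \<partial>mu)"
    proof (rule integral_mono)
      show "integrable mu (\<lambda>x. exp (u x))"
        by (rule integrable_const_bound[where B = "exp (max L 0)"]) (use L' m in \<open>auto simp: abs_le_iff\<close>)
      show "exp (- max L 0) \<le> exp (u x)" for x using L'[of x] by (simp only: exp_le_cancel_iff)
    qed simp
    finally show ?thesis unfolding expmu using exp_gt_zero less_le_trans by blast
  qed
  define U where "U = (\<integral>x. u x \<partial>mu)"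
  have U: "(\<integral>x. u x / (1 + sig x) ^ ?n \<partial>lborel) = \<omega> * U"
  proof -
    have "U = (\<integral>x. 1 / \<omega> * (u x / (1 + sig x) ^ ?n) \<partial>lborel)"
      unfolding U_def by (subst integral_mu(1)[OF n]) (auto simp: mu_density_def \<omega>_def)
    also have "\<dots> = 1 / \<omega> * (\<integral>x. u x / (1 + sig x) ^ ?n \<partial>lborel)" by (rule integral_mult_right_zero)
    finally show ?thesis using \<omega> by simp
  qed
  define HH where "HH = (\<integral>x. R_fun (grad_bubble x) (g x) \<partial>lborel)"
  have contR: "continuous_on UNIV (\<lambda>x. R_fun (grad_bubble x) (g x))"
    unfolding R_fun_def by (intro continuous_intros cb cont)
  have R00: "R_fun X 0 = 0" for X :: 'a by (simp add: R_fun_def)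
  have intR: "integrable lborel (\<lambda>x. R_fun (grad_bubble x) (g x))"
    by (rule integral_compactly_supported_integrable[OF contR, of R0]) (simp add: g0 R00)
  \<comment> \<open>The linear term that \<open>R_fun\<close> subtracts. The truncated energy of
    \<open>w\<close> is the sum of \<open>R_fun\<close>, the energy density of the profile and this
    term.\<close>
  define cr where "cr x = real ?n * (norm (grad_bubble x) ^ (?n - 2) * (grad_bubble x \<bullet> g x))" for x
  have cr: "cr x = - (real ?n * \<beta> ^ (?n - 1)) * ((x \<bullet> g x) / (1 + sig x) ^ (?n - 1))" for x
  proof -
    have "norm (grad_bubble x) ^ (?n - 2) * (grad_bubble x \<bullet> g x) = (norm (grad_bubble x) ^ (?n - 2) *\<^sub>R grad_bubble x) \<bullet> g x" by simp
    then show ?thesis unfolding cr_def grad_bubble_power[OF n] \<beta>_def[symmetric] by simp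
  qed
  have "(\<integral>x. cr x \<partial>lborel) = - (real ?n * \<beta> ^ (?n - 1)) * (\<integral>x. (x \<bullet> g x) / (1 + sig x) ^ (?n - 1) \<partial>lborel)"
    unfolding cr by (rule integral_mult_right_zero)
  also have "\<dots> = real ?n * \<beta> ^ (?n - 1) * (real ?n * (\<omega> * U))"
  proof -
    have "(\<integral>x. (x \<bullet> g x) / (1 + sig x) ^ (?n - 1) \<partial>lborel) = - real ?n * (\<integral>x. u x / (1 + sig x) ^ ?n \<partial>lborel)"
      by (rule bubble_divergence[OF n der cont R0])
    also have "\<dots> = - real ?n * (\<omega> * U)" by (simp only: U)
    finally have "(\<integral>x. (x \<bullet> g x) / (1 + sig x) ^ (?n - 1) \<partial>lborel) = - real ?n * (\<omega> * U)" .
    then show ?thesis by (simp only:) simp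
  qed
  \<comment> \<open>Integration by parts produces \<open>n^2 * \<beta> ^ (n - 1) * \<omega>\<close>,
    which is \<open>sharp_const n\<close> again. The mean of \<open>u\<close> thus appears with the
    same factor as the logarithm.\<close>
  also have "\<dots> = ?K * U"
  proof -
    have "\<beta> ^ ?n = \<beta> * \<beta> ^ (?n - 1)" by (metis DIM_positive Suc_diff_1 power_Suc)
    then have "?K = ((real ?n - 1) * \<beta>) * \<beta> ^ (?n - 1) * \<omega>"
      unfolding sharp_const_def \<beta>_def[symmetric] \<omega>_def by simp
    also have "(real ?n - 1) * \<beta> = real ?n * real ?n" using n by (simp add: \<beta>_def power2_eq_square)
    finally show ?thesis by simp
  qed
  finally have int_cr: "(\<integral>x. cr x \<partial>lborel) = ?K * U" .
  have contcr: "continuous_on UNIV cr" unfolding cr_def[abs_def] by (intro continuous_intros cb cont)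
  have intcr: "integrable lborel cr"
    by (rule integral_compactly_supported_integrable[OF contcr, of R0]) (simp add: g0 cr_def)
  obtain M where M: "\<And>x. norm x \<le> R0 \<Longrightarrow> M \<le> w x"
  proof -
    have cw: "continuous_on UNIV w"
      by (rule has_derivative_continuous_on[where f' = "\<lambda>x h. gw x \<bullet> h"]) (simp add: derw)
    have "compact (w ` cball 0 R0)" by (intro compact_continuous_image continuous_on_subset[OF cw]) auto
    then have "bounded (w ` cball 0 R0)" by (rule compact_imp_bounded)
    then obtain L where L: "\<And>z. z \<in> cball 0 R0 \<Longrightarrow> norm (w z) \<le> L" unfolding bounded_iff by blast
    show ?thesis by (rule that[of "- L"]) (use L in \<open>fastforce simp: abs_le_iff\<close>)
  qed
  define s where "s r = rt ?n r ^ ?n" for r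
  \<comment> \<open>The excess of the logarithm of the average over its value for the profile; its
    limit is the logarithm of the \<open>mu\<close>-integral of \<open>exp u\<close>.\<close>
  define \<Lambda> where "\<Lambda> r = ln (1 + D / (\<omega> * (1 - 1 / (1 + s r)) ^ (?n - 1)))" for r
  have s_top: "filterlim s at_top at_top"
    unfolding s_def by (rule filterlim_pow_at_top[OF _ rt_at_top[OF n]]) simp
  have q_lim: "((\<lambda>r. 1 - 1 / (1 + s r)) \<longlongrightarrow> 1) at_top"
  proof -
    have "filterlim (\<lambda>r. 1 + s r) at_infinity at_top"
      by (rule filterlim_at_top_imp_at_infinity, rule filterlim_tendsto_add_at_top[OF tendsto_const s_top])
    then have "((\<lambda>r. 1 / (1 + s r)) \<longlongrightarrow> 0) at_top" by (rule tendsto_divide_0[OF tendsto_const])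
    from tendsto_diff[OF tendsto_const[of 1] this] show ?thesis by simp
  qed
  have l_lim: "(\<Lambda> \<longlongrightarrow> ln (1 + D / \<omega>)) at_top"
  proof -
    have "(\<Lambda> \<longlongrightarrow> ln (1 + D / (\<omega> * 1 ^ (?n - 1)))) at_top"
      unfolding \<Lambda>_def by (intro tendsto_intros q_lim) (use \<omega> expmu_pos in auto)
    then show ?thesis by simp
  qed
  have ev1: "\<forall>\<^sub>F r in at_top. 0 < 1 + D / (\<omega> * (1 - 1 / (1 + s r)) ^ (?n - 1))"
  proof (rule order_tendstoD)
    show "((\<lambda>r. 1 + D / (\<omega> * (1 - 1 / (1 + s r)) ^ (?n - 1))) \<longlongrightarrow> 1 + D / (\<omega> * 1 ^ (?n - 1))) at_top"
      by (intro tendsto_intros q_lim) (use \<omega> in auto)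
  qed (use expmu_pos in simp)
  \<comment> \<open>For large \<open>r\<close> the chosen level lies below all values of
    \<open>w\<close> on the ball containing the support, so the superlevel set is exactly the ball
    of radius \<open>r\<close>.\<close>
  have ev2: "\<forall>\<^sub>F r in at_top. - real ?n * ln (1 + s r) < M"
  proof -
    have "\<forall>\<^sub>F r in at_top. exp (\<bar>M\<bar> / real ?n) \<le> s r" using s_top unfolding filterlim_at_top by blast
    then show ?thesis
    proof eventually_elim
      case (elim r)
      have "\<bar>M\<bar> / real ?n = ln (exp (\<bar>M\<bar> / real ?n))" by simp
      also have "\<dots> < ln (1 + s r)"
        using elim exp_gt_zero[of "\<bar>M\<bar> / real ?n"] by (intro ln_less_cancel_iff[THEN iffD2]) linarith+
      finally have "\<bar>M\<bar> < real ?n * ln (1 + s r)" by (simp add: pos_divide_less_eq mult.commute)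
      then show ?case by linarith
    qed
  qed
  \<comment> \<open>The minimum covers both signs of \<open>\<Lambda> r\<close>; its two entries
    have the same limit because \<open>1 - 1 / (1 + s r)\<close> tends to 1.\<close>
  have main: "?K * min (\<Lambda> r) (\<Lambda> r * (1 - 1 / (1 + s r)) ^ (?n - 1)) - ?K * U \<le> HH"
    if r: "max R0 0 < r" and r1: "0 < 1 + D / (\<omega> * (1 - 1 / (1 + s r)) ^ (?n - 1))" and r2: "- real ?n * ln (1 + s r) < M" for r
  proof -
    have r0: "0 < r" "R0 < r" using r by auto
    define c where "c = - real ?n * ln (1 + s r)"
    have sr: "0 < s r" unfolding s_def using rt_pos[OF r0(1)] by simp
    have out: "w x = - real ?n * ln (1 + s (norm x))" if "R0 < norm x" for x
      using R0[OF that] by (simp add: w_def bubble_def sig_def s_def)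
    have s_lt: "s a < s b" if "0 \<le> a" "a < b" for a b
      using that n powr_less_mono2[of "real ?n / (real ?n - 1)" a b] rt_power(2)[OF n, of a] rt_power(2)[OF n, of b]
      by (simp add: s_def)
    have s_mono: "s a < s b \<longleftrightarrow> a < b" if "0 \<le> a" "0 \<le> b" for a b
      using s_lt[OF that(1), of b] s_lt[OF that(2), of a] by (cases a b rule: linorder_cases) auto
    have superlevel: "{x. c < w x} = ball 0 r"
    proof (intro set_eqI iffI)
      fix x assume "x \<in> {x. c < w x}"
      show "x \<in> ball 0 r"
      proof (cases "R0 < norm x")
        case True
        then have "ln (1 + s (norm x)) < ln (1 + s r)" using \<open>x \<in> {x. c < w x}\<close> out by (simp add: c_def)
        moreover have "0 \<le> s (norm x)" by (simp add: s_def rt_nonneg)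
        ultimately have "s (norm x) < s r" using sr by (subst (asm) ln_less_cancel_iff) auto
        then show ?thesis using s_mono[of "norm x" r] r0 by simp
      qed (use r0 in auto)
    next
      fix x :: 'a assume "x \<in> ball 0 r"
      show "x \<in> {x. c < w x}"
      proof (cases "R0 < norm x")
        case True
        have "s (norm x) < s r" using s_mono[of "norm x" r] r0 \<open>x \<in> ball 0 r\<close> by simp
        moreover have "0 \<le> s (norm x)" by (simp add: s_def rt_nonneg)
        ultimately have "ln (1 + s (norm x)) < ln (1 + s r)" by (subst ln_less_cancel_iff) auto
        then show ?thesis using out[OF True] by (simp add: c_def)
      next
        case False
        then show ?thesis using M[of x] r2 by (simp add: c_def)
      qed
    qed
    interpret B: bounded_superlevel w gw c
      by unfold_locales (use derw contgw n in \<open>auto simp: superlevel\<close>)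
    have vol: "B.vol c = \<omega> * r ^ ?n"
      unfolding B.vol_def superlevel using r0 by (simp add: content_ball \<omega>_def)
    define q where "q = 1 - 1 / (1 + s r)"
    have q: "0 < q" "q \<le> 1" using sr by (auto simp: q_def)
    have ec: "exp c = 1 / (1 + s r) ^ ?n"
      using sr by (simp add: c_def exp_minus inverse_eq_divide exp_of_nat_mult)
    let ?ib = "\<lambda>x :: 'a. indicator (ball 0 r) x * (1 / (1 + sig x) ^ ?n) :: real"
    have intb: "integrable lborel ?ib"
    proof -
      have "integrable (lborel :: 'a measure) (\<lambda>x. 1 / (1 + sig x) ^ ?n)"
        using bubble_mass(1)[where 'a='a, OF n] by (simp add: sig_def)
      then have "integrable lborel (\<lambda>x :: 'a. 1 / (1 + sig x) ^ ?n * indicator (ball 0 r) x)"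
        by (intro integrable_real_mult_indicator) auto
      then show ?thesis by (simp add: mult.commute)
    qed
    have mass: "B.mass c = \<omega> * q ^ (?n - 1) + D"
    proof -
      have "B.mass c = (\<integral>x. ?ib x + (exp (u x) - 1) / (1 + sig x) ^ ?n \<partial>lborel)"
        unfolding B.mass_def superlevel
      proof (intro Bochner_Integration.integral_cong refl)
        fix x
        show "indicator (ball 0 r) x * exp (w x) = ?ib x + (exp (u x) - 1) / (1 + sig x) ^ ?n"
        proof (cases "norm x < r")
          case True
          then show ?thesis by (simp add: expw diff_divide_distrib)
        next
          case False
          then show ?thesis using R0[of x] r0 by simp
        qed
      qed
      also have "\<dots> = (\<integral>x. ?ib x \<partial>(lborel :: 'a measure)) + D"
        unfolding D_def by (rule Bochner_Integration.integral_add[OF intb intD])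
      also have "(\<integral>x. ?ib x \<partial>(lborel :: 'a measure)) = \<omega> * q ^ (?n - 1)"
        using bubble_mass_ball[where 'a='a, OF n r0(1)] by (simp add: sig_def q_def s_def \<omega>_def)
      finally show ?thesis .
    qed
    have ratio: "B.ratio c = (1 + s r) * (1 + D / (\<omega> * q ^ (?n - 1)))"
    proof -
      \<comment> \<open>Both sides are powers of \<open>rt ?n r\<close> with exponent
        \<open>n (n - 1)\<close>. This turns volume times \<open>exp c\<close> into
        \<open>\<omega> * q ^ (n - 1) / (1 + s r)\<close>, so the powers of \<open>q\<close> cancel
        in the average.\<close>
      have rn: "r ^ ?n = s r ^ (?n - 1)"
      proof -
        have "r ^ ?n = (rt ?n r ^ (?n - 1)) ^ ?n" using rt_power(1)[OF n, of r] r0 by simp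
        also have "\<dots> = (rt ?n r ^ ?n) ^ (?n - 1)" by (simp only: power_mult[symmetric] mult.commute)
        finally show ?thesis by (simp add: s_def)
      qed
      define p where "p = 1 + s r"
      have p: "0 < p" using sr by (simp add: p_def)
      have q': "q = s r / p" using p by (simp add: q_def p_def field_simps)
      have pn: "p ^ ?n = p * p ^ (?n - 1)" by (metis DIM_positive Suc_diff_1 power_Suc)
      have v: "B.vol c * exp c = \<omega> * q ^ (?n - 1) / p"
        unfolding vol ec rn q' p_def[symmetric] pn power_divide by simp
      have "(\<omega> * Q + D) / (\<omega> * Q / p) = p * (1 + D / (\<omega> * Q))" if "0 < Q" for Q
        using \<omega> p that by (simp add: field_simps)
      from this[of "q ^ (?n - 1)"] q show ?thesis
        unfolding B.ratio_def mass v p_def[symmetric] by simp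
    qed
    have rl: "ln (B.ratio c) = ln (1 + s r) + \<Lambda> r"
      unfolding ratio \<Lambda>_def q_def using sr r1 by (subst ln_mult) auto
    have ne: "{x. c < w x} \<noteq> {}" unfolding superlevel using r0 by simp
    have E: "B.energy c = HH + ?K * Phi ?n (ln (1 + s r)) + ?K * U"
    proof -
      let ?ie = "\<lambda>x :: 'a. indicator (ball 0 r) x * norm (grad_bubble x) ^ ?n"
      have ie: "integrable lborel ?ie"
        by (rule B.integrable_superlevel_continuous) (auto simp: superlevel intro!: continuous_intros cb)
      have "B.energy c = (\<integral>x. (R_fun (grad_bubble x) (g x) + ?ie x) + cr x \<partial>lborel)"
        unfolding B.energy_def superlevel
      proof (intro Bochner_Integration.integral_cong refl)
        fix x
        show "indicator (ball 0 r) x * norm (gw x) ^ ?n = (R_fun (grad_bubble x) (g x) + ?ie x) + cr x"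
        proof (cases "norm x < r")
          case True
          then show ?thesis by (simp add: R_fun_def cr_def gw_def)
        next
          case False
          then have "g x = 0" using g0 r0 by simp
          then show ?thesis using False by (simp add: R00 cr_def)
        qed
      qed
      also have "\<dots> = (HH + (\<integral>x. ?ie x \<partial>lborel)) + ?K * U"
        using Bochner_Integration.integral_add[OF Bochner_Integration.integrable_add[OF intR ie] intcr]
          Bochner_Integration.integral_add[OF intR ie] int_cr by (simp add: HH_def)
      also have "(\<integral>x. ?ie x \<partial>lborel) = ?K * Phi ?n (ln (1 + s r))"
        using bubble_energy_ball[where 'a='a, OF n r0(1)] unfolding norm_grad_bubble[OF n] s_def sig_def .
      finally show ?thesis by simp
    qed
    have "?K * Phi ?n (ln (1 + s r) + \<Lambda> r) \<le> HH + ?K * Phi ?n (ln (1 + s r)) + ?K * U"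
      using B.energy_ge_Phi[OF ne] unfolding E rl .
    then have 1: "?K * (Phi ?n (ln (1 + s r) + \<Lambda> r) - Phi ?n (ln (1 + s r))) - ?K * U \<le> HH"
      by (simp add: right_diff_distrib)
    \<comment> \<open>If \<open>\<Lambda> r\<close> is nonnegative, the derivative of
      \<open>Phi\<close> is at least its value at the left end,
      \<open>(1 - 1 / (1 + s r)) ^ (n - 1)\<close>; if it is negative, the derivative is at most
      1.\<close>
    have "min (\<Lambda> r) (\<Lambda> r * (1 - 1 / (1 + s r)) ^ (?n - 1)) \<le> Phi ?n (ln (1 + s r) + \<Lambda> r) - Phi ?n (ln (1 + s r))"
    proof (cases "0 \<le> \<Lambda> r")
      case True
      have "exp (- ln (1 + s r)) = 1 / (1 + s r)" using sr by (simp add: exp_minus inverse_eq_divide)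
      then have "\<Lambda> r * (1 - 1 / (1 + s r)) ^ (?n - 1) \<le> Phi ?n (ln (1 + s r) + \<Lambda> r) - Phi ?n (ln (1 + s r))"
        using Phi_diff_bounds(2)[of ?n "ln (1 + s r)" "ln (1 + s r) + \<Lambda> r"] True sr by simp
      then show ?thesis by linarith
    next
      case False
      have "0 \<le> ln (1 + s r) + \<Lambda> r" using B.ratio_ge_1[OF order_refl ne] unfolding rl[symmetric] by simp
      then have "Phi ?n (ln (1 + s r)) - Phi ?n (ln (1 + s r) + \<Lambda> r) \<le> - \<Lambda> r"
        using Phi_diff_bounds(3)[of ?n "ln (1 + s r) + \<Lambda> r" "ln (1 + s r)"] False by simp
      then show ?thesis by linarith
    qed
    then have "?K * min (\<Lambda> r) (\<Lambda> r * (1 - 1 / (1 + s r)) ^ (?n - 1)) \<le> ?K * (Phi ?n (ln (1 + s r) + \<Lambda> r) - Phi ?n (ln (1 + s r)))"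
      using K by (intro mult_left_mono) auto
    then show ?thesis using 1 by linarith
  qed
  have "((\<lambda>r. ?K * min (\<Lambda> r) (\<Lambda> r * (1 - 1 / (1 + s r)) ^ (?n - 1)) - ?K * U) \<longlongrightarrow>
    ?K * min (ln (1 + D / \<omega>)) (ln (1 + D / \<omega>) * 1 ^ (?n - 1)) - ?K * U) at_top"
    by (intro tendsto_intros l_lim q_lim)
  moreover have "\<forall>\<^sub>F r in at_top. ?K * min (\<Lambda> r) (\<Lambda> r * (1 - 1 / (1 + s r)) ^ (?n - 1)) - ?K * U \<le> HH"
    using ev1 ev2 eventually_gt_at_top[of "max R0 0"] by eventually_elim (rule main)
  ultimately have "?K * min (ln (1 + D / \<omega>)) (ln (1 + D / \<omega>) * 1 ^ (?n - 1)) - ?K * U \<le> HH"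
    by (rule tendsto_upperbound) simp
  then have "?K * (ln (\<integral>x. exp (u x) \<partial>mu) - U) \<le> HH" by (simp add: expmu right_diff_distrib)
  then have "ln (\<integral>x. exp (u x) \<partial>mu) - U \<le> HH / ?K" using K by (simp add: field_simps)
  also have "HH / ?K = alpha ?n * (\<integral>x. H_fun x (g x) \<partial>lborel)"
  proof -
    define N where "N = real ?n"
    have N: "2 \<le> N" using n by (simp add: N_def)
    have "(\<integral>x. H_fun x (g x) \<partial>lborel) = ((N - 1) / N) ^ ?n * HH"
      unfolding H_fun_eq[OF n] HH_def N_def by (rule integral_mult_right_zero)
    moreover have "(N / (N - 1)) ^ ?n * ((N - 1) / N) ^ ?n = 1"
      using N unfolding power_mult_distrib[symmetric] by simp
    ultimately show ?thesis
      unfolding alpha_eq[OF n] N_def[symmetric] by (simp add: mult.assoc[symmetric])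
  qed
  finally show ?thesis by (simp add: U_def)
qed

section \<open>Optimality of the constant\<close>

lemma frechet_derivative_eqI: "(f has_derivative D) (at x) \<Longrightarrow> frechet_derivative f (at x) = D"
  by (rule frechet_derivative_at[symmetric])

lemma continuously_differentiable_SucI:
  assumes "\<And>x. (f has_derivative D x) (at x)" "\<And>h. continuously_differentiable k (\<lambda>x. D x h)"
  shows "continuously_differentiable (Suc k) f"
  using assms by (auto simp: frechet_derivative_eqI[OF assms(1)] differentiable_def)

lemma continuously_differentiable_SucE:
  assumes "continuously_differentiable (Suc k) f"
  obtains D where "\<And>x. (f has_derivative D x) (at x)" "\<And>h. continuously_differentiable k (\<lambda>x. D x h)"
proof (rule that)
  show "(f has_derivative frechet_derivative f (at x)) (at x)" for x
    using assms by (simp add: frechet_derivative_works)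
  show "continuously_differentiable k (\<lambda>x. frechet_derivative f (at x) h)" for h using assms by simp
qed

lemma continuously_differentiable_Suc_imp:
  "continuously_differentiable (Suc k) f \<Longrightarrow> continuously_differentiable k f"
proof (induction k arbitrary: f)
  case 0
  obtain D where D: "\<And>x. (f has_derivative D x) (at x)"
    by (rule continuously_differentiable_SucE[OF 0], rule that)
  have "continuous_on UNIV f" by (rule has_derivative_continuous_on[where f' = D]) (simp add: D)
  then show ?case by simp
next
  case (Suc k)
  obtain D where D: "\<And>x. (f has_derivative D x) (at x)" "\<And>h. continuously_differentiable (Suc k) (\<lambda>x. D x h)"
    by (rule continuously_differentiable_SucE[OF Suc.prems], rule that)
  show ?case by (rule continuously_differentiable_SucI[OF D(1)]) (rule Suc.IH[OF D(2)])
qed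

lemma continuously_differentiable_const: "continuously_differentiable k (\<lambda>x. c)"
proof (induction k arbitrary: c)
  case (Suc k)
  show ?case by (rule continuously_differentiable_SucI[OF has_derivative_const]) (rule Suc)
qed simp

lemma continuously_differentiable_add:
  "continuously_differentiable k f \<Longrightarrow> continuously_differentiable k g \<Longrightarrow> continuously_differentiable k (\<lambda>x. f x + g x)"
proof (induction k arbitrary: f g)
  case 0 then show ?case by (simp add: continuous_on_add)
next
  case (Suc k)
  obtain D where D: "\<And>x. (f has_derivative D x) (at x)" "\<And>h. continuously_differentiable k (\<lambda>x. D x h)"
    by (rule continuously_differentiable_SucE[OF Suc.prems(1)], rule that)
  obtain E where E: "\<And>x. (g has_derivative E x) (at x)" "\<And>h. continuously_differentiable k (\<lambda>x. E x h)"
    by (rule continuously_differentiable_SucE[OF Suc.prems(2)], rule that)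
  show ?case
    by (rule continuously_differentiable_SucI[OF has_derivative_add[OF D(1) E(1)]]) (rule Suc.IH[OF D(2) E(2)])
qed

lemma continuously_differentiable_mult:
  fixes f g :: "'a::real_normed_vector \<Rightarrow> real"
  shows "continuously_differentiable k f \<Longrightarrow> continuously_differentiable k g \<Longrightarrow> continuously_differentiable k (\<lambda>x. f x * g x)"
proof (induction k arbitrary: f g)
  case 0 then show ?case by (simp add: continuous_on_mult)
next
  case (Suc k)
  obtain D where D: "\<And>x. (f has_derivative D x) (at x)" "\<And>h. continuously_differentiable k (\<lambda>x. D x h)"
    by (rule continuously_differentiable_SucE[OF Suc.prems(1)], rule that)
  obtain E where E: "\<And>x. (g has_derivative E x) (at x)" "\<And>h. continuously_differentiable k (\<lambda>x. E x h)"
    by (rule continuously_differentiable_SucE[OF Suc.prems(2)], rule that)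
  note fg = continuously_differentiable_Suc_imp[OF Suc.prems(1)] continuously_differentiable_Suc_imp[OF Suc.prems(2)]
  show ?case
    by (rule continuously_differentiable_SucI[OF has_derivative_mult[OF D(1) E(1)]])
      (rule continuously_differentiable_add[OF Suc.IH[OF fg(1) E(2)] Suc.IH[OF D(2) fg(2)]])
qed

lemma continuously_differentiable_inner_left: "continuously_differentiable k (\<lambda>x. x \<bullet> a)"
proof (cases k)
  case (Suc j)
  show ?thesis unfolding Suc
    by (rule continuously_differentiable_SucI[OF has_derivative_inner_left[OF has_derivative_ident]])
      (rule continuously_differentiable_const)
qed (auto intro!: continuous_intros)

lemma continuously_differentiable_norm_square: "continuously_differentiable k (\<lambda>x :: 'a::euclidean_space. x \<bullet> x)"
proof (cases k)
  case (Suc j)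
  show ?thesis unfolding Suc
  proof (rule continuously_differentiable_SucI)
    show "((\<lambda>x::'a. x \<bullet> x) has_derivative (\<lambda>h. x \<bullet> h + h \<bullet> x)) (at x)" for x
      by (intro has_derivative_inner has_derivative_ident)
    show "continuously_differentiable j (\<lambda>x::'a. x \<bullet> h + h \<bullet> x)" for h
      using continuously_differentiable_add[OF continuously_differentiable_inner_left[of j h] continuously_differentiable_inner_left[of j h]]
      by (simp add: inner_commute[of h])
  qed
qed (auto intro!: continuous_intros)

lemma continuously_differentiable_inverse:
  fixes f :: "'a::real_normed_vector \<Rightarrow> real"
  assumes pos: "\<And>x. 0 < f x"
  shows "continuously_differentiable k f \<Longrightarrow> continuously_differentiable k (\<lambda>x. inverse (f x))"
proof (induction k)
  case 0 then show ?case using pos by (auto intro!: continuous_intros) (metis less_irrefl)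
next
  case (Suc k)
  obtain D where D: "\<And>x. (f has_derivative D x) (at x)" "\<And>h. continuously_differentiable k (\<lambda>x. D x h)"
    by (rule continuously_differentiable_SucE[OF Suc.prems], rule that)
  note IH = Suc.IH[OF continuously_differentiable_Suc_imp[OF Suc.prems]]
  have nz: "f x \<noteq> 0" for x using pos[of x] by simp
  have d: "((\<lambda>x. inverse (f x)) has_derivative (\<lambda>h. - (inverse (f x) * D x h * inverse (f x)))) (at x)" for x
    by (rule Deriv.has_derivative_inverse[OF nz D(1)])
  have "continuously_differentiable k (\<lambda>x. (- 1) * (inverse (f x) * D x h * inverse (f x)))" for h
    by (intro continuously_differentiable_mult continuously_differentiable_const IH D)
  then show ?case by (intro continuously_differentiable_SucI[OF d]) simp
qed

lemma continuously_differentiable_ln: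
  fixes f :: "'a::real_normed_vector \<Rightarrow> real"
  assumes pos: "\<And>x. 0 < f x" and f: "continuously_differentiable k f"
  shows "continuously_differentiable k (\<lambda>x. ln (f x))"
proof (cases k)
  case 0 then show ?thesis using f pos by (auto intro!: continuous_intros) (metis less_irrefl)
next
  case (Suc j)
  obtain D where D: "\<And>x. (f has_derivative D x) (at x)" "\<And>h. continuously_differentiable j (\<lambda>x. D x h)"
    by (rule continuously_differentiable_SucE[OF f[unfolded Suc]], rule that)
  have d: "((\<lambda>x. ln (f x)) has_derivative (\<lambda>h. D x h * inverse (f x))) (at x)" for x
    by (rule has_derivative_ln[OF pos D(1)])
  show ?thesis unfolding Suc
    by (rule continuously_differentiable_SucI[OF d])
      (intro continuously_differentiable_mult D continuously_differentiable_inverse pos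
        continuously_differentiable_Suc_imp[OF f[unfolded Suc]])
qed

text \<open>The functions \<open>t\<^sup>-\<^sup>m e\<^sup>-\<^sup>1\<^sup>/\<^sup>t\<close>, whose span is closed under differentiation.\<close>

definition flat_exp :: "nat \<Rightarrow> real \<Rightarrow> real" where
  "flat_exp m t = (if 0 < t then (1 / t) ^ m * exp (- (1 / t)) else 0)"

lemma flat_nonneg: "0 \<le> flat_exp m t" by (simp add: flat_exp_def)
lemma flat_0_pos: "0 < t \<Longrightarrow> 0 < flat_exp 0 t" by (simp add: flat_exp_def)

text \<open>Only the origin needs an argument: from the right, with \<open>y = 1 / h\<close>, the
  difference quotient is \<open>y ^ (m + 1) / exp y\<close>, which tends to 0.\<close>

lemma DERIV_flat: "DERIV (flat_exp m) t :> flat_exp (m + 2) t - m * flat_exp (m + 1) t"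
proof -
  consider "0 < t" | "t < 0" | "t = 0" by linarith
  then show ?thesis
  proof cases
    case 1
    have "DERIV (\<lambda>t. (1 / t) ^ m * exp (- (1 / t))) t :> flat_exp (m + 2) t - m * flat_exp (m + 1) t"
    proof -
      have d: "DERIV (\<lambda>t. 1 / t) t :> - ((1 / t) ^ 2)"
        using 1 by (auto intro!: derivative_eq_intros simp: power2_eq_square)
      have "DERIV (\<lambda>t. (1 / t) ^ m * exp (- (1 / t))) t :>
          (real m * (- ((1 / t) ^ 2) * (1 / t) ^ (m - Suc 0))) * exp (- (1 / t)) + (exp (- (1 / t)) * (- (- ((1 / t) ^ 2)))) * (1 / t) ^ m"
        by (intro DERIV_mult DERIV_power[OF d] DERIV_fun_exp DERIV_minus d)
      moreover have "(real m * (- ((1 / t) ^ 2) * (1 / t) ^ (m - Suc 0))) * exp (- (1 / t)) + (exp (- (1 / t)) * (- (- ((1 / t) ^ 2)))) * (1 / t) ^ m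
         = flat_exp (m + 2) t - m * flat_exp (m + 1) t"
        using 1 by (cases m) (simp_all add: flat_exp_def power2_eq_square algebra_simps)
      ultimately show ?thesis by metis
    qed
    then show ?thesis
      by (rule has_field_derivative_transform_within_open[where S = "{0<..}"]) (use 1 in \<open>auto simp: flat_exp_def\<close>)
  next
    case 2
    have "DERIV (\<lambda>t. 0) t :> flat_exp (m + 2) t - m * flat_exp (m + 1) t" using 2 by (simp add: flat_exp_def)
    then show ?thesis
      by (rule has_field_derivative_transform_within_open[where S = "{..<0}"]) (use 2 in \<open>auto simp: flat_exp_def\<close>)
  next
    case 3
    have "((\<lambda>y::real. y ^ (m + 1) / exp y) \<longlongrightarrow> 0) at_top" by (rule tendsto_power_div_exp_0)
    then have "((\<lambda>h::real. inverse h ^ (m + 1) / exp (inverse h)) \<longlongrightarrow> 0) (at_right 0)"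
      by (rule filterlim_compose[OF _ filterlim_inverse_at_top_right])
    moreover have "\<forall>\<^sub>F h in at_right 0. inverse h ^ (m + 1) / exp (inverse h) = (flat_exp m (0 + h) - flat_exp m 0) / h"
      by (rule eventually_at_rightI[of 0 1]) (auto simp: flat_exp_def exp_minus divide_inverse)
    ultimately have r: "((\<lambda>h. (flat_exp m (0 + h) - flat_exp m 0) / h) \<longlongrightarrow> 0) (at_right 0)"
      by (rule Lim_transform_eventually)
    have l: "((\<lambda>h. (flat_exp m (0 + h) - flat_exp m 0) / h) \<longlongrightarrow> 0) (at_left 0)"
    proof (rule Lim_transform_eventually[OF tendsto_const])
      show "\<forall>\<^sub>F h in at_left 0. 0 = (flat_exp m (0 + h) - flat_exp m 0) / h"
        by (rule eventually_at_leftI[of "-1"]) (auto simp: flat_exp_def)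
    qed
    from l r have "((\<lambda>h. (flat_exp m (0 + h) - flat_exp m 0) / h) \<longlongrightarrow> 0) (at 0)" by (simp add: filterlim_at_split)
    then show ?thesis using 3 by (simp add: DERIV_def flat_exp_def)
  qed
qed

lemma continuously_differentiable_flat:
  fixes f :: "'a::real_normed_vector \<Rightarrow> real"
  shows "continuously_differentiable k f \<Longrightarrow> continuously_differentiable k (\<lambda>x. flat_exp m (f x))"
proof (induction k arbitrary: m)
  case 0
  have "isCont (flat_exp m) t" for t using DERIV_flat by (rule DERIV_isCont)
  then have "continuous_on UNIV (flat_exp m)" by (simp add: continuous_at_imp_continuous_on)
  then show ?case using 0 by (auto intro: continuous_on_compose2)
next
  case (Suc k)
  obtain D where D: "\<And>x. (f has_derivative D x) (at x)" "\<And>h. continuously_differentiable k (\<lambda>x. D x h)"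
    by (rule continuously_differentiable_SucE[OF Suc.prems], rule that)
  note IH = Suc.IH[OF continuously_differentiable_Suc_imp[OF Suc.prems]]
  have d: "((\<lambda>x. flat_exp m (f x)) has_derivative (\<lambda>h. D x h * (flat_exp (m + 2) (f x) + (- m) * flat_exp (m + 1) (f x)))) (at x)" for x
    using DERIV_compose_FDERIV[OF DERIV_flat D(1)] by simp
  show ?case
    by (rule continuously_differentiable_SucI[OF d])
      (intro continuously_differentiable_mult continuously_differentiable_add continuously_differentiable_const IH D)
qed

text \<open>A quotient a / (a + b) of flat functions that never vanish together: a is positive
  inside radius 2 and b outside radius 1.\<close>

definition cutoff :: "'a::euclidean_space \<Rightarrow> real" where
  "cutoff x = flat_exp 0 (4 - x \<bullet> x) * inverse (flat_exp 0 (4 - x \<bullet> x) + flat_exp 0 (x \<bullet> x - 1))"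

lemma cutoff_denominator_pos: "0 < flat_exp 0 (4 - t) + flat_exp 0 (t - 1)"
  using flat_nonneg[of 0 "4 - t"] flat_nonneg[of 0 "t - 1"] flat_0_pos[of "4 - t"] flat_0_pos[of "t - 1"]
  by (cases "t < 4") (auto intro: add_pos_nonneg add_nonneg_pos)

lemma smooth_cutoff: "smooth (cutoff :: 'a::euclidean_space \<Rightarrow> real)"
  unfolding smooth_def
proof
  fix k
  have a: "continuously_differentiable k (\<lambda>x::'a. 4 + (- 1) * (x \<bullet> x))" "continuously_differentiable k (\<lambda>x::'a. x \<bullet> x + - 1)"
    by (intro continuously_differentiable_add continuously_differentiable_mult continuously_differentiable_const continuously_differentiable_norm_square)+
  have b: "continuously_differentiable k (\<lambda>x::'a. flat_exp 0 (4 - x \<bullet> x))" "continuously_differentiable k (\<lambda>x::'a. flat_exp 0 (x \<bullet> x - 1))"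
    using continuously_differentiable_flat[OF a(1), of 0] continuously_differentiable_flat[OF a(2), of 0] by simp_all
  show "continuously_differentiable k (cutoff :: 'a \<Rightarrow> real)"
    unfolding cutoff_def[abs_def]
    by (intro continuously_differentiable_mult continuously_differentiable_inverse continuously_differentiable_add b cutoff_denominator_pos)
qed

lemma norm_le_iff_inner: "0 \<le> c \<Longrightarrow> norm x \<le> c \<longleftrightarrow> x \<bullet> x \<le> c ^ 2"
  by (metis dot_square_norm norm_ge_zero power2_le_imp_le power_mono)

lemma cutoff_eq_1: "norm x \<le> 1 \<Longrightarrow> cutoff x = 1"
  using cutoff_denominator_pos[of "x \<bullet> x"] norm_le_iff_inner[of 1 x] by (simp add: cutoff_def flat_exp_def[of 0 "x \<bullet> x - 1"])

lemma cutoff_eq_0: "2 \<le> norm x \<Longrightarrow> cutoff x = 0"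
proof -
  assume "2 \<le> norm x"
  then have "2 ^ 2 \<le> norm x ^ 2" by (intro power_mono) auto
  then have "4 \<le> x \<bullet> x" by (simp add: dot_square_norm)
  then show ?thesis by (simp add: cutoff_def flat_exp_def[of 0 "4 - x \<bullet> x"])
qed

lemma cutoff_bounds: "0 \<le> cutoff x" "cutoff x \<le> 1"
proof -
  have p: "0 < flat_exp 0 (4 - x \<bullet> x) + flat_exp 0 (x \<bullet> x - 1)" by (rule cutoff_denominator_pos)
  show "0 \<le> cutoff x" unfolding cutoff_def using p flat_nonneg by (intro mult_nonneg_nonneg) auto
  show "cutoff x \<le> 1" unfolding cutoff_def using p flat_nonneg[of 0 "x \<bullet> x - 1"] by (simp add: divide_inverse[symmetric])
qed

section \<open>Energy and entropy of smoothed logarithmic peaks\<close>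

lemma alpha_closed:
  assumes n: "2 \<le> n"
  shows "alpha n = 1 / ((real n - 1) * real n ^ n * unit_ball_vol n)"
proof -
  define N where "N = real n"
  have N: "2 \<le> N" using n by (simp add: N_def)
  have "(N ^ 2 / (N - 1)) ^ n = (N / (N - 1)) ^ n * N ^ n"
    by (simp add: power2_eq_square power_mult_distrib[symmetric])
  then show ?thesis
    unfolding alpha_eq[OF n] using N by (simp add: sharp_const_def N_def[symmetric])
qed

lemma alpha_pos: "2 \<le> n \<Longrightarrow> 0 < alpha n"
  unfolding alpha_closed by (intro divide_pos_pos mult_pos_pos zero_less_power) auto

lemma power_add_diff_le:
  fixes a b :: real
  assumes "0 \<le> a" "0 \<le> b"
  shows "(a + b) ^ k \<le> b ^ k + k * a * (a + b) ^ (k - 1)"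
proof (induction k)
  case (Suc k)
  have "(a + b) ^ Suc k = b * (a + b) ^ k + a * (a + b) ^ k" by (simp add: algebra_simps)
  also have "b * (a + b) ^ k \<le> b * (b ^ k + k * a * (a + b) ^ (k - 1))" using Suc assms by (intro mult_left_mono)
  also have "\<dots> \<le> b ^ Suc k + k * a * (a + b) ^ k"
  proof (cases k)
    case (Suc j)
    have "b * (a + b) ^ j \<le> (a + b) * (a + b) ^ j" using assms by (intro mult_right_mono) auto
    then have "real k * a * (b * (a + b) ^ j) \<le> real k * a * ((a + b) * (a + b) ^ j)" using assms by (intro mult_left_mono) auto
    then show ?thesis by (simp add: Suc algebra_simps)
  qed simp
  finally show ?case by (simp add: algebra_simps)
qed simp

text \<open>Where \<open>Y\<close> is large, the remainder is \<open>norm Y ^ n\<close> up to terms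
  of order \<open>n - 1\<close>, uniformly for \<open>X\<close> in a ball. On a high peak the energy
  is therefore asymptotically that of \<open>u\<close> alone.\<close>

lemma R_fun_le:
  fixes X Y :: "'a::euclidean_space" and a :: real
  assumes n: "2 \<le> DIM('a)" and X: "norm X \<le> a"
  shows "R_fun X Y \<le> norm Y ^ DIM('a) + 2 * DIM('a) * a * (a + norm Y) ^ (DIM('a) - 1)"
proof -
  let ?n = "DIM('a)"
  have a: "0 \<le> a" using X norm_ge_zero order_trans by blast
  have "norm (X + Y) ^ ?n \<le> (a + norm Y) ^ ?n"
    using norm_triangle_ineq[of X Y] X by (intro power_mono) auto
  also have "\<dots> \<le> norm Y ^ ?n + ?n * a * (a + norm Y) ^ (?n - 1)" by (rule power_add_diff_le[OF a norm_ge_zero])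
  finally have 1: "norm (X + Y) ^ ?n \<le> norm Y ^ ?n + ?n * a * (a + norm Y) ^ (?n - 1)" .
  have "- (norm X ^ (?n - 2) * (X \<bullet> Y)) \<le> norm X ^ (?n - 2) * (norm X * norm Y)"
  proof -
    have "- (X \<bullet> Y) \<le> norm X * norm Y" using norm_cauchy_schwarz[of X "- Y"] by simp
    then have "norm X ^ (?n - 2) * (- (X \<bullet> Y)) \<le> norm X ^ (?n - 2) * (norm X * norm Y)" by (intro mult_left_mono) auto
    then show ?thesis by simp
  qed
  also have "\<dots> \<le> (a + norm Y) ^ (?n - 2) * (a * (a + norm Y))"
  proof -
    have "norm X \<le> a + norm Y" using X norm_ge_zero[of Y] by linarith
    then show ?thesis using X a by (intro mult_mono power_mono) auto
  qed
  also have "\<dots> = a * (a + norm Y) ^ (?n - 1)"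
  proof -
    have "?n - 1 = Suc (?n - 2)" using n by arith
    then show ?thesis by (simp only: power_Suc) simp
  qed
  finally have "real ?n * (- (norm X ^ (?n - 2) * (X \<bullet> Y))) \<le> real ?n * (a * (a + norm Y) ^ (?n - 1))"
    by (intro mult_left_mono) auto
  then have 2: "- (real ?n * norm X ^ (?n - 2) * (X \<bullet> Y)) \<le> real ?n * a * (a + norm Y) ^ (?n - 1)" by simp
  have "0 \<le> norm X ^ ?n" by simp
  then show ?thesis using 1 2 unfolding R_fun_def by linarith
qed

lemma norm_grad_bubble_le:
  assumes n: "2 \<le> DIM('a)"
  shows "norm (grad_bubble (x::'a::euclidean_space)) \<le> real DIM('a) ^ 2 / (real DIM('a) - 1)"
proof -
  let ?n = "DIM('a)"
  define t where "t = rt ?n (norm x)"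
  have t: "0 \<le> t" by (simp add: t_def rt_nonneg)
  have "t \<le> 1 + t ^ ?n"
  proof (cases "t \<le> 1")
    case True then show ?thesis using t by (meson add_increasing2 zero_le_power)
  next
    case False
    then have "t ^ 1 \<le> t ^ ?n" by (intro power_increasing) (auto simp: Suc_leI)
    then show ?thesis by simp
  qed
  then have "t / (1 + t ^ ?n) \<le> 1" using t by (simp add: divide_le_eq add_pos_nonneg)
  moreover have "0 \<le> real ?n ^ 2 / (real ?n - 1)" using n by simp
  ultimately have "real ?n ^ 2 / (real ?n - 1) * (t / (1 + t ^ ?n)) \<le> real ?n ^ 2 / (real ?n - 1) * 1" by (rule mult_left_mono)
  then show ?thesis unfolding norm_grad_bubble[OF n] by (simp add: t_def sig_def)
qed

text \<open>The polar weight cancels the singularity, leaving a constant. This kernel absorbs all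
  the terms of order \<open>n - 1\<close>.\<close>

lemma riesz_kernel_integrable:
  assumes n: "2 \<le> DIM('a)" and R: "0 < R"
  shows "integrable (lborel :: 'a::euclidean_space measure) (\<lambda>x. indicator (ball 0 R) x * (1 / norm x ^ (DIM('a) - 1)))"
proof -
  let ?n = "DIM('a)"
  have "integrable (lborel :: 'a measure) (\<lambda>x. indicator {x. ereal (norm x) < ereal R} x * (1 / norm x ^ (?n - 1)))"
  proof (rule radial_FTC_nonneg(1)[where F = "\<lambda>r. real ?n * unit_ball_vol ?n * r" and A = 0 and B = "real ?n * unit_ball_vol ?n * R"])
    show "DERIV (\<lambda>r. real ?n * unit_ball_vol ?n * r) r :> polar_weight ?n r * (1 / r ^ (?n - 1))" if "0 < r" for r
      using that by (auto intro!: derivative_eq_intros simp: polar_weight_def)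
    show "isCont (\<lambda>r. 1 / r ^ (?n - 1)) r" if "0 < r" for r :: real
      using that by (intro continuous_intros) auto
    show "((\<lambda>r. real ?n * unit_ball_vol ?n * r) \<longlongrightarrow> 0) (at_right 0)" by (auto intro!: tendsto_eq_intros)
    show "(((\<lambda>r. real ?n * unit_ball_vol ?n * r) \<circ> real_of_ereal) \<longlongrightarrow> real ?n * unit_ball_vol ?n * R) (at_left (ereal R))"
      by (simp add: ereal_tendsto_simps) (intro tendsto_intros)
  qed (use R in auto)
  moreover have "{x::'a. ereal (norm x) < ereal R} = ball 0 R" by auto
  ultimately show ?thesis by simp
qed

text \<open>The factor \<open>norm x ^ (n - 1)\<close> in the denominator cancels the polar weight
  and leaves \<open>r / (r^2 + \<delta>^2)\<close>, with a logarithm as primitive. This is the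
  source of the term \<open>ln (1 / \<delta>)\<close>.\<close>

lemma log_kernel_integral:
  assumes n: "2 \<le> DIM('a)" and \<delta>: "0 < \<delta>"
  shows "integrable (lborel :: 'a::euclidean_space measure) (\<lambda>x. indicator (ball 0 1) x * (norm x / (norm x ^ (DIM('a) - 1) * (norm x ^ 2 + \<delta> ^ 2))))"
    and "(\<integral>x. indicator (ball 0 1) x * (norm x / (norm x ^ (DIM('a) - 1) * (norm x ^ 2 + \<delta> ^ 2))) \<partial>(lborel :: 'a measure))
      = real DIM('a) * unit_ball_vol DIM('a) / 2 * (ln (1 + \<delta> ^ 2) - ln (\<delta> ^ 2))"
proof -
  let ?n = "DIM('a)"
  define c where "c = real ?n * unit_ball_vol ?n / 2"
  define f where "f = (\<lambda>r::real. r / (r ^ (?n - 1) * (r ^ 2 + \<delta> ^ 2)))"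
  have p: "0 < r ^ 2 + \<delta> ^ 2" for r using \<delta> by (simp add: add_nonneg_pos)
  have e: "{x::'a. ereal (norm x) < ereal 1} = ball 0 1" by auto
  have D: "DERIV (\<lambda>r. c * ln (r ^ 2 + \<delta> ^ 2)) r :> polar_weight ?n r * f r" if r: "0 < r" for r
  proof -
    have "DERIV (\<lambda>r. c * ln (r ^ 2 + \<delta> ^ 2)) r :> c * (2 * r / (r ^ 2 + \<delta> ^ 2))"
      using p[of r] by (auto intro!: derivative_eq_intros simp: power2_eq_square)
    moreover have "c * (2 * r / (r ^ 2 + \<delta> ^ 2)) = polar_weight ?n r * f r"
      using r by (simp add: c_def f_def polar_weight_def)
    ultimately show ?thesis by metis
  qed
  have m: "f \<in> borel_measurable borel" unfolding f_def by measurable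
  have cont: "isCont f r" if "0 < r" for r
    unfolding f_def using that p[of r] by (intro continuous_intros) auto
  have nn: "0 \<le> f r" if "0 < r" for r using that p[of r] by (simp add: f_def)
  have c': "isCont (\<lambda>r. c * ln (r ^ 2 + \<delta> ^ 2)) r" for r
    using p[of r] by (intro continuous_intros) auto
  have A: "((\<lambda>r. c * ln (r ^ 2 + \<delta> ^ 2)) \<longlongrightarrow> c * ln (\<delta> ^ 2)) (at_right 0)"
    using c'[of 0] by (simp add: isCont_def filterlim_at_split)
  have B: "(((\<lambda>r. c * ln (r ^ 2 + \<delta> ^ 2)) \<circ> real_of_ereal) \<longlongrightarrow> c * ln (1 + \<delta> ^ 2)) (at_left (ereal 1))"
    using c'[of 1] by (simp add: isCont_def filterlim_at_split ereal_tendsto_simps)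
  have b: "(0::ereal) < ereal 1" by simp
  note * = radial_FTC_nonneg[where 'a='a, OF m b D cont nn A B, unfolded e]
  show "integrable (lborel :: 'a::euclidean_space measure) (\<lambda>x. indicator (ball 0 1) x * (norm x / (norm x ^ (DIM('a) - 1) * (norm x ^ 2 + \<delta> ^ 2))))"
    using *(1) by (simp add: f_def)
  show "(\<integral>x. indicator (ball 0 1) x * (norm x / (norm x ^ (DIM('a) - 1) * (norm x ^ 2 + \<delta> ^ 2))) \<partial>(lborel :: 'a measure))
      = real DIM('a) * unit_ball_vol DIM('a) / 2 * (ln (1 + \<delta> ^ 2) - ln (\<delta> ^ 2))"
    using *(2) by (simp add: f_def c_def right_diff_distrib)
qed

text \<open>A cut-off peak \<open>k ln (1/|x|)\<close>, smoothed at scale \<open>\<delta>\<close>,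
  in the manner of Moser's test functions.\<close>

definition moser :: "real \<Rightarrow> real \<Rightarrow> 'a::euclidean_space \<Rightarrow> real" where
  "moser k \<delta> x = - (k / 2) * ln (x \<bullet> x + \<delta> ^ 2) * cutoff x"

lemma smooth_moser: "0 < \<delta> \<Longrightarrow> smooth (moser k \<delta> :: 'a::euclidean_space \<Rightarrow> real)"
  unfolding smooth_def
proof
  fix j assume \<delta>: "0 < \<delta>"
  have "continuously_differentiable j (cutoff :: 'a \<Rightarrow> real)" using smooth_cutoff[where 'a='a] by (simp add: smooth_def)
  then show "continuously_differentiable j (moser k \<delta> :: 'a \<Rightarrow> real)"
    unfolding moser_def[abs_def]
    by (intro continuously_differentiable_mult continuously_differentiable_const continuously_differentiable_ln
       continuously_differentiable_add continuously_differentiable_norm_square)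
      (use \<delta> in \<open>simp add: add_nonneg_pos\<close>)
qed

lemma moser_eq_0: "2 \<le> norm x \<Longrightarrow> moser k \<delta> x = 0"
  by (simp add: moser_def cutoff_eq_0)

lemma compactly_supportedI:
  fixes f :: "'a::euclidean_space \<Rightarrow> real"
  assumes "\<And>x. r < norm x \<Longrightarrow> f x = 0" shows "compactly_supported f"
proof -
  have "{x. f x \<noteq> 0} \<subseteq> cball 0 r" using assms by (force simp: not_le[symmetric])
  then have "bounded {x. f x \<noteq> 0}" using bounded_cball bounded_subset by blast
  then show ?thesis by (simp add: compactly_supported_def)
qed

text \<open>What matters is that \<open>C\<close> is independent of \<open>\<delta>\<close>. In the
  unit ball the cutoff is 1 and the gradient is explicit; between radii 1 and 2 neither the
  logarithm nor its gradient sees the singularity.\<close>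

lemma moser_gradient_bounds:
  assumes k: "0 \<le> k"
  shows "\<exists>C\<ge>0. \<forall>\<delta> g x. 0 < \<delta> \<longrightarrow> \<delta> \<le> 1 \<longrightarrow> (\<forall>y. (moser k \<delta> has_derivative (\<lambda>h. g y \<bullet> h)) (at (y::'a::euclidean_space))) \<longrightarrow>
      (norm x < 1 \<longrightarrow> norm (g x) = k * norm x / (norm x ^ 2 + \<delta> ^ 2)) \<and>
      (1 \<le> norm x \<longrightarrow> norm (g x) \<le> C) \<and> (2 < norm x \<longrightarrow> g x = 0)"
proof -
  obtain gc where gc: "\<And>x::'a. (cutoff has_derivative (\<lambda>h. gc x \<bullet> h)) (at x)" "continuous_on UNIV gc"
    using smooth_gradient[OF smooth_cutoff] by metis
  have "compact (gc ` cball 0 2)" by (intro compact_continuous_image continuous_on_subset[OF gc(2)]) auto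
  then have "bounded (gc ` cball 0 2)" by (rule compact_imp_bounded)
  then obtain L where L: "\<And>x. x \<in> cball 0 2 \<Longrightarrow> norm (gc x) \<le> L" unfolding bounded_iff by blast
  have L0: "0 \<le> L" using L[of 0] norm_ge_zero[of "gc 0"] by (simp del: norm_ge_zero)
  have loc: "a = b" if "(f has_derivative (\<lambda>h. a \<bullet> h)) (at x)" "(f' has_derivative (\<lambda>h. b \<bullet> h)) (at x)"
    "open S" "x \<in> S" "\<And>y. y \<in> S \<Longrightarrow> f y = f' y" for f f' :: "'a \<Rightarrow> real" and a b x S
  proof -
    have "(f' has_derivative (\<lambda>h. a \<bullet> h)) (at x)"
      by (rule has_derivative_transform_within_open[OF that(1,3,4,5)])
    from has_derivative_unique[OF this that(2)] have e: "a \<bullet> h = b \<bullet> h" for h by metis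
    then have "(a - b) \<bullet> (a - b) = 0" by (simp add: inner_diff_left)
    then show ?thesis by simp
  qed
  define C where "C = k + k / 2 * ln 5 * L"
  show ?thesis
  proof (intro exI[of _ C] conjI allI impI)
    show C0: "0 \<le> C" using k L0 by (simp add: C_def)
    fix \<delta> :: real and g :: "'a \<Rightarrow> 'a" and x
    assume \<delta>: "0 < \<delta>" "\<delta> \<le> 1" and g': "\<forall>y. (moser k \<delta> has_derivative (\<lambda>h. g y \<bullet> h)) (at y)"
    have g: "(moser k \<delta> has_derivative (\<lambda>h. g y \<bullet> h)) (at y)" for y using g' by blast
    have p: "0 < y \<bullet> y + \<delta> ^ 2" for y :: 'a using \<delta> by (simp add: add_nonneg_pos)
    define l where "l y = - (k / 2) * ln (y \<bullet> y + \<delta> ^ 2)" for y :: 'a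
    define gl where "gl y = (- (k / (y \<bullet> y + \<delta> ^ 2))) *\<^sub>R y" for y :: 'a
    have dl: "(l has_derivative (\<lambda>h. gl y \<bullet> h)) (at y)" for y
    proof -
      have "((\<lambda>y::'a. y \<bullet> y + \<delta> ^ 2) has_derivative (\<lambda>h. y \<bullet> h + h \<bullet> y + 0)) (at y)"
        by (intro has_derivative_add has_derivative_inner has_derivative_ident has_derivative_const)
      from has_derivative_mult_right[OF has_derivative_ln[OF p this], of "- (k / 2)"]
      have "(l has_derivative (\<lambda>h. - (k / 2) * ((y \<bullet> h + h \<bullet> y + 0) * inverse (y \<bullet> y + \<delta> ^ 2)))) (at y)"
        by (simp add: l_def[abs_def])
      moreover have "- (k / 2) * ((y \<bullet> h + h \<bullet> y + 0) * inverse (y \<bullet> y + \<delta> ^ 2)) = gl y \<bullet> h" for h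
      proof -
        have "- (k / 2) * ((p + p + 0) * inverse q) = - (k / q) * p" for p q :: real
          by (cases "q = 0") (simp_all add: field_simps)
        then show ?thesis unfolding gl_def inner_scaleR_left inner_commute[of h y] .
      qed
      ultimately show ?thesis by simp
    qed
    have ngl: "norm (gl y) = k * norm y / (norm y ^ 2 + \<delta> ^ 2)" for y
      using p[of y] k by (simp add: gl_def dot_square_norm)
    show "norm (g x) = k * norm x / (norm x ^ 2 + \<delta> ^ 2)" if "norm x < 1"
    proof -
      have "g x = gl x"
        by (rule loc[OF g dl, where S = "ball 0 1"]) (use that in \<open>auto simp: moser_def l_def cutoff_eq_1\<close>)
      then show ?thesis using ngl by simp
    qed
    show *: "g x = 0" if "2 < norm x"
    proof -
      have "open {x. 2 < norm (x::'a)}" by (intro open_Collect_less continuous_intros)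
      moreover have "((\<lambda>x. 0) has_derivative (\<lambda>h. (0::'a) \<bullet> h)) (at x)" by simp
      ultimately show ?thesis
        by (intro loc[OF g, where S = "{x. 2 < norm x}" and f' = "\<lambda>x. 0" and x = x]) (use that in \<open>auto simp: moser_eq_0\<close>)
    qed
    show "norm (g x) \<le> C" if "1 \<le> norm x"
    proof (cases "2 < norm x")
      case True then show ?thesis using * C0 by simp
    next
      case False
      have "((\<lambda>y. l y * cutoff y) has_derivative (\<lambda>h. l x * (gc x \<bullet> h) + (gl x \<bullet> h) * cutoff x)) (at x)"
        by (intro has_derivative_mult dl gc)
      then have "((\<lambda>y. l y * cutoff y) has_derivative (\<lambda>h. (l x *\<^sub>R gc x + cutoff x *\<^sub>R gl x) \<bullet> h)) (at x)"
        by (simp add: inner_add_left mult.commute)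
      then have "g x = l x *\<^sub>R gc x + cutoff x *\<^sub>R gl x"
        by (rule loc[OF g, where S = UNIV]) (auto simp: moser_def l_def)
      then have "norm (g x) \<le> norm (l x *\<^sub>R gc x) + norm (cutoff x *\<^sub>R gl x)" using norm_triangle_ineq by metis
      also have "norm (l x *\<^sub>R gc x) \<le> k / 2 * ln 5 * L"
      proof -
        have n1: "1 \<le> norm x ^ 2" using that by (simp add: one_le_power)
        have n2: "norm x ^ 2 \<le> 2 ^ 2" using False by (intro power_mono) auto
        have n2': "norm x ^ 2 \<le> 4" using n2 by simp
        have d2: "\<delta> ^ 2 \<le> 1" "0 < \<delta> ^ 2" using \<delta> by (auto intro: power_le_one)
        \<comment> \<open>The argument of the logarithm stays between 1 and 5, whatever
          \<open>\<delta> \<le> 1\<close> is.\<close>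
        have q: "1 \<le> x \<bullet> x + \<delta> ^ 2" "x \<bullet> x + \<delta> ^ 2 \<le> 5" using n1 n2' d2 unfolding dot_square_norm by linarith+
        then have "0 \<le> ln (x \<bullet> x + \<delta> ^ 2)" "ln (x \<bullet> x + \<delta> ^ 2) \<le> ln 5" by auto
        then have "\<bar>l x\<bar> \<le> k / 2 * ln 5" using k by (simp add: l_def abs_mult mult_left_mono)
        then have "\<bar>l x\<bar> * norm (gc x) \<le> k / 2 * ln 5 * L" using L[of x] False by (intro mult_mono) auto
        then show ?thesis by simp
      qed
      also have "norm (cutoff x *\<^sub>R gl x) \<le> k"
      proof -
        have "norm x \<le> norm x ^ 2 + \<delta> ^ 2"
          using that self_le_power[of "norm x" 2] by (simp add: add_increasing2)
        then have "norm x / (norm x ^ 2 + \<delta> ^ 2) \<le> 1" using p[of x] by (simp add: dot_square_norm)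
        then have "k * (norm x / (norm x ^ 2 + \<delta> ^ 2)) \<le> k * 1" using k by (intro mult_left_mono)
        then have "norm (gl x) \<le> k" by (simp add: ngl)
        then have "cutoff x * norm (gl x) \<le> 1 * k" using cutoff_bounds[of x] by (intro mult_mono) auto
        then show ?thesis using cutoff_bounds(1)[of x] by simp
      qed
      finally show ?thesis by (simp add: C_def)
    qed
  qed
qed

text \<open>Inside the unit ball the leading part \<open>(k r / (r^2 + \<delta>^2)) ^ n\<close> is
  bounded by the logarithmic kernel and the rest by the Riesz kernel. For this \<open>k\<close> the
  factor of \<open>H_fun_eq\<close> times \<open>k ^ n\<close> is \<open>n ^ n\<close>, and the
  polar weight supplies \<open>n\<close> times the volume of the unit ball.\<close>

lemma moser_energy_le:
  assumes n: "2 \<le> DIM('a::euclidean_space)"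
  defines "k \<equiv> real DIM('a) ^ 2 / (real DIM('a) - 1)"
  obtains A where "\<And>\<delta>. 0 < \<delta> \<Longrightarrow> \<delta> \<le> 1 \<Longrightarrow>
    (\<integral>x. H_fun x (grad (moser k \<delta>) (x::'a)) \<partial>lborel) \<le> real DIM('a) ^ (DIM('a) + 1) * unit_ball_vol DIM('a) * ln (1 / \<delta>) + A"
proof -
  let ?n = "DIM('a)"
  have k0: "0 \<le> k" using n by (simp add: k_def)
  obtain C where C0: "0 \<le> C" and C: "\<forall>\<delta> g x. 0 < \<delta> \<longrightarrow> \<delta> \<le> 1 \<longrightarrow> (\<forall>y. (moser k \<delta> has_derivative (\<lambda>h. g y \<bullet> h)) (at (y::'a))) \<longrightarrow>
      (norm x < 1 \<longrightarrow> norm (g x) = k * norm x / (norm x ^ 2 + \<delta> ^ 2)) \<and>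
      (1 \<le> norm x \<longrightarrow> norm (g x) \<le> C) \<and> (2 < norm x \<longrightarrow> g x = 0)"
    using moser_gradient_bounds[where 'a='a, OF k0] by (elim exE conjE)
  define c where "c = ((real ?n - 1) / real ?n) ^ ?n"
  have c: "0 \<le> c" "c * k ^ ?n = real ?n ^ ?n"
  proof -
    show "0 \<le> c" using n by (simp add: c_def)
    have "(real ?n - 1) / real ?n * k = real ?n" using n by (simp add: k_def power2_eq_square)
    then show "c * k ^ ?n = real ?n ^ ?n" unfolding c_def power_mult_distrib[symmetric] by simp
  qed
  \<comment> \<open>\<open>K1\<close> bounds the lower-order terms in the unit ball, where
    \<open>k + norm (g x) \<le> 2 * k / r\<close>; \<open>K2\<close> below bounds everything in the
    annulus between radii 1 and 2.\<close>
  define K1 where "K1 = 2 * real ?n * k * (2 * k) ^ (?n - 1)"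
  define K2 where "K2 = C ^ ?n + 2 * real ?n * k * (k + C) ^ (?n - 1)"
  have K: "0 \<le> K1" "0 \<le> K2" using k0 C0 by (auto simp: K1_def K2_def)
  define rk where "rk x = indicator (ball 0 3) x * (1 / norm x ^ (?n - 1))" for x :: 'a
  define lk where "lk \<delta> x = indicator (ball 0 1) x * (norm x / (norm x ^ (?n - 1) * (norm x ^ 2 + \<delta> ^ 2)))" for x :: 'a and \<delta>
  define bd where "bd \<delta> x = c * (k ^ ?n * lk \<delta> x + (K1 * rk x + K2 * indicator (ball 0 3) x))" for x :: 'a and \<delta>
  define J where "J = K1 * (\<integral>x. rk x \<partial>lborel) + K2 * measure lborel (ball (0::'a) 3)"
  have ki: "integrable lborel rk" unfolding rk_def[abs_def] by (rule riesz_kernel_integrable[OF n]) simp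
  have bi: "integrable lborel (indicator (ball 0 3) :: 'a \<Rightarrow> real)"
    using emeasure_bounded_finite[of "ball (0::'a) 3"] by (intro integrable_real_indicator) auto
  have bound: "(\<integral>x. H_fun x (grad (moser k \<delta>) (x::'a)) \<partial>lborel) \<le> real ?n ^ (?n + 1) * unit_ball_vol ?n * ln (1 / \<delta>)
     + (c * J + real ?n ^ (?n + 1) * unit_ball_vol ?n / 2 * ln 2)" if \<delta>: "0 < \<delta>" "\<delta> \<le> 1" for \<delta>
  proof -
    have li: "integrable lborel (lk \<delta>)" unfolding lk_def[abs_def] by (rule log_kernel_integral(1)[OF n \<delta>(1)])
    obtain g where g: "\<And>y::'a. (moser k \<delta> has_derivative (\<lambda>h. g y \<bullet> h)) (at y)" "\<And>x. grad (moser k \<delta>) x = g x"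
      using smooth_gradient[OF smooth_moser[where 'a='a, OF \<delta>(1), of k]] by metis
    have Cg: "norm x < 1 \<Longrightarrow> norm (g x) = k * norm x / (norm x ^ 2 + \<delta> ^ 2)" "1 \<le> norm x \<Longrightarrow> norm (g x) \<le> C"
      "2 < norm x \<Longrightarrow> g x = 0" for x
      using C[rule_format, OF \<delta>, of g x] g(1) by auto
    have lk0: "0 \<le> lk \<delta> x" for x by (simp add: lk_def)
    have rk0: "0 \<le> rk x" for x by (simp add: rk_def)
    have bd0: "0 \<le> bd \<delta> x" for x
      unfolding bd_def using c(1) K k0 lk0[of x] rk0[of x] by (intro mult_nonneg_nonneg add_nonneg_nonneg) auto
    have le: "H_fun x (g x) \<le> bd \<delta> x" if "x \<noteq> 0" for x
    proof -
      have R: "R_fun (grad_bubble x) (g x) \<le> norm (g x) ^ ?n + 2 * real ?n * k * (k + norm (g x)) ^ (?n - 1)"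
        using R_fun_le[OF n norm_grad_bubble_le[OF n], of x "g x"] unfolding k_def of_nat_mult of_nat_numeral .
      have "R_fun (grad_bubble x) (g x) \<le> k ^ ?n * lk \<delta> x + (K1 * rk x + K2 * indicator (ball 0 3) x)"
      proof -
        consider "norm x < 1" | "1 \<le> norm x" "norm x \<le> 2" | "2 < norm x" by linarith
        then show ?thesis
        proof cases
          case 1
          define r where "r = norm x"
          have r: "0 < r" "r < 1" using that 1 by (auto simp: r_def)
          define q where "q = r ^ 2 + \<delta> ^ 2"
          have q: "0 < q" "r ^ 2 \<le> q" using \<delta> by (auto simp: q_def add_nonneg_pos)
          have ng: "norm (g x) = k * (r / q)" using Cg(1)[OF 1] by (simp add: r_def q_def)
          define j where "j = ?n - 1"
          have j: "?n = Suc j" unfolding j_def by (metis DIM_positive Suc_diff_1)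
          \<comment> \<open>All but one of the factors \<open>1 / q\<close> in
            \<open>(r / q) ^ n\<close> are replaced by \<open>1 / r^2\<close>, which leaves
            \<open>r / (r ^ (n - 1) * q)\<close>, the logarithmic kernel.\<close>
          have "(r ^ 2) ^ j \<le> q ^ j" using q by (intro power_mono) auto
          then have "(r * r ^ j) * r ^ j \<le> r * q ^ j" using r by (simp add: power2_eq_square power_mult_distrib mult.assoc)
          then have "(r / q) ^ ?n \<le> r / (r ^ j * q)" unfolding j using r q by (simp add: power_divide field_simps)
          then have "k ^ ?n * (r / q) ^ ?n \<le> k ^ ?n * (r / (r ^ j * q))" using k0 by (intro mult_left_mono) auto
          moreover have "lk \<delta> x = r / (r ^ j * q)" using 1 by (simp add: lk_def r_def q_def j_def)
          ultimately have 2: "norm (g x) ^ ?n \<le> k ^ ?n * lk \<delta> x" unfolding ng power_mult_distrib by simp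
          have "r / q \<le> r / r ^ 2" using q r by (intro divide_left_mono) auto
          also have "\<dots> = 1 / r" using r by (simp add: power2_eq_square)
          finally have "k * (r / q) \<le> k * (1 / r)" using k0 by (intro mult_left_mono)
          moreover have "k * 1 \<le> k * (1 / r)" using k0 r by (intro mult_left_mono) auto
          ultimately have "k + norm (g x) \<le> 2 * k * (1 / r)" unfolding ng by simp
          then have "(k + norm (g x)) ^ (?n - 1) \<le> (2 * k * (1 / r)) ^ (?n - 1)" using k0 by (intro power_mono) auto
          also have "\<dots> = (2 * k) ^ (?n - 1) * rk x" using 1 by (simp add: rk_def r_def power_mult_distrib power_divide)
          finally have "2 * real ?n * k * (k + norm (g x)) ^ (?n - 1) \<le> 2 * real ?n * k * ((2 * k) ^ (?n - 1) * rk x)"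
            using k0 by (intro mult_left_mono) auto
          also have "\<dots> = K1 * rk x" by (simp add: K1_def)
          finally have "2 * real ?n * k * (k + norm (g x)) ^ (?n - 1) \<le> K1 * rk x" .
          moreover have "0 \<le> K2 * indicator (ball 0 3) x" using K by simp
          ultimately show ?thesis using R 2 by linarith
        next
          case 2
          have ng: "norm (g x) \<le> C" using Cg(2) 2 by blast
          have "norm (g x) ^ ?n + 2 * real ?n * k * (k + norm (g x)) ^ (?n - 1) \<le> K2"
            unfolding K2_def using ng k0 by (intro add_mono mult_left_mono power_mono) auto
          moreover have "K2 * indicator (ball 0 3) x = K2" using 2 by simp
          moreover have "0 \<le> k ^ ?n * lk \<delta> x" "0 \<le> K1 * rk x" using k0 lk0 K rk0 by auto
          ultimately show ?thesis using R by linarith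
        next
          case 3
          then have "g x = 0" using Cg(3) by blast
          then have "R_fun (grad_bubble x) (g x) = 0" by (simp add: R_fun_def)
          moreover have "0 \<le> k ^ ?n * lk \<delta> x" "0 \<le> K1 * rk x" "0 \<le> K2 * indicator (ball 0 3) x" using k0 lk0 K rk0 by auto
          ultimately show ?thesis by linarith
        qed
      qed
      then show ?thesis unfolding H_fun_eq[OF n] bd_def c_def[symmetric] using c(1) by (intro mult_left_mono)
    qed
    have bdi: "integrable lborel (bd \<delta>)"
      unfolding bd_def[abs_def] by (intro integrable_mult_right Bochner_Integration.integrable_add li ki bi)
    have "(\<integral>x. H_fun x (grad (moser k \<delta>) (x::'a)) \<partial>lborel) \<le> (\<integral>x. bd \<delta> x \<partial>lborel)"
      unfolding g(2)
    proof (rule integral_mono_AE')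
      show "AE x in lborel. H_fun x (g x) \<le> bd \<delta> x"
        using AE_lborel_singleton[of "0::'a"] by eventually_elim (rule le)
    qed (use bdi bd0 in auto)
    also have "(\<integral>x. bd \<delta> x \<partial>lborel) = c * (k ^ ?n * (\<integral>x. lk \<delta> x \<partial>lborel) + J)"
    proof -
      have "(\<integral>x. bd \<delta> x \<partial>lborel) = c * (\<integral>x. k ^ ?n * lk \<delta> x + (K1 * rk x + K2 * indicator (ball 0 3) x) \<partial>lborel)"
        unfolding bd_def by (rule integral_mult_right_zero)
      also have "(\<integral>x. k ^ ?n * lk \<delta> x + (K1 * rk x + K2 * indicator (ball 0 3) x) \<partial>lborel)
         = (\<integral>x. k ^ ?n * lk \<delta> x \<partial>lborel) + (\<integral>x. K1 * rk x + K2 * indicator (ball 0 3) x \<partial>lborel)"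
        by (intro Bochner_Integration.integral_add integrable_mult_right Bochner_Integration.integrable_add li ki bi)
      also have "(\<integral>x. K1 * rk x + K2 * indicator (ball 0 3) x \<partial>lborel) = (\<integral>x. K1 * rk x \<partial>lborel) + (\<integral>x. K2 * indicator (ball (0::'a) 3) x \<partial>lborel)"
        by (intro Bochner_Integration.integral_add integrable_mult_right li ki bi)
      also have "\<dots> = J" by (simp add: J_def)
      finally show ?thesis by simp
    qed
    also have "(\<integral>x. lk \<delta> x \<partial>lborel) = real ?n * unit_ball_vol ?n / 2 * (ln (1 + \<delta> ^ 2) - ln (\<delta> ^ 2))"
      unfolding lk_def by (rule log_kernel_integral(2)[OF n \<delta>(1)])
    also have "c * (k ^ ?n * (real ?n * unit_ball_vol ?n / 2 * (ln (1 + \<delta> ^ 2) - ln (\<delta> ^ 2))) + J)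
       = real ?n ^ (?n + 1) * unit_ball_vol ?n / 2 * (ln (1 + \<delta> ^ 2) - ln (\<delta> ^ 2)) + c * J"
    proof -
      have "c * (k ^ ?n * (real ?n * u / 2 * v) + J) = (c * k ^ ?n) * (real ?n * u / 2 * v) + c * J" for u v by (simp add: distrib_left)
      then show ?thesis unfolding c(2) by simp
    qed
    also have "\<dots> \<le> real ?n ^ (?n + 1) * unit_ball_vol ?n / 2 * (ln 2 + 2 * ln (1 / \<delta>)) + c * J"
    proof -
      have "ln (1 + \<delta> ^ 2) \<le> ln 2" using \<delta> by (subst ln_le_cancel_iff) (auto simp: add_pos_nonneg power_le_one)
      moreover have "ln (\<delta> ^ 2) = - 2 * ln (1 / \<delta>)" using \<delta> by (simp add: ln_realpow ln_div)
      ultimately have "ln (1 + \<delta> ^ 2) - ln (\<delta> ^ 2) \<le> ln 2 + 2 * ln (1 / \<delta>)" by linarith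
      then show ?thesis by (intro add_right_mono mult_left_mono) auto
    qed
    finally show ?thesis by (simp add: algebra_simps add_divide_distrib)
  qed
  then show ?thesis by (rule that)
qed

text \<open>On the ball of radius \<open>\<delta>\<close> the peak is at least
  \<open>k ln (1 / \<delta>)\<close> minus a constant, while that ball has \<open>mu\<close>-measure
  of order \<open>\<delta> ^ n\<close>; this yields the rate \<open>k - n\<close>. The mean of the
  peak is bounded above because a logarithmic singularity is integrable.\<close>

lemma moser_entropy_ge:
  assumes n: "2 \<le> DIM('a::euclidean_space)" and k: "0 \<le> k"
  obtains B where "\<And>\<delta>. 0 < \<delta> \<Longrightarrow> \<delta> \<le> 1 \<Longrightarrow>
    (k - real DIM('a)) * ln (1 / \<delta>) - B \<le> ln (\<integral>x. exp (moser k \<delta> (x::'a)) \<partial>mu) - (\<integral>x. moser k \<delta> (x::'a) \<partial>mu)"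
proof -
  let ?n = "DIM('a)"
  interpret prob_space "mu :: 'a measure" by (rule prob_space_mu[OF n])
  have s: "sets (mu :: 'a measure) = sets borel" by (simp add: mu_def)
  define \<omega> where "\<omega> = unit_ball_vol ?n"
  have \<omega>: "0 < \<omega>" by (simp add: \<omega>_def)
  have dens_le: "mu_density x \<le> 1 / \<omega>" for x :: 'a
  proof -
    have "1 \<le> (1 + sig x) ^ ?n" using one_plus_sig(3)[of x] by (rule one_le_power)
    then show ?thesis using \<omega> by (simp add: mu_density_def \<omega>_def divide_le_eq unit_ball_vol_nonzero)
  qed
  have dens_ge: "1 / (\<omega> * 2 ^ ?n) \<le> mu_density x" if "norm x \<le> 1" for x :: 'a
  proof -
    have "norm x powr (real ?n / (real ?n - 1)) \<le> 1"
      using that n by (intro powr_le1) auto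
    then have "sig x \<le> 1" using sig_eq_powr[OF n, of x] by simp
    then have "(1 + sig x) ^ ?n \<le> 2 ^ ?n" using sig_nonneg[of x] by (intro power_mono) auto
    then show ?thesis using \<omega> one_plus_sig(1)[of x] unfolding mu_density_def \<omega>_def[symmetric]
      by (simp add: divide_simps mult_left_mono)
  qed
  define rk where "rk x = indicator (ball 0 3) x * (1 / norm x ^ (?n - 1))" for x :: 'a
  have ki: "integrable lborel rk" unfolding rk_def[abs_def] by (rule riesz_kernel_integrable[OF n]) simp
  define B1 where "B1 = (\<integral>x. k * 3 ^ (?n - 2) / \<omega> * rk x \<partial>lborel)"
  have upper: "(\<integral>x. moser k \<delta> (x::'a) \<partial>mu) \<le> B1" if \<delta>: "0 < \<delta>" "\<delta> \<le> 1" for \<delta>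
  proof -
    have contm: "continuous_on UNIV (moser k \<delta> :: 'a \<Rightarrow> real)"
      using smooth_moser[where 'a='a, OF \<delta>(1), of k] unfolding smooth_def by (metis continuously_differentiable.simps(1))
    have mm [measurable]: "(moser k \<delta> :: 'a \<Rightarrow> real) \<in> borel_measurable borel" using contm by (rule borel_measurable_continuous_onI)
    have rk0: "0 \<le> rk x" for x by (simp add: rk_def)
    have le: "mu_density x * moser k \<delta> x \<le> k * 3 ^ (?n - 2) / \<omega> * rk x" if "x \<noteq> 0" for x :: 'a
    proof (cases "norm x < 2")
      case False
      then show ?thesis using k \<omega> rk0[of x] by (simp add: moser_eq_0)
    next
      case True
      define r where "r = norm x"
      have r: "0 < r" "r < 2" using that True by (auto simp: r_def)
      \<comment> \<open>A crude bound, \<open>ln (1 / r) \<le> 1 / r\<close>, suffices: it is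
        uniform in \<open>\<delta>\<close> and is dominated by the Riesz kernel.\<close>
      have "- ln (x \<bullet> x + \<delta> ^ 2) \<le> 2 / r"
      proof -
        have "ln (r ^ 2) \<le> ln (x \<bullet> x + \<delta> ^ 2)"
          using r \<delta> by (subst ln_le_cancel_iff) (auto simp: r_def dot_square_norm add_pos_nonneg)
        moreover have "ln (r ^ 2) = - (2 * ln (1 / r))" using r by (simp add: ln_realpow ln_div)
        moreover have "ln (1 / r) \<le> 1 / r" using r ln_le_minus_one[of "1 / r"] by simp
        ultimately show ?thesis by linarith
      qed
      then have "k / 2 * (- ln (x \<bullet> x + \<delta> ^ 2)) \<le> k / 2 * (2 / r)" using k by (intro mult_left_mono) auto
      then have 1: "- (k / 2) * ln (x \<bullet> x + \<delta> ^ 2) \<le> k / r" by simp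
      have kr: "0 \<le> k / r" using k r by simp
      have "moser k \<delta> x \<le> k / r"
      proof -
        have "moser k \<delta> x \<le> k / r * cutoff x" unfolding moser_def using 1 cutoff_bounds(1)[of x] by (rule mult_right_mono)
        also have "\<dots> \<le> k / r * 1" using cutoff_bounds(2)[of x] kr by (rule mult_left_mono)
        finally show ?thesis by simp
      qed
      then have "mu_density x * moser k \<delta> x \<le> mu_density x * (k / r)" using mu_density_nonneg by (rule mult_left_mono)
      also have "\<dots> \<le> 1 / \<omega> * (k / r)" using dens_le kr by (rule mult_right_mono)
      also have "\<dots> \<le> k * 3 ^ (?n - 2) / \<omega> * rk x"
      proof -
        define j where "j = ?n - 2"
        have j: "?n - 1 = Suc j" "?n - 2 = j" unfolding j_def using n by arith+
        have "r ^ j \<le> 3 ^ j" using r by (intro power_mono) auto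
        then have "1 / r \<le> 3 ^ j / r ^ Suc j" using r by (simp add: field_simps)
        then have "k / \<omega> * (1 / r) \<le> k / \<omega> * (3 ^ j / r ^ Suc j)" using k \<omega> by (intro mult_left_mono) auto
        moreover have "rk x = 1 / r ^ Suc j" using r unfolding rk_def r_def j by simp
        ultimately show ?thesis unfolding j by simp
      qed
      finally show ?thesis .
    qed
    have "(\<integral>x. moser k \<delta> (x::'a) \<partial>mu) = (\<integral>x. mu_density x * moser k \<delta> (x::'a) \<partial>lborel)"
      by (rule integral_mu(1)[OF n mm])
    also have "\<dots> \<le> B1"
      unfolding B1_def
    proof (rule integral_mono_AE')
      show "AE x in lborel. mu_density x * moser k \<delta> x \<le> k * 3 ^ (?n - 2) / \<omega> * rk x"
        using AE_lborel_singleton[of "0::'a"] by eventually_elim (rule le)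
      show "integrable lborel (\<lambda>x. k * 3 ^ (?n - 2) / \<omega> * rk x)" by (intro integrable_mult_right ki)
      show "AE x in lborel. 0 \<le> k * 3 ^ (?n - 2) / \<omega> * rk x" using k \<omega> rk0 by (intro AE_I2 mult_nonneg_nonneg) auto
    qed
    finally show ?thesis .
  qed
  have lower: "(k - real ?n) * ln (1 / \<delta>) - (k / 2 + real ?n) * ln 2 \<le> ln (\<integral>x. exp (moser k \<delta> (x::'a)) \<partial>mu)"
    if \<delta>: "0 < \<delta>" "\<delta> \<le> 1" for \<delta>
  proof -
    have contm: "continuous_on UNIV (moser k \<delta> :: 'a \<Rightarrow> real)"
      using smooth_moser[where 'a='a, OF \<delta>(1), of k] unfolding smooth_def by (metis continuously_differentiable.simps(1))
    have mm [measurable]: "(moser k \<delta> :: 'a \<Rightarrow> real) \<in> borel_measurable borel" using contm by (rule borel_measurable_continuous_onI)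
    define a where "a = k * ln (1 / \<delta>) - k / 2 * ln 2"
    have ge: "a \<le> moser k \<delta> x" if "norm x < \<delta>" for x :: 'a
    proof -
      have "x \<bullet> x \<le> \<delta> ^ 2" using that by (simp add: dot_square_norm power_mono)
      then have "ln (x \<bullet> x + \<delta> ^ 2) \<le> ln (2 * \<delta> ^ 2)" using \<delta> by (subst ln_le_cancel_iff) (auto simp: add_nonneg_pos)
      also have "\<dots> = ln 2 - 2 * ln (1 / \<delta>)" using \<delta> by (simp add: ln_mult ln_realpow ln_div)
      finally have "k / 2 * ln (x \<bullet> x + \<delta> ^ 2) \<le> k / 2 * (ln 2 - 2 * ln (1 / \<delta>))" using k by (intro mult_left_mono) auto
      moreover have "cutoff x = 1" using that \<delta> by (intro cutoff_eq_1) auto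
      ultimately show ?thesis by (simp add: moser_def a_def right_diff_distrib)
    qed
    \<comment> \<open>The volume \<open>\<omega> * \<delta> ^ n\<close> of the small ball, times the
      lower bound \<open>1 / (\<omega> * 2 ^ n)\<close> of the density on the unit ball, times the
      smallest value of the exponential there.\<close>
    have "exp a * (\<delta> ^ ?n / 2 ^ ?n) = (\<integral>x. indicator (ball (0::'a) \<delta>) x * (exp a / (\<omega> * 2 ^ ?n)) \<partial>lborel)"
      using \<delta> \<omega> by (simp add: content_ball \<omega>_def unit_ball_vol_nonzero)
    also have "\<dots> \<le> (\<integral>x. mu_density x * exp (moser k \<delta> (x::'a)) \<partial>lborel)"
    proof (rule integral_mono)
      show "integrable lborel (\<lambda>x. indicator (ball (0::'a) \<delta>) x * (exp a / (\<omega> * 2 ^ ?n)))"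
        using emeasure_bounded_finite[of "ball (0::'a) \<delta>"] by (intro integrable_mult_left integrable_real_indicator) auto
      obtain L where L: "\<And>x::'a. \<bar>moser k \<delta> x\<bar> \<le> L"
      proof -
        have "compact ((\<lambda>x::'a. moser k \<delta> x) ` cball 0 2)"
          by (intro compact_continuous_image continuous_on_subset[OF contm]) auto
        then have "bounded ((\<lambda>x::'a. moser k \<delta> x) ` cball 0 2)" by (rule compact_imp_bounded)
        then obtain L where L: "\<And>x::'a. x \<in> cball 0 2 \<Longrightarrow> norm (moser k \<delta> x) \<le> L" unfolding bounded_iff by blast
        have "\<bar>moser k \<delta> x\<bar> \<le> max L 0" for x :: 'a
          using L[of x] moser_eq_0[of x k \<delta>] by (cases "norm x \<le> 2") (auto simp: le_max_iff_disj)
        then show ?thesis by (rule that)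
      qed
      have m: "(\<lambda>x::'a. exp (moser k \<delta> x)) \<in> borel_measurable mu"
        unfolding measurable_cong_sets[OF s refl] by measurable
      have "integrable mu (\<lambda>x::'a. exp (moser k \<delta> x))"
        by (rule integrable_const_bound[where B = "exp L"]) (use L m in \<open>auto simp: abs_le_iff\<close>)
      then show "integrable lborel (\<lambda>x. mu_density x * exp (moser k \<delta> (x::'a)))"
        by (subst (asm) integral_mu(2)[OF n]) auto
      fix x :: 'a
      show "indicator (ball (0::'a) \<delta>) x * (exp a / (\<omega> * 2 ^ ?n)) \<le> mu_density x * exp (moser k \<delta> x)"
      proof (cases "norm x < \<delta>")
        case True
        have "1 / (\<omega> * 2 ^ ?n) * exp a \<le> mu_density x * exp (moser k \<delta> x)"
          using dens_ge[of x] ge[OF True] True \<delta> mu_density_nonneg[of x] by (intro mult_mono) auto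
        then show ?thesis using True by simp
      next
        case False
        then show ?thesis using mu_density_nonneg[of x] by simp
      qed
    qed
    also have "\<dots> = (\<integral>x. exp (moser k \<delta> (x::'a)) \<partial>mu)"
      by (rule integral_mu(1)[OF n, symmetric]) measurable
    finally have "ln (exp a * (\<delta> ^ ?n / 2 ^ ?n)) \<le> ln (\<integral>x. exp (moser k \<delta> (x::'a)) \<partial>mu)"
      using \<delta> by (intro ln_mono) auto
    moreover have "ln (exp a * (\<delta> ^ ?n / 2 ^ ?n)) = a - real ?n * ln (1 / \<delta>) - real ?n * ln 2"
      using \<delta> by (simp add: ln_mult ln_div ln_realpow)
    ultimately show ?thesis by (simp add: a_def algebra_simps)
  qed
  show ?thesis
    by (rule that[of "(k / 2 + real ?n) * ln 2 + B1"]) (use upper lower in fastforce)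
qed

text \<open>With \<open>k = n^2/(n-1)\<close> the entropy grows at the rate
  \<open>k - n = n/(n-1)\<close> and the energy at the rate \<open>\<Theta>\<close>, up to bounded
  terms; the identity \<open>k - n = alpha n * \<Theta>\<close> makes the quotient of the rates
  exactly \<open>alpha n\<close>.\<close>

theorem onofri_optimal:
  assumes n: "2 \<le> DIM('a::euclidean_space)"
    and C: "\<And>u :: 'a \<Rightarrow> real. smooth u \<Longrightarrow> compactly_supported u \<Longrightarrow>
       ln (\<integral>x. exp (u x) \<partial>mu) - (\<integral>x. u x \<partial>mu) \<le> C * (\<integral>x. H_fun x (grad u x) \<partial>lborel)"
  shows "alpha DIM('a) \<le> C"
proof (rule ccontr)
  assume "\<not> alpha DIM('a) \<le> C"
  let ?n = "DIM('a)"
  define k where "k = real ?n ^ 2 / (real ?n - 1)"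
  have k: "0 \<le> k" using n by (simp add: k_def)
  define \<Theta> where "\<Theta> = real ?n ^ (?n + 1) * unit_ball_vol ?n"
  have \<Theta>: "0 < \<Theta>" by (simp add: \<Theta>_def)
  have kn: "k - real ?n = alpha ?n * \<Theta>"
  proof -
    define N where "N = real ?n"
    have N: "2 \<le> N" using n by (simp add: N_def)
    have "N ^ 2 / (N - 1) - N = N / (N - 1)" using N by (simp add: field_simps power2_eq_square)
    moreover have "1 / ((N - 1) * p * w) * (N * p * w) = N / (N - 1)" if "p \<noteq> 0" "w \<noteq> 0" for p w :: real
      using that N by simp
    ultimately show ?thesis
      unfolding alpha_closed[OF n] \<Theta>_def k_def N_def[symmetric] using unit_ball_vol_nonzero[of ?n] N
      by (simp add: N_def)
  qed
  have \<alpha>: "0 < alpha ?n" by (rule alpha_pos[OF n])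
  obtain A where A: "\<And>\<delta>. 0 < \<delta> \<Longrightarrow> \<delta> \<le> 1 \<Longrightarrow> (\<integral>x. H_fun x (grad (moser k \<delta>) (x::'a)) \<partial>lborel) \<le> \<Theta> * ln (1 / \<delta>) + A"
    unfolding \<Theta>_def k_def by (rule moser_energy_le[where 'a='a, OF n]) blast
  obtain B where B: "\<And>\<delta>. 0 < \<delta> \<Longrightarrow> \<delta> \<le> 1 \<Longrightarrow>
    (k - real ?n) * ln (1 / \<delta>) - B \<le> ln (\<integral>x. exp (moser k \<delta> (x::'a)) \<partial>mu) - (\<integral>x. moser k \<delta> (x::'a) \<partial>mu)"
    by (rule moser_entropy_ge[where 'a='a, OF n k]) blast
  \<comment> \<open>The upper bound on the energy is to be multiplied by the constant, which must be
    nonnegative for that; the replacement is still below \<open>alpha\<close>.\<close>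
  define D where "D = max C 0"
  have D: "0 \<le> D" "C \<le> D" "D < alpha ?n" using \<open>\<not> alpha ?n \<le> C\<close> \<alpha> by (auto simp: D_def)
  \<comment> \<open>The value of \<open>ln (1 / \<delta>)\<close>. The first summand makes the
    difference of the rates outweigh the bounded terms; the second makes the energy \<open>H\<close>
    positive, by the inequality with \<open>alpha\<close> already proved.\<close>
  define M where "M = max 0 ((\<bar>B\<bar> + \<bar>D * A\<bar> + 1) / ((alpha ?n - D) * \<Theta>)) + (\<bar>B\<bar> + 1) / (alpha ?n * \<Theta>)"
  define \<delta> where "\<delta> = exp (- M)"
  have M: "0 \<le> M" using \<alpha> \<Theta> by (simp add: M_def)
  have \<delta>: "0 < \<delta>" "\<delta> \<le> 1" "ln (1 / \<delta>) = M" using M by (auto simp: \<delta>_def ln_div)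
  define H where "H = (\<integral>x. H_fun x (grad (moser k \<delta>) (x::'a)) \<partial>lborel)"
  have sm: "smooth (moser k \<delta> :: 'a \<Rightarrow> real)" by (rule smooth_moser[OF \<delta>(1)])
  have cs: "compactly_supported (moser k \<delta> :: 'a \<Rightarrow> real)"
    by (rule compactly_supportedI[of 2]) (simp add: moser_eq_0)
  obtain g where g: "\<And>y::'a. (moser k \<delta> has_derivative (\<lambda>h. g y \<bullet> h)) (at y)" "continuous_on UNIV g" "\<And>x. grad (moser k \<delta>) x = g x"
    using smooth_gradient[OF sm] by metis
  have 0: "moser k \<delta> x = 0" if "2 < norm x" for x :: 'a using that by (simp add: moser_eq_0)
  have 1: "alpha ?n * \<Theta> * M - B \<le> C * H" using C[OF sm cs] B[OF \<delta>(1,2)] unfolding H_def kn \<delta>(3) by linarith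
  have 2: "alpha ?n * \<Theta> * M - B \<le> alpha ?n * H"
  proof -
    have "ln (\<integral>x. exp (moser k \<delta> (x::'a)) \<partial>mu) - (\<integral>x. moser k \<delta> (x::'a) \<partial>mu) \<le> alpha ?n * (\<integral>x. H_fun x (g x) \<partial>lborel)"
      by (rule onofri_C1[OF n g(1,2), of 2]) (rule 0)
    then show ?thesis using B[OF \<delta>(1,2)] unfolding H_def kn \<delta>(3) g(3) by linarith
  qed
  have M1: "\<bar>B\<bar> + 1 \<le> alpha ?n * \<Theta> * M"
  proof -
    have "(\<bar>B\<bar> + 1) / (alpha ?n * \<Theta>) \<le> M" by (simp add: M_def)
    then show ?thesis using \<alpha> \<Theta> by (simp add: divide_le_eq mult.commute)
  qed
  have "0 < alpha ?n * H" using 2 M1 by linarith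
  then have H0: "0 < H" using \<alpha> by (simp add: zero_less_mult_iff)
  have "alpha ?n * \<Theta> * M - B \<le> D * H" using 1 mult_right_mono[OF D(2), of H] H0 by linarith
  also have "\<dots> \<le> D * (\<Theta> * M + A)" using A[OF \<delta>(1,2)] D(1) unfolding H_def[symmetric] \<delta>(3) by (rule mult_left_mono)
  finally have 3: "(alpha ?n - D) * \<Theta> * M \<le> B + D * A" by (simp add: algebra_simps)
  have pos: "0 < (alpha ?n - D) * \<Theta>" using D \<Theta> by simp
  have "(\<bar>B\<bar> + \<bar>D * A\<bar> + 1) / ((alpha ?n - D) * \<Theta>) \<le> M"
  proof -
    have "0 \<le> (\<bar>B\<bar> + 1) / (alpha ?n * \<Theta>)" using \<alpha> \<Theta> by simp
    then show ?thesis unfolding M_def by linarith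
  qed
  then have "\<bar>B\<bar> + \<bar>D * A\<bar> + 1 \<le> (alpha ?n - D) * \<Theta> * M" using pos by (simp add: divide_le_eq mult.commute)
  then show False using 3 by linarith
qed

section \<open>Approximate extremals\<close>

definition flip_coord :: "'a::euclidean_space set \<Rightarrow> 'a \<Rightarrow> 'a" where
  "flip_coord B x = (\<Sum>j\<in>Basis. ((if j \<in> B then - 1 else 1) * (x \<bullet> j)) *\<^sub>R j)"

definition permute_coord :: "('a::euclidean_space \<Rightarrow> 'a) \<Rightarrow> 'a \<Rightarrow> 'a" where
  "permute_coord \<pi> x = (\<Sum>j\<in>Basis. (x \<bullet> \<pi> j) *\<^sub>R j)"

lemma flip_coord_inner: "j \<in> Basis \<Longrightarrow> flip_coord B x \<bullet> j = (if j \<in> B then - 1 else 1) * (x \<bullet> j)"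
  by (simp add: flip_coord_def)

lemma permute_coord_inner: "j \<in> Basis \<Longrightarrow> permute_coord \<pi> x \<bullet> j = x \<bullet> \<pi> j"
  by (simp add: permute_coord_def)

lemma norm_eq_sum_Basis: "norm x ^ 2 = (\<Sum>j\<in>Basis. (x \<bullet> j) ^ 2)" for x :: "'a::euclidean_space"
  unfolding power2_norm_eq_inner euclidean_inner[of x x] by (simp only: power2_eq_square)

lemma norm_flip_coord: "norm (flip_coord B x) = norm x"
proof -
  have "norm (flip_coord B x) ^ 2 = norm x ^ 2"
    unfolding norm_eq_sum_Basis by (intro sum.cong refl) (simp add: flip_coord_inner power_mult_distrib)
  then show ?thesis by simp
qed

lemma norm_permute_coord:
  assumes "bij_betw \<pi> Basis Basis" shows "norm (permute_coord \<pi> x) = norm x"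
proof -
  have "norm (permute_coord \<pi> x) ^ 2 = (\<Sum>j\<in>Basis. (x \<bullet> \<pi> j) ^ 2)"
    unfolding norm_eq_sum_Basis by (intro sum.cong refl) (simp add: permute_coord_inner)
  also have "\<dots> = norm x ^ 2" unfolding norm_eq_sum_Basis by (rule sum.reindex_bij_betw[OF assms])
  finally show ?thesis by simp
qed

lemma flip_coord_measurable [measurable]: "flip_coord B \<in> borel_measurable borel"
  unfolding flip_coord_def[abs_def] by measurable

lemma permute_coord_measurable [measurable]: "permute_coord \<pi> \<in> borel_measurable borel"
  unfolding permute_coord_def[abs_def] by measurable

lemma lborel_distr_flip_coord: "distr lborel borel (flip_coord B) = (lborel :: 'a::euclidean_space measure)"
proof -
  have "lborel = density (distr lborel borel (\<lambda>x. 0 + (\<Sum>j\<in>Basis. ((if j \<in> B then - 1 else 1) * (x \<bullet> j)) *\<^sub>R j :: 'a)))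
      (\<lambda>_. ennreal (\<Prod>j\<in>Basis. \<bar>if j \<in> B then - 1 else 1\<bar>))"
    by (rule lborel_affine_euclidean) auto
  moreover have "(\<Prod>j\<in>(Basis :: 'a set). \<bar>if j \<in> B then - 1 else 1 :: real\<bar>) = 1" by (intro prod.neutral) auto
  ultimately have "lborel = density (distr lborel borel (flip_coord B)) (\<lambda>_. 1 :: ennreal)"
    by (simp add: flip_coord_def[abs_def])
  then show ?thesis by (simp add: density_1)
qed

lemma lborel_distr_permute_coord:
  assumes \<pi>: "\<And>j. j \<in> Basis \<Longrightarrow> \<pi> j \<in> Basis" "\<And>j. \<pi> (\<pi> j) = j"
  shows "distr lborel borel (permute_coord \<pi>) = (lborel :: 'a::euclidean_space measure)"
proof (rule lborel_eqI[symmetric])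
  have bij: "bij_betw \<pi> Basis Basis"
    by (rule bij_betwI[where g = \<pi>]) (use \<pi> in auto)
  fix l u :: 'a assume lu: "\<And>b. b \<in> Basis \<Longrightarrow> l \<bullet> b \<le> u \<bullet> b"
  have "permute_coord \<pi> -` box l u = box (permute_coord \<pi> l) (permute_coord \<pi> u)"
  proof (intro set_eqI)
    fix x
    have "x \<in> permute_coord \<pi> -` box l u \<longleftrightarrow> (\<forall>j\<in>Basis. l \<bullet> j < x \<bullet> \<pi> j \<and> x \<bullet> \<pi> j < u \<bullet> j)"
      by (simp add: mem_box permute_coord_inner)
    also have "\<dots> \<longleftrightarrow> (\<forall>j\<in>Basis. l \<bullet> \<pi> j < x \<bullet> j \<and> x \<bullet> j < u \<bullet> \<pi> j)"
      using \<pi> by metis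
    also have "\<dots> \<longleftrightarrow> x \<in> box (permute_coord \<pi> l) (permute_coord \<pi> u)"
      by (simp add: mem_box permute_coord_inner)
    finally show "x \<in> permute_coord \<pi> -` box l u \<longleftrightarrow> x \<in> box (permute_coord \<pi> l) (permute_coord \<pi> u)" .
  qed
  then have "emeasure (distr lborel borel (permute_coord \<pi>)) (box l u) = emeasure lborel (box (permute_coord \<pi> l) (permute_coord \<pi> u))"
    by (subst emeasure_distr) auto
  also have "\<dots> = (\<Prod>b\<in>Basis. (permute_coord \<pi> u - permute_coord \<pi> l) \<bullet> b)"
    by (rule emeasure_lborel_box) (use lu \<pi> in \<open>simp add: permute_coord_inner\<close>)
  also have "(\<Prod>b\<in>Basis. (permute_coord \<pi> u - permute_coord \<pi> l) \<bullet> b) = (\<Prod>b\<in>Basis. (u - l) \<bullet> \<pi> b)"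
    by (intro prod.cong refl) (simp add: inner_diff_left permute_coord_inner)
  also have "\<dots> = (\<Prod>b\<in>Basis. (u - l) \<bullet> b)" by (rule prod.reindex_bij_betw[OF bij])
  finally show "emeasure (distr lborel borel (permute_coord \<pi>)) (box l u) = (\<Prod>b\<in>Basis. (u - l) \<bullet> b)" .
qed simp

lemma integral_lborel_distr:
  fixes f :: "'a::euclidean_space \<Rightarrow> real"
  assumes "distr lborel borel T = (lborel :: 'a measure)" "T \<in> borel_measurable borel" "f \<in> borel_measurable borel"
  shows "(\<integral>x. f (T x) \<partial>lborel) = (\<integral>x. f x \<partial>lborel)"
  using integral_distr[of T lborel borel f] assms by simp

lemma integral_odd_radial:
  fixes e :: "'a::euclidean_space"
  assumes [measurable]: "\<phi> \<in> borel_measurable borel"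
  shows "(\<integral>x. (x \<bullet> e) * \<phi> (norm x) \<partial>lborel) = 0"
proof -
  have "flip_coord Basis x = - x" for x :: 'a
    by (rule euclidean_eqI) (simp add: flip_coord_inner)
  then have d: "distr lborel borel uminus = (lborel :: 'a measure)"
    using lborel_distr_flip_coord[of "Basis :: 'a set"] by (metis (no_types, lifting) ext)
  have "(\<integral>x. (x \<bullet> e) * \<phi> (norm x) \<partial>lborel) = (\<integral>x. (- x \<bullet> e) * \<phi> (norm (- x)) \<partial>lborel)"
    by (rule integral_lborel_distr[OF d, symmetric]) auto
  also have "\<dots> = - (\<integral>x. (x \<bullet> e) * \<phi> (norm x) \<partial>lborel)" by simp
  finally show ?thesis by simp
qed

text \<open>Flipping one coordinate annihilates the mixed second moments, transposing two
  coordinates shows that the pure ones coincide, and their sum is the integral of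
  \<open>norm x ^ 2 * \<phi> (norm x)\<close>. Hence the second moment matrix is a multiple of the
  identity.\<close>

lemma integral_quadratic_radial:
  fixes e :: "'a::euclidean_space"
  assumes [measurable]: "\<phi> \<in> borel_measurable borel" and int: "integrable (lborel :: 'a measure) (\<lambda>x. norm x ^ 2 * \<phi> (norm x))"
    and e: "norm e = 1"
  shows "integrable lborel (\<lambda>x. (x \<bullet> e) ^ 2 * \<phi> (norm x))"
    and "(\<integral>x. (x \<bullet> e) ^ 2 * \<phi> (norm x) \<partial>lborel) = (\<integral>x. norm x ^ 2 * \<phi> (norm x) \<partial>(lborel :: 'a measure)) / DIM('a)"
proof -
  define S where "S i j = (\<integral>x. (x \<bullet> i) * (x \<bullet> j) * \<phi> (norm x) \<partial>(lborel :: 'a measure))" for i j :: 'a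
  have intS: "integrable lborel (\<lambda>x::'a. (x \<bullet> i) * (x \<bullet> j) * \<phi> (norm x))" if "norm i \<le> 1" "norm j \<le> 1" for i j
  proof (rule Bochner_Integration.integrable_bound[OF int])
    show "AE x in lborel. norm ((x \<bullet> i) * (x \<bullet> j) * \<phi> (norm x)) \<le> norm (norm x ^ 2 * \<phi> (norm x))"
    proof (rule AE_I2)
      fix x :: 'a
      have a: "\<bar>x \<bullet> k\<bar> \<le> norm x" if "norm k \<le> 1" for k
        using Cauchy_Schwarz_ineq2[of x k] mult_left_mono[OF that norm_ge_zero[of x]] by linarith
      have "\<bar>x \<bullet> i\<bar> * \<bar>x \<bullet> j\<bar> \<le> norm x * norm x" using a that by (intro mult_mono) auto
      then have "\<bar>x \<bullet> i\<bar> * \<bar>x \<bullet> j\<bar> * \<bar>\<phi> (norm x)\<bar> \<le> norm x * norm x * \<bar>\<phi> (norm x)\<bar>" by (rule mult_right_mono) simp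
      then show "norm ((x \<bullet> i) * (x \<bullet> j) * \<phi> (norm x)) \<le> norm (norm x ^ 2 * \<phi> (norm x))"
        by (simp add: abs_mult power2_eq_square)
    qed
  qed auto
  have off: "S i j = 0" if ij: "i \<in> Basis" "j \<in> Basis" "i \<noteq> j" for i j
  proof -
    have "S i j = (\<integral>x. (flip_coord {i} x \<bullet> i) * (flip_coord {i} x \<bullet> j) * \<phi> (norm (flip_coord {i} x)) \<partial>(lborel :: 'a measure))"
      unfolding S_def by (rule integral_lborel_distr[OF lborel_distr_flip_coord, symmetric]) auto
    also have "\<dots> = (\<integral>x. - ((x \<bullet> i) * (x \<bullet> j) * \<phi> (norm x)) \<partial>(lborel :: 'a measure))"
      using ij by (simp add: flip_coord_inner norm_flip_coord)
    also have "\<dots> = - S i j" by (simp add: S_def)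
    finally show ?thesis by simp
  qed
  have diag: "S i i = S j j" if ij: "i \<in> Basis" "j \<in> Basis" for i j
  proof -
    define \<pi> where "\<pi> b = (if b = i then j else if b = j then i else b)" for b
    have \<pi>: "\<And>b. b \<in> Basis \<Longrightarrow> \<pi> b \<in> Basis" "\<And>b. \<pi> (\<pi> b) = b" using ij by (auto simp: \<pi>_def)
    have bij: "bij_betw \<pi> Basis Basis"
      by (rule bij_betwI[where g = \<pi>]) (use \<pi> in auto)
    have "S i i = (\<integral>x. (permute_coord \<pi> x \<bullet> i) * (permute_coord \<pi> x \<bullet> i) * \<phi> (norm (permute_coord \<pi> x)) \<partial>(lborel :: 'a measure))"
      unfolding S_def by (rule integral_lborel_distr[OF lborel_distr_permute_coord[OF \<pi>], symmetric]) auto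
    also have "\<dots> = S j j" unfolding S_def norm_permute_coord[OF bij] permute_coord_inner[OF ij(1)] by (simp add: \<pi>_def)
    finally show ?thesis .
  qed
  obtain b :: 'a where b: "b \<in> Basis" using nonempty_Basis by blast
  have ni: "norm i \<le> 1" if "i \<in> Basis" for i :: 'a using that by simp
  have "(\<integral>x. norm x ^ 2 * \<phi> (norm x) \<partial>(lborel :: 'a measure)) = (\<integral>x. (\<Sum>i\<in>Basis. (x \<bullet> i) * (x \<bullet> i) * \<phi> (norm x)) \<partial>(lborel :: 'a measure))"
    unfolding norm_eq_sum_Basis by (simp add: sum_distrib_right power2_eq_square)
  also have "\<dots> = (\<Sum>i\<in>Basis. S i i)"
    unfolding S_def by (rule Bochner_Integration.integral_sum) (intro intS ni)
  also have "\<dots> = (\<Sum>i\<in>(Basis :: 'a set). S b b)" by (intro sum.cong refl diag b)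
  finally have 1: "(\<integral>x. norm x ^ 2 * \<phi> (norm x) \<partial>(lborel :: 'a measure)) = DIM('a) * S b b" by simp
  show "integrable lborel (\<lambda>x. (x \<bullet> e) ^ 2 * \<phi> (norm x))"
    using intS[of e e] e by (simp add: power2_eq_square)
  have ex: "x \<bullet> e = (\<Sum>i\<in>Basis. (e \<bullet> i) * (x \<bullet> i))" for x :: 'a
    by (simp add: euclidean_inner[of x e] mult.commute)
  have "(\<integral>x. (x \<bullet> e) ^ 2 * \<phi> (norm x) \<partial>lborel) = (\<integral>x. (\<Sum>i\<in>Basis. \<Sum>j\<in>Basis. ((e \<bullet> i) * (e \<bullet> j)) * ((x \<bullet> i) * (x \<bullet> j) * \<phi> (norm x))) \<partial>lborel)"
  proof (intro Bochner_Integration.integral_cong refl)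
    fix x :: 'a
    have "(x \<bullet> e) ^ 2 = (\<Sum>i\<in>Basis. \<Sum>j\<in>Basis. ((e \<bullet> i) * (x \<bullet> i)) * ((e \<bullet> j) * (x \<bullet> j)))"
      unfolding ex power2_eq_square by (rule sum_product)
    then show "(x \<bullet> e) ^ 2 * \<phi> (norm x) = (\<Sum>i\<in>Basis. \<Sum>j\<in>Basis. ((e \<bullet> i) * (e \<bullet> j)) * ((x \<bullet> i) * (x \<bullet> j) * \<phi> (norm x)))"
      by (simp add: sum_distrib_left mult_ac)
  qed
  also have "\<dots> = (\<Sum>i\<in>Basis. \<integral>x. (\<Sum>j\<in>Basis. ((e \<bullet> i) * (e \<bullet> j)) * ((x \<bullet> i) * (x \<bullet> j) * \<phi> (norm x))) \<partial>lborel)"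
    by (rule Bochner_Integration.integral_sum) (intro Bochner_Integration.integrable_sum integrable_mult_right intS ni)
  also have "\<dots> = (\<Sum>i\<in>Basis. \<Sum>j\<in>Basis. \<integral>x. ((e \<bullet> i) * (e \<bullet> j)) * ((x \<bullet> i) * (x \<bullet> j) * \<phi> (norm x)) \<partial>lborel)"
    by (intro sum.cong refl Bochner_Integration.integral_sum integrable_mult_right intS ni)
  also have "\<dots> = (\<Sum>i\<in>Basis. \<Sum>j\<in>Basis. ((e \<bullet> i) * (e \<bullet> j)) * S i j)"
    unfolding S_def by (intro sum.cong refl integral_mult_right_zero)
  also have "\<dots> = (\<Sum>i\<in>Basis. ((e \<bullet> i) * (e \<bullet> i)) * S b b)"
  proof (intro sum.cong refl)
    fix i :: 'a assume i: "i \<in> Basis"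
    have "(\<Sum>j\<in>Basis. ((e \<bullet> i) * (e \<bullet> j)) * S i j) = (\<Sum>j\<in>Basis. if j = i then ((e \<bullet> i) * (e \<bullet> i)) * S i i else 0)"
      using i off by (intro sum.cong refl) auto
    also have "\<dots> = ((e \<bullet> i) * (e \<bullet> i)) * S b b" using i diag[OF i b] by simp
    finally show "(\<Sum>j\<in>Basis. ((e \<bullet> i) * (e \<bullet> j)) * S i j) = ((e \<bullet> i) * (e \<bullet> i)) * S b b" .
  qed
  also have "\<dots> = norm e ^ 2 * S b b" unfolding norm_eq_sum_Basis by (simp add: sum_distrib_right power2_eq_square)
  finally show "(\<integral>x. (x \<bullet> e) ^ 2 * \<phi> (norm x) \<partial>lborel) = (\<integral>x. norm x ^ 2 * \<phi> (norm x) \<partial>(lborel :: 'a measure)) / DIM('a)"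
    unfolding 1 e by simp
qed

text \<open>The companion of \<open>radial_FTC_nonneg\<close> for integrands that change sign;
  integrability is a hypothesis here.\<close>

lemma radial_FTC:
  fixes f F :: "real \<Rightarrow> real"
  assumes [measurable]: "f \<in> borel_measurable borel"
    and int: "integrable (lborel :: 'a::euclidean_space measure) (\<lambda>x. f (norm x))"
    and F: "\<And>r. 0 < r \<Longrightarrow> DERIV F r :> polar_weight DIM('a) r * f r"
    and f: "\<And>r. 0 < r \<Longrightarrow> isCont f r"
    and A: "(F \<longlongrightarrow> A) (at_right 0)" and B: "(F \<longlongrightarrow> B) at_top"
  shows "(\<integral>x. f (norm x) \<partial>(lborel :: 'a measure)) = B - A"
proof -
  have m: "f \<in> borel_measurable borel" by measurable
  have e: "indicator {0<..} r * polar_weight DIM('a) r * f r = indicator (einterval 0 \<infinity>) r * (polar_weight DIM('a) r * f r)" for r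
    by (auto simp: indicator_def einterval_def)
  have int': "set_integrable lborel (einterval 0 \<infinity>) (\<lambda>r. polar_weight DIM('a) r * f r)"
    using int unfolding radial_integral(1)[OF m] e by (simp add: set_integrable_def)
  have "(LBINT r=0..\<infinity>. polar_weight DIM('a) r * f r) = B - A"
  proof (rule interval_integral_FTC_integrable[OF _ _ _ int'])
    show "((F \<circ> real_of_ereal) \<longlongrightarrow> A) (at_right 0)" using A by (simp add: zero_ereal_def ereal_tendsto_simps)
    show "((F \<circ> real_of_ereal) \<longlongrightarrow> B) (at_left \<infinity>)" using B by (simp add: ereal_tendsto_simps)
    show "(F has_vector_derivative polar_weight DIM('a) r * f r) (at r)" if "0 < ereal r" for r
      using F[of r] that by (simp add: has_real_derivative_iff_has_vector_derivative[symmetric])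
    show "isCont (\<lambda>r. polar_weight DIM('a) r * f r) r" if "0 < ereal r" for r
      unfolding polar_weight_def using f[of r] that by (intro continuous_intros) auto
  qed simp
  then show ?thesis unfolding radial_integral(2)[OF m] e
    by (simp add: interval_lebesgue_integral_def set_lebesgue_integral_def)
qed

section \<open>Second-order limits and the remainder of the power of the norm\<close>

lemma dominated_convergence_at_0:
  fixes f :: "real \<Rightarrow> 'a \<Rightarrow> real"
  assumes m: "\<And>t. f t \<in> borel_measurable M" "g \<in> borel_measurable M"
    and int: "integrable M w" and lim: "AE x in M. ((\<lambda>t. f t x) \<longlongrightarrow> g x) (at 0)"
    and dom: "\<And>t. t \<noteq> 0 \<Longrightarrow> \<bar>t\<bar> \<le> 1 \<Longrightarrow> AE x in M. \<bar>f t x\<bar> \<le> w x"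
  shows "((\<lambda>t. \<integral>x. f t x \<partial>M) \<longlongrightarrow> (\<integral>x. g x \<partial>M)) (at 0)"
  unfolding tendsto_at_iff_sequentially comp_def
proof (intro allI impI)
  fix S :: "nat \<Rightarrow> real" assume S: "\<forall>i. S i \<in> UNIV - {0}" "S \<longlonglongrightarrow> 0"
  then have "\<forall>\<^sub>F i in sequentially. dist (S i) 0 < 1" by (intro tendstoD) auto
  then obtain N where N: "\<And>i. i \<ge> N \<Longrightarrow> \<bar>S i\<bar> < 1" by (auto simp: eventually_sequentially)
  have S': "(\<lambda>i. S (i + N)) \<longlonglongrightarrow> 0" using S(2) by (rule LIMSEQ_ignore_initial_segment)
  have "(\<lambda>i. \<integral>x. f (S (i + N)) x \<partial>M) \<longlonglongrightarrow> (\<integral>x. g x \<partial>M)"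
  proof (rule integral_dominated_convergence[OF m(2) m(1) int])
    show "AE x in M. (\<lambda>i. f (S (i + N)) x) \<longlonglongrightarrow> g x"
      using lim
    proof eventually_elim
      case (elim x)
      show ?case
        by (rule filterlim_compose[OF elim]) (use S' S(1) in \<open>auto simp: filterlim_at intro!: always_eventually\<close>)
    qed
    show "AE x in M. norm (f (S (i + N)) x) \<le> w x" for i
      using dom[of "S (i + N)"] N[of "i + N"] S(1) by (simp add: less_imp_le)
  qed
  then show "(\<lambda>i. \<integral>x. f (S i) x \<partial>M) \<longlonglongrightarrow> (\<integral>x. g x \<partial>M)" by (rule LIMSEQ_offset)
qed

text \<open>One use of de l'Hopital's rule reduces the claim to the difference quotient of
  \<open>F'\<close> at 0.\<close>

lemma second_order_quotient:
  fixes F F' :: "real \<Rightarrow> real"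
  assumes F: "\<forall>\<^sub>F t in nhds 0. DERIV F t :> F' t" and F2: "DERIV F' 0 :> c"
  shows "((\<lambda>t. (F t - F 0 - t * F' 0) / t ^ 2) \<longlongrightarrow> c / 2) (at 0)"
proof (rule lhopital[where f' = "\<lambda>t. F' t - F' 0" and g' = "\<lambda>t. 2 * t"])
  have D0: "DERIV F 0 :> F' 0" using F by (rule eventually_nhds_x_imp_x)
  have "isCont (\<lambda>t. F t - F 0 - t * F' 0) 0" using DERIV_isCont[OF D0] by (intro continuous_intros)
  then show "((\<lambda>t. F t - F 0 - t * F' 0) \<longlongrightarrow> 0) (at 0)" by (simp add: isCont_def)
  show "((\<lambda>t::real. t ^ 2) \<longlongrightarrow> 0) (at 0)" by (auto intro!: tendsto_eq_intros)
  show "\<forall>\<^sub>F t::real in at 0. t ^ 2 \<noteq> 0" by (auto simp: eventually_at_filter)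
  show "\<forall>\<^sub>F t::real in at 0. 2 * t \<noteq> 0" by (auto simp: eventually_at_filter)
  have "\<forall>\<^sub>F t in at 0. DERIV F t :> F' t" using F by (simp add: eventually_nhds_conv_at)
  then show "\<forall>\<^sub>F t in at 0. DERIV (\<lambda>t. F t - F 0 - t * F' 0) t :> F' t - F' 0"
    by eventually_elim (auto intro!: derivative_eq_intros)
  show "\<forall>\<^sub>F t::real in at 0. DERIV (\<lambda>t. t ^ 2) t :> 2 * t"
    by (intro always_eventually allI) (auto intro!: derivative_eq_intros)
  have "((\<lambda>t. (F' (0 + t) - F' 0) / t) \<longlongrightarrow> c) (at 0)" using F2 by (simp add: DERIV_def)
  then have "((\<lambda>t. (F' t - F' 0) / t / 2) \<longlongrightarrow> c / 2) (at 0)" by (intro tendsto_divide tendsto_const) auto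
  then show "((\<lambda>t. (F' t - F' 0) / (2 * t)) \<longlongrightarrow> c / 2) (at 0)" by (simp add: mult.commute)
qed

text \<open>Convexity of the \<open>n\<close>-th power of the norm: the tangent inequality for
  powers at \<open>norm X\<close>, followed by Cauchy--Schwarz for \<open>X\<close> and
  \<open>X + Y\<close>.\<close>

lemma R_fun_nonneg:
  fixes X Y :: "'a::euclidean_space"
  assumes n: "2 \<le> DIM('a)"
  shows "0 \<le> R_fun X Y"
proof -
  let ?n = "DIM('a)"
  have y: "real ?n * norm X ^ (?n - 1) * norm (X + Y) - (real ?n - 1) * norm X ^ ?n \<le> norm (X + Y) ^ ?n"
    by (rule young_power) auto
  define k where "k = ?n - 2"
  have k: "?n - 1 = Suc k" "?n = Suc (Suc k)" "?n - 2 = k" unfolding k_def using n by arith+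
  have "norm X ^ 2 + X \<bullet> Y \<le> norm X * norm (X + Y)"
    using norm_cauchy_schwarz[of X "X + Y"] by (simp add: inner_add_right dot_square_norm)
  then have "norm X ^ k * (norm X ^ 2 + X \<bullet> Y) \<le> norm X ^ k * (norm X * norm (X + Y))" by (intro mult_left_mono) auto
  then have "norm X ^ ?n + norm X ^ (?n - 2) * (X \<bullet> Y) \<le> norm X ^ (?n - 1) * norm (X + Y)"
    unfolding k(1,3) by (subst k(2)) (simp add: distrib_left power2_eq_square mult_ac)
  then have "real ?n * (norm X ^ ?n + norm X ^ (?n - 2) * (X \<bullet> Y)) \<le> real ?n * (norm X ^ (?n - 1) * norm (X + Y))" by (intro mult_left_mono) auto
  then show ?thesis using y unfolding R_fun_def by (simp add: algebra_simps)
qed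

text \<open>A local Lipschitz bound for \<open>norm Z ^ m *\<^sub>R Z\<close>, which up to a factor
  is the gradient of a power of the norm.\<close>

lemma norm_power_scaleR_diff_le:
  fixes P X :: "'a::euclidean_space"
  shows "norm (norm P ^ m *\<^sub>R P - norm X ^ m *\<^sub>R X) \<le> (real m + 1) * max (norm P) (norm X) ^ m * norm (P - X)"
proof -
  define M where "M = max (norm P) (norm X)"
  have M: "0 \<le> M" "norm P \<le> M" "norm X \<le> M" by (auto simp: M_def le_max_iff_disj)
  \<comment> \<open>The additional factor \<open>M\<close> replaces the exponent
    \<open>k - 1\<close> by \<open>k\<close>, so that \<open>k = 0\<close> is no exception.\<close>
  have pd: "\<bar>a ^ k - b ^ k\<bar> * M \<le> real k * M ^ k * \<bar>a - b\<bar>" if "0 \<le> a" "a \<le> M" "0 \<le> b" "b \<le> M" for a b :: real and k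
  proof (induction k)
    case (Suc k)
    have "a ^ Suc k - b ^ Suc k = a * (a ^ k - b ^ k) + (a - b) * b ^ k" by (simp add: algebra_simps)
    then have "\<bar>a ^ Suc k - b ^ Suc k\<bar> \<le> a * \<bar>a ^ k - b ^ k\<bar> + \<bar>a - b\<bar> * b ^ k"
      using that abs_triangle_ineq[of "a * (a ^ k - b ^ k)" "(a - b) * b ^ k"] by (simp add: abs_mult)
    also have "\<dots> \<le> M * \<bar>a ^ k - b ^ k\<bar> + \<bar>a - b\<bar> * M ^ k"
      using that by (intro add_mono mult_mono mult_left_mono power_mono) auto
    finally have "\<bar>a ^ Suc k - b ^ Suc k\<bar> * M \<le> (M * \<bar>a ^ k - b ^ k\<bar> + \<bar>a - b\<bar> * M ^ k) * M"
      using M by (intro mult_right_mono)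
    also have "\<dots> = M * (\<bar>a ^ k - b ^ k\<bar> * M) + \<bar>a - b\<bar> * M ^ Suc k" by (simp add: algebra_simps)
    also have "\<dots> \<le> M * (real k * M ^ k * \<bar>a - b\<bar>) + \<bar>a - b\<bar> * M ^ Suc k"
      using Suc M by (intro add_right_mono mult_left_mono) auto
    also have "\<dots> = real (Suc k) * M ^ Suc k * \<bar>a - b\<bar>" by (simp add: algebra_simps)
    finally show ?case .
  qed simp
  have "norm P ^ m *\<^sub>R P - norm X ^ m *\<^sub>R X = norm P ^ m *\<^sub>R (P - X) + (norm P ^ m - norm X ^ m) *\<^sub>R X"
    by (simp add: algebra_simps)
  then have "norm (norm P ^ m *\<^sub>R P - norm X ^ m *\<^sub>R X) \<le> norm P ^ m * norm (P - X) + \<bar>norm P ^ m - norm X ^ m\<bar> * norm X"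
    using norm_triangle_ineq[of "norm P ^ m *\<^sub>R (P - X)" "(norm P ^ m - norm X ^ m) *\<^sub>R X"] by simp
  also have "norm P ^ m * norm (P - X) \<le> M ^ m * norm (P - X)"
    using M by (intro mult_right_mono power_mono) auto
  also have "\<bar>norm P ^ m - norm X ^ m\<bar> * norm X \<le> \<bar>norm P ^ m - norm X ^ m\<bar> * M" using M by (intro mult_left_mono) auto
  also have "\<dots> \<le> real m * M ^ m * \<bar>norm P - norm X\<bar>" using M by (intro pd) auto
  also have "\<dots> \<le> real m * M ^ m * norm (P - X)"
    using M norm_triangle_ineq3[of P X] by (intro mult_left_mono) auto
  finally show ?thesis unfolding M_def[symmetric] by (simp add: algebra_simps)
qed

text \<open>Convexity bounds the remainder by the increment of the gradient of \<open>|X|\<^sup>d\<close>.\<close>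

lemma R_fun_le_quadratic:
  fixes X Y :: "'a::euclidean_space"
  assumes n: "2 \<le> DIM('a)"
  shows "R_fun X Y \<le> real DIM('a) * (real DIM('a) - 1) * (norm X + norm Y) ^ (DIM('a) - 2) * norm Y ^ 2"
proof -
  let ?n = "DIM('a)"
  define P where "P = X + Y"
  define G where "G Z = norm Z ^ (?n - 2) *\<^sub>R Z" for Z :: 'a
  \<comment> \<open>The tangent inequality taken at the end point \<open>X + Y\<close> and read
    backwards bounds the growth of the power from above by the gradient there.\<close>
  have "0 \<le> R_fun P (- Y)" by (rule R_fun_nonneg[OF n])
  then have "norm P ^ ?n \<le> norm X ^ ?n + real ?n * (G P \<bullet> Y)"
    by (simp add: R_fun_def P_def G_def)
  then have "R_fun X Y \<le> real ?n * ((G P - G X) \<bullet> Y)"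
    by (simp add: R_fun_def P_def G_def inner_diff_left right_diff_distrib)
  also have "(G P - G X) \<bullet> Y \<le> norm (G P - G X) * norm Y" by (rule norm_cauchy_schwarz)
  also have "norm (G P - G X) \<le> (real (?n - 2) + 1) * max (norm P) (norm X) ^ (?n - 2) * norm (P - X)"
    unfolding G_def by (rule norm_power_scaleR_diff_le)
  also have "\<dots> \<le> (real ?n - 1) * (norm X + norm Y) ^ (?n - 2) * norm Y"
  proof -
    have "max (norm P) (norm X) \<le> norm X + norm Y" using norm_triangle_ineq[of X Y] by (simp add: P_def)
    then have "max (norm P) (norm X) ^ (?n - 2) \<le> (norm X + norm Y) ^ (?n - 2)"
      by (intro power_mono) (auto simp: le_max_iff_disj)
    moreover have "real (?n - 2) + 1 = real ?n - 1" using n by (simp add: of_nat_diff)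
    moreover have "0 \<le> real ?n - 1" using n by simp
    ultimately show ?thesis by (simp add: P_def mult_left_mono mult_right_mono)
  qed
  finally show ?thesis by (simp add: mult_left_mono mult_right_mono power2_eq_square mult_ac)
qed

text \<open>Half the Hessian of the \<open>n\<close>-th power of the norm: the radial direction
  counts with weight \<open>n - 1\<close>, the tangential ones with weight 1.\<close>

lemma R_fun_second_order:
  fixes X Y :: "'a::euclidean_space"
  assumes n: "2 \<le> DIM('a)" and X: "X \<noteq> 0"
  shows "((\<lambda>t. R_fun X (t *\<^sub>R Y) / t ^ 2) \<longlongrightarrow>
     real DIM('a) / 2 * norm X ^ (DIM('a) - 2) * (norm Y ^ 2 + (real DIM('a) - 2) * (sgn X \<bullet> Y) ^ 2)) (at 0)"
proof -
  let ?n = "DIM('a)"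
  define N where "N t = norm (X + t *\<^sub>R Y)" for t
  define F where "F t = N t ^ ?n" for t
  define F' where "F' t = real ?n * (N t ^ (?n - 2) * (X \<bullet> Y + t * (Y \<bullet> Y)))" for t
  have dN: "DERIV N t :> sgn (X + t *\<^sub>R Y) \<bullet> Y" if "X + t *\<^sub>R Y \<noteq> 0" for t
  proof -
    have "((\<lambda>t. X + t *\<^sub>R Y) has_derivative (\<lambda>h. h *\<^sub>R Y)) (at t)"
      by (auto intro!: derivative_eq_intros)
    then have "((\<lambda>t. norm (X + t *\<^sub>R Y)) has_derivative (\<lambda>h. (h *\<^sub>R Y) \<bullet> sgn (X + t *\<^sub>R Y))) (at t)"
      by (rule has_derivative_compose) (rule has_derivative_norm[OF that])
    moreover have "(\<lambda>h. (h *\<^sub>R Y) \<bullet> sgn (X + t *\<^sub>R Y)) = (*) (sgn (X + t *\<^sub>R Y) \<bullet> Y)"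
      by (rule ext) (simp add: inner_commute)
    ultimately show ?thesis by (simp add: N_def[abs_def] has_field_derivative_def)
  qed
  have "continuous (at 0) (\<lambda>t. X + t *\<^sub>R Y)" by (intro continuous_intros)
  then have "\<forall>\<^sub>F t in nhds 0. X + t *\<^sub>R Y \<noteq> 0"
    using X by (intro eventually_nhds_conv_at[THEN iffD2] conjI tendsto_imp_eventually_ne[of _ X]) (auto simp: continuous_within)
  then have F: "\<forall>\<^sub>F t in nhds 0. DERIV F t :> F' t"
  proof eventually_elim
    case (elim t)
    have "DERIV F t :> real ?n * (N t ^ (?n - 1) * (sgn (X + t *\<^sub>R Y) \<bullet> Y))"
      unfolding F_def[abs_def] using DERIV_power[OF dN[OF elim], of ?n] by (simp add: mult_ac)
    moreover have "N t ^ (?n - 1) * (sgn (X + t *\<^sub>R Y) \<bullet> Y) = N t ^ (?n - 2) * (X \<bullet> Y + t * (Y \<bullet> Y))"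
    proof -
      have "?n - 1 = Suc (?n - 2)" using n by arith
      then have "N t ^ (?n - 1) = N t ^ (?n - 2) * N t" by (simp only: power_Suc2)
      moreover have "N t * (sgn (X + t *\<^sub>R Y) \<bullet> Y) = X \<bullet> Y + t * (Y \<bullet> Y)"
        using elim by (simp add: N_def sgn_div_norm inner_add_left)
      ultimately show ?thesis by (simp only: mult.assoc)
    qed
    ultimately show ?case by (simp add: F'_def)
  qed
  have N0: "N 0 = norm X" "0 < N 0" using X by (auto simp: N_def)
  have dN0: "DERIV N 0 :> sgn X \<bullet> Y" using dN[of 0] X by simp
  have "DERIV F' 0 :> real ?n * (real (?n - 2) * ((sgn X \<bullet> Y) * N 0 ^ (?n - 2 - Suc 0)) * (X \<bullet> Y + 0 * (Y \<bullet> Y)) + (0 + 1 * (Y \<bullet> Y)) * N 0 ^ (?n - 2))"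
    unfolding F'_def[abs_def]
    by (intro DERIV_cmult DERIV_mult DERIV_power[OF dN0] DERIV_add DERIV_const DERIV_cmult_right DERIV_ident)
  moreover have "real ?n * (real (?n - 2) * ((sgn X \<bullet> Y) * N 0 ^ (?n - 2 - Suc 0)) * (X \<bullet> Y + 0 * (Y \<bullet> Y)) + (0 + 1 * (Y \<bullet> Y)) * N 0 ^ (?n - 2))
     = real ?n * norm X ^ (?n - 2) * (norm Y ^ 2 + (real ?n - 2) * (sgn X \<bullet> Y) ^ 2)"
  \<comment> \<open>In dimension 2 the natural-number exponent \<open>n - 2 - 1\<close> is cut off
    at 0, but it is multiplied by \<open>n - 2 = 0\<close>; otherwise one factor of the norm is
    split off.\<close>
  proof (cases "?n = 2")
    case True
    then show ?thesis by (simp add: dot_square_norm)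
  next
    case False
    have XY: "X \<bullet> Y = norm X * (sgn X \<bullet> Y)" using X by (simp add: sgn_div_norm)
    have "?n - 2 = Suc (?n - 2 - Suc 0)" using False n by arith
    then have "norm X ^ (?n - 2) = norm X * norm X ^ (?n - 2 - Suc 0)" by (metis power_Suc)
    moreover have "real (?n - 2) = real ?n - 2" using n by (simp add: of_nat_diff)
    ultimately show ?thesis
      unfolding N0(1) XY dot_square_norm[of Y] by (simp add: algebra_simps power2_eq_square)
  qed
  ultimately have F2: "DERIV F' 0 :> real ?n * norm X ^ (?n - 2) * (norm Y ^ 2 + (real ?n - 2) * (sgn X \<bullet> Y) ^ 2)" by metis
  have "R_fun X (t *\<^sub>R Y) = F t - F 0 - t * F' 0" for t
    by (simp add: R_fun_def F_def F'_def N_def)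
  then show ?thesis using second_order_quotient[OF F F2] by simp
qed

section \<open>The radial profile of the approximate extremal\<close>

definition prof :: "nat \<Rightarrow> real \<Rightarrow> real" where
  "prof n r = rt n r / (1 + rt n r ^ n)"

text \<open>The logarithmic derivative of the profile: \<open>slope n r\<close> is
  \<open>r * prof' / prof\<close> for positive \<open>r\<close>.\<close>

definition slope :: "nat \<Rightarrow> real \<Rightarrow> real" where
  "slope n r = (1 - (real n - 1) * rt n r ^ n) / ((real n - 1) * (1 + rt n r ^ n))"

lemma prof_measurable [measurable]: "prof n \<in> borel_measurable borel"
  unfolding prof_def[abs_def] by measurable

lemma slope_measurable [measurable]: "slope n \<in> borel_measurable borel"
  unfolding slope_def[abs_def] by measurable

lemma prof_nonneg: "0 \<le> prof n r"
  unfolding prof_def using rt_nonneg[of n r] one_plus_rt_pos[of n r] by simp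

lemma norm_grad_bubble_prof:
  "2 \<le> DIM('a) \<Longrightarrow> norm (grad_bubble (x::'a::euclidean_space)) = real DIM('a) ^ 2 / (real DIM('a) - 1) * prof DIM('a) (norm x)"
  by (simp add: norm_grad_bubble prof_def sig_def)

text \<open>The exponents satisfy \<open>(n - 2)/(n - 1) + 1/(n - 1) = 1\<close>. Comparison with
  \<open>grad_bubble\<close> shows that \<open>v_fun e x\<close> is
  \<open>(n - 1)/n * (grad_bubble x \<bullet> e)\<close>.\<close>

lemma v_fun_eq:
  assumes n: "2 \<le> DIM('a)"
  shows "v_fun e x = - real DIM('a) * prof DIM('a) (norm x) * (sgn x \<bullet> (e::'a::euclidean_space))"
proof (cases "x = 0")
  case False
  define N where "N = real DIM('a)"
  have N: "2 \<le> N" using n by (simp add: N_def)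
  have r: "0 < norm x" using False by simp
  have "norm x powr ((N - 2) / (N - 1)) * rt DIM('a) (norm x) = norm x powr ((N - 2) / (N - 1) + 1 / (N - 1))"
    by (simp add: rt_def N_def powr_add)
  also have "(N - 2) / (N - 1) + 1 / (N - 1) = 1" using N by (simp add: field_simps)
  finally have p: "norm x powr ((N - 2) / (N - 1)) * rt DIM('a) (norm x) = norm x" using r by simp
  have "0 < norm x powr ((N - 2) / (N - 1))" using r by simp
  then have q: "1 / norm x powr ((N - 2) / (N - 1)) = rt DIM('a) (norm x) / norm x"
    using p r by (simp add: field_simps)
  have "v_fun e x = - N * ((x \<bullet> e) * (1 / norm x powr ((N - 2) / (N - 1))) / (1 + sig x))"
    using sig_eq_powr[OF n, of x] by (simp add: v_fun_def Let_def N_def)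
  then show ?thesis
    unfolding q by (simp add: N_def prof_def sig_def sgn_div_norm divide_inverse mult_ac)
qed (simp add: v_fun_def)

text \<open>The factor \<open>prof / r\<close> acts on the tangential part of \<open>e\<close>; on
  its radial part it is multiplied by \<open>slope\<close>, which gives the derivative of
  \<open>prof\<close>.\<close>

definition grad_v :: "'a \<Rightarrow> 'a \<Rightarrow> 'a::euclidean_space" where
  "grad_v e x = (- (real DIM('a) * prof DIM('a) (norm x) / norm x)) *\<^sub>R
     (e + ((slope DIM('a) (norm x) - 1) * (sgn x \<bullet> e)) *\<^sub>R sgn x)"

lemma DERIV_rt:
  assumes n: "2 \<le> n" and r: "0 < r"
  shows "DERIV (rt n) r :> rt n r / ((real n - 1) * r)"
proof -
  have "DERIV (\<lambda>r. r powr (1 / (real n - 1))) r :> 1 / (real n - 1) * r powr (1 / (real n - 1) - 1)"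
    using r by (auto intro!: derivative_eq_intros)
  moreover have "r powr (1 / (real n - 1) - 1) = rt n r / r" using r by (simp add: powr_diff rt_def)
  ultimately show ?thesis by (simp add: rt_def[abs_def])
qed

lemma rt_power_mult: "2 \<le> n \<Longrightarrow> 0 \<le> r \<Longrightarrow> rt n r ^ n = r * rt n r"
proof -
  assume n: "2 \<le> n" and r: "0 \<le> r"
  have "n = Suc (n - 1)" using n by arith
  then have "rt n r ^ n = rt n r * rt n r ^ (n - 1)" by (metis power_Suc)
  then show ?thesis using rt_power(1)[OF n r] by simp
qed

lemma DERIV_prof_quotient:
  assumes n: "2 \<le> n" and r: "0 < r"
  shows "DERIV (\<lambda>r. prof n r / r) r :> prof n r / r * (slope n r - 1) / r"
proof -
  define m where "m = real n - 1"
  have m: "1 \<le> m" "real n = m + 1" using n by (auto simp: m_def)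
  define t where "t = rt n r"
  define s where "s = rt n r ^ n"
  have s: "s = r * t" using rt_power_mult[OF n, of r] r by (simp add: s_def t_def)
  have t0: "0 < t" using rt_pos[OF r] by (simp add: t_def)
  have s0: "0 < 1 + s" by (simp add: s_def one_plus_rt_pos)
  have "DERIV (\<lambda>r. rt n r / (1 + rt n r ^ n) / r) r :>
    ((t / (m * r) * (1 + s) - t * (0 + (m + 1) / m * t)) / ((1 + s) * (1 + s)) * r - t / (1 + s) * 1) / (r * r)"
    unfolding t_def s_def m(2)[symmetric] unfolding m_def
    by (intro DERIV_divide DERIV_add DERIV_const DERIV_rt[OF n r] DERIV_rt_power[OF n r] DERIV_ident)
      (use r one_plus_rt_pos[of n r] in auto)
  moreover have "((t / (m * r) * (1 + s) - t * (0 + (m + 1) / m * t)) / ((1 + s) * (1 + s)) * r - t / (1 + s) * 1) / (r * r)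
    = t / (1 + s) / r * ((1 - m * s) / (m * (1 + s)) - 1) / r"
  proof -
    have "(t / (m * r) * (1 + s) - t * (0 + (m + 1) / m * t)) * r = t / m * (1 + s - (m + 1) * s)"
      using m r by (simp add: s field_simps)
    then have "(t / (m * r) * (1 + s) - t * (0 + (m + 1) / m * t)) / ((1 + s) * (1 + s)) * r = t / m * (1 - m * s) / ((1 + s) * (1 + s))"
      by (simp add: algebra_simps)
    moreover have "t / m * (1 - m * s) / ((1 + s) * (1 + s)) = t / (1 + s) * ((1 - m * s) / (m * (1 + s)))"
      by simp
    ultimately have q: "(t / (m * r) * (1 + s) - t * (0 + (m + 1) / m * t)) / ((1 + s) * (1 + s)) * r = t / (1 + s) * ((1 - m * s) / (m * (1 + s)))"
      by (simp only:)
    have "(a * W - a * 1) / (r * r) = a / r * (W - 1) / r" for a W using r by (simp add: field_simps)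
    then show ?thesis unfolding q by blast
  qed
  ultimately show ?thesis unfolding prof_def slope_def t_def s_def m_def by metis
qed

lemma has_derivative_v_fun:
  fixes e x :: "'a::euclidean_space"
  assumes n: "2 \<le> DIM('a)" and x: "x \<noteq> 0"
  shows "(v_fun e has_derivative (\<lambda>h. grad_v e x \<bullet> h)) (at x)"
proof -
  let ?n = "DIM('a)"
  define \<psi> where "\<psi> r = prof ?n r / r" for r
  have d: "((\<lambda>y. \<psi> (norm y)) has_derivative (\<lambda>h. (h \<bullet> sgn x) * (\<psi> (norm x) * (slope ?n (norm x) - 1) / norm x))) (at x)"
    using DERIV_compose_FDERIV[OF DERIV_prof_quotient[OF n, of "norm x"] has_derivative_norm[OF x]] x
    by (simp add: \<psi>_def[abs_def])
  have "((\<lambda>y. - real ?n * (\<psi> (norm y) * (y \<bullet> e))) has_derivative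
     (\<lambda>h. - real ?n * (\<psi> (norm x) * (h \<bullet> e) + (h \<bullet> sgn x) * (\<psi> (norm x) * (slope ?n (norm x) - 1) / norm x) * (x \<bullet> e)))) (at x)"
    by (intro has_derivative_mult_right has_derivative_mult d has_derivative_inner_left has_derivative_ident)
  moreover have "- real ?n * (\<psi> (norm x) * (h \<bullet> e) + (h \<bullet> sgn x) * (\<psi> (norm x) * (slope ?n (norm x) - 1) / norm x) * (x \<bullet> e)) = grad_v e x \<bullet> h" for h
  proof -
    have xe: "x \<bullet> e = norm x * (sgn x \<bullet> e)" using x by (simp add: sgn_div_norm)
    have *: "- N * (P / r * E + B * (P / r * (L - 1) / r) * (r * A)) = - (N * P / r) * (E + (L - 1) * A * B)"
      if "r \<noteq> 0" for N P r E B L A :: real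
      using that by (simp add: field_simps)
    show ?thesis
      unfolding xe grad_v_def \<psi>_def inner_scaleR_left inner_add_left inner_commute[of h]
      using x by (intro *) simp
  qed
  moreover have "- real ?n * (\<psi> (norm y) * (y \<bullet> e)) = v_fun e y" for y
    unfolding v_fun_eq[OF n] by (simp add: \<psi>_def sgn_div_norm divide_inverse)
  ultimately show ?thesis by simp
qed

lemma prof_le:
  assumes "2 \<le> n" "0 < r"
  shows "prof n r \<le> rt n r" "prof n r \<le> 1 / r" "prof n r \<le> 1"
proof -
  have t: "0 < rt n r" using rt_pos[OF assms(2)] .
  have s: "rt n r ^ n = r * rt n r" using rt_power_mult[OF assms(1), of r] assms(2) by simp
  have s0: "0 < rt n r ^ n" using t by simp
  have "rt n r / (1 + rt n r ^ n) \<le> rt n r / 1" using divide_left_mono[of 1 "1 + rt n r ^ n" "rt n r"] t s0 by simp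
  then show "prof n r \<le> rt n r" by (simp add: prof_def)
  have "rt n r / (1 + rt n r ^ n) \<le> rt n r / rt n r ^ n" using divide_left_mono[of "rt n r ^ n" "1 + rt n r ^ n" "rt n r"] t s0 by simp
  also have "\<dots> = 1 / r" unfolding s using t by simp
  finally show "prof n r \<le> 1 / r" by (simp add: prof_def)
  have "rt n r \<le> 1 + rt n r ^ n"
  proof (cases "rt n r \<le> 1")
    case True then show ?thesis using s0 by linarith
  next
    case False
    then have "rt n r ^ 1 \<le> rt n r ^ n" using assms(1) by (intro power_increasing) auto
    then show ?thesis by simp
  qed
  then show "prof n r \<le> 1" unfolding prof_def using s0 by (simp add: divide_le_eq)
qed

lemma prof_le_1: "2 \<le> n \<Longrightarrow> 0 \<le> r \<Longrightarrow> prof n r \<le> 1"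
  using prof_le(3)[of n r] by (cases "r = 0") (auto simp: prof_def)

lemma abs_slope_le:
  assumes n: "2 \<le> n" shows "\<bar>slope n r\<bar> \<le> 1"
proof -
  define m where "m = real n - 1"
  have m: "1 \<le> m" using n by (simp add: m_def)
  define s where "s = rt n r ^ n"
  have s: "0 \<le> s" by (simp add: s_def rt_nonneg)
  have ms: "0 \<le> m * s" using m s by simp
  have "\<bar>1 - m * s\<bar> \<le> m * (1 + s)" using m ms unfolding distrib_left by linarith
  moreover have "0 < m * (1 + s)" using m s by simp
  ultimately show ?thesis unfolding slope_def m_def[symmetric] s_def[symmetric] by (simp add: abs_divide)
qed

text \<open>Assembled from two functions already known to be integrable: the Riesz kernel controls
  the unit ball and the density of \<open>mu\<close>, up to a factor, the exterior.\<close>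

definition dominator :: "nat \<Rightarrow> real \<Rightarrow> real" where
  "dominator n r = 2 ^ (n - 2) * (indicator {..<1} r * (1 / r ^ (n - 1))) + 2 ^ (n - 2) * 2 ^ n * (1 / (1 + rt n r ^ n) ^ n)"

lemma dominator_integrable:
  assumes n: "2 \<le> DIM('a)"
  shows "integrable (lborel :: 'a::euclidean_space measure) (\<lambda>x. dominator DIM('a) (norm x))"
proof -
  have i: "indicator {..<1} (norm x) = (indicator (ball 0 1) x :: real)" for x :: 'a by (auto simp: indicator_def)
  show ?thesis unfolding dominator_def i
    by (intro Bochner_Integration.integrable_add integrable_mult_right riesz_kernel_integrable[OF n] bubble_mass[OF n]) simp
qed

text \<open>With \<open>t = rt n r\<close> and \<open>s = t ^ n\<close>: for \<open>r < 1\<close>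
  one has \<open>prof ^ n \<le> s \<le> r\<close> and \<open>1 + 1 / r \<le> 2 / r\<close>. For
  \<open>r \<ge> 1\<close> one has \<open>prof \<le> 1 / r\<close>, and
  \<open>s ^ n = r ^ (n + 1) * t \<le> r ^ (n + 2)\<close> compares the remaining power of
  \<open>r\<close> with the density.\<close>

lemma dominator_bound:
  assumes n: "2 \<le> n" and r: "0 < r"
  shows "prof n r ^ n * (1 + 1 / r) ^ (n - 2) / r ^ 2 \<le> dominator n r"
proof -
  define k where "k = n - 2"
  have k: "n = Suc (Suc k)" "n - 2 = k" "n - 1 = Suc k" unfolding k_def using n by arith+
  define t where "t = rt n r"
  have t: "0 < t" using rt_pos[OF r] by (simp add: t_def)
  define s where "s = t ^ n"
  have s: "s = r * t" using rt_power_mult[OF n, of r] r by (simp add: s_def t_def)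
  have s0: "0 < s" using t by (simp add: s_def)
  have tr: "t ^ Suc k = r" using rt_power(1)[OF n, of r] r unfolding k(3) by (simp add: t_def)
  have P0: "0 \<le> prof n r" by (rule prof_nonneg)
  have d2: "0 \<le> 2 ^ k * 2 ^ n * (1 / (1 + s) ^ n)" using s0 by simp
  show ?thesis
  proof (cases "r < 1")
    case True
    have "t \<le> 1"
    proof (rule ccontr)
      assume "\<not> t \<le> 1"
      then have "1 \<le> t ^ Suc k" by (intro one_le_power) simp
      then show False using True tr by simp
    qed
    then have "s \<le> r" using r unfolding s by (simp add: mult_left_le)
    have "prof n r ^ n \<le> t ^ n" using prof_le(1)[OF n r] P0 by (intro power_mono) (auto simp: t_def)
    also have "\<dots> \<le> r" using \<open>s \<le> r\<close> by (simp add: s_def)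
    finally have a: "prof n r ^ n \<le> r" .
    have "1 + 1 / r \<le> 2 / r" using True r by (simp add: field_simps)
    then have b: "(1 + 1 / r) ^ k \<le> (2 / r) ^ k" using r by (intro power_mono) auto
    have "prof n r ^ n * (1 + 1 / r) ^ k \<le> r * (2 / r) ^ k"
      using a b r P0 by (intro mult_mono) auto
    then have "prof n r ^ n * (1 + 1 / r) ^ k / r ^ 2 \<le> r * (2 / r) ^ k / r ^ 2" by (intro divide_right_mono) auto
    also have "\<dots> = 2 ^ k * (1 / r ^ Suc k)" using r by (simp add: power_divide power2_eq_square)
    finally show ?thesis using True d2 unfolding dominator_def k(2,3) t_def[symmetric] s_def[symmetric] by simp
  next
    case False
    have t1: "1 \<le> t"
    proof (rule ccontr)
      assume "\<not> 1 \<le> t"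
      then have "t ^ Suc k < 1" using t by (intro power_Suc_less_one) auto
      then show False using False tr by simp
    qed
    have tler: "t \<le> r" using t1 tr self_le_power[of t "Suc k"] by simp
    have s1: "1 \<le> s" using t1 by (simp add: s_def one_le_power)
    have "prof n r ^ n \<le> (1 / r) ^ n" using prof_le(2)[OF n r] P0 by (intro power_mono) auto
    moreover have "(1 + 1 / r) ^ k \<le> 2 ^ k" using False r by (intro power_mono) (auto simp: field_simps)
    ultimately have "prof n r ^ n * (1 + 1 / r) ^ k \<le> (1 / r) ^ n * 2 ^ k" using r by (intro mult_mono) auto
    then have "prof n r ^ n * (1 + 1 / r) ^ k / r ^ 2 \<le> (1 / r) ^ n * 2 ^ k / r ^ 2" by (intro divide_right_mono) auto
    also have "\<dots> = 2 ^ k * (1 / (r ^ n * r ^ 2))" by (simp add: power_divide)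
    also have "\<dots> \<le> 2 ^ k * (2 ^ n * (1 / (1 + s) ^ n))"
    proof -
      have "(1 + s) ^ n \<le> (2 * s) ^ n" using s1 by (intro power_mono) auto
      also have "(2 * s) ^ n = 2 ^ n * (r ^ n * (r * t))" unfolding power_mult_distrib s using s by (simp add: s_def)
      also have "\<dots> \<le> 2 ^ n * (r ^ n * r ^ 2)" using tler r by (simp add: power2_eq_square)
      finally have "(1 + s) ^ n \<le> 2 ^ n * (r ^ n * r ^ 2)" .
      then have "1 / (r ^ n * r ^ 2) \<le> 2 ^ n * (1 / (1 + s) ^ n)" using r s0 by (simp add: field_simps)
      then show ?thesis by (intro mult_left_mono) auto
    qed
    finally show ?thesis using False unfolding dominator_def k(2,3) t_def[symmetric] s_def[symmetric] by simp
  qed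
qed

lemma norm_grad_v:
  fixes e x :: "'a::euclidean_space"
  assumes e: "norm e = 1" and x: "x \<noteq> 0"
  shows "norm (grad_v e x) ^ 2 = (real DIM('a) * prof DIM('a) (norm x) / norm x) ^ 2 * (1 - (sgn x \<bullet> e) ^ 2 + slope DIM('a) (norm x) ^ 2 * (sgn x \<bullet> e) ^ 2)"
    and "sgn x \<bullet> grad_v e x = - (real DIM('a) * prof DIM('a) (norm x) / norm x) * (slope DIM('a) (norm x) * (sgn x \<bullet> e))"
proof -
  define L z where "L = slope DIM('a) (norm x)" and "z = sgn x \<bullet> e"
  have ee: "e \<bullet> e = 1" using e by (simp add: dot_square_norm)
  have ss: "sgn x \<bullet> sgn x = 1" using x by (simp add: dot_square_norm norm_sgn)
  have "norm (e + ((L - 1) * z) *\<^sub>R sgn x) ^ 2 = 1 + 2 * ((L - 1) * z) * z + ((L - 1) * z) ^ 2"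
    unfolding power2_norm_eq_inner inner_add_left inner_add_right inner_scaleR_left inner_scaleR_right ee ss
    unfolding inner_commute[of e] z_def[symmetric] by (simp add: power2_eq_square algebra_simps)
  also have "\<dots> = 1 - z ^ 2 + L ^ 2 * z ^ 2" by (simp add: power2_eq_square algebra_simps)
  finally show "norm (grad_v e x) ^ 2 = (real DIM('a) * prof DIM('a) (norm x) / norm x) ^ 2 * (1 - (sgn x \<bullet> e) ^ 2 + slope DIM('a) (norm x) ^ 2 * (sgn x \<bullet> e) ^ 2)"
    unfolding grad_v_def norm_scaleR L_def[symmetric] z_def[symmetric] power_mult_distrib power2_abs power2_minus by simp
  have "sgn x \<bullet> (e + ((L - 1) * z) *\<^sub>R sgn x) = L * z"
    unfolding inner_add_right inner_scaleR_right ss z_def[symmetric] by (simp add: algebra_simps)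
  then show "sgn x \<bullet> grad_v e x = - (real DIM('a) * prof DIM('a) (norm x) / norm x) * (slope DIM('a) (norm x) * (sgn x \<bullet> e))"
    unfolding grad_v_def inner_scaleR_right L_def[symmetric] z_def[symmetric] by simp
qed

lemma norm_grad_v_le:
  fixes e x :: "'a::euclidean_space"
  assumes n: "2 \<le> DIM('a)" and e: "norm e = 1" and x: "x \<noteq> 0"
  shows "norm (grad_v e x) \<le> real DIM('a) * prof DIM('a) (norm x) / norm x"
proof -
  have a: "0 \<le> real DIM('a) * prof DIM('a) (norm x) / norm x" using prof_nonneg by simp
  have "slope DIM('a) (norm x) ^ 2 \<le> 1" using abs_slope_le[OF n, of "norm x"] by (simp add: abs_square_le_1)
  then have "slope DIM('a) (norm x) ^ 2 * (sgn x \<bullet> e) ^ 2 \<le> 1 * (sgn x \<bullet> e) ^ 2" by (intro mult_right_mono) auto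
  then have "1 - (sgn x \<bullet> e) ^ 2 + slope DIM('a) (norm x) ^ 2 * (sgn x \<bullet> e) ^ 2 \<le> 1" by simp
  then have "norm (grad_v e x) ^ 2 \<le> (real DIM('a) * prof DIM('a) (norm x) / norm x) ^ 2 * 1"
    unfolding norm_grad_v(1)[OF e x] by (intro mult_left_mono) auto
  then show ?thesis by (intro power2_le_imp_le[OF _ a]) simp
qed

text \<open>The coefficient of \<open>t^2\<close> in
  \<open>H_fun x (t *\<^sub>R grad_v e x)\<close>, with all powers of the profile collected.\<close>

definition hess_form :: "'a \<Rightarrow> 'a::euclidean_space \<Rightarrow> real" where
  "hess_form e x = real DIM('a) ^ (DIM('a) - 1) * (real DIM('a) - 1) ^ 2 / 2 * (prof DIM('a) (norm x) ^ DIM('a) / norm x ^ 2)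
     * (1 - (sgn x \<bullet> e) ^ 2 + (real DIM('a) - 1) * slope DIM('a) (norm x) ^ 2 * (sgn x \<bullet> e) ^ 2)"

lemma grad_v_measurable [measurable]: "grad_v e \<in> borel_measurable borel"
  unfolding grad_v_def[abs_def] sgn_div_norm by measurable

lemma hess_form_measurable [measurable]: "hess_form e \<in> borel_measurable borel"
  unfolding hess_form_def[abs_def] sgn_div_norm by measurable

text \<open>The gradient of the profile is radial, so the radial weight \<open>n - 1\<close> of the
  Hessian falls on the \<open>slope\<close> part of \<open>grad_v\<close>. It does not vanish away
  from the origin, as \<open>R_fun_second_order\<close> requires.\<close>

lemma H_fun_second_order:
  fixes e x :: "'a::euclidean_space"
  assumes n: "2 \<le> DIM('a)" and e: "norm e = 1" and x: "x \<noteq> 0"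
  shows "((\<lambda>t. H_fun x (t *\<^sub>R grad_v e x) / t ^ 2) \<longlongrightarrow> hess_form e x) (at 0)"
proof -
  define N where "N = real DIM('a)"
  have N: "2 \<le> N" using n by (simp add: N_def)
  define k where "k = DIM('a) - 2"
  have k: "DIM('a) = Suc (Suc k)" "DIM('a) - 2 = k" "DIM('a) - 1 = Suc k" unfolding k_def using n by arith+
  define P where "P = prof DIM('a) (norm x)"
  define L z where "L = slope DIM('a) (norm x)" and "z = sgn x \<bullet> e"
  have P: "0 < P"
    unfolding P_def prof_def using rt_pos[of "norm x" "DIM('a)"] x one_plus_rt_pos by (intro divide_pos_pos) auto
  define \<beta> where "\<beta> = N ^ 2 / (N - 1)"
  have \<beta>: "0 < \<beta>" using N by (simp add: \<beta>_def)
  have gb: "grad_bubble x = (- (\<beta> * P)) *\<^sub>R sgn x"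
    by (simp add: grad_bubble_def \<beta>_def N_def P_def prof_def sig_def)
  have gb0: "grad_bubble x \<noteq> 0" using gb \<beta> P x by (simp add: sgn_zero_iff)
  have sg: "sgn (grad_bubble x) = - sgn x"
    unfolding gb sgn_scaleR using \<beta> P x by (simp add: sgn_mult sgn_div_norm[of "sgn x"] norm_sgn)
  have ngb: "norm (grad_bubble x) = \<beta> * P" unfolding norm_grad_bubble_prof[OF n] by (simp add: \<beta>_def N_def P_def)
  have "((\<lambda>t. ((N - 1) / N) ^ DIM('a) * (R_fun (grad_bubble x) (t *\<^sub>R grad_v e x) / t ^ 2)) \<longlongrightarrow>
     ((N - 1) / N) ^ DIM('a) * (N / 2 * norm (grad_bubble x) ^ (DIM('a) - 2) * (norm (grad_v e x) ^ 2 + (N - 2) * (sgn (grad_bubble x) \<bullet> grad_v e x) ^ 2))) (at 0)"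
    unfolding N_def by (intro tendsto_mult tendsto_const R_fun_second_order[OF n gb0])
  moreover have "((N - 1) / N) ^ DIM('a) * (R_fun (grad_bubble x) (t *\<^sub>R grad_v e x) / t ^ 2) = H_fun x (t *\<^sub>R grad_v e x) / t ^ 2" for t
    by (simp add: H_fun_eq[OF n] N_def)
  moreover have "((N - 1) / N) ^ DIM('a) * (N / 2 * norm (grad_bubble x) ^ (DIM('a) - 2) * (norm (grad_v e x) ^ 2 + (N - 2) * (sgn (grad_bubble x) \<bullet> grad_v e x) ^ 2)) = hess_form e x"
  proof -
    have b: "((N - 1) / N) ^ DIM('a) * \<beta> ^ k = N ^ k * ((N - 1) / N) ^ 2"
    proof -
      have "(N - 1) / N * \<beta> = N" using N by (simp add: \<beta>_def power2_eq_square)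
      then have "((N - 1) / N) ^ k * \<beta> ^ k = N ^ k" unfolding power_mult_distrib[symmetric] by simp
      then show ?thesis unfolding k(1) by (simp add: power2_eq_square mult_ac)
    qed
    have sgv: "(sgn (grad_bubble x) \<bullet> grad_v e x) ^ 2 = (N * P / norm x) ^ 2 * (L ^ 2 * z ^ 2)"
      unfolding sg inner_minus_left norm_grad_v(2)[OF e x] N_def[symmetric] P_def[symmetric] L_def[symmetric] z_def[symmetric]
      by (simp add: power_mult_distrib power_divide)
    have "((N - 1) / N) ^ DIM('a) * (N / 2 * norm (grad_bubble x) ^ (DIM('a) - 2) * (norm (grad_v e x) ^ 2 + (N - 2) * (sgn (grad_bubble x) \<bullet> grad_v e x) ^ 2))
      = (((N - 1) / N) ^ DIM('a) * \<beta> ^ k) * (N / 2 * P ^ k * ((N * P / norm x) ^ 2 * (1 - z ^ 2 + L ^ 2 * z ^ 2 + (N - 2) * (L ^ 2 * z ^ 2))))"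
      unfolding sgv norm_grad_v(1)[OF e x] ngb k(2) N_def[symmetric] P_def[symmetric] L_def[symmetric] z_def[symmetric] power_mult_distrib[of \<beta>]
      by (simp add: algebra_simps)
    also have "\<dots> = (N * N ^ k) * (N - 1) ^ 2 / 2 * ((P ^ k * P ^ 2) / norm x ^ 2) * (1 - z ^ 2 + (N - 1) * L ^ 2 * z ^ 2)"
    proof -
      have "Nk * ((N - 1) / N) ^ 2 * (N / 2 * Pk * ((N * P / r) ^ 2 * (1 - z ^ 2 + L ^ 2 * z ^ 2 + (N - 2) * (L ^ 2 * z ^ 2))))
        = (N * Nk) * (N - 1) ^ 2 / 2 * ((Pk * P ^ 2) / r ^ 2) * (1 - z ^ 2 + (N - 1) * L ^ 2 * z ^ 2)" for Nk Pk r :: real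
      proof -
        have "1 - z ^ 2 + L ^ 2 * z ^ 2 + (N - 2) * (L ^ 2 * z ^ 2) = 1 - z ^ 2 + (N - 1) * L ^ 2 * z ^ 2" by (simp add: algebra_simps)
        then show ?thesis using N by (simp add: power_divide power_mult_distrib)
      qed
      then show ?thesis unfolding b by blast
    qed
    also have "N * N ^ k = N ^ (DIM('a) - 1)" unfolding k(3) by simp
    also have "P ^ k * P ^ 2 = P ^ DIM('a)" unfolding k(1) by (simp add: power2_eq_square)
    finally show ?thesis unfolding hess_form_def N_def P_def L_def z_def .
  qed
  ultimately show ?thesis by (simp only:)
qed

text \<open>The norms of \<open>grad_bubble x\<close> and \<open>t *\<^sub>R grad_v e x\<close> are
  at most \<open>\<beta> * P\<close> and \<open>N * P / r\<close>, so the quadratic bound on the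
  remainder is a constant times \<open>P ^ n * (1 + 1 / r) ^ (n - 2) / r ^ 2\<close>, which
  \<open>dominator\<close> controls.\<close>

lemma H_fun_dominated:
  fixes e :: "'a::euclidean_space"
  assumes n: "2 \<le> DIM('a)" and e: "norm e = 1"
  obtains C where "\<And>t x. t \<noteq> 0 \<Longrightarrow> \<bar>t\<bar> \<le> 1 \<Longrightarrow> x \<noteq> 0 \<Longrightarrow> \<bar>H_fun x (t *\<^sub>R grad_v e x) / t ^ 2\<bar> \<le> C * dominator DIM('a) (norm (x::'a))"
proof -
  define N where "N = real DIM('a)"
  have N: "2 \<le> N" using n by (simp add: N_def)
  define k where "k = DIM('a) - 2"
  have k: "DIM('a) = Suc (Suc k)" "DIM('a) - 2 = k" unfolding k_def using n by arith+
  define \<beta> where "\<beta> = N ^ 2 / (N - 1)"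
  have \<beta>: "0 < \<beta>" using N by (simp add: \<beta>_def)
  define c where "c = ((N - 1) / N) ^ DIM('a)"
  have c: "0 \<le> c" using N by (simp add: c_def)
  define C where "C = c * (N * (N - 1) * (\<beta> + N) ^ k * N ^ 2)"
  have C: "0 \<le> C" using c N \<beta> by (simp add: C_def)
  show ?thesis
  proof (rule that[of C])
    fix t :: real and x :: 'a assume t: "t \<noteq> 0" "\<bar>t\<bar> \<le> 1" and x: "x \<noteq> 0"
    define r where "r = norm x"
    have r: "0 < r" using x by (simp add: r_def)
    define P where "P = prof DIM('a) r"
    have P: "0 \<le> P" by (simp add: P_def prof_nonneg)
    define G where "G = norm (grad_v e x)"
    have G: "0 \<le> G" "G \<le> N * P / r" using norm_grad_v_le[OF n e x] by (auto simp: G_def N_def P_def r_def)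
    have "t ^ 2 > 0" using t by simp
    have "R_fun (grad_bubble x) (t *\<^sub>R grad_v e x) \<le> N * (N - 1) * (\<beta> * P + \<bar>t\<bar> * G) ^ k * (\<bar>t\<bar> * G) ^ 2"
      using R_fun_le_quadratic[OF n, of "grad_bubble x" "t *\<^sub>R grad_v e x"]
      unfolding norm_grad_bubble_prof[OF n] norm_scaleR k(2) G_def[symmetric] N_def[symmetric] \<beta>_def[symmetric] r_def[symmetric] P_def[symmetric] .
    also have "(\<bar>t\<bar> * G) ^ 2 = t ^ 2 * G ^ 2" by (simp add: power_mult_distrib)
    finally have 1: "R_fun (grad_bubble x) (t *\<^sub>R grad_v e x) / t ^ 2 \<le> N * (N - 1) * (\<beta> * P + \<bar>t\<bar> * G) ^ k * G ^ 2"
      using \<open>t ^ 2 > 0\<close> by (simp add: divide_le_eq mult_ac)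
    have "\<bar>t\<bar> * G \<le> 1 * (N * P / r)" using G t by (intro mult_mono) auto
    also have "\<dots> \<le> (\<beta> + N) * P / r" using P \<beta> r by (simp add: divide_right_mono mult_right_mono)
    finally have "\<beta> * P + \<bar>t\<bar> * G \<le> (\<beta> + N) * P * (1 + 1 / r)"
    proof -
      assume "\<bar>t\<bar> * G \<le> (\<beta> + N) * P / r"
      moreover have "\<beta> * P \<le> (\<beta> + N) * P" using P N by (simp add: mult_right_mono)
      ultimately show ?thesis by (simp add: distrib_left)
    qed
    then have "(\<beta> * P + \<bar>t\<bar> * G) ^ k \<le> ((\<beta> + N) * P * (1 + 1 / r)) ^ k" using \<beta> P G by (intro power_mono) auto
    moreover have "G ^ 2 \<le> (N * P / r) ^ 2" using G by (intro power_mono)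
    ultimately have "N * (N - 1) * (\<beta> * P + \<bar>t\<bar> * G) ^ k * G ^ 2 \<le> N * (N - 1) * ((\<beta> + N) * P * (1 + 1 / r)) ^ k * (N * P / r) ^ 2"
      using N \<beta> P r by (intro mult_mono mult_left_mono) auto
    also have "\<dots> = N * (N - 1) * (\<beta> + N) ^ k * N ^ 2 * (P ^ k * P ^ 2 * (1 + 1 / r) ^ k / r ^ 2)"
      by (simp add: power_mult_distrib power_divide)
    also have "P ^ k * P ^ 2 = P ^ DIM('a)" unfolding k(1) by (simp add: power2_eq_square)
    finally have 2: "R_fun (grad_bubble x) (t *\<^sub>R grad_v e x) / t ^ 2 \<le> N * (N - 1) * (\<beta> + N) ^ k * N ^ 2 * (P ^ DIM('a) * (1 + 1 / r) ^ k / r ^ 2)"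
      using 1 by linarith
    have eq: "H_fun x (t *\<^sub>R grad_v e x) / t ^ 2 = c * (R_fun (grad_bubble x) (t *\<^sub>R grad_v e x) / t ^ 2)"
      by (simp add: H_fun_eq[OF n] c_def N_def)
    have "\<bar>H_fun x (t *\<^sub>R grad_v e x) / t ^ 2\<bar> = c * (R_fun (grad_bubble x) (t *\<^sub>R grad_v e x) / t ^ 2)"
      unfolding eq using c R_fun_nonneg[OF n, of "grad_bubble x" "t *\<^sub>R grad_v e x"] by simp
    also have "\<dots> \<le> c * (N * (N - 1) * (\<beta> + N) ^ k * N ^ 2 * (P ^ DIM('a) * (1 + 1 / r) ^ k / r ^ 2))"
      using 2 c by (rule mult_left_mono)
    also have "\<dots> = C * (P ^ DIM('a) * (1 + 1 / r) ^ k / r ^ 2)" by (simp add: C_def)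
    also have "\<dots> \<le> C * dominator DIM('a) r"
      using dominator_bound[OF n r] C unfolding k(2) P_def[symmetric] by (rule mult_left_mono)
    finally show "\<bar>H_fun x (t *\<^sub>R grad_v e x) / t ^ 2\<bar> \<le> C * dominator DIM('a) (norm x)" unfolding r_def .
  qed
qed

lemma numerator_limit:
  fixes e :: "'a::euclidean_space"
  assumes n: "2 \<le> DIM('a)" and e: "norm e = 1"
  shows "((\<lambda>t. (\<integral>x. H_fun x (grad (\<lambda>x. t * v_fun e x) x) \<partial>lborel) / t ^ 2) \<longlongrightarrow> (\<integral>x. hess_form e x \<partial>lborel)) (at 0)"
proof -
  define f where "f t x = H_fun x (t *\<^sub>R grad_v e x) / t ^ 2" for t and x :: 'a
  have contgb: "(grad_bubble :: 'a \<Rightarrow> 'a) \<in> borel_measurable borel"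
    using continuous_grad_bubble[OF n] by (rule borel_measurable_continuous_onI)
  note [measurable] = contgb
  have Hm: "(\<lambda>x. H_fun x (p x)) \<in> borel_measurable borel" if [measurable]: "p \<in> borel_measurable borel" for p :: "'a \<Rightarrow> 'a"
    unfolding H_fun_eq[OF n] R_fun_def by measurable
  obtain C where C: "\<And>t x. t \<noteq> 0 \<Longrightarrow> \<bar>t\<bar> \<le> 1 \<Longrightarrow> x \<noteq> 0 \<Longrightarrow> \<bar>H_fun x (t *\<^sub>R grad_v e x) / t ^ 2\<bar> \<le> C * dominator DIM('a) (norm (x::'a))"
    using H_fun_dominated[OF n e] by blast
  have ne0: "AE x in lborel. x \<noteq> (0::'a)" by (rule AE_lborel_singleton)
  have "((\<lambda>t. \<integral>x. f t x \<partial>lborel) \<longlongrightarrow> (\<integral>x. hess_form e x \<partial>lborel)) (at 0)"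
  proof (rule dominated_convergence_at_0)
    have "(\<lambda>x. H_fun x (t *\<^sub>R grad_v e x)) \<in> borel_measurable borel" for t by (rule Hm) measurable
    then show "f t \<in> borel_measurable lborel" for t unfolding f_def[abs_def] by measurable
    show "hess_form e \<in> borel_measurable lborel" by measurable
    show "integrable lborel (\<lambda>x::'a. C * dominator DIM('a) (norm x))" by (intro integrable_mult_right dominator_integrable[OF n])
    show "AE x in lborel. ((\<lambda>t. f t x) \<longlongrightarrow> hess_form e x) (at 0)"
      using ne0 
    proof eventually_elim
      case (elim x) show ?case unfolding f_def by (rule H_fun_second_order[OF n e elim])
    qed
    show "AE x in lborel. \<bar>f t x\<bar> \<le> C * dominator DIM('a) (norm x)" if "t \<noteq> 0" "\<bar>t\<bar> \<le> 1" for t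
      using ne0 
    proof eventually_elim
      case (elim x) show ?case unfolding f_def by (rule C[OF that elim])
    qed
  qed
  moreover have "(\<integral>x. f t x \<partial>lborel) = (\<integral>x. H_fun x (grad (\<lambda>x. t * v_fun e x) x) \<partial>lborel) / t ^ 2" for t
  proof -
    \<comment> \<open>At the origin the value of \<open>grad\<close> is unspecified. It affects the
      integral on a null set only, but has to be named for the integrand to be seen to be
      measurable.\<close>
    define g0 where "g0 = grad (\<lambda>x. t * v_fun e x) 0"
    have g: "grad (\<lambda>x. t * v_fun e x) x = (if x = 0 then g0 else t *\<^sub>R grad_v e x)" for x
    proof (cases "x = 0")
      case False
      have "((\<lambda>x. t * v_fun e x) has_derivative (\<lambda>h. (t *\<^sub>R grad_v e x) \<bullet> h)) (at x)"
        using has_derivative_mult_right[OF has_derivative_v_fun[OF n False], of t] by simp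
      then show ?thesis using False by (simp add: grad_eqI)
    qed (simp add: g0_def)
    have "(\<integral>x. H_fun x (grad (\<lambda>x. t * v_fun e x) x) \<partial>lborel) = (\<integral>x. H_fun x (t *\<^sub>R grad_v e x) \<partial>lborel)"
    proof (rule integral_cong_AE)
      have "(\<lambda>x. H_fun x (if x = 0 then g0 else t *\<^sub>R grad_v e x)) \<in> borel_measurable borel" by (rule Hm) measurable
      then show "(\<lambda>x. H_fun x (grad (\<lambda>x. t * v_fun e x) x)) \<in> borel_measurable lborel" unfolding g by simp
      have "(\<lambda>x. H_fun x (t *\<^sub>R grad_v e x)) \<in> borel_measurable borel" by (rule Hm) measurable
      then show "(\<lambda>x. H_fun x (t *\<^sub>R grad_v e x)) \<in> borel_measurable lborel" by simp
      show "AE x in lborel. H_fun x (grad (\<lambda>x. t * v_fun e x) x) = H_fun x (t *\<^sub>R grad_v e x)"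
        using ne0 by eventually_elim (simp add: g)
    qed
    then show ?thesis by (simp add: f_def)
  qed
  ultimately show ?thesis by simp
qed

section \<open>Reduction of both quadratic forms to radial integrals\<close>

lemma prof_power_integrable:
  assumes n: "2 \<le> DIM('a)"
  shows "integrable (lborel :: 'a::euclidean_space measure) (\<lambda>x. prof DIM('a) (norm x) ^ DIM('a) / norm x ^ 2)"
proof (rule Bochner_Integration.integrable_bound[OF dominator_integrable[OF n]])
  have "AE x in lborel. x \<noteq> (0::'a)" by (rule AE_lborel_singleton)
  then show "AE x in (lborel :: 'a measure). norm (prof DIM('a) (norm x) ^ DIM('a) / norm x ^ 2) \<le> norm (dominator DIM('a) (norm x))"
  proof eventually_elim
    case (elim x)
    define p where "p = prof DIM('a) (norm x) ^ DIM('a)"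
    have p: "0 \<le> p" by (simp add: p_def prof_nonneg)
    have "1 ^ (DIM('a) - 2) \<le> (1 + 1 / norm x) ^ (DIM('a) - 2)" by (intro power_mono) auto
    then have "p * 1 \<le> p * (1 + 1 / norm x) ^ (DIM('a) - 2)" using p by (intro mult_left_mono) auto
    then have "p / norm x ^ 2 \<le> p * (1 + 1 / norm x) ^ (DIM('a) - 2) / norm x ^ 2" by (intro divide_right_mono) auto
    also have "\<dots> \<le> dominator DIM('a) (norm x)" unfolding p_def using elim by (intro dominator_bound[OF n]) simp
    finally show ?case using p unfolding p_def[symmetric] by simp
  qed
qed measurable

lemma prof_square_integrable:
  assumes n: "2 \<le> DIM('a)"
  shows "integrable (lborel :: 'a::euclidean_space measure) (\<lambda>x. prof DIM('a) (norm x) ^ 2 * (1 / (1 + rt DIM('a) (norm x) ^ DIM('a)) ^ DIM('a)))"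
proof (rule Bochner_Integration.integrable_bound[OF bubble_mass(1)[OF n]])
  show "AE x in (lborel :: 'a measure). norm (prof DIM('a) (norm x) ^ 2 * (1 / (1 + rt DIM('a) (norm x) ^ DIM('a)) ^ DIM('a)))
     \<le> norm (1 / (1 + rt DIM('a) (norm x) ^ DIM('a)) ^ DIM('a))"
  proof (rule AE_I2)
    fix x :: 'a
    define E where "E = 1 / (1 + rt DIM('a) (norm x) ^ DIM('a)) ^ DIM('a)"
    have E: "0 \<le> E" unfolding E_def using one_plus_rt_pos[of "DIM('a)" "norm x"] by simp
    have "prof DIM('a) (norm x) ^ 2 \<le> 1" using prof_le_1[OF n, of "norm x"] prof_nonneg by (intro power_le_one) auto
    then show "norm (prof DIM('a) (norm x) ^ 2 * (1 / (1 + rt DIM('a) (norm x) ^ DIM('a)) ^ DIM('a)))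
     \<le> norm (1 / (1 + rt DIM('a) (norm x) ^ DIM('a)) ^ DIM('a))"
      unfolding E_def[symmetric] using E mult_right_mono[of "prof DIM('a) (norm x) ^ 2" 1 E] by simp
  qed
qed measurable

lemma slope_square_le: "2 \<le> n \<Longrightarrow> slope n r ^ 2 \<le> 1"
  using abs_slope_le[of n r] by (simp add: abs_square_le_1)

lemma prof_slope_integrable:
  assumes n: "2 \<le> DIM('a)"
  shows "integrable (lborel :: 'a::euclidean_space measure)
    (\<lambda>x. prof DIM('a) (norm x) ^ DIM('a) / norm x ^ 2 * slope DIM('a) (norm x) ^ 2)"
proof (rule Bochner_Integration.integrable_bound[OF prof_power_integrable[OF n]])
  show "AE x in (lborel :: 'a measure). norm (prof DIM('a) (norm x) ^ DIM('a) / norm x ^ 2 * slope DIM('a) (norm x) ^ 2)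
     \<le> norm (prof DIM('a) (norm x) ^ DIM('a) / norm x ^ 2)"
  proof (rule AE_I2)
    fix x :: 'a
    define E where "E = prof DIM('a) (norm x) ^ DIM('a) / norm x ^ 2"
    have E: "0 \<le> E" unfolding E_def using prof_nonneg by simp
    show "norm (prof DIM('a) (norm x) ^ DIM('a) / norm x ^ 2 * slope DIM('a) (norm x) ^ 2)
     \<le> norm (prof DIM('a) (norm x) ^ DIM('a) / norm x ^ 2)"
      unfolding E_def[symmetric] using E mult_left_mono[OF slope_square_le[OF n, of "norm x"] E] by simp
  qed
qed measurable

text \<open>The mean of \<open>(sgn x \<bullet> e)^2\<close> over spheres is \<open>1/n\<close>, and
  \<open>1 - 1/n + (n - 1) * L / n = (n - 1)/n * (1 + L)\<close> for the squared slope
  \<open>L\<close>.\<close>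

lemma integral_hess_form:
  fixes e :: "'a::euclidean_space"
  assumes n: "2 \<le> DIM('a)" and e: "norm e = 1"
  shows "(\<integral>x. hess_form e x \<partial>lborel) = real DIM('a) ^ (DIM('a) - 1) * (real DIM('a) - 1) ^ 2 / 2 * ((real DIM('a) - 1) / real DIM('a))
    * (\<integral>x. prof DIM('a) (norm x) ^ DIM('a) / norm x ^ 2 * (1 + slope DIM('a) (norm x) ^ 2) \<partial>(lborel :: 'a measure))"
proof -
  define N where "N = real DIM('a)"
  have N: "2 \<le> N" using n by (simp add: N_def)
  define \<kappa> where "\<kappa> = N ^ (DIM('a) - 1) * (N - 1) ^ 2 / 2"
  define p where "p r = prof DIM('a) r ^ DIM('a) / r ^ 2" for r
  define L where "L r = slope DIM('a) r ^ 2" for r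
  have [measurable]: "p \<in> borel_measurable borel" "L \<in> borel_measurable borel"
    unfolding p_def[abs_def] L_def[abs_def] by measurable
  \<comment> \<open>Divided by \<open>r ^ 2\<close> because the averaging lemma concerns
    \<open>(x \<bullet> e)^2\<close>, not the square for the unit vector \<open>sgn x\<close>.
    Division by zero gives 0 at the origin, consistently on both sides.\<close>
  define \<phi> where "\<phi> r = \<kappa> * p r * ((N - 1) * L r - 1) / r ^ 2" for r
  have [measurable]: "\<phi> \<in> borel_measurable borel" unfolding \<phi>_def[abs_def] by measurable
  have p0: "p 0 = 0" by (simp add: p_def)
  have ip: "integrable (lborel :: 'a measure) (\<lambda>x. p (norm x))" unfolding p_def by (rule prof_power_integrable[OF n])
  have ipL: "integrable (lborel :: 'a measure) (\<lambda>x. p (norm x) * L (norm x))" unfolding p_def L_def by (rule prof_slope_integrable[OF n])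
  have r\<phi>: "norm x ^ 2 * \<phi> (norm x) = \<kappa> * (N - 1) * (p (norm x) * L (norm x)) - \<kappa> * p (norm x)" for x :: 'a
  proof (cases "x = 0")
    case False
    then have "norm x ^ 2 * \<phi> (norm x) = \<kappa> * p (norm x) * ((N - 1) * L (norm x) - 1)" by (simp add: \<phi>_def)
    then show ?thesis by (simp add: algebra_simps)
  qed (simp add: p0)
  have i\<phi>: "integrable (lborel :: 'a measure) (\<lambda>x. norm x ^ 2 * \<phi> (norm x))"
    unfolding r\<phi> by (intro Bochner_Integration.integrable_diff integrable_mult_right ip ipL)
  have h: "hess_form e x = \<kappa> * p (norm x) + (x \<bullet> e) ^ 2 * \<phi> (norm x)" for x
  proof -
    have z: "(sgn x \<bullet> e) ^ 2 = (x \<bullet> e) ^ 2 / norm x ^ 2" by (simp add: sgn_div_norm divide_inverse power_mult_distrib power_inverse)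
    show ?thesis unfolding hess_form_def z N_def[symmetric] \<kappa>_def[symmetric] p_def[symmetric] L_def[symmetric] \<phi>_def
      by (simp add: algebra_simps diff_divide_distrib add_divide_distrib)
  qed
  have iz: "integrable lborel (\<lambda>x. (x \<bullet> e) ^ 2 * \<phi> (norm x))"
    by (rule integral_quadratic_radial(1)[OF _ i\<phi> e]) measurable
  have "(\<integral>x. hess_form e x \<partial>lborel) = (\<integral>x. \<kappa> * p (norm x) \<partial>(lborel :: 'a measure)) + (\<integral>x. (x \<bullet> e) ^ 2 * \<phi> (norm x) \<partial>lborel)"
    unfolding h by (rule Bochner_Integration.integral_add[OF integrable_mult_right[OF ip] iz])
  also have "(\<integral>x. (x \<bullet> e) ^ 2 * \<phi> (norm x) \<partial>lborel) = (\<integral>x. norm x ^ 2 * \<phi> (norm x) \<partial>(lborel :: 'a measure)) / N"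
    unfolding N_def by (rule integral_quadratic_radial(2)[OF _ i\<phi> e]) measurable
  also have "(\<integral>x. norm x ^ 2 * \<phi> (norm x) \<partial>(lborel :: 'a measure))
    = \<kappa> * (N - 1) * (\<integral>x. p (norm x) * L (norm x) \<partial>(lborel :: 'a measure)) - \<kappa> * (\<integral>x. p (norm x) \<partial>(lborel :: 'a measure))"
    unfolding r\<phi> by (subst Bochner_Integration.integral_diff) (use ip ipL in auto)
  also have "(\<integral>x. \<kappa> * p (norm x) \<partial>(lborel :: 'a measure)) = \<kappa> * (\<integral>x. p (norm x) \<partial>(lborel :: 'a measure))" by simp
  finally have "(\<integral>x. hess_form e x \<partial>lborel) = \<kappa> * ((N - 1) / N)
     * ((\<integral>x. p (norm x) \<partial>(lborel :: 'a measure)) + (\<integral>x. p (norm x) * L (norm x) \<partial>(lborel :: 'a measure)))"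
    using N by (simp add: field_simps)
  also have "(\<integral>x. p (norm x) \<partial>(lborel :: 'a measure)) + (\<integral>x. p (norm x) * L (norm x) \<partial>(lborel :: 'a measure))
     = (\<integral>x. p (norm x) * (1 + L (norm x)) \<partial>(lborel :: 'a measure))"
    unfolding distrib_left mult_1_right by (rule Bochner_Integration.integral_add[OF ip ipL, symmetric])
  finally show ?thesis unfolding \<kappa>_def p_def L_def N_def .
qed

text \<open>The square of \<open>v_fun e x\<close> is
  \<open>n^2 * prof^2 * (sgn x \<bullet> e)^2\<close>; averaging over spheres removes one factor
  \<open>n\<close>.\<close>

lemma variance_v_fun:
  fixes e :: "'a::euclidean_space"
  assumes n: "2 \<le> DIM('a)" and e: "norm e = 1"
  shows "(\<integral>x. v_fun e x ^ 2 \<partial>mu) = real DIM('a) / unit_ball_vol DIM('a)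
    * (\<integral>x. prof DIM('a) (norm x) ^ 2 * (1 / (1 + rt DIM('a) (norm x) ^ DIM('a)) ^ DIM('a)) \<partial>(lborel :: 'a measure))"
proof -
  define N where "N = real DIM('a)"
  have N: "2 \<le> N" using n by (simp add: N_def)
  define q where "q r = prof DIM('a) r ^ 2 * (1 / (1 + rt DIM('a) r ^ DIM('a)) ^ DIM('a))" for r
  have [measurable]: "q \<in> borel_measurable borel" unfolding q_def[abs_def] by measurable
  have q0: "q 0 = 0" by (simp add: q_def prof_def)
  define c where "c = N ^ 2 / unit_ball_vol DIM('a)"
  define \<phi> where "\<phi> r = c * q r / r ^ 2" for r
  have [measurable]: "\<phi> \<in> borel_measurable borel" unfolding \<phi>_def[abs_def] by measurable
  have r\<phi>: "norm x ^ 2 * \<phi> (norm x) = c * q (norm x)" for x :: 'a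
    by (cases "x = 0") (simp_all add: \<phi>_def q0)
  have i\<phi>: "integrable (lborel :: 'a measure) (\<lambda>x. norm x ^ 2 * \<phi> (norm x))"
    unfolding r\<phi> unfolding q_def by (rule integrable_mult_right[OF prof_square_integrable[OF n]])
  have v: "mu_density x * v_fun e x ^ 2 = (x \<bullet> e) ^ 2 * \<phi> (norm x)" for x :: 'a
  proof -
    have z: "(sgn x \<bullet> e) ^ 2 = (x \<bullet> e) ^ 2 / norm x ^ 2" by (simp add: sgn_div_norm divide_inverse power_mult_distrib power_inverse)
    show ?thesis unfolding v_fun_eq[OF n] power_mult_distrib z mu_density_def sig_def \<phi>_def q_def c_def N_def by (simp add: mult_ac)
  qed
  have [measurable]: "v_fun e \<in> borel_measurable borel"
    unfolding v_fun_eq[OF n, abs_def] sgn_div_norm by measurable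
  have "(\<integral>x. v_fun e x ^ 2 \<partial>mu) = (\<integral>x. (x \<bullet> e) ^ 2 * \<phi> (norm x) \<partial>lborel)"
    unfolding v[symmetric] by (rule integral_mu(1)[OF n]) measurable
  also have "\<dots> = (\<integral>x. norm x ^ 2 * \<phi> (norm x) \<partial>(lborel :: 'a measure)) / N"
    unfolding N_def by (rule integral_quadratic_radial(2)[OF _ i\<phi> e]) measurable
  also have "\<dots> = c / N * (\<integral>x. q (norm x) \<partial>(lborel :: 'a measure))" unfolding r\<phi> by simp
  also have "c / N = N / unit_ball_vol DIM('a)" using N by (simp add: c_def power2_eq_square)
  finally show ?thesis unfolding N_def q_def .
qed

lemma prof_square_integral_pos:
  assumes n: "2 \<le> DIM('a)"
  shows "0 < (\<integral>x. prof DIM('a) (norm x) ^ 2 * (1 / (1 + rt DIM('a) (norm x) ^ DIM('a)) ^ DIM('a)) \<partial>(lborel :: 'a::euclidean_space measure))"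
    (is "0 < (\<integral>x. ?q x \<partial>lborel)")
proof -
  have q: "0 \<le> ?q x" for x :: 'a using one_plus_rt_pos[of "DIM('a)" "norm x"] by simp
  have "(\<integral>x. ?q x \<partial>lborel) \<noteq> 0"
  proof
    assume "(\<integral>x. ?q x \<partial>lborel) = 0"
    then have 1: "AE x in (lborel :: 'a measure). ?q x = 0"
      using integral_nonneg_eq_0_iff_AE[OF prof_square_integrable[OF n] AE_I2[OF q]] by simp
    have "AE x in lborel. x \<noteq> (0::'a)" by (rule AE_lborel_singleton)
    with 1 have "AE x in (lborel :: 'a measure). False"
    proof eventually_elim
      case (elim x)
      have "0 < rt DIM('a) (norm x)" using elim(2) by (intro rt_pos) simp
      then have "0 < ?q x" unfolding prof_def using one_plus_rt_pos[of "DIM('a)" "norm x"] by simp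
      then show ?case using elim(1) by linarith
    qed
    then have "emeasure (lborel :: 'a measure) (space lborel) = 0"
      unfolding eventually_False by (rule ae_filter_eq_bot_iff[THEN iffD1])
    then show False using emeasure_lborel_UNIV[where 'a = 'a] by simp
  qed
  moreover have "0 \<le> (\<integral>x. ?q x \<partial>(lborel :: 'a measure))" by (intro integral_nonneg_AE AE_I2 q)
  ultimately show ?thesis by linarith
qed

text \<open>The difference of the two radial integrands is the derivative of the function \<open>F\<close> below, which vanishes at \<open>0\<close> and at
  infinity.\<close>

lemma prof_slope_identity:
  assumes n: "2 \<le> DIM('a)"
  shows "(real DIM('a) - 1) ^ 2 * (\<integral>x. prof DIM('a) (norm x) ^ DIM('a) / norm x ^ 2 * (1 + slope DIM('a) (norm x) ^ 2) \<partial>(lborel :: 'a::euclidean_space measure))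
    = real DIM('a) ^ 3 * (\<integral>x. prof DIM('a) (norm x) ^ 2 * (1 / (1 + rt DIM('a) (norm x) ^ DIM('a)) ^ DIM('a)) \<partial>(lborel :: 'a measure))"
proof -
  let ?n = "DIM('a)"
  define N where "N = real ?n"
  define m where "m = N - 1"
  have m: "1 \<le> m" "N = m + 1" using n by (auto simp: m_def N_def)
  define k where "k = ?n - 2"
  have k: "?n - 1 = Suc k" "?n = Suc (Suc k)" unfolding k_def using n by arith+
  have rk: "real (Suc k) = m" unfolding k(1)[symmetric] using n by (simp add: m_def N_def of_nat_diff)
  define \<omega> where "\<omega> = unit_ball_vol N"
  define p where "p r = prof ?n r ^ ?n / r ^ 2 * (1 + slope ?n r ^ 2)" for r
  define q where "q r = prof ?n r ^ 2 * (1 / (1 + rt ?n r ^ ?n) ^ ?n)" for r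
  have [measurable]: "p \<in> borel_measurable borel" "q \<in> borel_measurable borel"
    unfolding p_def[abs_def] q_def[abs_def] by measurable
  have ip: "integrable (lborel :: 'a measure) (\<lambda>x. p (norm x))"
    unfolding p_def distrib_left mult_1_right
    by (intro Bochner_Integration.integrable_add prof_power_integrable[OF n] prof_slope_integrable[OF n])
  have iq: "integrable (lborel :: 'a measure) (\<lambda>x. q (norm x))" unfolding q_def by (rule prof_square_integrable[OF n])
  define f where "f r = m ^ 2 * p r - N ^ 3 * q r" for r
  define E where "E r = inverse (1 + rt ?n r ^ ?n)" for r
  \<comment> \<open>In terms of the profile this is
    \<open>n * \<omega> * m^2 * r ^ (n - 1) * prof ^ (n - 1) * prof'\<close>, the boundary term that
    arises when the radial part of the quadratic form is integrated by parts.\<close>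
  define F where "F r = N * \<omega> * m * (r ^ Suc k * rt ?n r * (1 - m * rt ?n r ^ ?n) * E r ^ Suc ?n)" for r
  have E0: "0 < E r" for r unfolding E_def using one_plus_rt_pos by simp
  have "(\<integral>x. f (norm x) \<partial>(lborel :: 'a measure)) = 0 - 0"
  proof (rule radial_FTC)
    show "f \<in> borel_measurable borel" unfolding f_def[abs_def] by measurable
    show "integrable (lborel :: 'a measure) (\<lambda>x. f (norm x))" unfolding f_def
      by (intro Bochner_Integration.integrable_diff integrable_mult_right ip iq)
    fix r :: real assume r: "0 < r"
    have c: "isCont (prof ?n) r" "isCont (slope ?n) r" "isCont (rt ?n) r"
      unfolding prof_def[abs_def] slope_def[abs_def]
      by (intro continuous_intros isCont_rt r; use one_plus_rt_pos[of ?n r] m in \<open>simp add: m_def N_def\<close>)+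
    show "isCont f r" unfolding f_def[abs_def] p_def q_def
      by (intro continuous_intros c; use one_plus_rt_pos[of ?n r] r in simp)
    define t where "t = rt ?n r"
    define s where "s = rt ?n r ^ ?n"
    define a where "a = r ^ k * t"
    have s: "s = r * t" using rt_power_mult[OF n, of r] r by (simp add: s_def t_def)
    have s0: "0 < 1 + s" by (simp add: s_def one_plus_rt_pos)
    define G where "G = E r"
    have G: "G = 1 / (1 + s)" "G * (1 + s) = 1" using s0 by (auto simp: G_def E_def s_def inverse_eq_divide)
    have dt: "DERIV (rt ?n) r :> t / (m * r)" using DERIV_rt[OF n r] by (simp add: t_def m_def N_def)
    have ds: "DERIV (\<lambda>r. rt ?n r ^ ?n) r :> N / m * t" using DERIV_rt_power[OF n r] by (simp add: t_def m_def N_def)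
    have d1: "DERIV (\<lambda>r. r ^ Suc k * rt ?n r) r :> real (Suc k) * r ^ k * t + t / (m * r) * r ^ Suc k"
      unfolding t_def by (intro DERIV_mult dt[unfolded t_def]) (use DERIV_pow[of "Suc k" r] in simp)
    have d2: "DERIV (\<lambda>r. 1 - m * rt ?n r ^ ?n) r :> 0 - m * (N / m * t)"
      by (intro DERIV_diff DERIV_const DERIV_cmult ds)
    have d3: "DERIV E r :> - (G * (0 + N / m * t) * G)"
      unfolding E_def[abs_def] G_def by (intro DERIV_inverse' DERIV_add DERIV_const ds) (use s0 in \<open>simp add: s_def\<close>)
    have d4: "DERIV (\<lambda>r. E r ^ Suc ?n) r :> real (Suc ?n) * (- (G * (0 + N / m * t) * G) * G ^ ?n)"
      using DERIV_power[OF d3, of "Suc ?n"] by (simp add: G_def)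
    have d5: "DERIV F r :> N * \<omega> * m * (((real (Suc k) * r ^ k * t + t / (m * r) * r ^ Suc k) * (1 - m * s) + (0 - m * (N / m * t)) * (r ^ Suc k * t)) * G ^ Suc ?n
        + (real (Suc ?n) * (- (G * (0 + N / m * t) * G) * G ^ ?n)) * (r ^ Suc k * t * (1 - m * s)))"
      unfolding F_def[abs_def] G_def s_def t_def
      by (intro DERIV_cmult DERIV_mult d1[unfolded t_def] d2[unfolded t_def] d4[unfolded t_def G_def])
    have "m * (((real (Suc k) * r ^ k * t + t / (m * r) * r ^ Suc k) * (1 - m * s) + (0 - m * (N / m * t)) * (r ^ Suc k * t)) * G ^ Suc ?n
        + (real (Suc ?n) * (- (G * (0 + N / m * t) * G) * G ^ ?n)) * (r ^ Suc k * t * (1 - m * s)))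
      = a * G ^ ?n * (G * ((m ^ 2 + 1) * (1 - m * s) - N * m * s) - (N + 1) * N * s * (1 - m * s) * G ^ 2)"
    proof -
      have 1: "real (Suc k) * r ^ k * t + t / (m * r) * r ^ Suc k = a * (m + 1 / m)"
        unfolding rk a_def using r m by (simp add: field_simps)
      have 2: "r ^ Suc k * t = a * r" by (simp add: a_def)
      have 3: "real (Suc ?n) = N + 1" by (simp add: N_def)
      have "m * ((a * (m + 1 / m) * B + (0 - m * (N / m * t)) * (a * r)) * (G * Gn) + ((N + 1) * (- (G * (0 + N / m * t) * G) * Gn)) * (a * r * B))
        = a * Gn * (G * ((m ^ 2 + 1) * B - N * m * (r * t)) - (N + 1) * N * (r * t) * B * G ^ 2)" for B Gn
        using m(1) by (simp add: field_simps power2_eq_square)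
      then show ?thesis unfolding 1 2 3 unfolding s power_Suc by blast
    qed
    \<comment> \<open>The relation \<open>G * (1 + s) = 1\<close> brings all terms to the common
      power \<open>G ^ 2\<close>; what remains is a polynomial in \<open>s\<close> and
      \<open>m\<close>.\<close>
    also have "\<dots> = a * G ^ ?n * (G ^ 2 * ((m ^ 2 + 1) * (1 - m * s) * (1 + s) - N * m * s * (1 + s) - (N + 1) * N * s * (1 - m * s)))"
    proof -
      have *: "G * Y = G ^ 2 * (Y * (1 + s))" for Y using G(2) by (simp add: power2_eq_square mult_ac)
      have "G * (Y - Z) - W * G ^ 2 = G ^ 2 * (Y * (1 + s) - Z * (1 + s) - W)" for Y Z W
        unfolding *[of "Y - Z"] by (simp add: algebra_simps)
      then show ?thesis by (simp only:)
    qed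
    \<comment> \<open>A polynomial identity once \<open>N = m + 1\<close> is inserted; its right
      side groups the terms into the integrands of the two quadratic forms.\<close>
    also have "(m ^ 2 + 1) * (1 - m * s) * (1 + s) - N * m * s * (1 + s) - (N + 1) * N * s * (1 - m * s)
       = m ^ 2 * (1 + s) ^ 2 + (1 - m * s) ^ 2 - N ^ 3 * s"
      unfolding m(2) by (simp add: algebra_simps power2_eq_square power3_eq_cube)
    also have "G ^ 2 * (m ^ 2 * (1 + s) ^ 2 + (1 - m * s) ^ 2 - N ^ 3 * s) = m ^ 2 * (1 + (1 / m * ((1 - m * s) * G)) ^ 2) - N ^ 3 * s * G ^ 2"
    proof -
      have "G ^ 2 * (m ^ 2 * (1 + s) ^ 2) = m ^ 2 * (G * (1 + s)) ^ 2" by (simp add: power_mult_distrib mult_ac)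
      moreover have "m ^ 2 * (1 / m * ((1 - m * s) * G)) ^ 2 = (1 - m * s) ^ 2 * G ^ 2" using m by (simp add: power_mult_distrib power_divide)
      ultimately show ?thesis unfolding G(2) by (simp add: algebra_simps)
    qed
    also have "a * G ^ ?n * (m ^ 2 * (1 + (1 / m * ((1 - m * s) * G)) ^ 2) - N ^ 3 * s * G ^ 2) = r ^ Suc k * f r"
    proof -
      have P: "prof ?n r = t * G" by (simp add: prof_def t_def G(1) s_def)
      have Pn: "prof ?n r ^ ?n = s * G ^ ?n" unfolding P power_mult_distrib by (simp add: s_def t_def)
      have L: "slope ?n r = 1 / m * ((1 - m * s) * G)" by (simp add: slope_def s_def[symmetric] N_def[symmetric] m_def[symmetric] G(1))
      have Gn: "1 / (1 + rt ?n r ^ ?n) ^ ?n = G ^ ?n" by (simp add: s_def[symmetric] G(1) power_divide)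
      have "r ^ k * t * Gn * (m ^ 2 * W - N ^ 3 * (r * t) * G ^ 2) = r * r ^ k * (m ^ 2 * (r * t * Gn / r ^ 2 * W) - N ^ 3 * ((t * G) ^ 2 * Gn))" for W Gn
        using r by (simp add: field_simps power2_eq_square)
      then show ?thesis unfolding f_def p_def q_def Gn Pn unfolding L P unfolding a_def s power_Suc by blast
    qed
    finally show "DERIV F r :> polar_weight ?n r * f r"
      using d5 unfolding polar_weight_def k(1) N_def[symmetric] \<omega>_def[symmetric] mult.assoc by simp
  next
    have t0: "(rt ?n \<longlongrightarrow> 0) (at_right 0)" by (rule tendsto_rt_0[OF n])
    have "(F \<longlongrightarrow> N * \<omega> * m * (0 ^ Suc k * 0 * (1 - m * 0 ^ ?n) * inverse (1 + 0 ^ ?n) ^ Suc ?n)) (at_right 0)"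
      unfolding F_def[abs_def] E_def
      by (intro tendsto_intros t0) (simp add: k(2))
    then show "(F \<longlongrightarrow> 0) (at_right 0)" by simp
    show "(F \<longlongrightarrow> 0) at_top"
    proof (rule Lim_null_comparison)
      show "((\<lambda>r. \<bar>N * \<omega> * m\<bar> * m * inverse (r ^ 2)) \<longlongrightarrow> 0) at_top" by real_asymp
      show "\<forall>\<^sub>F r in at_top. norm (F r) \<le> \<bar>N * \<omega> * m\<bar> * m * inverse (r ^ 2)"
        using eventually_gt_at_top[of 0]
      proof eventually_elim
        case (elim r)
        define t where "t = rt ?n r"
        have t: "0 < t" using rt_pos[OF elim] by (simp add: t_def)
        define s where "s = t ^ ?n"
        have s: "s = r * t" using rt_power_mult[OF n, of r] elim by (simp add: s_def t_def)
        have s0: "0 < s" using t by (simp add: s_def)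
        have G: "E r = 1 / (1 + s)" by (simp add: E_def s_def t_def inverse_eq_divide)
        have "\<bar>(1 - m * s) * E r\<bar> \<le> m"
        proof -
          have "(1 - m * s) * E r = m * slope ?n r" using m
            by (simp add: slope_def G s_def t_def N_def[symmetric] m_def[symmetric])
          then show ?thesis using abs_slope_le[OF n, of r] m by (simp add: abs_mult mult_left_le)
        qed
        \<comment> \<open>Since \<open>s ^ n = r ^ n * s = r ^ (n - 1) * t * r ^ 2\<close>, the
          growing factor of \<open>F\<close> is cancelled with \<open>r ^ 2\<close> to
          spare.\<close>
        moreover have "E r ^ ?n \<le> inverse (r ^ Suc k * t * r ^ 2)"
        proof -
          have "E r \<le> inverse s" using s0 by (simp add: G inverse_eq_divide frac_le)
          then have "E r ^ ?n \<le> inverse s ^ ?n" using E0[of r] by (intro power_mono) auto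
          also have "\<dots> = inverse (r ^ ?n * t ^ ?n)" by (simp add: s power_inverse power_mult_distrib)
          also have "r ^ ?n * t ^ ?n = r ^ Suc k * t * r ^ 2" unfolding s_def[symmetric] s unfolding k(2) by (simp add: power2_eq_square)
          finally show ?thesis .
        qed
        ultimately have "\<bar>(1 - m * s) * E r\<bar> * E r ^ ?n \<le> m * inverse (r ^ Suc k * t * r ^ 2)"
          using E0[of r] m by (intro mult_mono) auto
        then have "r ^ Suc k * t * (\<bar>(1 - m * s) * E r\<bar> * E r ^ ?n) \<le> r ^ Suc k * t * (m * inverse (r ^ Suc k * t * r ^ 2))"
          using elim t by (intro mult_left_mono) auto
        also have "\<dots> = m * inverse (r ^ 2)" using elim t by (simp add: field_simps)
        finally have "\<bar>N * \<omega> * m\<bar> * (r ^ Suc k * t * (\<bar>(1 - m * s) * E r\<bar> * E r ^ ?n)) \<le> \<bar>N * \<omega> * m\<bar> * (m * inverse (r ^ 2))"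
          by (intro mult_left_mono) auto
        moreover have "norm (F r) = \<bar>N * \<omega> * m\<bar> * (r ^ Suc k * t * (\<bar>(1 - m * s) * E r\<bar> * E r ^ ?n))"
        proof -
          have "\<bar>r ^ Suc k\<bar> = r ^ Suc k" "\<bar>t\<bar> = t" "\<bar>E r\<bar> = E r" "\<bar>E r ^ ?n\<bar> = E r ^ ?n" using elim t E0[of r] by auto
          then show ?thesis unfolding F_def t_def[symmetric] s_def[symmetric] power_Suc[of "E r"] real_norm_def abs_mult
            by (simp only: mult.assoc mult.left_commute)
        qed
        ultimately show ?case by simp
      qed
    qed
  qed
  moreover have "(\<integral>x. f (norm x) \<partial>(lborel :: 'a measure)) = m ^ 2 * (\<integral>x. p (norm x) \<partial>(lborel :: 'a measure)) - N ^ 3 * (\<integral>x. q (norm x) \<partial>(lborel :: 'a measure))"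
    unfolding f_def by (subst Bochner_Integration.integral_diff) (use ip iq in auto)
  ultimately show ?thesis unfolding p_def q_def m_def N_def by simp
qed

section \<open>Second-order expansion of the denominator and the limit\<close>

lemma exp_second_order_bound: "\<bar>exp y - 1 - y\<bar> \<le> y ^ 2 * exp \<bar>y\<bar>" for y :: real
proof -
  have a: "\<bar>exp y - 1\<bar> \<le> \<bar>y\<bar> * exp \<bar>y\<bar>"
  proof (cases "0 \<le> y")
    case True
    have "(1 - y) * exp y \<le> exp (- y) * exp y" using exp_ge_add_one_self[of "- y"] by (intro mult_right_mono) auto
    then have "exp y - 1 \<le> y * exp y" by (simp add: exp_minus algebra_simps)
    then show ?thesis using True by simp
  next
    case False
    then have "1 - exp y \<le> - y * 1" using exp_ge_add_one_self[of y] by linarith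
    also have "\<dots> \<le> - y * exp (- y)" using False by (intro mult_left_mono) auto
    finally show ?thesis using False by simp
  qed
  have "(1 - y) * exp y \<le> exp (- y) * exp y" using exp_ge_add_one_self[of "- y"] by (intro mult_right_mono) auto
  then have "exp y - 1 - y \<le> y * (exp y - 1)" by (simp add: exp_minus algebra_simps)
  also have "\<dots> \<le> \<bar>y\<bar> * \<bar>exp y - 1\<bar>" by (simp add: abs_mult[symmetric])
  also have "\<dots> \<le> \<bar>y\<bar> * (\<bar>y\<bar> * exp \<bar>y\<bar>)" using a by (intro mult_left_mono) auto
  finally have "exp y - 1 - y \<le> y ^ 2 * exp \<bar>y\<bar>" by (simp add: power2_eq_square mult.assoc[symmetric])
  then show ?thesis using exp_ge_add_one_self[of y] by linarith
qed

text \<open>As the mean vanishes, the moment generating function is \<open>1 + t ^ 2 * A t\<close>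
  with \<open>A t\<close> tending to half the variance, by dominated convergence. Passing to the
  logarithm changes this only by a term of order \<open>t ^ 4\<close>.\<close>

lemma (in prob_space) cumulant_second_order:
  fixes v :: "'a \<Rightarrow> real"
  assumes [measurable]: "v \<in> borel_measurable M" and B: "\<And>x. \<bar>v x\<bar> \<le> B" and mean: "(\<integral>x. v x \<partial>M) = 0"
  shows "((\<lambda>t. (ln (\<integral>x. exp (t * v x) \<partial>M) - (\<integral>x. t * v x \<partial>M)) / t ^ 2) \<longlongrightarrow> (\<integral>x. v x ^ 2 \<partial>M) / 2) (at 0)"
proof -
  define V where "V = (\<integral>x. v x ^ 2 \<partial>M) / 2"
  define f where "f t x = (exp (t * v x) - 1 - t * v x) / t ^ 2" for t x
  define A where "A t = (\<integral>x. f t x \<partial>M)" for t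
  have A: "(A \<longlongrightarrow> V) (at 0)"
    unfolding A_def[abs_def] V_def integral_divide_zero[symmetric]
  proof (rule dominated_convergence_at_0)
    show "f t \<in> borel_measurable M" for t unfolding f_def[abs_def] by measurable
    show "(\<lambda>x. v x ^ 2 / 2) \<in> borel_measurable M" by measurable
    show "integrable M (\<lambda>_. B ^ 2 * exp B)" by simp
    show "AE x in M. ((\<lambda>t. f t x) \<longlongrightarrow> v x ^ 2 / 2) (at 0)"
    proof (rule AE_I2)
      fix x
      have "((\<lambda>t. (exp (t * v x) - exp (0 * v x) - t * (v x * exp (0 * v x))) / t ^ 2) \<longlongrightarrow> v x ^ 2 / 2) (at 0)"
      proof (rule second_order_quotient)
        show "\<forall>\<^sub>F t in nhds 0. ((\<lambda>t. exp (t * v x)) has_real_derivative v x * exp (t * v x)) (at t)"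
          by (intro always_eventually allI) (auto intro!: derivative_eq_intros)
        show "DERIV (\<lambda>t. v x * exp (t * v x)) 0 :> v x ^ 2"
          by (auto intro!: derivative_eq_intros simp: power2_eq_square)
      qed
      then show "((\<lambda>t. f t x) \<longlongrightarrow> v x ^ 2 / 2) (at 0)" by (simp add: f_def)
    qed
    show "AE x in M. \<bar>f t x\<bar> \<le> B ^ 2 * exp B" if t: "t \<noteq> 0" "\<bar>t\<bar> \<le> 1" for t
    proof (rule AE_I2)
      fix x
      have "\<bar>t * v x\<bar> \<le> 1 * B" unfolding abs_mult using t B[of x] by (intro mult_mono) auto
      then have e: "exp \<bar>t * v x\<bar> \<le> exp B" by simp
      have v: "v x ^ 2 \<le> B ^ 2" using B[of x] by (simp add: abs_le_square_iff[symmetric])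
      have "\<bar>f t x\<bar> = \<bar>exp (t * v x) - 1 - t * v x\<bar> / t ^ 2" by (simp add: f_def)
      also have "\<dots> \<le> ((t * v x) ^ 2 * exp \<bar>t * v x\<bar>) / t ^ 2" by (intro divide_right_mono exp_second_order_bound) simp
      also have "\<dots> = v x ^ 2 * exp \<bar>t * v x\<bar>" using t by (simp add: power_mult_distrib)
      also have "\<dots> \<le> B ^ 2 * exp B" using e v by (intro mult_mono) auto
      finally show "\<bar>f t x\<bar> \<le> B ^ 2 * exp B" .
    qed
  qed
  have iv: "integrable M v" by (rule integrable_const_bound[of _ B]) (use B in auto)
  have ie: "integrable M (\<lambda>x. exp (t * v x))" for t
  proof (rule integrable_const_bound[of _ "exp (\<bar>t\<bar> * B)"])
    have "\<bar>t * v x\<bar> \<le> \<bar>t\<bar> * B" for x unfolding abs_mult using B[of x] by (intro mult_left_mono) auto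
    then have "t * v x \<le> \<bar>t\<bar> * B" for x by (meson abs_ge_self order_trans)
    then show "AE x in M. norm (exp (t * v x)) \<le> exp (\<bar>t\<bar> * B)" by simp
  qed measurable
  have tA: "(\<integral>x. exp (t * v x) \<partial>M) = 1 + t ^ 2 * A t" for t
  proof (cases "t = 0")
    case False
    then have "t ^ 2 * A t = (\<integral>x. exp (t * v x) - 1 - t * v x \<partial>M)"
      unfolding A_def f_def by simp
    also have "\<dots> = (\<integral>x. exp (t * v x) \<partial>M) - 1"
      by (simp add: ie iv Bochner_Integration.integral_diff prob_space mean)
    finally show ?thesis by simp
  qed (simp add: prob_space)
  have "((\<lambda>t. t ^ 2 * A t) \<longlongrightarrow> 0 ^ 2 * V) (at 0)" by (intro tendsto_intros A)
  then have small: "\<forall>\<^sub>F t in at 0. \<bar>t ^ 2 * A t\<bar> < 1 / 2"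
    by (auto dest!: tendstoD[of _ _ _ "1 / 2"])
  have "((\<lambda>t. (ln (1 + t ^ 2 * A t) - t ^ 2 * A t) / t ^ 2) \<longlongrightarrow> 0) (at 0)"
  proof (rule Lim_null_comparison)
    have "((\<lambda>t. 2 * (t ^ 2 * A t ^ 2)) \<longlongrightarrow> 2 * (0 ^ 2 * V ^ 2)) (at 0)" by (intro tendsto_intros A)
    then show "((\<lambda>t. 2 * (t ^ 2 * A t ^ 2)) \<longlongrightarrow> 0) (at 0)" by simp
    show "\<forall>\<^sub>F t in at 0. norm ((ln (1 + t ^ 2 * A t) - t ^ 2 * A t) / t ^ 2) \<le> 2 * (t ^ 2 * A t ^ 2)"
      using small eventually_neq_at_within[of 0 0 UNIV]
    proof eventually_elim
      case (elim t)
      have "\<bar>ln (1 + t ^ 2 * A t) - t ^ 2 * A t\<bar> \<le> 2 * (t ^ 2 * A t) ^ 2"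
        using elim(1) by (intro abs_ln_one_plus_x_minus_x_bound) simp
      then have "\<bar>ln (1 + t ^ 2 * A t) - t ^ 2 * A t\<bar> / t ^ 2 \<le> 2 * (t ^ 2 * A t) ^ 2 / t ^ 2" by (intro divide_right_mono) auto
      also have "\<dots> = 2 * (t ^ 2 * A t ^ 2)" using elim(2) by (simp add: power_mult_distrib power2_eq_square)
      finally show ?case by simp
    qed
  qed
  from tendsto_add[OF this A] have "((\<lambda>t. (ln (1 + t ^ 2 * A t) - t ^ 2 * A t) / t ^ 2 + A t) \<longlongrightarrow> V) (at 0)" by simp
  moreover have "\<forall>\<^sub>F t in at 0. (ln (1 + t ^ 2 * A t) - t ^ 2 * A t) / t ^ 2 + A t = (ln (\<integral>x. exp (t * v x) \<partial>M) - (\<integral>x. t * v x \<partial>M)) / t ^ 2"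
    using eventually_neq_at_within[of 0 0 UNIV]
  proof eventually_elim
    case (elim t)
    then show ?case unfolding tA by (simp add: mean diff_divide_distrib)
  qed
  ultimately show ?thesis unfolding V_def by (rule Lim_transform_eventually)
qed

text \<open>Numerator and denominator are both divided by \<open>t ^ 2\<close>. The identity
  \<open>(N - 1)^2 * Ip = N^3 * Iq\<close> makes their limits proportional, with the factor
  \<open>(N - 1) * N ^ n * \<omega>\<close>, which is \<open>1 / alpha n\<close>; positivity of
  \<open>Iq\<close> keeps the denominator away from 0.\<close>

theorem Q_fun_limit:
  fixes e :: "'a::euclidean_space"
  assumes n: "2 \<le> DIM('a)" and e: "norm e = 1"
  shows "((\<lambda>t. Q_fun (\<lambda>x. t * v_fun e x)) \<longlongrightarrow> 1 / alpha DIM('a)) (at 0)"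
proof -
  let ?n = "DIM('a)"
  define N where "N = real ?n"
  have N: "2 \<le> N" using n by (simp add: N_def)
  define \<omega> where "\<omega> = unit_ball_vol N"
  have \<omega>: "0 < \<omega>" unfolding \<omega>_def using N by simp
  define Iq where "Iq = (\<integral>x. prof ?n (norm x) ^ 2 * (1 / (1 + rt ?n (norm x) ^ ?n) ^ ?n) \<partial>(lborel :: 'a measure))"
  define Ip where "Ip = (\<integral>x. prof ?n (norm x) ^ ?n / norm x ^ 2 * (1 + slope ?n (norm x) ^ 2) \<partial>(lborel :: 'a measure))"
  have Iq: "0 < Iq" unfolding Iq_def by (rule prof_square_integral_pos[OF n])
  have id: "(N - 1) ^ 2 * Ip = N ^ 3 * Iq" unfolding N_def Ip_def Iq_def by (rule prof_slope_identity[OF n])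
  have V: "(\<integral>x. v_fun e x ^ 2 \<partial>mu) = N / \<omega> * Iq" unfolding N_def \<omega>_def Iq_def by (rule variance_v_fun[OF n e])
  have H: "(\<integral>x. hess_form e x \<partial>lborel) = N ^ (?n - 1) * (N - 1) ^ 2 / 2 * ((N - 1) / N) * Ip"
    unfolding N_def Ip_def by (rule integral_hess_form[OF n e])
  have meas [measurable]: "v_fun e \<in> borel_measurable borel"
    unfolding v_fun_eq[OF n, abs_def] sgn_div_norm by measurable
  then have measmu: "v_fun e \<in> borel_measurable mu" unfolding mu_density_eq[OF n] by simp
  have bound: "\<bar>v_fun e x\<bar> \<le> N" for x
  proof -
    have "\<bar>sgn x \<bullet> e\<bar> \<le> norm (sgn x) * norm e" by (rule Cauchy_Schwarz_ineq2)
    also have "\<dots> \<le> 1" using e by (simp add: norm_sgn)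
    finally have "prof ?n (norm x) * \<bar>sgn x \<bullet> e\<bar> \<le> 1 * 1"
      using prof_le_1[OF n, of "norm x"] prof_nonneg by (intro mult_mono) auto
    then have "N * (prof ?n (norm x) * \<bar>sgn x \<bullet> e\<bar>) \<le> N * (1 * 1)" using N by (intro mult_left_mono) auto
    then show ?thesis unfolding v_fun_eq[OF n] using prof_nonneg[of ?n "norm x"] N by (simp add: abs_mult N_def)
  qed
  have mean: "(\<integral>x. v_fun e x \<partial>mu) = 0"
  proof -
    define \<phi> where "\<phi> r = - (N / \<omega>) * prof ?n r / r / (1 + rt ?n r ^ ?n) ^ ?n" for r
    have "(\<integral>x. v_fun e x \<partial>mu) = (\<integral>x. mu_density x * v_fun e x \<partial>lborel)" by (rule integral_mu(1)[OF n]) measurable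
    also have "\<dots> = (\<integral>x. (x \<bullet> e) * \<phi> (norm x) \<partial>lborel)"
      unfolding v_fun_eq[OF n] mu_density_def sig_def \<phi>_def N_def \<omega>_def
      by (simp add: sgn_div_norm divide_inverse mult_ac)
    also have "\<dots> = 0" by (rule integral_odd_radial) (unfold \<phi>_def[abs_def], measurable)
    finally show ?thesis .
  qed
  have num: "((\<lambda>t. (\<integral>x. H_fun x (grad (\<lambda>x. t * v_fun e x) x) \<partial>lborel) / t ^ 2) \<longlongrightarrow> (\<integral>x. hess_form e x \<partial>lborel)) (at 0)"
    by (rule numerator_limit[OF n e])
  have den: "((\<lambda>t. (ln (\<integral>x. exp (t * v_fun e x) \<partial>mu) - (\<integral>x. t * v_fun e x \<partial>mu)) / t ^ 2) \<longlongrightarrow> (\<integral>x. v_fun e x ^ 2 \<partial>mu) / 2) (at 0)"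
    by (rule prob_space.cumulant_second_order[OF prob_space_mu[OF n] measmu bound mean])
  have "(\<integral>x. v_fun e x ^ 2 \<partial>mu) / 2 \<noteq> 0" unfolding V using N \<omega> Iq by simp
  from tendsto_divide[OF num den this] have "((\<lambda>t. Q_fun (\<lambda>x. t * v_fun e x)) \<longlongrightarrow> (\<integral>x. hess_form e x \<partial>lborel) / ((\<integral>x. v_fun e x ^ 2 \<partial>mu) / 2)) (at 0)"
  proof (rule Lim_transform_eventually)
    show "\<forall>\<^sub>F t in at 0. (\<integral>x. H_fun x (grad (\<lambda>x. t * v_fun e x) x) \<partial>lborel) / t ^ 2 / ((ln (\<integral>x. exp (t * v_fun e x) \<partial>mu) - (\<integral>x. t * v_fun e x \<partial>mu)) / t ^ 2)
      = Q_fun (\<lambda>x. t * v_fun e x)"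
      using eventually_neq_at_within[of 0 0 UNIV] by eventually_elim (simp add: Q_fun_def)
  qed
  moreover have "(\<integral>x. hess_form e x \<partial>lborel) / ((\<integral>x. v_fun e x ^ 2 \<partial>mu) / 2) = 1 / alpha ?n"
  proof -
    have p: "N ^ ?n = N * N ^ (?n - 1)" using power_minus_mult[of ?n N] by (simp add: mult.commute)
    have "N ^ (?n - 1) * (N - 1) ^ 2 / 2 * ((N - 1) / N) * Ip = N ^ (?n - 1) * (N - 1) / (2 * N) * ((N - 1) ^ 2 * Ip)"
      by (simp add: mult_ac)
    also have "\<dots> = ((N - 1) * (N * N ^ (?n - 1)) * \<omega>) * ((N / \<omega> * Iq) / 2)"
      unfolding id using N \<omega> by (simp add: power3_eq_cube mult_ac)
    finally have h: "(\<integral>x. hess_form e x \<partial>lborel) = ((N - 1) * N ^ ?n * \<omega>) * ((\<integral>x. v_fun e x ^ 2 \<partial>mu) / 2)"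
      unfolding H V p .
    have a: "1 / alpha ?n = (N - 1) * N ^ ?n * \<omega>" unfolding alpha_closed[OF n] N_def \<omega>_def by simp
    show ?thesis unfolding h a using \<open>(\<integral>x. v_fun e x ^ 2 \<partial>mu) / 2 \<noteq> 0\<close> by simp
  qed
  ultimately show ?thesis by simp
qed

lemma compactly_supported_outside:
  fixes u :: "'a::euclidean_space \<Rightarrow> real"
  assumes "compactly_supported u"
  obtains R where "\<And>x. R < norm x \<Longrightarrow> u x = 0"
proof -
  have "bounded (closure {x. u x \<noteq> 0})" using assms unfolding compactly_supported_def by (rule compact_imp_bounded)
  then have "bounded {x. u x \<noteq> 0}" by (rule bounded_subset) (rule closure_subset)
  then obtain R where R: "\<And>x. u x \<noteq> 0 \<Longrightarrow> norm x \<le> R" unfolding bounded_iff by blast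
  show ?thesis by (rule that[of R]) (use R in force)
qed

theorem onofri_smooth:
  fixes u :: "'a::euclidean_space \<Rightarrow> real"
  assumes n: "2 \<le> DIM('a)" and u: "smooth u" "compactly_supported u"
  shows "ln (\<integral>x. exp (u x) \<partial>mu) - (\<integral>x. u x \<partial>mu) \<le> alpha DIM('a) * (\<integral>x. H_fun x (grad u x) \<partial>lborel)"
proof -
  obtain g where g: "\<And>x. (u has_derivative (\<lambda>h. g x \<bullet> h)) (at x)" "continuous_on UNIV g" "\<And>x. grad u x = g x"
    by (rule smooth_gradient[OF u(1)], rule that)
  obtain R where R: "\<And>x. R < norm x \<Longrightarrow> u x = 0" by (rule compactly_supported_outside[OF u(2)], rule that)
  show ?thesis unfolding g(3) by (rule onofri_C1[OF n g(1) g(2) R])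
qed

theorem theorem1p1:
  assumes "CARD('n::finite) \<ge> 2"
  shows "(\<forall>u :: real ^ 'n \<Rightarrow> real. smooth u \<and> compactly_supported u \<longrightarrow>
            ln (\<integral>x. exp (u x) \<partial>mu) - (\<integral>x. u x \<partial>mu)
              \<le> alpha CARD('n) * (\<integral>x. H_fun x (grad u x) \<partial>lborel))
       \<and> (\<forall>C :: real.
            (\<forall>u :: real ^ 'n \<Rightarrow> real. smooth u \<and> compactly_supported u \<longrightarrow>
               ln (\<integral>x. exp (u x) \<partial>mu) - (\<integral>x. u x \<partial>mu)
                 \<le> C * (\<integral>x. H_fun x (grad u x) \<partial>lborel))
            \<longrightarrow> alpha CARD('n) \<le> C)
       \<and> (\<forall>e :: real ^ 'n. norm e = 1 \<longrightarrow>
            ((\<lambda>\<epsilon>::real. Q_fun (\<lambda>x. \<epsilon> * v_fun e x)) \<longlongrightarrow> 1 / alpha CARD('n)) (at 0))"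
proof -
  have n: "2 \<le> DIM(real ^ 'n)" using assms by simp
  have C: "alpha CARD('n) = alpha DIM(real ^ 'n)" by simp
  show ?thesis unfolding C
  proof (intro conjI allI impI)
    fix u :: "real ^ 'n \<Rightarrow> real" assume "smooth u \<and> compactly_supported u"
    then show "ln (\<integral>x. exp (u x) \<partial>mu) - (\<integral>x. u x \<partial>mu) \<le> alpha DIM(real ^ 'n) * (\<integral>x. H_fun x (grad u x) \<partial>lborel)"
      by (intro onofri_smooth[OF n]) auto
  next
    fix C :: real
    assume "\<forall>u :: real ^ 'n \<Rightarrow> real. smooth u \<and> compactly_supported u \<longrightarrow>
      ln (\<integral>x. exp (u x) \<partial>mu) - (\<integral>x. u x \<partial>mu) \<le> C * (\<integral>x. H_fun x (grad u x) \<partial>lborel)"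
    then show "alpha DIM(real ^ 'n) \<le> C" by (intro onofri_optimal[OF n]) auto
  next
    fix e :: "real ^ 'n" assume "norm e = 1"
    then show "((\<lambda>\<epsilon>::real. Q_fun (\<lambda>x. \<epsilon> * v_fun e x)) \<longlongrightarrow> 1 / alpha DIM(real ^ 'n)) (at 0)"
      by (rule Q_fun_limit[OF n])
  qed
qed

end
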